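(* Let $0<\Lambda<\frac12$, $\frac38<b_0<\frac12$, $a\in L^\infty(\mathbb{R};\mathbb{R})$, $|a|_\infty=\|a\|_{L^\infty}$, and let $h$ be admissible with $0<h\le h_0:=\min\left\{1,\frac{\pi(1/2-\Lambda)}{2\langle|a|_\infty\rangle}\right\}$. Let $I\subseteq\mathbb{R}$ be a bounded interval. There exists $C=C(\Lambda,b_0)>0$ such that for any spacetime function $U:I\times\mathbb{T}\to\mathbb{C}$, $$\|P_hU\|_{L^4(I\times\mathbb{T})}\le C\|P_hU\|_{X_h^{0,b_0}(I)},$$ and $$\|U\|_{X^{0,-b_0}(I)}+\|P_hU\|_{X_h^{0,-b_0}(I)}\le C\|U\|_{L^{4/3}(I\times\mathbb{T})}.$$ The constant $C$ depends only on $\Lambda,b_0$.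
   Context: Notation: $\langle x\rangle=(1+x^2)^{1/2}$; $\mathbb{T}=\mathbb{R}/(2\pi\mathbb{Z})$. A mesh size $h$ is admissible if $h=\pi/M$ with $M\in\mathbb{N}$; $\mathbb{T}_h^*=\{-M,\dots,M-1\}$ and $E_h=\{k\in\mathbb{T}_h^*:|hk|\le\Lambda\pi\}$. For $f$ on $\mathbb{T}$, $\widehat f(k)=\frac1{2\pi}\int_{\mathbb{T}}f(x)e^{-ikx}dx$; $P_h$ is the spatial Fourier projector $\widehat{P_hf}(k)=\mathbf{1}_{E_h}(k)\widehat f(k)$. Phases: $\omega_{h,a(t)}(k)=\frac4{h^2}\sin^2\left(\frac{h(k-a(t))}2\right)$, $\phi_k(t)=\int_0^t(k-a(\tau))^2d\tau$, $\phi_{h,k}(t)=\int_0^t\omega_{h,a(\tau)}(k)d\tau$. Time-restricted norms: $\|f\|_{H^b(I)}=\inf\{\|F\|_{H^b(\mathbb{R})}:F|_I=f\}$. Restriction norms: $\|u\|_{X^{s,b}(I)}^2=\sum_{k\in\mathbb{Z}}\langle k\rangle^{2s}\|e^{i\phi_k(t)}\widehat u(k,t)\|_{H_t^b(I)}^2$ and, for functions with spatial frequencies in $\mathbb{T}_h^*$, $\|U\|_{X_h^{s,b}(I)}^2=\sum_{k\in\mathbb{T}_h^*}\langle k\rangle^{2s}\|e^{i\phi_{h,k}(t)}\widehat U(k,t)\|_{H_t^b(I)}^2$. *)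

theory Defs
  imports "HOL-Analysis.Analysis" "HOL-Probability.Essential_Supremum"
begin

definition japanese :: "real \<Rightarrow> real" where
  "japanese x = sqrt (1 + x\<^sup>2)"

text \<open>All norms take values in \<^typ>\<open>ennreal\<close> (infinite off the corresponding space). The library has no
  real powers there; this one is used for exponents \<open>p > 0\<close> only.\<close>

definition epowr :: "ennreal \<Rightarrow> real \<Rightarrow> ennreal" where
  "epowr x p = (if x = top then top else ennreal (enn2real x powr p))"


section \<open>Tempered distributions and Sobolev spaces on the line\<close>

definition nderiv :: "nat \<Rightarrow> (real \<Rightarrow> complex) \<Rightarrow> real \<Rightarrow> complex" where
  "nderiv n f = ((\<lambda>g t. vector_derivative g (at t)) ^^ n) f"

definition smooth :: "(real \<Rightarrow> complex) \<Rightarrow> bool" where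
  "smooth f \<longleftrightarrow> (\<forall>n t. nderiv n f differentiable (at t))"

definition schwartz :: "(real \<Rightarrow> complex) \<Rightarrow> bool" where
  "schwartz f \<longleftrightarrow> smooth f \<and> (\<forall>j n. bounded (range (\<lambda>t. of_real t ^ j * nderiv n f t)))"

definition schwartz_seminorm :: "nat \<Rightarrow> nat \<Rightarrow> (real \<Rightarrow> complex) \<Rightarrow> real" where
  "schwartz_seminorm j n f = (SUP t. norm (of_real t ^ j * nderiv n f t))"

text \<open>A tempered distribution is a functional of which only the values on Schwartz functions matter.\<close>

definition tempered :: "((real \<Rightarrow> complex) \<Rightarrow> complex) \<Rightarrow> bool" where
  "tempered T \<longleftrightarrow>
     (\<forall>f g. schwartz f \<longrightarrow> schwartz g \<longrightarrow> T (\<lambda>t. f t + g t) = T f + T g) \<and>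
     (\<forall>c f. schwartz f \<longrightarrow> T (\<lambda>t. c * f t) = c * T f) \<and>
     (\<exists>N K. \<forall>f. schwartz f \<longrightarrow> norm (T f) \<le> K * (\<Sum>j\<le>N. \<Sum>n\<le>N. schwartz_seminorm j n f))"

definition fourier :: "(real \<Rightarrow> complex) \<Rightarrow> real \<Rightarrow> complex" where
  "fourier f \<tau> = (LINT t|lebesgue. f t * cis (- (t * \<tau>)))"

text \<open>The Fourier transform of \<open>T\<close>, defined by duality, is the function \<open>g\<close>.\<close>

definition has_fourier :: "((real \<Rightarrow> complex) \<Rightarrow> complex) \<Rightarrow> (real \<Rightarrow> complex) \<Rightarrow> bool" where
  "has_fourier T g \<longleftrightarrow> g \<in> borel_measurable lebesgue \<and>
     (\<forall>f. schwartz f \<longrightarrow> integrable lebesgue (\<lambda>\<tau>. g \<tau> * f \<tau>) \<and>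
                        T (fourier f) = (LINT \<tau>|lebesgue. g \<tau> * f \<tau>))"

text \<open>The function \<open>g\<close> is unique up to null sets if it exists, so the infimum merely picks the value
  of the weighted norm at it, or \<open>\<infinity>\<close> if the Fourier transform of \<open>T\<close> is not a function. The factor
  \<open>1/(2\<pi>)\<close> makes \<open>H\<^sup>0\<close> isometric to \<open>L\<^sup>2\<close>.\<close>

definition Hb_norm :: "real \<Rightarrow> ((real \<Rightarrow> complex) \<Rightarrow> complex) \<Rightarrow> ennreal" where
  "Hb_norm b T = (INF g\<in>{g. has_fourier T g}.
     epowr (ennreal (1 / (2 * pi)) *
            (\<integral>\<^sup>+\<tau>. ennreal (japanese \<tau> powr (2 * b) * (norm (g \<tau>))\<^sup>2) \<partial>lebesgue)) (1/2))"

text \<open>\<open>T = f\<close> on \<open>I\<close> in the sense of distributions, i.e. tested against smooth functions with compact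
  support in the interior of \<open>I\<close>; \<open>f\<close> has to be locally integrable there.\<close>

definition restricts_to :: "((real \<Rightarrow> complex) \<Rightarrow> complex) \<Rightarrow> real set \<Rightarrow> (real \<Rightarrow> complex) \<Rightarrow> bool" where
  "restricts_to T I f \<longleftrightarrow>
     (\<forall>K. compact K \<and> K \<subseteq> interior I \<longrightarrow> set_integrable lebesgue K f) \<and>
     (\<forall>\<phi>. smooth \<phi> \<and> compact (closure {t. \<phi> t \<noteq> 0}) \<and> closure {t. \<phi> t \<noteq> 0} \<subseteq> interior I \<longrightarrow>
          T \<phi> = (LINT t:interior I|lebesgue. f t * \<phi> t))"

definition Hb_norm_on :: "real \<Rightarrow> real set \<Rightarrow> (real \<Rightarrow> complex) \<Rightarrow> ennreal" where
  "Hb_norm_on b I f = (INF T\<in>{T. tempered T \<and> restricts_to T I f}. Hb_norm b T)"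


section \<open>Functions on the torus\<close>

text \<open>Functions on \<open>\<real>/(2\<pi>\<int>)\<close> are \<open>2\<pi>\<close>-periodic functions on \<open>\<real>\<close>, integrated over \<open>[0, 2\<pi>)\<close>.\<close>

definition fcoef :: "(real \<Rightarrow> complex) \<Rightarrow> int \<Rightarrow> complex" where
  "fcoef f k = of_real (1 / (2 * pi)) *
     (LINT x:{0..<2*pi}|lebesgue. f x * cis (- (of_int k * x)))"

definition Lp_norm :: "real \<Rightarrow> real set \<Rightarrow> (real \<Rightarrow> real \<Rightarrow> complex) \<Rightarrow> ennreal" where
  "Lp_norm p I U = epowr
     (\<integral>\<^sup>+(t, x). ennreal (norm (U t x) powr p) \<partial>lebesgue_on (I \<times> {0..<2*pi})) (1 / p)"

definition admissible :: "real \<Rightarrow> bool" where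
  "admissible h \<longleftrightarrow> (\<exists>M::nat. M > 0 \<and> h = pi / real M)"

definition mesh_count :: "real \<Rightarrow> nat" where
  "mesh_count h = (THE M. M > 0 \<and> h = pi / real M)"

definition dual_grid :: "real \<Rightarrow> int set" where
  "dual_grid h = {- int (mesh_count h)..int (mesh_count h) - 1}"

definition low_freqs :: "real \<Rightarrow> real \<Rightarrow> int set" where
  "low_freqs \<Lambda> h = {k \<in> dual_grid h. \<bar>h * of_int k\<bar> \<le> \<Lambda> * pi}"

definition proj :: "real \<Rightarrow> real \<Rightarrow> (real \<Rightarrow> complex) \<Rightarrow> real \<Rightarrow> complex" where
  "proj \<Lambda> h f x = (\<Sum>k\<in>low_freqs \<Lambda> h. fcoef f k * cis (of_int k * x))"


section \<open>Phases and restriction norms\<close>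

definition Linf_norm :: "(real \<Rightarrow> real) \<Rightarrow> ereal" where
  "Linf_norm a = esssup lebesgue (\<lambda>t. ereal \<bar>a t\<bar>)"

definition omega_h :: "real \<Rightarrow> real \<Rightarrow> int \<Rightarrow> real" where
  "omega_h h \<alpha> k = 4 / h\<^sup>2 * (sin (h * (of_int k - \<alpha>) / 2))\<^sup>2"

definition phase :: "(real \<Rightarrow> real) \<Rightarrow> int \<Rightarrow> real \<Rightarrow> real" where
  "phase a k t = (LINT \<tau>=ereal 0..ereal t|lebesgue. (of_int k - a \<tau>)\<^sup>2)"

definition phase_h :: "real \<Rightarrow> (real \<Rightarrow> real) \<Rightarrow> int \<Rightarrow> real \<Rightarrow> real" where
  "phase_h h a k t = (LINT \<tau>=ereal 0..ereal t|lebesgue. omega_h h (a \<tau>) k)"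

definition X_norm ::
  "(real \<Rightarrow> real) \<Rightarrow> real \<Rightarrow> real \<Rightarrow> real set \<Rightarrow> (real \<Rightarrow> real \<Rightarrow> complex) \<Rightarrow> ennreal" where
  "X_norm a s b I u = epowr
     (\<Sum>\<^sub>\<infinity>k::int. ennreal (japanese (of_int k) powr (2 * s)) *
        (Hb_norm_on b I (\<lambda>t. cis (phase a k t) * fcoef (u t) k))\<^sup>2) (1/2)"

definition Xh_norm ::
  "real \<Rightarrow> (real \<Rightarrow> real) \<Rightarrow> real \<Rightarrow> real \<Rightarrow> real set \<Rightarrow> (real \<Rightarrow> real \<Rightarrow> complex) \<Rightarrow> ennreal" where
  "Xh_norm h a s b I u = epowr
     (\<Sum>k\<in>dual_grid h. ennreal (japanese (of_int k) powr (2 * s)) *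
        (Hb_norm_on b I (\<lambda>t. cis (phase_h h a k t) * fcoef (u t) k))\<^sup>2) (1/2)"

end

theory Submission
  imports Defs "HOL-Probability.Characteristic_Functions" "HOL-Probability.Sinc_Integral"
begin

text \<open>Everything rests on an \<open>L\<^sup>4\<close> bound for sums of waves \<open>e\<^bsup>i(kx - p\<^sub>k(t))\<^esup>\<close>. On a time interval of
  length \<open>4\<^bsup>-j\<^esup>\<close>, Parseval in \<open>x\<close> turns the fourth power into the autocorrelations of the coefficients:
  those of lag \<open>n < 2\<^sup>j\<close> are bounded trivially, and those of lag \<open>n \<ge> 2\<^sup>j\<close> gain from the oscillation in time,
  because \<open>p\<^bsub>k+n\<^esub> - p\<^sub>k\<close> grows like \<open>n k t\<close>. Covering the line by such intervals, a function with
  modulations \<open>|\<tau>| \<sim> 4\<^sup>j\<close> loses \<open>4\<^bsup>3j/8\<^esup>\<close>, which is summable against the weight as soon as \<open>b > 3/8\<close>.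

  For the continuous phase the differences \<open>p\<^bsub>k+n\<^esub> - p\<^sub>k\<close> are affine in \<open>k\<close>, and the gain in time is
  Bessel's inequality. For the discrete phase it comes from the \<open>T T\<^sup>*\<close> method, where the kernel is estimated
  by summing by parts twice in \<open>k\<close>; the gap between \<open>\<Lambda>\<close> and \<open>1/2\<close> and the bound on \<open>h |a|\<close> keep the
  angles \<open>h (k - a)\<close> away from the inflection points \<open>\<plusminus> \<pi>/2\<close> of the dispersion relation.

  The first inequality follows because a distribution of finite \<open>H\<^sup>b\<close> norm is, on the interior of \<open>I\<close>, the
  sum of its dyadic pieces; the second one follows by duality.\<close>

section \<open>Oscillatory sums\<close>

text \<open>Time regularity gives nothing, because \<open>a\<close> is only bounded and measurable.
  The estimates survive since \<open>a\<close> enters the lag-\<open>n\<close> phase differences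
  only through functions of \<open>t\<close> alone: an additive term for the continuous phase, the
  pair \<open>C\<close>, \<open>S\<close> for the discrete one. Hence no constant sees
  \<open>a\<close>. Where 3/8 comes from: an interval of length 4^(-j) gives 2^(-j) for the fourth
  power, as fewer than 2^j short positive lags cost 4^(-j) each and the long ones gain 2^(-j)
  together. There, a transform supported in |\<tau>| <= 4^j is a Taylor series with constant
  coefficients, so free waves suffice. Bessel's inequality over the grid of interval ends costs 4^j
  for the energy, 16^j for its square. The product 8^j has the fourth root 4^(3j/8). The norms are
  infima over distributions, so before any L^4 norm makes sense the distribution must be identified
  with a function. This is the purpose of the explicit test functions and of Fourier inversion for
  them. The infimum is approached with an error that tends to 0. In the dual bound, a cutoff in the
  time frequency supplies the finiteness that allows cancelling.\<close>

lemma sum_int_telescope: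
  fixes f :: "int \<Rightarrow> 'a::ab_group_add"
  assumes "a \<le> b + 1"
  shows "(\<Sum>k\<in>{a..b}. f (k + 1) - f k) = f (b + 1) - f a"
proof -
  have "(\<Sum>k\<in>{a..c - 1}. f (k + 1) - f k) = f c - f a" if "a \<le> c" for c
    using that
  proof (induction c rule: int_ge_induct)
    case (step i)
    have "{a..i + 1 - 1} = insert i {a..i - 1}" using step by auto
    then show ?case using step by simp
  qed simp
  from this[of "b + 1"] assms show ?thesis by simp
qed

lemma norm_cis_minus_1: "norm (cis x - 1) = 2 * \<bar>sin (x / 2)\<bar>"
proof -
  have "(norm (cis x - 1))\<^sup>2 = (2 * \<bar>sin (x / 2)\<bar>)\<^sup>2"
    using cos_double_sin[of "x/2"] sin_cos_squared_add[of x]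
    unfolding cmod_power2 by (simp add: power2_eq_square algebra_simps)
  then show ?thesis by (metis norm_ge_zero abs_ge_zero power2_eq_iff_nonneg mult_nonneg_nonneg zero_le_numeral)
qed

lemma norm_cis_diff_le: "norm (cis x - cis y) \<le> \<bar>x - y\<bar>"
proof -
  have "cis x - cis y = cis y * (cis (x - y) - 1)"
    by (simp add: algebra_simps cis_mult)
  then have "norm (cis x - cis y) = 2 * \<bar>sin ((x - y) / 2)\<bar>"
    by (simp add: norm_mult norm_cis_minus_1)
  also have "\<dots> \<le> 2 * \<bar>(x - y) / 2\<bar>"
    using abs_sin_x_le_abs_x[of "(x - y) / 2"] by simp
  finally show ?thesis by simp
qed

text \<open>The cubic Taylor bound with \<open>x ^ 2 <= 4\<close>. The range up to 2 matters: it
  contains \<open>pi / 2\<close>, hence every half angle \<open>h * n / 2\<close> with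
  \<open>h * n <= pi\<close> that occurs later.\<close>

lemma sin_ge_third:
  fixes x :: real
  assumes "0 \<le> x" "x \<le> 2"
  shows "x / 3 \<le> sin x"
proof -
  have "\<bar>sin x - (\<Sum>m<3. sin_coeff m * x ^ m)\<bar> \<le> inverse (fact 3) * \<bar>x\<bar> ^ 3"
    by (rule Maclaurin_sin_bound)
  then have "\<bar>sin x - x\<bar> \<le> x ^ 3 / 6"
    using assms by (simp add: eval_nat_numeral sin_coeff_def)
  moreover have "x ^ 3 \<le> 4 * x"
  proof -
    have "x * (x * x) \<le> x * (2 * 2)" using assms by (intro mult_left_mono mult_mono) auto
    then show ?thesis by (simp add: power3_eq_cube algebra_simps)
  qed
  ultimately show ?thesis by linarith
qed

lemma norm_cis_minus_linear: "norm (cis x - 1 - \<i> * of_real x) \<le> x\<^sup>2 / 2"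
  using iexp_approx1[of x 1] by (simp add: cis_conv_exp eval_nat_numeral algebra_simps power2_eq_square)

text \<open>The linear terms of the two increments combine to \<open>u - v\<close>. For consecutive
  increments of a phase this is a second difference, of the same order \<open>h ^ 2\<close> as the
  squares.\<close>

lemma norm_cis_second_diff_le:
  "norm (cis (x + u) + cis (x - v) - 2 * cis x) \<le> \<bar>u - v\<bar> + u\<^sup>2 / 2 + v\<^sup>2 / 2"
proof -
  have "cis (x + u) + cis (x - v) - 2 * cis x
      = cis x * ((cis u - 1 - \<i> * of_real u) + (cis (- v) - 1 - \<i> * of_real (- v)) + \<i> * of_real (u - v))"
    by (simp add: algebra_simps cis_mult)
  also have "norm \<dots> \<le> norm (cis u - 1 - \<i> * of_real u) + norm (cis (- v) - 1 - \<i> * of_real (- v))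
      + norm (\<i> * of_real (u - v) :: complex)"
    unfolding norm_mult[of "cis x"] norm_cis mult_1
    by (intro norm_triangle_le add_mono norm_triangle_ineq order_refl)
  also have "\<dots> \<le> u\<^sup>2 / 2 + (- v)\<^sup>2 / 2 + \<bar>u - v\<bar>"
    by (intro add_mono norm_cis_minus_linear) (simp add: norm_mult flip: of_real_diff)
  finally show ?thesis by simp
qed

text \<open>Van der Corput's second-order bound: the phases have increments comparable to \<open>\<sigma>\<close>, and
  every difference of the amplitude and of the increments gains a factor \<open>h\<close>.\<close>

lemma oscillatory_sum_bound:
  fixes w D \<Theta> :: "int \<Rightarrow> real"
  assumes \<Theta>: "\<And>k. \<Theta> (k + 1) = \<Theta> k + D k"
    and pq: "p \<le> q" and supp: "\<And>k. k \<notin> {p..q} \<Longrightarrow> w k = 0"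
    and c: "0 < c" and \<sigma>: "0 < \<sigma>" "\<sigma> \<le> 2" and h: "0 < h" and W: "0 \<le> W"
    and Dl: "\<And>k. k \<in> {p - 2..q + 2} \<Longrightarrow> c * \<sigma> \<le> D k"
    and Du: "\<And>k. k \<in> {p - 2..q + 2} \<Longrightarrow> D k \<le> \<sigma>"
    and D1: "\<And>k. \<bar>D (k + 1) - D k\<bar> \<le> h * \<sigma>"
    and D2: "\<And>k. \<bar>D (k + 2) - 2 * D (k + 1) + D k\<bar> \<le> h\<^sup>2 * \<sigma>"
    and w0: "\<And>k. \<bar>w k\<bar> \<le> W"
    and w1: "\<And>k. \<bar>w (k + 1) - w k\<bar> \<le> W * h"
    and w2: "\<And>k. \<bar>w (k + 2) - 2 * w (k + 1) + w k\<bar> \<le> W * h\<^sup>2"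
  shows "norm (\<Sum>k\<in>{p..q}. of_real (w k) * cis (\<Theta> k))
    \<le> real_of_int (q - p + 3) * ((20 + 100 / c ^ 2) * 9 / c ^ 2 * W * h\<^sup>2 / \<sigma>\<^sup>2)"
proof -
  \<comment> \<open>Since \<open>z (k + 1) - z k = (cis (D k) - 1) * z k\<close>, multiplication by
    \<open>E\<close> inverts the difference operator on \<open>z\<close>. \<open>A\<close> and
    \<open>B\<close> are the amplitudes that face the difference of \<open>z\<close> in the two
    summations by parts; \<open>M\<close> bounds \<open>E\<close>, and \<open>\<kappa>\<close> is
    the scale-free part of that bound.\<close>
  define E where "E k = 1 / (cis (D k) - 1)" for k
  define M where "M = 3 / (c * \<sigma>)"
  define \<kappa> where "\<kappa> = 3 / c"
  define A where "A k = of_real (w k) * E k" for k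
  define B where "B k = (A k - A (k - 1)) * E k" for k
  define z where "z k = cis (\<Theta> k)" for k
  have z_step: "z (k + 1) = cis (D k) * z k" for k
    unfolding z_def \<Theta> cis_mult by (rule arg_cong[of _ _ cis]) (rule add.commute)
  have M0: "0 < M" and \<kappa>0: "0 < \<kappa>" and M\<sigma>: "M * \<sigma> = \<kappa>"
    using c \<sigma> by (auto simp: M_def \<kappa>_def)
  have low: "norm (cis (D k) - 1) \<ge> 1 / M" if "k \<in> {p - 2..q + 2}" for k
  proof -
    have "0 \<le> D k" using Dl[OF that] c \<sigma> by (meson less_eq_real_def mult_pos_pos order_trans)
    then have "D k / 2 / 3 \<le> sin (D k / 2)"
      using Du[OF that] \<sigma> by (intro sin_ge_third) auto
    moreover have "1 / M = c * \<sigma> / 3" by (simp add: M_def)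
    ultimately show ?thesis using Dl[OF that] by (simp add: norm_cis_minus_1)
  qed
  have ne: "cis (D k) - 1 \<noteq> 0" if "k \<in> {p - 2..q + 2}" for k
    using low[OF that] M0 by (metis norm_zero not_less zero_less_divide_1_iff)
  have E0: "norm (E k) \<le> M" if "k \<in> {p - 2..q + 2}" for k
  proof -
    have "0 < norm (cis (D k) - 1)" using ne[OF that] by simp
    then show ?thesis using low[OF that] M0 by (simp add: E_def norm_divide divide_le_eq le_divide_eq mult.commute)
  qed
  define Q where "Q k = cis (D (k + 1)) - cis (D k)" for k
  have Q0: "norm (Q k) \<le> h * \<sigma>" for k
    unfolding Q_def using norm_cis_diff_le D1 order_trans by blast
  have Q1: "norm (Q (k + 1) - Q k) \<le> 3 * h\<^sup>2 * \<sigma>" for k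
  proof -
    let ?u = "D (k + 2) - D (k + 1)" and ?v = "D (k + 1) - D k"
    have "Q (k + 1) - Q k = cis (D (k + 1) + ?u) + cis (D (k + 1) - ?v) - 2 * cis (D (k + 1))"
      by (simp add: Q_def algebra_simps)
    then have "norm (Q (k + 1) - Q k) \<le> \<bar>?u - ?v\<bar> + ?u\<^sup>2 / 2 + ?v\<^sup>2 / 2"
      using norm_cis_second_diff_le by metis
    also have "\<dots> \<le> h\<^sup>2 * \<sigma> + (h * \<sigma>)\<^sup>2 / 2 + (h * \<sigma>)\<^sup>2 / 2"
    proof -
      have "?u\<^sup>2 \<le> (h * \<sigma>)\<^sup>2" "?v\<^sup>2 \<le> (h * \<sigma>)\<^sup>2"
        using D1[of k] D1[of "k + 1"] by (auto simp: add.assoc intro!: abs_le_square_iff[THEN iffD1])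
      moreover have "\<bar>?u - ?v\<bar> \<le> h\<^sup>2 * \<sigma>" using D2[of k] by (simp add: algebra_simps)
      ultimately show ?thesis by simp
    qed
    also have "\<dots> = h\<^sup>2 * \<sigma> + (h\<^sup>2 * \<sigma>) * \<sigma>" by (simp add: power2_eq_square)
    also have "\<dots> \<le> h\<^sup>2 * \<sigma> + (h\<^sup>2 * \<sigma>) * 2" using \<sigma> by (intro add_left_mono mult_left_mono) auto
    finally show ?thesis by (simp add: algebra_simps)
  qed
  have E1_eq: "E (k + 1) - E k = - (E k * E (k + 1) * Q k)"
    if "k \<in> {p - 2..q + 1}" for k
  proof -
    have "1 / y - 1 / x = - (1 / x * (1 / y) * (y - x))" if "x \<noteq> 0" "y \<noteq> 0" for x y :: complex
      using that by (simp add: divide_simps)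
    from this[of "cis (D k) - 1" "cis (D (k + 1)) - 1"] show ?thesis
      using ne[of k] ne[of "k + 1"] that by (simp add: E_def Q_def)
  qed
  have E1: "norm (E (k + 1) - E k) \<le> \<kappa> * M * h" if "k \<in> {p - 2..q + 1}" for k
  proof -
    have "norm (E (k + 1) - E k) \<le> M * M * (h * \<sigma>)"
      unfolding E1_eq[OF that] norm_minus_cancel norm_mult
      using that M0 by (intro mult_mono E0 Q0) auto
    also have "\<dots> = \<kappa> * M * h" by (simp flip: M\<sigma>)
    finally show ?thesis .
  qed
  have E2: "norm (E (k + 2) - 2 * E (k + 1) + E k) \<le> (3 * \<kappa> + 2 * \<kappa>\<^sup>2) * M * h\<^sup>2"
    if "k \<in> {p - 2..q}" for k
  proof -
    have k2: "E (k + 2) - E (k + 1) = - (E (k + 1) * E (k + 2) * Q (k + 1))"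
      using E1_eq[of "k + 1"] that by (simp add: add.assoc)
    have "E (k + 2) - 2 * E (k + 1) + E k = (E (k + 2) - E (k + 1)) - (E (k + 1) - E k)" by simp
    also have "\<dots> = - (E (k + 1) * (E (k + 2) * (Q (k + 1) - Q k)
        + ((E (k + 1 + 1) - E (k + 1)) + (E (k + 1) - E k)) * Q k))"
      using E1_eq[of k] k2 that by (simp add: algebra_simps add.assoc)
    also have "norm \<dots> \<le> M * (M * (3 * h\<^sup>2 * \<sigma>) + (\<kappa> * M * h + \<kappa> * M * h) * (h * \<sigma>))"
      unfolding norm_minus_cancel norm_mult
      using that M0 \<sigma> h \<kappa>0
      by (intro mult_mono E0 norm_triangle_le add_mono E1 Q0 Q1 order_trans[OF norm_mult_ineq]) auto
    also have "\<dots> = (3 * (M * \<sigma>) + 2 * \<kappa> * (M * \<sigma>)) * M * h\<^sup>2"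
      by (simp add: algebra_simps power2_eq_square)
    finally show ?thesis by (simp add: M\<sigma> power2_eq_square algebra_simps)
  qed
  have A1: "norm (A (k + 1) - A k) \<le> W * M * h * (1 + \<kappa>)" if "k \<in> {p - 2..q + 1}" for k
  proof -
    have "A (k + 1) - A k = of_real (w (k + 1) - w k) * E k + of_real (w (k + 1)) * (E (k + 1) - E k)"
      by (simp add: A_def algebra_simps)
    also have "norm \<dots> \<le> (W * h) * M + W * (\<kappa> * M * h)"
      using that M0 W h
      by (intro norm_triangle_le add_mono order_trans[OF norm_mult_ineq] mult_mono E0 E1)
        (auto simp: w0 w1 simp flip: of_real_diff)
    finally show ?thesis by (simp add: algebra_simps)
  qed
  have A2: "norm (A (k + 2) - 2 * A (k + 1) + A k) \<le> W * M * h\<^sup>2 * (1 + 5 * \<kappa> + 2 * \<kappa>\<^sup>2)"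
    if "k \<in> {p - 2..q}" for k
  proof -
    \<comment> \<open>The Leibniz rule for second differences: each product of a difference of
      \<open>w\<close> and one of \<open>E\<close> carries \<open>h ^ 2\<close> in total.\<close>
    have "A (k + 2) - 2 * A (k + 1) + A k
        = of_real (w (k + 2) - 2 * w (k + 1) + w k) * E (k + 2)
        + 2 * (of_real (w (k + 1) - w k) * (E (k + 1 + 1) - E (k + 1)))
        - 2 * (of_real (w (k + 1) - w k) * 0)
        + of_real (w k) * (E (k + 2) - 2 * E (k + 1) + E k)"
      by (simp add: A_def algebra_simps)
    also have "norm \<dots> \<le> (W * h\<^sup>2) * M + 2 * ((W * h) * (\<kappa> * M * h)) + W * ((3 * \<kappa> + 2 * \<kappa>\<^sup>2) * M * h\<^sup>2)"
    proof -
      have "norm (complex_of_real (w (k + 2) - 2 * w (k + 1) + w k) * E (k + 2)) \<le> (W * h\<^sup>2) * M"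
        using that M0 W h w2[of k] unfolding norm_mult norm_of_real by (intro mult_mono E0) auto
      moreover have "norm (2 * (complex_of_real (w (k + 1) - w k) * (E (k + 1 + 1) - E (k + 1))))
          \<le> 2 * ((W * h) * (\<kappa> * M * h))"
        using that M0 W h w1[of k] unfolding norm_mult norm_of_real
        by (intro mult_mono E1) auto
      moreover have "norm (of_real (w k) * (E (k + 2) - 2 * E (k + 1) + E k))
          \<le> W * ((3 * \<kappa> + 2 * \<kappa>\<^sup>2) * M * h\<^sup>2)"
        using that M0 W h w0[of k] unfolding norm_mult norm_of_real by (intro mult_mono E2) auto
      ultimately show ?thesis
        unfolding mult_zero_right diff_zero
        by (intro norm_triangle_le add_mono) auto
    qed
    finally show ?thesis by (simp add: algebra_simps power2_eq_square)
  qed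
  have A_out: "A k = 0" if "k \<notin> {p..q}" for k using supp[OF that] by (simp add: A_def)
  \<comment> \<open>Two more terms than the support of \<open>w\<close>: the boundary values
    \<open>A (p - 1)\<close>, \<open>A (q + 2)\<close>, \<open>B (p - 1)\<close> and
    \<open>B (q + 2)\<close> all vanish, so neither summation by parts leaves a boundary
    term.\<close>
  let ?R = "{p..q + 2}"
  have s1: "(\<Sum>k\<in>?R. of_real (w k) * z k) = - (\<Sum>k\<in>?R. (A k - A (k - 1)) * z k)"
  proof -
    have "of_real (w k) * z k = A k * z (k + 1) - A (k - 1) * z k - (A k - A (k - 1)) * z k"
      if "k \<in> ?R" for k
    proof -
      have "of_real (w k) = A k * (cis (D k) - 1)" using ne[of k] that by (simp add: A_def E_def)
      then show ?thesis by (simp only: z_step) (simp add: algebra_simps)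
    qed
    then have "(\<Sum>k\<in>?R. of_real (w k) * z k)
        = (\<Sum>k\<in>?R. A (k + 1 - 1) * z (k + 1) - A (k - 1) * z k) - (\<Sum>k\<in>?R. (A k - A (k - 1)) * z k)"
      unfolding sum_subtractf[symmetric] by (intro sum.cong) auto
    also have "(\<Sum>k\<in>?R. A (k + 1 - 1) * z (k + 1) - A (k - 1) * z k) = 0"
      by (subst sum_int_telescope[where f="\<lambda>k. A (k - 1) * z k"]) (use pq in \<open>auto simp: A_out\<close>)
    finally show ?thesis by simp
  qed
  have B_out: "B k = 0" if "k < p \<or> k > q + 1" for k
    using that by (auto simp: B_def A_out)
  have s2: "(\<Sum>k\<in>?R. (A k - A (k - 1)) * z k) = - (\<Sum>k\<in>?R. (B k - B (k - 1)) * z k)"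
  proof -
    have "(A k - A (k - 1)) * z k = B k * z (k + 1) - B (k - 1) * z k - (B k - B (k - 1)) * z k"
      if "k \<in> ?R" for k
    proof -
      have "A k - A (k - 1) = B k * (cis (D k) - 1)" using ne[of k] that by (simp add: B_def E_def)
      then show ?thesis by (simp only: z_step) (simp add: algebra_simps)
    qed
    then have "(\<Sum>k\<in>?R. (A k - A (k - 1)) * z k)
        = (\<Sum>k\<in>?R. B (k + 1 - 1) * z (k + 1) - B (k - 1) * z k) - (\<Sum>k\<in>?R. (B k - B (k - 1)) * z k)"
      unfolding sum_subtractf[symmetric] by (intro sum.cong) auto
    also have "(\<Sum>k\<in>?R. B (k + 1 - 1) * z (k + 1) - B (k - 1) * z k) = 0"
      by (subst sum_int_telescope[where f="\<lambda>k. B (k - 1) * z k"]) (use pq in \<open>auto simp: B_out\<close>)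
    finally show ?thesis by simp
  qed
  define \<beta> where "\<beta> = W * M\<^sup>2 * h\<^sup>2 * (1 + 6 * \<kappa> + 3 * \<kappa>\<^sup>2)"
  have B1: "norm (B k - B (k - 1)) \<le> \<beta>" if "k \<in> ?R" for k
  proof -
    have "B k - B (k - 1) = (A (k - 2 + 2) - 2 * A (k - 2 + 1) + A (k - 2)) * E k
        + (A (k - 2 + 1) - A (k - 2)) * (E (k - 1 + 1) - E (k - 1))"
      by (simp add: B_def algebra_simps)
    also have "norm \<dots> \<le> (W * M * h\<^sup>2 * (1 + 5 * \<kappa> + 2 * \<kappa>\<^sup>2)) * M + (W * M * h * (1 + \<kappa>)) * (\<kappa> * M * h)"
      using that M0 W h \<kappa>0
      by (intro norm_triangle_le add_mono order_trans[OF norm_mult_ineq] mult_mono E0 E1 A1 A2) auto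
    finally show ?thesis by (simp add: \<beta>_def algebra_simps power2_eq_square)
  qed
  have "(\<Sum>k\<in>{p..q}. of_real (w k) * z k) = (\<Sum>k\<in>?R. of_real (w k) * z k)"
    using supp by (intro sum.mono_neutral_left) auto
  also have "\<dots> = (\<Sum>k\<in>?R. (B k - B (k - 1)) * z k)" using s1 s2 by simp
  also have "norm \<dots> \<le> (\<Sum>k\<in>?R. \<beta>)"
    using B1 by (intro sum_norm_le) (simp add: norm_mult z_def)
  also have "\<dots> = real_of_int (q - p + 3) * \<beta>" using pq by simp
  also have "\<beta> \<le> (20 + 100 / c ^ 2) * 9 / c ^ 2 * W * h\<^sup>2 / \<sigma>\<^sup>2"
  proof -
    \<comment> \<open>The polynomial is at most
      \<open>10 + 4 * \<kappa> ^ 2 = 10 + 36 / c ^ 2\<close>, rounded up. The remaining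
      \<open>9 / (c ^ 2 * \<sigma> ^ 2)\<close> is \<open>M ^ 2\<close>.\<close>
    have "6 * \<kappa> \<le> 9 + \<kappa>\<^sup>2" using zero_le_power2[of "\<kappa> - 3"] by (simp add: power2_eq_square algebra_simps)
    moreover have "\<kappa>\<^sup>2 = 9 / c ^ 2" by (simp add: \<kappa>_def power_divide)
    moreover have "0 \<le> 1 / c ^ 2" by simp
    ultimately have "1 + 6 * \<kappa> + 3 * \<kappa>\<^sup>2 \<le> 20 + 100 / c ^ 2" by linarith
    then have "\<beta> \<le> W * M\<^sup>2 * h\<^sup>2 * (20 + 100 / c ^ 2)"
      unfolding \<beta>_def using W by (intro mult_left_mono) auto
    also have "\<dots> = (20 + 100 / c ^ 2) * 9 / c ^ 2 * W * h\<^sup>2 / \<sigma>\<^sup>2"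
      by (simp add: M_def power_divide power_mult_distrib field_simps)
    finally show ?thesis .
  qed
  finally show ?thesis using pq by (simp add: z_def)
qed

section \<open>Autocorrelations of trigonometric polynomials\<close>

lemma borel_measurable_cis [measurable (raw)]:
  assumes "f \<in> borel_measurable M"
  shows "(\<lambda>x. cis (f x)) \<in> borel_measurable M"
  using borel_measurable_continuous_on[OF _ assms, of cis] by (simp add: continuous_on_cis continuous_on_id)

text \<open>The integral inequality on the counting measure with density \<open>w\<close>.\<close>

lemma Cauchy_Schwarz_suminf:
  fixes w x :: "nat \<Rightarrow> ennreal"
  shows "(\<Sum>j. w j * x j)\<^sup>2 \<le> (\<Sum>j. w j) * (\<Sum>j. w j * (x j)\<^sup>2)"
proof -
  let ?M = "density (count_space UNIV) w"
  have eq: "(\<integral>\<^sup>+j. y j \<partial>?M) = (\<Sum>j. w j * y j)" for y :: "nat \<Rightarrow> ennreal"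
    by (simp add: nn_integral_density nn_integral_count_space_nat)
  have "(\<integral>\<^sup>+j. 1 * x j \<partial>?M)\<^sup>2 \<le> (\<integral>\<^sup>+j. 1\<^sup>2 \<partial>?M) * (\<integral>\<^sup>+j. (x j)\<^sup>2 \<partial>?M)"
    by (rule Cauchy_Schwarz_nn_integral) auto
  then show ?thesis unfolding eq by simp
qed

text \<open>Jensen's inequality for the fourth power with unnormalized weights, by Cauchy-Schwarz
  applied twice. It lets a series be summed under an L^4 norm at the price of a convergent
  weight.\<close>

lemma power4_suminf_le:
  fixes w x :: "nat \<Rightarrow> ennreal"
  shows "(\<Sum>j. w j * x j) ^ 4 \<le> (\<Sum>j. w j) ^ 3 * (\<Sum>j. w j * x j ^ 4)"
proof -
  have "(\<Sum>j. w j * x j) ^ 4 = ((\<Sum>j. w j * x j)\<^sup>2)\<^sup>2" by simp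
  also have "\<dots> \<le> ((\<Sum>j. w j) * (\<Sum>j. w j * (x j)\<^sup>2))\<^sup>2"
    by (intro power_mono Cauchy_Schwarz_suminf) simp
  also have "\<dots> = (\<Sum>j. w j)\<^sup>2 * (\<Sum>j. w j * (x j)\<^sup>2)\<^sup>2" by (simp add: power_mult_distrib)
  also have "\<dots> \<le> (\<Sum>j. w j)\<^sup>2 * ((\<Sum>j. w j) * (\<Sum>j. w j * ((x j)\<^sup>2)\<^sup>2))"
    by (intro mult_left_mono Cauchy_Schwarz_suminf) simp
  finally show ?thesis by (simp add: power2_eq_square power3_eq_cube mult.assoc power4_eq_xxxx)
qed

text \<open>Hoelder with exponents 4/3 and 4, in fourth powers so that no roots of extended reals
  appear: split \<open>u ^ 3 * v\<close> as \<open>u ^ 2 * (u * v)\<close>, then split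
  \<open>u ^ 2 * v ^ 2\<close> again.\<close>

lemma nn_integral_Holder_4:
  fixes u v :: "'a \<Rightarrow> ennreal"
  assumes [measurable]: "u \<in> borel_measurable M" "v \<in> borel_measurable M"
  shows "(\<integral>\<^sup>+x. u x ^ 3 * v x \<partial>M) ^ 4 \<le> (\<integral>\<^sup>+x. u x ^ 4 \<partial>M) ^ 3 * (\<integral>\<^sup>+x. v x ^ 4 \<partial>M)"
proof -
  have "(\<integral>\<^sup>+x. u x ^ 3 * v x \<partial>M) ^ 4 = ((\<integral>\<^sup>+x. (u x)\<^sup>2 * (u x * v x) \<partial>M)\<^sup>2)\<^sup>2"
    unfolding power2_eq_square power3_eq_cube power4_eq_xxxx by (simp add: mult.assoc)
  also have "\<dots> \<le> ((\<integral>\<^sup>+x. ((u x)\<^sup>2)\<^sup>2 \<partial>M) * (\<integral>\<^sup>+x. (u x * v x)\<^sup>2 \<partial>M))\<^sup>2"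
    by (intro power_mono Cauchy_Schwarz_nn_integral) auto
  also have "\<dots> = (\<integral>\<^sup>+x. u x ^ 4 \<partial>M)\<^sup>2 * (\<integral>\<^sup>+x. (u x)\<^sup>2 * (v x)\<^sup>2 \<partial>M)\<^sup>2"
    by (simp add: power_mult_distrib)
  also have "\<dots> \<le> (\<integral>\<^sup>+x. u x ^ 4 \<partial>M)\<^sup>2 * ((\<integral>\<^sup>+x. ((u x)\<^sup>2)\<^sup>2 \<partial>M) * (\<integral>\<^sup>+x. ((v x)\<^sup>2)\<^sup>2 \<partial>M))"
    by (intro mult_left_mono Cauchy_Schwarz_nn_integral) auto
  also have "\<dots> = (\<integral>\<^sup>+x. u x ^ 4 \<partial>M) ^ 3 * (\<integral>\<^sup>+x. v x ^ 4 \<partial>M)"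
    by (simp add: power3_eq_cube power2_eq_square[of "integral\<^sup>N _ _"] mult.assoc)
  finally show ?thesis .
qed

lemma has_vector_derivative_cis_linear:
  "((\<lambda>x. cis (c * x)) has_vector_derivative \<i> * of_real c * cis (c * x)) (at x within S)"
proof -
  have "((\<lambda>z. exp (\<i> * (of_real c * z))) has_field_derivative \<i> * of_real c * exp (\<i> * (of_real c * of_real x))) (at (of_real x))"
    by (auto intro!: derivative_eq_intros)
  from has_vector_derivative_real_field[OF this, of S] show ?thesis
    by (simp add: cis_conv_exp)
qed

lemma integral_cis_int:
  fixes n :: int
  shows "(LINT x:{0..2 * pi}|lborel. cis (of_int n * x)) = (if n = 0 then of_real (2 * pi) else 0)"
proof (cases "n = 0")
  case False
  have "(LBINT x=ereal 0..ereal (2 * pi). cis (of_int n * x))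
      = cis (of_int n * (2 * pi)) / (\<i> * of_int n) - cis (of_int n * 0) / (\<i> * of_int n)"
  proof (rule interval_integral_FTC_finite)
    show "continuous_on {min 0 (2 * pi)..max 0 (2 * pi)} (\<lambda>x. cis (of_int n * x))"
      by (intro continuous_intros)
    show "((\<lambda>x. cis (of_int n * x) / (\<i> * of_int n)) has_vector_derivative cis (of_int n * x))
        (at x within {min 0 (2 * pi)..max 0 (2 * pi)})" for x
      using has_vector_derivative_divide[OF has_vector_derivative_cis_linear[of "of_int n"], of "\<i> * of_int n"] False
      by simp
  qed
  moreover have "cis (of_int n * (2 * pi)) = 1"
    using cis_multiple_2pi[of "of_int n"] by (simp add: mult.commute mult.left_commute)
  ultimately show ?thesis using False
    by (simp add: interval_integral_Icc)
qed (simp add: set_integral_const scaleR_conv_of_real)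

lemma nn_integral_norm_square_trig:
  assumes "finite D"
  shows "(\<integral>\<^sup>+x\<in>{0..2 * pi}. ennreal ((norm (\<Sum>n\<in>D. A n * cis (of_int n * x)))\<^sup>2) \<partial>lborel)
    = ennreal (2 * pi * (\<Sum>n\<in>D. (norm (A n))\<^sup>2))"
proof -
  let ?f = "\<lambda>x. \<Sum>n\<in>D. A n * cis (of_int n * x)"
  have int: "set_integrable lborel {0..2 * pi} (\<lambda>x. cis (of_int n * x))" for n :: int
    by (intro borel_integrable_atLeastAtMost' continuous_intros)
  have cint: "set_integrable lborel {0..2 * pi} (\<lambda>x. (norm (?f x))\<^sup>2)"
    by (intro borel_integrable_atLeastAtMost' continuous_intros)
  have "complex_of_real (LINT x:{0..2 * pi}|lborel. (norm (?f x))\<^sup>2)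
      = (LINT x:{0..2 * pi}|lborel. of_real ((norm (?f x))\<^sup>2))"
    unfolding set_lebesgue_integral_def by (subst integral_complex_of_real[symmetric]) (simp add: scaleR_conv_of_real)
  also have "\<dots> = (LINT x:{0..2 * pi}|lborel. \<Sum>n\<in>D. \<Sum>m\<in>D. (A n * cnj (A m)) * cis (of_int (n - m) * x))"
  proof (intro set_lebesgue_integral_cong allI impI)
    fix x
    have "complex_of_real ((norm (?f x))\<^sup>2) = ?f x * cnj (?f x)"
      by (metis complex_norm_square of_real_power)
    also have "\<dots> = (\<Sum>n\<in>D. \<Sum>m\<in>D. (A n * cis (of_int n * x)) * cnj (A m * cis (of_int m * x)))"
      by (simp only: cnj_sum sum_product)
    also have "\<dots> = (\<Sum>n\<in>D. \<Sum>m\<in>D. (A n * cnj (A m)) * cis (of_int (n - m) * x))"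
      by (intro sum.cong refl) (simp add: cis_cnj cis_mult left_diff_distrib)
    finally show "complex_of_real ((norm (?f x))\<^sup>2) = \<dots>" .
  qed simp
  also have "\<dots> = (\<Sum>n\<in>D. \<Sum>m\<in>D. (A n * cnj (A m)) * (LINT x:{0..2 * pi}|lborel. cis (of_int (n - m) * x)))"
    using int[of "_ - _"] unfolding set_lebesgue_integral_def set_integrable_def
    by (simp add: scaleR_sum_right flip: mult_scaleR_right)
  also have "\<dots> = (\<Sum>n\<in>D. \<Sum>m\<in>D. if m = n then (A n * cnj (A n)) * of_real (2 * pi) else 0)"
    unfolding integral_cis_int by (intro sum.cong) auto
  also have "\<dots> = of_real (2 * pi * (\<Sum>n\<in>D. (norm (A n))\<^sup>2))"
    using assms by (simp add: sum_distrib_left complex_norm_square mult_ac del: of_real_power)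
  finally have "(LINT x:{0..2 * pi}|lborel. (norm (?f x))\<^sup>2) = 2 * pi * (\<Sum>n\<in>D. (norm (A n))\<^sup>2)"
    using of_real_eq_iff by blast
  moreover have "(\<integral>\<^sup>+x\<in>{0..2 * pi}. ennreal ((norm (?f x))\<^sup>2) \<partial>lborel)
      = ennreal (LINT x:{0..2 * pi}|lborel. (norm (?f x))\<^sup>2)"
    using cint unfolding set_integrable_def set_lebesgue_integral_def
    by (subst nn_integral_eq_integral[symmetric])
      (auto intro!: nn_integral_cong split: split_indicator)
  ultimately show ?thesis by simp
qed
text \<open>The autocorrelation coefficients of \<open>c\<close> are the Fourier coefficients of \<open>|\<Sum>c\<^sub>k e\<^sup>i\<^sup>k\<^sup>x|\<^sup>2\<close>.\<close>

definition corr :: "int set \<Rightarrow> (int \<Rightarrow> complex) \<Rightarrow> int \<Rightarrow> complex" where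
  "corr K c n = (\<Sum>k | k \<in> K \<and> k + n \<in> K. c (k + n) * cnj (c k))"

lemma corr_uminus: "corr K c (- n) = cnj (corr K c n)"
proof -
  have "corr K c (- n) = (\<Sum>k | k \<in> K \<and> k + n \<in> K. c k * cnj (c (k + n)))"
    unfolding corr_def
    by (rule sum.reindex_bij_witness[of _ "\<lambda>k. k + n" "\<lambda>k. k - n"]) auto
  then show ?thesis by (simp add: corr_def mult.commute)
qed

lemma norm_corr_le:
  assumes "finite K"
  shows "norm (corr K c n) \<le> (\<Sum>k\<in>K. (norm (c k))\<^sup>2)"
proof -
  let ?S = "{k. k \<in> K \<and> k + n \<in> K}"
  have fin: "finite ?S" using assms by (rule finite_subset[rotated]) auto
  have "norm (corr K c n) \<le> (\<Sum>k\<in>?S. (norm (c (k + n)))\<^sup>2 / 2 + (norm (c k))\<^sup>2 / 2)"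
    unfolding corr_def
  proof (rule sum_norm_le)
    fix k
    show "norm (c (k + n) * cnj (c k)) \<le> (norm (c (k + n)))\<^sup>2 / 2 + (norm (c k))\<^sup>2 / 2"
      using zero_le_power2[of "norm (c (k + n)) - norm (c k)"]
      by (simp add: norm_mult power2_diff)
  qed
  also have "\<dots> = (\<Sum>k\<in>(\<lambda>k. k + n) ` ?S. (norm (c k))\<^sup>2) / 2 + (\<Sum>k\<in>?S. (norm (c k))\<^sup>2) / 2"
    by (subst sum.reindex) (auto simp: sum.distrib sum_divide_distrib)
  also have "\<dots> \<le> (\<Sum>k\<in>K. (norm (c k))\<^sup>2) / 2 + (\<Sum>k\<in>K. (norm (c k))\<^sup>2) / 2"
    using assms by (intro add_mono divide_right_mono sum_mono2) auto
  finally show ?thesis by simp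
qed

text \<open>The map from (n, k) to (k + n, k) is injective into \<open>K \<times> K\<close>, so the
  energies of all lags together are part of one double sum. This keeps the sum over lags from
  costing a factor \<open>card N\<close>.\<close>

lemma sum_corr_energy_le:
  fixes c :: "int \<Rightarrow> complex"
  assumes "finite K" "finite N"
  shows "(\<Sum>n\<in>N. \<Sum>k | k \<in> K \<and> k + n \<in> K. (norm (c (k + n) * cnj (c k)))\<^sup>2) \<le> (\<Sum>k\<in>K. (norm (c k))\<^sup>2)\<^sup>2"
proof -
  have fin: "finite {k. k \<in> K \<and> k + n \<in> K}" for n
    using assms by (rule_tac finite_subset[of _ K]) auto
  have "(\<Sum>n\<in>N. \<Sum>k | k \<in> K \<and> k + n \<in> K. (norm (c (k + n) * cnj (c k)))\<^sup>2)
      = (\<Sum>p\<in>(SIGMA n:N. {k. k \<in> K \<and> k + n \<in> K}). (norm (c (snd p + fst p)))\<^sup>2 * (norm (c (snd p)))\<^sup>2)"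
    using assms fin by (subst sum.Sigma) (auto simp: norm_mult power_mult_distrib intro!: sum.cong)
  also have "\<dots> = (\<Sum>p\<in>(\<lambda>p. (snd p + fst p, snd p)) ` (SIGMA n:N. {k. k \<in> K \<and> k + n \<in> K}). (norm (c (fst p)))\<^sup>2 * (norm (c (snd p)))\<^sup>2)"
    by (subst sum.reindex) (auto simp: inj_on_def)
  also have "\<dots> \<le> (\<Sum>p\<in>K \<times> K. (norm (c (fst p)))\<^sup>2 * (norm (c (snd p)))\<^sup>2)"
    using assms by (intro sum_mono2) auto
  also have "\<dots> = (\<Sum>k\<in>K. (norm (c k))\<^sup>2)\<^sup>2"
    by (simp add: power2_eq_square sum_product sum.cartesian_product case_prod_beta)
  finally show ?thesis .
qed

lemma norm_trig_square_eq_corr: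
  assumes K: "K \<subseteq> {- int m..int m}"
  shows "of_real ((norm (\<Sum>k\<in>K. c k * cis (of_int k * x)))\<^sup>2)
    = (\<Sum>n\<in>{- 2 * int m..2 * int m}. corr K c n * cis (of_int n * x))"
proof -
  have fin: "finite K" using K finite_subset by blast
  let ?D = "{- 2 * int m..2 * int m}"
  have "complex_of_real ((norm (\<Sum>k\<in>K. c k * cis (of_int k * x)))\<^sup>2)
      = (\<Sum>k\<in>K. c k * cis (of_int k * x)) * cnj (\<Sum>k\<in>K. c k * cis (of_int k * x))"
    by (metis complex_norm_square of_real_power)
  also have "\<dots> = (\<Sum>l\<in>K. \<Sum>k\<in>K. c l * cnj (c k) * cis (of_int (l - k) * x))"
    by (simp only: cnj_sum sum_product) (intro sum.cong refl, simp add: cis_cnj cis_mult left_diff_distrib)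
  also have "\<dots> = (\<Sum>k\<in>K. \<Sum>l\<in>K. c l * cnj (c k) * cis (of_int (l - k) * x))"
    by (rule sum.swap)
  also have "\<dots> = (\<Sum>k\<in>K. \<Sum>n | n \<in> ?D \<and> k + n \<in> K. c (k + n) * cnj (c k) * cis (of_int n * x))"
  proof (rule sum.cong[OF refl])
    fix k assume k: "k \<in> K"
    have bd: "- int m \<le> l \<and> l \<le> int m" if "l \<in> K" for l using K that by auto
    show "(\<Sum>l\<in>K. c l * cnj (c k) * cis (of_int (l - k) * x))
      = (\<Sum>n | n \<in> ?D \<and> k + n \<in> K. c (k + n) * cnj (c k) * cis (of_int n * x))"
      by (intro sum.reindex_bij_witness[of _ "\<lambda>n. k + n" "\<lambda>l. l - k"])
        (use bd[OF k] in \<open>auto dest!: bd\<close>)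
  qed
  also have "\<dots> = (\<Sum>n\<in>?D. \<Sum>k | k \<in> K \<and> k + n \<in> K. c (k + n) * cnj (c k) * cis (of_int n * x))"
    using fin by (intro sum.swap_restrict) auto
  finally show ?thesis by (simp add: corr_def sum_distrib_right)
qed

text \<open>Parseval applied to the squared modulus, whose Fourier coefficients are the
  autocorrelations. Conjugate symmetry folds the negative lags onto the positive ones, hence the
  factor 2.\<close>

lemma nn_integral_trig_power4:
  assumes K: "K \<subseteq> {- int m..int m}"
  shows "(\<integral>\<^sup>+x\<in>{0..2 * pi}. ennreal (norm (\<Sum>k\<in>K. c k * cis (of_int k * x)) ^ 4) \<partial>lborel)
    = ennreal (2 * pi * ((norm (corr K c 0))\<^sup>2 + 2 * (\<Sum>n\<in>{1..2 * int m}. (norm (corr K c n))\<^sup>2)))"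
proof -
  let ?D = "{- 2 * int m..2 * int m}"
  have "norm (\<Sum>k\<in>K. c k * cis (of_int k * x)) ^ 4
      = (norm (\<Sum>n\<in>?D. corr K c n * cis (of_int n * x)))\<^sup>2" for x
    unfolding norm_trig_square_eq_corr[OF K, symmetric] norm_of_real by simp
  then have "(\<integral>\<^sup>+x\<in>{0..2 * pi}. ennreal (norm (\<Sum>k\<in>K. c k * cis (of_int k * x)) ^ 4) \<partial>lborel)
      = ennreal (2 * pi * (\<Sum>n\<in>?D. (norm (corr K c n))\<^sup>2))"
    using nn_integral_norm_square_trig[of ?D "corr K c"] by simp
  also have "?D = {0} \<union> {1..2 * int m} \<union> uminus ` {1..2 * int m}"
    unfolding image_uminus_atLeastAtMost by auto
  also have "(\<Sum>n\<in>\<dots>. (norm (corr K c n))\<^sup>2)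
      = (norm (corr K c 0))\<^sup>2 + (\<Sum>n\<in>{1..2 * int m}. (norm (corr K c n))\<^sup>2) + (\<Sum>n\<in>uminus ` {1..2 * int m}. (norm (corr K c n))\<^sup>2)"
    by (subst sum.union_disjoint, simp, simp, fastforce)+ simp
  also have "(\<Sum>n\<in>uminus ` {1..2 * int m}. (norm (corr K c n))\<^sup>2) = (\<Sum>n\<in>{1..2 * int m}. (norm (corr K c n))\<^sup>2)"
    by (subst sum.reindex) (auto simp: corr_uminus)
  finally show ?thesis by (simp add: add.commute)
qed

section \<open>The \<open>L\<^sup>4\<close> bound for separated phases\<close>

text \<open>On intervals of length \<open>1/n\<close>, the waves \<open>e\<^bsup>i(p\<^bsub>k+n\<^esub> - p\<^sub>k)\<^esup>\<close> are almost orthogonal, like exponentials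
  whose frequencies are spaced by \<open>n\<close>.\<close>

definition separated :: "(int \<Rightarrow> real \<Rightarrow> real) \<Rightarrow> int set \<Rightarrow> real \<Rightarrow> bool" where
  "separated p K B \<longleftrightarrow> (\<forall>n t\<^sub>0 d. 1 \<le> n \<longrightarrow>
     (\<integral>\<^sup>+t\<in>{t\<^sub>0..t\<^sub>0 + 1 / of_int n}. ennreal ((norm (\<Sum>k | k \<in> K \<and> k + n \<in> K.
         d k * cis (- (p (k + n) t - p k t))))\<^sup>2) \<partial>lborel)
     \<le> ennreal (B / of_int n * (\<Sum>k | k \<in> K \<and> k + n \<in> K. (norm (d k))\<^sup>2)))"

lemma nn_integral_cover:
  assumes "finite S" "A \<subseteq> (\<Union>i\<in>S. B i)"
    and [measurable]: "f \<in> borel_measurable M" "\<And>i. i \<in> S \<Longrightarrow> B i \<in> sets M"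
  shows "(\<integral>\<^sup>+x\<in>A. f x \<partial>M) \<le> (\<Sum>i\<in>S. \<integral>\<^sup>+x\<in>B i. f x \<partial>M)"
proof -
  have "(\<integral>\<^sup>+x\<in>A. f x \<partial>M) \<le> (\<integral>\<^sup>+x. (\<Sum>i\<in>S. f x * indicator (B i) x) \<partial>M)"
  proof (rule nn_integral_mono)
    fix x
    show "f x * indicator A x \<le> (\<Sum>i\<in>S. f x * indicator (B i) x)"
    proof (cases "x \<in> A")
      case True
      then obtain i where i: "i \<in> S" "x \<in> B i" using assms by blast
      then have "f x * indicator A x = f x * indicator (B i) x" using True by simp
      also have "\<dots> \<le> (\<Sum>i\<in>S. f x * indicator (B i) x)"
        using i assms by (intro member_le_sum) auto
      finally show ?thesis .
    qed simp
  qed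
  also have "\<dots> = (\<Sum>i\<in>S. \<integral>\<^sup>+x\<in>B i. f x \<partial>M)"
    by (rule nn_integral_sum) measurable
  finally show ?thesis .
qed

lemma Icc_cover:
  fixes t\<^sub>0 l :: real
  assumes "0 < l" "0 < q"
  shows "{t\<^sub>0..t\<^sub>0 + real q * l} \<subseteq> (\<Union>i\<in>{..<q}. {t\<^sub>0 + real i * l..t\<^sub>0 + real i * l + l})"
proof
  fix t assume t: "t \<in> {t\<^sub>0..t\<^sub>0 + real q * l}"
  define r where "r = (t - t\<^sub>0) / l"
  have r: "0 \<le> r" "r \<le> q" and tr: "t = t\<^sub>0 + r * l"
    using t assms by (auto simp: r_def field_simps)
  \<comment> \<open>The minimum puts the right end point, where \<open>r = q\<close>, into the last
    interval.\<close>
  define i where "i = min (nat \<lfloor>r\<rfloor>) (q - 1)"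
  have "i < q" "real i \<le> r" "r \<le> real i + 1" using r assms unfolding i_def by linarith+
  moreover have "real i * l \<le> r * l" "r * l \<le> (real i + 1) * l"
    using calculation assms by (auto intro!: mult_right_mono)
  ultimately show "t \<in> (\<Union>i\<in>{..<q}. {t\<^sub>0 + real i * l..t\<^sub>0 + real i * l + l})"
    unfolding tr by (auto simp: algebra_simps)
qed

text \<open>At most \<open>l * n + 1\<close> intervals of length \<open>1 / n\<close> cover one of
  length \<open>l\<close>, and each costs \<open>B / n\<close>. The term \<open>1 / n\<close> is the
  price of rounding up; it dominates on short intervals.\<close>

lemma separatedD_interval:
  assumes "separated p K B" "finite K" "1 \<le> n" "0 < l"
    and [measurable]: "\<And>k. p k \<in> borel_measurable borel"
  shows "(\<integral>\<^sup>+t\<in>{t\<^sub>0..t\<^sub>0 + l}. ennreal ((norm (\<Sum>k | k \<in> K \<and> k + n \<in> K.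
         d k * cis (- (p (k + n) t - p k t))))\<^sup>2) \<partial>lborel)
     \<le> ennreal ((l + 1 / of_int n) * B * (\<Sum>k | k \<in> K \<and> k + n \<in> K. (norm (d k))\<^sup>2))"
    (is "?L \<le> ennreal (_ * ?S)")
proof -
  define q where "q = nat \<lceil>l * of_int n\<rceil>"
  have q: "0 < q" "l * of_int n \<le> q" "real q \<le> l * of_int n + 1"
    using assms by (auto simp: q_def)
  let ?f = "\<lambda>t. ennreal ((norm (\<Sum>k | k \<in> K \<and> k + n \<in> K. d k * cis (- (p (k + n) t - p k t))))\<^sup>2)"
  have "l \<le> real q * (1 / of_int n)" using q assms by (simp add: field_simps)
  then have "{t\<^sub>0..t\<^sub>0 + l} \<subseteq> {t\<^sub>0..t\<^sub>0 + real q * (1 / of_int n)}" by auto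
  also have "\<dots> \<subseteq> (\<Union>i\<in>{..<q}. {t\<^sub>0 + real i * (1 / of_int n)..t\<^sub>0 + real i * (1 / of_int n) + 1 / of_int n})"
    using q assms by (intro Icc_cover) auto
  finally have "?L \<le> (\<Sum>i<q. \<integral>\<^sup>+t\<in>{t\<^sub>0 + real i * (1 / of_int n)..t\<^sub>0 + real i * (1 / of_int n) + 1 / of_int n}. ?f t \<partial>lborel)"
    by (intro nn_integral_cover) auto
  also have "\<dots> \<le> (\<Sum>i<q. ennreal (B / of_int n * ?S))"
    using assms unfolding separated_def by (intro sum_mono) blast
  also have "\<dots> = ennreal (real q) * ennreal (B / of_int n * ?S)"
    by (simp add: ennreal_of_nat_eq_real_of_nat)
  also have "\<dots> \<le> ennreal (l * of_int n + 1) * ennreal (B / of_int n * ?S)"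
    using q by (intro mult_right_mono ennreal_leI) auto
  also have "\<dots> = ennreal ((l + 1 / of_int n) * B * ?S)"
    using assms by (subst ennreal_mult'[symmetric]) (auto simp: field_simps)
  finally show ?thesis .
qed

lemma ennreal_scaled_sum:
  assumes "0 \<le> c" "0 \<le> a" "\<And>n. n \<in> N \<Longrightarrow> 0 \<le> b n"
  shows "ennreal (c * (a + 2 * sum b N)) = ennreal c * (ennreal a + 2 * (\<Sum>n\<in>N. ennreal (b n)))"
proof -
  have "ennreal (c * (a + 2 * sum b N)) = ennreal c * (ennreal a + ennreal 2 * ennreal (sum b N))"
    using assms by (simp add: ennreal_mult ennreal_plus sum_nonneg del: ennreal_numeral)
  then show ?thesis using assms by (simp add: sum_ennreal)
qed

text \<open>The threshold \<open>2 ^ j\<close> balances two bounds: the positive lags below it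
  contribute at most \<open>2 ^ j\<close> times \<open>S ^ 2 / 4 ^ j\<close>, while above it
  \<open>1 / 4 ^ j + 1 / n <= 2 / 2 ^ j\<close> multiplies energies whose sum over all lags is at
  most \<open>S ^ 2\<close>. Lag zero gives 1 and the doubled positive lags give
  \<open>2 * (1 + 2 * B)\<close>, together \<open>3 + 4 * B\<close>.\<close>

lemma local_L4:
  assumes sep: "separated p K B" and fin: "finite K" and B: "0 \<le> B"
    and [measurable]: "\<And>k. p k \<in> borel_measurable borel"
  shows "(\<integral>\<^sup>+t\<in>{t\<^sub>0..t\<^sub>0 + 1 / 4 ^ j}. (\<integral>\<^sup>+x\<in>{0..2 * pi}.
      ennreal (norm (\<Sum>k\<in>K. c k * cis (of_int k * x - p k t)) ^ 4) \<partial>lborel) \<partial>lborel)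
    \<le> ennreal (2 * pi * (3 + 4 * B) / 2 ^ j * (\<Sum>k\<in>K. (norm (c k))\<^sup>2)\<^sup>2)"
proof -
  obtain m :: nat where m: "K \<subseteq> {- int m..int m}"
  proof -
    obtain M where "\<forall>k\<in>K. \<bar>k\<bar> \<le> M" using fin by (metis finite_imageI Max_ge imageI)
    then have "K \<subseteq> {- int (nat M)..int (nat M)}" by force
    then show ?thesis using that by blast
  qed
  let ?J = "{t\<^sub>0..t\<^sub>0 + 1 / 4 ^ j}"
  define S where "S = (\<Sum>k\<in>K. (norm (c k))\<^sup>2)"
  define ct where "ct t k = c k * cis (- p k t)" for t k
  define E where "E n = (\<Sum>k | k \<in> K \<and> k + n \<in> K. (norm (c (k + n) * cnj (c k)))\<^sup>2)" for n
  have S_ct: "(\<Sum>k\<in>K. (norm (ct t k))\<^sup>2) = S" for t by (simp add: ct_def S_def norm_mult)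
  have corr_ct: "corr K (ct t) n = (\<Sum>k | k \<in> K \<and> k + n \<in> K. (c (k + n) * cnj (c k)) * cis (- (p (k + n) t - p k t)))" for t n
    unfolding corr_def ct_def by (intro sum.cong) (auto simp: cis_cnj cis_mult algebra_simps)
  have corr_meas [measurable]: "(\<lambda>t. corr K (ct t) n) \<in> borel_measurable borel" for n
    unfolding corr_ct by measurable
  have corr_le: "norm (corr K (ct t) n) \<le> S" for t n
    using norm_corr_le[OF fin, of "ct t" n] by (simp add: S_ct)
  have S0: "0 \<le> S" by (auto simp: S_def intro: sum_nonneg)
  have E0: "0 \<le> E n" for n by (auto simp: E_def intro: sum_nonneg)
  have triv: "(\<integral>\<^sup>+t\<in>?J. ennreal ((norm (corr K (ct t) n))\<^sup>2) \<partial>lborel) \<le> ennreal (S\<^sup>2 / 4 ^ j)" for n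
  proof -
    have "(\<integral>\<^sup>+t\<in>?J. ennreal ((norm (corr K (ct t) n))\<^sup>2) \<partial>lborel) \<le> (\<integral>\<^sup>+t\<in>?J. ennreal (S\<^sup>2) \<partial>lborel)"
      by (intro nn_integral_mono mult_right_mono ennreal_leI power_mono corr_le) auto
    also have "\<dots> = ennreal (S\<^sup>2 / 4 ^ j)"
      by (simp add: nn_integral_cmult_indicator ennreal_mult'[symmetric])
    finally show ?thesis .
  qed
  define e where "e n = (if n < 2 ^ j then S\<^sup>2 / 4 ^ j else 2 * B / 2 ^ j * E n)" for n :: int
  have e: "(\<integral>\<^sup>+t\<in>?J. ennreal ((norm (corr K (ct t) n))\<^sup>2) \<partial>lborel) \<le> ennreal (e n)" if "1 \<le> n" for n
  proof (cases "n < 2 ^ j")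
    case False
    have "(\<integral>\<^sup>+t\<in>?J. ennreal ((norm (corr K (ct t) n))\<^sup>2) \<partial>lborel) \<le> ennreal ((1 / 4 ^ j + 1 / of_int n) * B * E n)"
      unfolding corr_ct E_def by (rule separatedD_interval[OF sep fin that]) auto
    also have "\<dots> \<le> ennreal ((1 / 2 ^ j + 1 / 2 ^ j) * B * E n)"
    proof (intro ennreal_leI mult_right_mono add_mono E0 B)
      show "1 / 4 ^ j \<le> 1 / (2::real) ^ j" by (intro divide_left_mono power_mono) auto
      have "(2::real) ^ j \<le> of_int n" using False by (metis not_less of_int_le_iff of_int_numeral of_int_power)
      then show "1 / of_int n \<le> 1 / (2::real) ^ j" using that by (intro divide_left_mono) auto
    qed
    finally show ?thesis using False by (simp add: e_def)
  qed (use triv in \<open>simp add: e_def\<close>)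
  have e0: "0 \<le> e n" for n using B E0 by (simp add: e_def)
  have sum_e: "(\<Sum>n\<in>{1..2 * int m}. e n) \<le> (1 + 2 * B) / 2 ^ j * S\<^sup>2"
  proof -
    have "(\<Sum>n\<in>{1..2 * int m}. e n) \<le> (\<Sum>n\<in>{1..2 * int m}. (if n < 2 ^ j then S\<^sup>2 / 4 ^ j else 0) + 2 * B / 2 ^ j * E n)"
      using B E0 by (intro sum_mono) (auto simp: e_def)
    also have "\<dots> = (\<Sum>n\<in>{1..2 * int m}. if n < 2 ^ j then S\<^sup>2 / 4 ^ j else 0) + 2 * B / 2 ^ j * (\<Sum>n\<in>{1..2 * int m}. E n)"
      by (simp add: sum.distrib sum_distrib_left)
    also have "(\<Sum>n\<in>{1..2 * int m}. if n < 2 ^ j then S\<^sup>2 / 4 ^ j else 0) \<le> (\<Sum>n\<in>{1..2 ^ j :: int}. S\<^sup>2 / 4 ^ j)"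
      unfolding sum.inter_filter[symmetric, OF finite_atLeastAtMost_int] using S0 by (intro sum_mono2) auto
    also have "\<dots> = 1 / 2 ^ j * S\<^sup>2" by (simp add: power_mult_distrib[symmetric] field_simps)
    finally have "(\<Sum>n\<in>{1..2 * int m}. e n) \<le> 1 / 2 ^ j * S\<^sup>2 + 2 * B / 2 ^ j * (\<Sum>n\<in>{1..2 * int m}. E n)"
      by simp
    moreover have "(\<Sum>n\<in>{1..2 * int m}. E n) \<le> S\<^sup>2"
      unfolding E_def S_def by (intro sum_corr_energy_le fin) auto
    then have "2 * B / 2 ^ j * (\<Sum>n\<in>{1..2 * int m}. E n) \<le> 2 * B / 2 ^ j * S\<^sup>2"
      using B by (intro mult_left_mono) auto
    ultimately show ?thesis by (simp add: add_divide_distrib distrib_right)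
  qed
  have "norm (\<Sum>k\<in>K. c k * cis (of_int k * x - p k t)) = norm (\<Sum>k\<in>K. ct t k * cis (of_int k * x))" for t x
    by (simp add: ct_def mult.assoc cis_mult)
  then have "(\<integral>\<^sup>+t\<in>?J. (\<integral>\<^sup>+x\<in>{0..2 * pi}. ennreal (norm (\<Sum>k\<in>K. c k * cis (of_int k * x - p k t)) ^ 4) \<partial>lborel) \<partial>lborel)
    = (\<integral>\<^sup>+t\<in>?J. ennreal (2 * pi * ((norm (corr K (ct t) 0))\<^sup>2 + 2 * (\<Sum>n\<in>{1..2 * int m}. (norm (corr K (ct t) n))\<^sup>2))) \<partial>lborel)"
    by (simp only: nn_integral_trig_power4[OF m])
  also have "\<dots> = (\<integral>\<^sup>+t. ennreal (2 * pi) * (ennreal ((norm (corr K (ct t) 0))\<^sup>2) * indicator ?J t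
      + 2 * (\<Sum>n\<in>{1..2 * int m}. ennreal ((norm (corr K (ct t) n))\<^sup>2) * indicator ?J t)) \<partial>lborel)"
  proof (rule nn_integral_cong)
    fix t
    show "ennreal (2 * pi * ((norm (corr K (ct t) 0))\<^sup>2 + 2 * (\<Sum>n\<in>{1..2 * int m}. (norm (corr K (ct t) n))\<^sup>2))) * indicator ?J t
      = ennreal (2 * pi) * (ennreal ((norm (corr K (ct t) 0))\<^sup>2) * indicator ?J t
      + 2 * (\<Sum>n\<in>{1..2 * int m}. ennreal ((norm (corr K (ct t) n))\<^sup>2) * indicator ?J t))"
      by (cases "t \<in> ?J") (simp_all add: ennreal_scaled_sum del: atLeastAtMost_iff)
  qed
  also have "\<dots> = ennreal (2 * pi) * ((\<integral>\<^sup>+t\<in>?J. ennreal ((norm (corr K (ct t) 0))\<^sup>2) \<partial>lborel)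
      + 2 * (\<Sum>n\<in>{1..2 * int m}. \<integral>\<^sup>+t\<in>?J. ennreal ((norm (corr K (ct t) n))\<^sup>2) \<partial>lborel))"
    by (subst nn_integral_cmult, measurable, subst nn_integral_add, measurable,
      subst nn_integral_cmult, measurable, subst nn_integral_sum, measurable)
  also have "\<dots> \<le> ennreal (2 * pi) * (ennreal (S\<^sup>2 / 4 ^ j) + 2 * (\<Sum>n\<in>{1..2 * int m}. ennreal (e n)))"
    using e by (intro mult_left_mono add_mono triv sum_mono) auto
  also have "\<dots> = ennreal (2 * pi * (S\<^sup>2 / 4 ^ j + 2 * (\<Sum>n\<in>{1..2 * int m}. e n)))"
    using e0 by (simp add: ennreal_scaled_sum)
  also have "\<dots> \<le> ennreal (2 * pi * (S\<^sup>2 / 2 ^ j + 2 * ((1 + 2 * B) / 2 ^ j * S\<^sup>2)))"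
    using sum_e by (intro ennreal_leI mult_left_mono add_mono divide_left_mono power_mono) auto
  also have "2 * pi * (S\<^sup>2 / 2 ^ j + 2 * ((1 + 2 * B) / 2 ^ j * S\<^sup>2)) = 2 * pi * (3 + 4 * B) / 2 ^ j * S\<^sup>2"
    by (simp add: field_simps)
  finally show ?thesis by (simp add: S_def)
qed

section \<open>Band-limited time dependence: Bessel's inequality and Taylor expansion\<close>

lemma integrable_of_square_bounded_support:
  fixes G :: "real \<Rightarrow> complex"
  assumes [measurable]: "G \<in> borel_measurable borel"
    and supp: "\<And>\<tau>. G \<tau> \<noteq> 0 \<Longrightarrow> \<bar>\<tau>\<bar> \<le> L" and fin: "(\<integral>\<^sup>+\<tau>. ennreal ((norm (G \<tau>))\<^sup>2) \<partial>lborel) < \<infinity>"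
  shows "integrable lborel G"
proof (rule integrableI_bounded)
  have "(\<integral>\<^sup>+\<tau>. ennreal (norm (G \<tau>)) \<partial>lborel) \<le> (\<integral>\<^sup>+\<tau>. indicator {-L..L} \<tau> + ennreal ((norm (G \<tau>))\<^sup>2) \<partial>lborel)"
  proof (rule nn_integral_mono)
    fix \<tau>
    show "ennreal (norm (G \<tau>)) \<le> indicator {-L..L} \<tau> + ennreal ((norm (G \<tau>))\<^sup>2)"
    proof (cases "G \<tau> = 0")
      case False
      then have "\<bar>\<tau>\<bar> \<le> L" by (rule supp)
      moreover have "norm (G \<tau>) \<le> 1 + (norm (G \<tau>))\<^sup>2"
        using zero_le_power2[of "norm (G \<tau>) - 1"] norm_ge_zero[of "G \<tau>"] unfolding power2_diff
        by (simp del: zero_le_power2 norm_ge_zero)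
      ultimately show ?thesis
        by (simp add: abs_le_iff ennreal_plus[symmetric] ennreal_1[symmetric] del: ennreal_plus ennreal_1)
    qed simp
  qed
  also have "\<dots> < \<infinity>" using fin by (subst nn_integral_add) (auto simp: emeasure_lborel_Icc_eq)
  finally show "(\<integral>\<^sup>+\<tau>. ennreal (norm (G \<tau>)) \<partial>lborel) < \<infinity>" .
qed simp

lemma nn_integral_norm_square_trig_scaled:
  assumes L: "0 < L" and S: "finite S"
  shows "(\<integral>\<^sup>+\<tau>\<in>{- pi * L..pi * L}. ennreal ((norm (\<Sum>m\<in>S. d m * cis (of_int m / L * \<tau>)))\<^sup>2) \<partial>lborel)
    = ennreal (2 * pi * L * (\<Sum>m\<in>S. (norm (d m))\<^sup>2))"
proof -
  have ind: "indicator {- pi * L..pi * L} (- pi * L + L * x) = (indicator {0..2 * pi} x :: ennreal)" for x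
  proof -
    have "- pi * L + L * x \<le> pi * L \<longleftrightarrow> x \<le> 2 * pi"
      using L by (simp add: field_simps)
    moreover have "- pi * L \<le> - pi * L + L * x \<longleftrightarrow> 0 \<le> x" using L by (simp add: zero_le_mult_iff)
    ultimately show ?thesis by (simp add: indicator_def)
  qed
  have "(\<integral>\<^sup>+\<tau>\<in>{- pi * L..pi * L}. ennreal ((norm (\<Sum>m\<in>S. d m * cis (of_int m / L * \<tau>)))\<^sup>2) \<partial>lborel)
     = ennreal L * (\<integral>\<^sup>+x. ennreal ((norm (\<Sum>m\<in>S. d m * cis (of_int m / L * (- pi * L + L * x))))\<^sup>2)
         * indicator {- pi * L..pi * L} (- pi * L + L * x) \<partial>lborel)"
    using L by (subst nn_integral_real_affine[where c=L and t="- pi * L"]) auto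
  also have "(\<integral>\<^sup>+x. ennreal ((norm (\<Sum>m\<in>S. d m * cis (of_int m / L * (- pi * L + L * x))))\<^sup>2)
         * indicator {- pi * L..pi * L} (- pi * L + L * x) \<partial>lborel)
    = (\<integral>\<^sup>+x\<in>{0..2 * pi}. ennreal ((norm (\<Sum>m\<in>S. (d m * cis (- of_int m * pi)) * cis (of_int m * x)))\<^sup>2) \<partial>lborel)"
  proof -
    have eq: "d m * cis (of_int m / L * (- pi * L + L * x)) = (d m * cis (- of_int m * pi)) * cis (of_int m * x)" for m x
    proof -
      have "of_int m / L * (- pi * L + L * x) = - of_int m * pi + of_int m * x"
        using L by (simp add: field_simps)
      then show ?thesis by (simp only: mult.assoc cis_mult)
    qed
    show ?thesis by (simp only: ind eq)
  qed
  also have "\<dots> = ennreal (2 * pi * (\<Sum>m\<in>S. (norm (d m * cis (- of_int m * pi)))\<^sup>2))"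
    using S by (rule nn_integral_norm_square_trig)
  finally show ?thesis using L by (simp add: ennreal_mult'[symmetric] norm_mult mult_ac)
qed

text \<open>As \<open>pi > 1\<close>, the support lies in the period
  \<open>{- pi * L..pi * L}\<close>, on which the exponentials are orthogonal. The integrals are
  samples at the points \<open>m / L\<close> of the transform of \<open>G\<close>; pairing
  \<open>G\<close> with the polynomial \<open>P\<close> built from them yields \<open>s ^ 2\<close>
  on the left and \<open>s\<close> on the right.\<close>

lemma Bessel_exponentials:
  fixes G :: "real \<Rightarrow> complex" and L :: real
  assumes G [measurable]: "G \<in> borel_measurable borel" and L: "0 < L"
    and supp: "\<And>\<tau>. G \<tau> \<noteq> 0 \<Longrightarrow> \<bar>\<tau>\<bar> \<le> L" and S: "finite S"
  shows "(\<Sum>m\<in>S. ennreal ((norm (LINT \<tau>|lborel. G \<tau> * cis (of_int m / L * \<tau>)))\<^sup>2))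
     \<le> ennreal (2 * pi * L) * (\<integral>\<^sup>+\<tau>. ennreal ((norm (G \<tau>))\<^sup>2) \<partial>lborel)"
proof (cases "(\<integral>\<^sup>+\<tau>. ennreal ((norm (G \<tau>))\<^sup>2) \<partial>lborel) < \<infinity>")
  case False
  then show ?thesis using L by (simp add: ennreal_mult_top less_top[symmetric])
next
  case True
  have Gi: "integrable lborel G" by (rule integrable_of_square_bounded_support[OF G supp True])
  define c where "c m = (LINT \<tau>|lborel. G \<tau> * cis (of_int m / L * \<tau>))" for m
  define P where "P \<tau> = (\<Sum>m\<in>S. cnj (c m) * cis (of_int m / L * \<tau>))" for \<tau>
  define s where "s = (\<Sum>m\<in>S. (norm (c m))\<^sup>2)"
  have s0: "0 \<le> s" by (simp add: s_def sum_nonneg)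
  have Gic: "integrable lborel (\<lambda>\<tau>. G \<tau> * cis (of_int m / L * \<tau>))" for m
    by (rule Bochner_Integration.integrable_bound[OF Gi]) (auto simp: norm_mult)
  have "of_real s = (\<Sum>m\<in>S. cnj (c m) * c m)"
    by (simp add: s_def complex_norm_square mult.commute del: of_real_power)
  also have "\<dots> = (LINT \<tau>|lborel. (\<Sum>m\<in>S. cnj (c m) * (G \<tau> * cis (of_int m / L * \<tau>))))"
    using Gic by (simp add: c_def)
  also have "\<dots> = (LINT \<tau>|lborel. G \<tau> * P \<tau>)"
    unfolding P_def by (intro Bochner_Integration.integral_cong refl) (simp add: sum_distrib_left mult_ac)
  finally have "s = norm (LINT \<tau>|lborel. G \<tau> * P \<tau>)" using s0 by (metis norm_of_real abs_of_nonneg)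
  moreover have "integrable lborel (\<lambda>\<tau>. G \<tau> * P \<tau>)"
  proof -
    have "integrable lborel (\<lambda>\<tau>. (\<Sum>m\<in>S. cnj (c m) * (G \<tau> * cis (of_int m / L * \<tau>))))"
      using Gic by simp
    then show ?thesis unfolding P_def by (simp add: sum_distrib_left mult_ac)
  qed
  ultimately have "ennreal s \<le> (\<integral>\<^sup>+\<tau>. ennreal (norm (G \<tau> * P \<tau>)) \<partial>lborel)"
    using integral_norm_bound_ennreal by metis
  also have "\<dots> = (\<integral>\<^sup>+\<tau>. ennreal (norm (G \<tau>)) * (ennreal (norm (P \<tau>)) * indicator {- pi * L..pi * L} \<tau>) \<partial>lborel)"
  proof (rule nn_integral_cong)
    fix \<tau>
    have "\<bar>\<tau>\<bar> \<le> pi * L" if "G \<tau> \<noteq> 0"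
    proof -
      have "1 * L \<le> pi * L" using pi_gt3 L by (intro mult_right_mono) auto
      then show ?thesis using supp[OF that] by linarith
    qed
    then show "ennreal (norm (G \<tau> * P \<tau>)) = ennreal (norm (G \<tau>)) * (ennreal (norm (P \<tau>)) * indicator {- pi * L..pi * L} \<tau>)"
      by (cases "G \<tau> = 0") (auto simp: norm_mult ennreal_mult abs_le_iff indicator_def)
  qed
  finally have "(ennreal s)\<^sup>2 \<le> (\<integral>\<^sup>+\<tau>. ennreal (norm (G \<tau>)) * (ennreal (norm (P \<tau>)) * indicator {- pi * L..pi * L} \<tau>) \<partial>lborel)\<^sup>2"
    by (intro power_mono) auto
  also have "\<dots> \<le> (\<integral>\<^sup>+\<tau>. (ennreal (norm (G \<tau>)))\<^sup>2 \<partial>lborel) * (\<integral>\<^sup>+\<tau>. (ennreal (norm (P \<tau>)) * indicator {- pi * L..pi * L} \<tau>)\<^sup>2 \<partial>lborel)"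
    unfolding P_def by (rule Cauchy_Schwarz_nn_integral) measurable
  also have "(\<integral>\<^sup>+\<tau>. (ennreal (norm (P \<tau>)) * indicator {- pi * L..pi * L} \<tau>)\<^sup>2 \<partial>lborel)
      = (\<integral>\<^sup>+\<tau>\<in>{- pi * L..pi * L}. ennreal ((norm (P \<tau>))\<^sup>2) \<partial>lborel)"
    by (intro nn_integral_cong) (simp add: ennreal_power split: split_indicator)
  also have "\<dots> = ennreal (2 * pi * L) * ennreal s"
    unfolding P_def nn_integral_norm_square_trig_scaled[OF L S]
    using L s0 by (simp add: s_def ennreal_mult)
  finally have *: "ennreal s * ennreal s \<le> (ennreal (2 * pi * L) * (\<integral>\<^sup>+\<tau>. ennreal ((norm (G \<tau>))\<^sup>2) \<partial>lborel)) * ennreal s"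
    by (simp only: ennreal_power[OF norm_ge_zero] power2_eq_square[of "ennreal s"] mult_ac)
  have "ennreal s \<le> ennreal (2 * pi * L) * (\<integral>\<^sup>+\<tau>. ennreal ((norm (G \<tau>))\<^sup>2) \<partial>lborel)"
  \<comment> \<open>\<open>s\<close> is a finite sum of reals, so it may be cancelled.\<close>
  proof (cases "s = 0")
    case False
    obtain r where r: "0 \<le> r" "(\<integral>\<^sup>+\<tau>. ennreal ((norm (G \<tau>))\<^sup>2) \<partial>lborel) = ennreal r"
      using True by (cases "\<integral>\<^sup>+\<tau>. ennreal ((norm (G \<tau>))\<^sup>2) \<partial>lborel" rule: ennreal_cases) auto
    have "s * s \<le> 2 * pi * L * r * s"
      using * r s0 L unfolding r by (simp add: ennreal_mult[symmetric])
    moreover have "0 < s" using False s0 by linarith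
    ultimately have "s \<le> 2 * pi * L * r" by (rule mult_right_le_imp_le)
    then have "ennreal s \<le> ennreal (2 * pi * L * r)" by (rule ennreal_leI)
    also have "\<dots> = ennreal (2 * pi * L) * ennreal r" using L r(1) by (intro ennreal_mult) auto
    finally show ?thesis unfolding r(2) .
  qed simp
  moreover have "(\<Sum>m\<in>S. ennreal ((norm (c m))\<^sup>2)) = ennreal s"
    unfolding s_def by (rule sum_ennreal) simp
  ultimately show ?thesis unfolding c_def by simp
qed

lemma nested_nn_integral_suminf:
  fixes f :: "nat \<Rightarrow> real \<Rightarrow> real \<Rightarrow> ennreal"
  assumes [measurable]: "\<And>p. case_prod (f p) \<in> borel_measurable (borel \<Otimes>\<^sub>M borel)" "A \<in> sets borel" "B \<in> sets borel"
  shows "(\<integral>\<^sup>+t\<in>A. (\<integral>\<^sup>+x\<in>B. (\<Sum>p. w p * f p t x) \<partial>lborel) \<partial>lborel)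
    = (\<Sum>p. w p * (\<integral>\<^sup>+t\<in>A. (\<integral>\<^sup>+x\<in>B. f p t x \<partial>lborel) \<partial>lborel))"
proof -
  have inner: "(\<integral>\<^sup>+x\<in>B. (\<Sum>p. w p * f p t x) \<partial>lborel) = (\<Sum>p. w p * (\<integral>\<^sup>+x\<in>B. f p t x \<partial>lborel))" for t
    by (simp add: ennreal_suminf_multc[symmetric] mult.assoc nn_integral_suminf nn_integral_cmult)
  show ?thesis unfolding inner
    by (simp add: ennreal_suminf_multc[symmetric] mult.assoc nn_integral_suminf nn_integral_cmult)
qed

lemma sums_norm_ennreal_le:
  fixes f :: "nat \<Rightarrow> 'a::real_normed_vector"
  assumes "f sums s"
  shows "ennreal (norm s) \<le> (\<Sum>p. ennreal (norm (f p)))"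
proof (rule LIMSEQ_le_const2)
  show "(\<lambda>n. ennreal (norm (\<Sum>p<n. f p))) \<longlonglongrightarrow> ennreal (norm s)"
    using assms unfolding sums_def by (intro tendsto_ennrealI tendsto_norm)
  have "ennreal (norm (\<Sum>p<n. f p)) \<le> (\<Sum>p. ennreal (norm (f p)))" for n
  proof -
    have "ennreal (norm (\<Sum>p<n. f p)) \<le> ennreal (\<Sum>p<n. norm (f p))" by (intro ennreal_leI norm_sum)
    also have "\<dots> = (\<Sum>p<n. ennreal (norm (f p)))" by (simp add: sum_ennreal)
    also have "\<dots> \<le> (\<Sum>p. ennreal (norm (f p)))" by (intro sum_le_suminf) auto
    finally show ?thesis .
  qed
  then show "\<exists>N. \<forall>n\<ge>N. ennreal (norm (\<Sum>p<n. f p)) \<le> (\<Sum>p. ennreal (norm (f p)))" by blast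
qed

lemma sum_power2_le_power2_sum_ennreal:
  fixes f :: "'a \<Rightarrow> ennreal"
  shows "(\<Sum>m\<in>S. (f m)\<^sup>2) \<le> (\<Sum>m\<in>S. f m)\<^sup>2"
proof (cases "finite S")
  case True
  then show ?thesis
  proof induction
    case (insert m S)
    have "(f m)\<^sup>2 + (\<Sum>m\<in>S. f m)\<^sup>2 \<le> (f m + (\<Sum>m\<in>S. f m))\<^sup>2"
      unfolding power2_eq_square distrib_left distrib_right
      by (intro add_mono) (auto simp: add_increasing2)
    then show ?case using insert by (simp add: order_trans[OF add_left_mono])
  qed simp
qed simp

text \<open>Expansion of \<open>cis ((t - s) * \<tau>)\<close> in powers:
  \<open>|t - s| * |\<tau>| <= 1\<close> on the support, so the terms are dominated by
  \<open>norm (G \<tau>) / fact p\<close>. The dependence on \<open>t\<close> is isolated in scalars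
  of size at most \<open>1 / fact p\<close>; the coefficients that remain are constant in
  \<open>t\<close>.\<close>

lemma fourier_taylor_sums:
  fixes G :: "real \<Rightarrow> complex"
  assumes [measurable]: "G \<in> borel_measurable borel" and G: "integrable lborel G" and L: "0 < L"
    and supp: "\<And>\<tau>. G \<tau> \<noteq> 0 \<Longrightarrow> \<bar>\<tau>\<bar> \<le> L" and t: "\<bar>t - s\<bar> \<le> 1 / L"
  shows "(\<lambda>p. of_real (((t - s) * L) ^ p / fact p) * (LINT \<tau>|lborel. G \<tau> * (\<i> * of_real (\<tau> / L)) ^ p * cis (s * \<tau>)))
    sums (LINT \<tau>|lborel. G \<tau> * cis (t * \<tau>))"
proof -
  define f where "f p \<tau> = of_real (((t - s) * L) ^ p / fact p) * (G \<tau> * (\<i> * of_real (\<tau> / L)) ^ p * cis (s * \<tau>))" for p \<tau>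
  have f_eq: "f p \<tau> = G \<tau> * cis (s * \<tau>) * ((\<i> * of_real ((t - s) * \<tau>)) ^ p /\<^sub>R fact p)" for p \<tau>
  proof -
    have "\<i> * of_real ((t - s) * \<tau>) = of_real ((t - s) * L) * (\<i> * of_real (\<tau> / L) :: complex)"
      using L by (simp add: field_simps)
    moreover have "of_real (((t - s) * L) ^ p / fact p) = of_real (inverse (fact p)) * (of_real ((t - s) * L) :: complex) ^ p"
      by (simp add: divide_inverse)
    ultimately show ?thesis
      by (simp only: power_mult_distrib f_def scaleR_conv_of_real mult_ac)
  qed
  have f_sums: "(\<lambda>p. f p \<tau>) sums (G \<tau> * cis (t * \<tau>))" for \<tau>
  proof -
    have "cis (t * \<tau>) = cis (s * \<tau>) * exp (\<i> * of_real ((t - s) * \<tau>))"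
      unfolding cis_conv_exp[symmetric] cis_mult by (simp add: algebra_simps)
    then show ?thesis unfolding f_eq
      using sums_mult[OF exp_converges, of "G \<tau> * cis (s * \<tau>)" "\<i> * of_real ((t - s) * \<tau>)"]
      by (simp add: mult.assoc)
  qed
  have f_norm: "norm (f p \<tau>) \<le> norm (G \<tau>) * (1 / fact p)" for p \<tau>
  proof (cases "G \<tau> = 0")
    case False
    have "\<bar>t - s\<bar> * \<bar>\<tau>\<bar> \<le> 1 / L * L" using supp[OF False] t L by (intro mult_mono) auto
    then have "\<bar>(t - s) * \<tau>\<bar> ^ p \<le> 1" using L by (intro power_le_one) (auto simp: abs_mult)
    moreover have "norm ((\<i> * of_real ((t - s) * \<tau>)) ^ p :: complex) = \<bar>(t - s) * \<tau>\<bar> ^ p"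
      by (simp only: norm_power norm_mult norm_of_real norm_ii mult_1)
    ultimately have "norm (f p \<tau>) = norm (G \<tau>) * (\<bar>(t - s) * \<tau>\<bar> ^ p / fact p)"
      "\<bar>(t - s) * \<tau>\<bar> ^ p / fact p \<le> 1 / fact p"
      unfolding f_eq norm_mult norm_cis norm_scaleR by (simp_all add: divide_inverse divide_right_mono)
    then show ?thesis by (simp add: mult_left_mono del: times_divide_eq_right)
  qed (simp add: f_eq)
  have f_int: "integrable lborel (f p)" for p
  proof (rule Bochner_Integration.integrable_bound)
    show "integrable lborel (\<lambda>\<tau>. norm (G \<tau>) * (1 / fact p))" using G by simp
    show "f p \<in> borel_measurable lborel" unfolding f_def by measurable
  qed (use f_norm in auto)
  have "(\<lambda>p. integral\<^sup>L lborel (f p)) sums (LINT \<tau>|lborel. (\<Sum>p. f p \<tau>))"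
  proof (rule sums_integral[OF f_int])
    have sm: "summable (\<lambda>p. c * (1 / fact p))" for c :: real
      using summable_exp[of "1::real"] by (intro summable_mult) (simp add: field_simps)
    show "AE \<tau> in lborel. summable (\<lambda>p. norm (f p \<tau>))"
      by (rule AE_I2, rule summable_comparison_test'[OF sm]) (use f_norm in auto)
    show "summable (\<lambda>p. LINT \<tau>|lborel. norm (f p \<tau>))"
    proof (rule summable_comparison_test'[OF sm])
      fix p :: nat
      have "(LINT \<tau>|lborel. norm (f p \<tau>)) \<le> (LINT \<tau>|lborel. norm (G \<tau>) * (1 / fact p))"
        using f_int G f_norm by (intro integral_mono) auto
      then show "norm (LINT \<tau>|lborel. norm (f p \<tau>)) \<le> (LINT \<tau>|lborel. norm (G \<tau>)) * (1 / fact p)"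
        by simp
    qed
  qed
  moreover have "(\<Sum>p. f p \<tau>) = G \<tau> * cis (t * \<tau>)" for \<tau> using f_sums sums_unique by metis
  moreover have "integral\<^sup>L lborel (f p) = of_real (((t - s) * L) ^ p / fact p) * (LINT \<tau>|lborel. G \<tau> * (\<i> * of_real (\<tau> / L)) ^ p * cis (s * \<tau>))" for p
    unfolding f_def by (rule integral_mult_right_zero)
  ultimately show ?thesis by simp
qed

text \<open>The factors of the constant: \<open>2 * pi * (3 + 4 * B) / 2 ^ j\<close> from
  \<open>local_L4\<close> on each interval of length 4^(-j), \<open>exp 3 * exp 1\<close> from
  Jensen over the Taylor index, \<open>(2 * pi * 4 ^ j) ^ 2\<close> from Bessel over the grid. The
  powers combine to \<open>16 ^ j / 2 ^ j = 8 ^ j\<close>, uniformly in \<open>Q\<close>.\<close>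

lemma band_limited_L4:
  fixes G :: "int \<Rightarrow> real \<Rightarrow> complex"
  assumes sep: "separated p K B" and fin: "finite K" and B: "0 \<le> B"
    and p [measurable]: "\<And>k. p k \<in> borel_measurable borel"
    and G [measurable]: "\<And>k. G k \<in> borel_measurable borel"
    and supp: "\<And>k \<tau>. G k \<tau> \<noteq> 0 \<Longrightarrow> \<bar>\<tau>\<bar> \<le> 4 ^ j"
  shows "(\<integral>\<^sup>+t\<in>{- real Q..real Q}. (\<integral>\<^sup>+x\<in>{0..2 * pi}.
      ennreal (norm (\<Sum>k\<in>K. (LINT \<tau>|lborel. G k \<tau> * cis (t * \<tau>)) * cis (of_int k * x - p k t)) ^ 4) \<partial>lborel) \<partial>lborel)
    \<le> ennreal (exp 4 * 8 * pi ^ 3 * (3 + 4 * B) * 8 ^ j) * (\<Sum>k\<in>K. \<integral>\<^sup>+\<tau>. ennreal ((norm (G k \<tau>))\<^sup>2) \<partial>lborel)\<^sup>2"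
    (is "?lhs \<le> ennreal ?C * ?Z\<^sup>2")
proof (cases "?Z < \<infinity>")
  case False
  define C where "C = ?C"
  have "0 < C" using B by (simp add: C_def add_pos_nonneg)
  moreover have "?Z = top" using False by (simp add: less_top[symmetric])
  ultimately have "ennreal C * ?Z\<^sup>2 = top" by (simp add: ennreal_mult_top power2_eq_square)
  then show ?thesis unfolding C_def by simp
next
  case True
  define L :: real where "L = 4 ^ j"
  have L: "0 < L" by (simp add: L_def)
  have Z_fin: "(\<integral>\<^sup>+\<tau>. ennreal ((norm (G k \<tau>))\<^sup>2) \<partial>lborel) < \<infinity>" if "k \<in> K" for k
    using True fin that by simp
  have Gi: "integrable lborel (G k)" if "k \<in> K" for k
    using integrable_of_square_bounded_support[OF G supp Z_fin[OF that]] by simp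
  \<comment> \<open>Taylor coefficients at the left end \<open>m / L\<close> of the interval
    \<open>J m\<close>; \<open>V m q\<close> is the free wave with these amplitudes.\<close>
  define c where "c m k q = (LINT \<tau>|lborel. G k \<tau> * (\<i> * of_real (\<tau> / L)) ^ q * cis (of_int m / L * \<tau>))" for m k q
  define V where "V m q t x = (\<Sum>k\<in>K. c m k q * cis (of_int k * x - p k t))" for m q t x
  define u where "u t x = (\<Sum>k\<in>K. (LINT \<tau>|lborel. G k \<tau> * cis (t * \<tau>)) * cis (of_int k * x - p k t))" for t x
  define J where "J m = {of_int m / L..of_int m / L + 1 / 4 ^ j}" for m :: int
  define w where "w q = ennreal (1 / fact q)" for q :: nat
  have w_sum: "(\<Sum>q. w q) = ennreal (exp 1)"
  proof -
    have "(\<lambda>q. 1 / fact q :: real) sums exp 1" using exp_converges[of "1::real"] by (simp add: field_simps)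
    then show ?thesis unfolding w_def by (intro suminf_ennreal_eq) auto
  qed
  have V_meas [measurable]: "case_prod (\<lambda>t x. ennreal (norm (V m q t x) ^ 4)) \<in> borel_measurable (borel \<Otimes>\<^sub>M borel)" for m q
    unfolding V_def by measurable
  have u_meas [measurable]: "case_prod (\<lambda>t x. ennreal (norm (u t x) ^ 4)) \<in> borel_measurable (borel \<Otimes>\<^sub>M borel)"
    unfolding u_def by measurable
  have pointwise: "ennreal (norm (u t x) ^ 4) \<le> (\<Sum>q. (ennreal (exp 3) * w q) * ennreal (norm (V m q t x) ^ 4))"
    if t: "t \<in> J m" for m t x
  proof -
    let ?a = "\<lambda>q. ((t - of_int m / L) * L) ^ q / fact q"
    have tm: "\<bar>t - of_int m / L\<bar> \<le> 1 / L" using t by (auto simp: J_def L_def)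
    have "(\<lambda>q. \<Sum>k\<in>K. of_real (?a q) * c m k q * cis (of_int k * x - p k t)) sums u t x"
      unfolding u_def
    proof (intro sums_sum sums_mult2)
      fix k assume "k \<in> K"
      then show "(\<lambda>q. of_real (?a q) * c m k q) sums (LINT \<tau>|lborel. G k \<tau> * cis (t * \<tau>))"
        unfolding c_def using fourier_taylor_sums[OF G Gi L _ tm] supp by (simp add: L_def)
    qed
    then have "(\<lambda>q. of_real (?a q) * V m q t x) sums u t x"
      by (simp add: V_def sum_distrib_left mult.assoc)
    then have "ennreal (norm (u t x)) \<le> (\<Sum>q. ennreal (norm (of_real (?a q) * V m q t x)))"
      by (rule sums_norm_ennreal_le)
    also have "\<dots> \<le> (\<Sum>q. w q * ennreal (norm (V m q t x)))"
    proof (intro suminf_le)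
      fix q
      have "\<bar>(t - of_int m / L) * L\<bar> \<le> 1" using tm L by (simp add: abs_mult pos_le_divide_eq)
      then have "norm (of_real (?a q) :: complex) \<le> 1 / fact q"
        unfolding norm_of_real abs_divide power_abs by (simp add: power_le_one divide_right_mono)
      then show "ennreal (norm (of_real (?a q) * V m q t x)) \<le> w q * ennreal (norm (V m q t x))"
        unfolding w_def norm_mult
        by (subst ennreal_mult[symmetric], simp, simp) (rule ennreal_leI, rule mult_right_mono, assumption, simp)
    qed auto
    finally have "ennreal (norm (u t x)) ^ 4 \<le> (\<Sum>q. w q * ennreal (norm (V m q t x))) ^ 4"
      by (rule power_mono) simp
    also have "\<dots> \<le> (\<Sum>q. w q) ^ 3 * (\<Sum>q. w q * ennreal (norm (V m q t x)) ^ 4)"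
      by (rule power4_suminf_le)
    also have "(\<Sum>q. w q) ^ 3 = ennreal (exp 3)"
      unfolding w_sum by (simp add: ennreal_power exp_of_nat_mult[symmetric])
    finally show ?thesis by (simp only: mult.assoc ennreal_suminf_cmult ennreal_power[OF norm_ge_zero])
  qed
  define D where "D = 2 * pi * (3 + 4 * B) / 2 ^ j"
  have D: "0 \<le> D" using B by (simp add: D_def)
  have local: "(\<integral>\<^sup>+t\<in>J m. (\<integral>\<^sup>+x\<in>{0..2 * pi}. ennreal (norm (u t x) ^ 4) \<partial>lborel) \<partial>lborel)
      \<le> (\<Sum>q. ennreal (exp 3) * w q * (ennreal D * (\<Sum>k\<in>K. ennreal ((norm (c m k q))\<^sup>2))\<^sup>2))" for m
  proof -
    have "(\<integral>\<^sup>+t\<in>J m. (\<integral>\<^sup>+x\<in>{0..2 * pi}. ennreal (norm (u t x) ^ 4) \<partial>lborel) \<partial>lborel)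
      \<le> (\<integral>\<^sup>+t\<in>J m. (\<integral>\<^sup>+x\<in>{0..2 * pi}. (\<Sum>q. (ennreal (exp 3) * w q) * ennreal (norm (V m q t x) ^ 4)) \<partial>lborel) \<partial>lborel)"
    proof (rule nn_integral_mono)
      fix t
      show "(\<integral>\<^sup>+x\<in>{0..2 * pi}. ennreal (norm (u t x) ^ 4) \<partial>lborel) * indicator (J m) t
        \<le> (\<integral>\<^sup>+x\<in>{0..2 * pi}. (\<Sum>q. (ennreal (exp 3) * w q) * ennreal (norm (V m q t x) ^ 4)) \<partial>lborel) * indicator (J m) t"
        using pointwise by (cases "t \<in> J m") (auto intro!: nn_integral_mono mult_right_mono)
    qed
    also have "\<dots> = (\<Sum>q. (ennreal (exp 3) * w q) * (\<integral>\<^sup>+t\<in>J m. (\<integral>\<^sup>+x\<in>{0..2 * pi}. ennreal (norm (V m q t x) ^ 4) \<partial>lborel) \<partial>lborel))"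
      by (rule nested_nn_integral_suminf[OF V_meas]) (auto simp: J_def)
    also have "\<dots> \<le> (\<Sum>q. (ennreal (exp 3) * w q) * ennreal (D * (\<Sum>k\<in>K. (norm (c m k q))\<^sup>2)\<^sup>2))"
      unfolding V_def J_def D_def
      by (intro suminf_le mult_left_mono local_L4[OF sep fin B p]) auto
    finally show ?thesis using D
      by (simp add: ennreal_mult sum_nonneg sum_ennreal ennreal_power)
  qed
  let ?S = "{- int Q * 4 ^ j..int Q * 4 ^ j}"
  have "{- real Q..real Q} \<subseteq> (\<Union>m\<in>?S. J m)"
  proof
    fix t assume t: "t \<in> {- real Q..real Q}"
    define m where "m = \<lfloor>t * L\<rfloor>"
    have "real_of_int (- int Q * 4 ^ j) \<le> t * L" "t * L \<le> real_of_int (int Q * 4 ^ j)"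
      using t L by (auto simp: L_def intro!: mult_right_mono)
        (metis mult_minus_left mult_right_mono L L_def less_eq_real_def)
    then have "m \<in> ?S" unfolding m_def by (simp add: le_floor_iff floor_le_iff)
    moreover have "of_int m \<le> t * L" "t * L \<le> of_int m + 1" unfolding m_def by linarith+
    then have "t \<in> J m" using L unfolding J_def L_def[symmetric] by (simp add: field_simps)
    ultimately show "t \<in> (\<Union>m\<in>?S. J m)" by blast
  qed
  then have "?lhs \<le> (\<Sum>m\<in>?S. \<integral>\<^sup>+t\<in>J m. (\<integral>\<^sup>+x\<in>{0..2 * pi}. ennreal (norm (u t x) ^ 4) \<partial>lborel) \<partial>lborel)"
    unfolding u_def[symmetric] by (intro nn_integral_cover) (auto simp: J_def)
  also have "\<dots> \<le> (\<Sum>m\<in>?S. \<Sum>q. ennreal (exp 3) * w q * (ennreal D * (\<Sum>k\<in>K. ennreal ((norm (c m k q))\<^sup>2))\<^sup>2))"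
    by (intro sum_mono local)
  also have "\<dots> = (\<Sum>q. \<Sum>m\<in>?S. ennreal (exp 3) * w q * (ennreal D * (\<Sum>k\<in>K. ennreal ((norm (c m k q))\<^sup>2))\<^sup>2))"
    by (rule suminf_sum[symmetric]) simp
  also have "\<dots> \<le> (\<Sum>q. ennreal (exp 3) * w q * (ennreal D * (ennreal (2 * pi * L) * ?Z)\<^sup>2))"
  proof (intro suminf_le)
    fix q
    \<comment> \<open>Each interval yields the square of its energy. A sum of squares is at most the
      square of the sum, and the sum of the energies over the grid is what Bessel's inequality
      controls.\<close>
    have "(\<Sum>m\<in>?S. (\<Sum>k\<in>K. ennreal ((norm (c m k q))\<^sup>2))\<^sup>2) \<le> (\<Sum>m\<in>?S. \<Sum>k\<in>K. ennreal ((norm (c m k q))\<^sup>2))\<^sup>2"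
      by (rule sum_power2_le_power2_sum_ennreal)
    also have "(\<Sum>m\<in>?S. \<Sum>k\<in>K. ennreal ((norm (c m k q))\<^sup>2)) = (\<Sum>k\<in>K. \<Sum>m\<in>?S. ennreal ((norm (c m k q))\<^sup>2))"
      by (rule sum.swap)
    also have "\<dots> \<le> (\<Sum>k\<in>K. ennreal (2 * pi * L) * (\<integral>\<^sup>+\<tau>. ennreal ((norm (G k \<tau>))\<^sup>2) \<partial>lborel))"
    proof (rule sum_mono)
      fix k assume "k \<in> K"
      have "(\<Sum>m\<in>?S. ennreal ((norm (c m k q))\<^sup>2))
          \<le> ennreal (2 * pi * L) * (\<integral>\<^sup>+\<tau>. ennreal ((norm (G k \<tau> * (\<i> * of_real (\<tau> / L)) ^ q))\<^sup>2) \<partial>lborel)"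
        unfolding c_def using supp L by (intro Bessel_exponentials) (auto simp: L_def)
      also have "\<dots> \<le> ennreal (2 * pi * L) * (\<integral>\<^sup>+\<tau>. ennreal ((norm (G k \<tau>))\<^sup>2) \<partial>lborel)"
      proof (intro mult_left_mono nn_integral_mono ennreal_leI power_mono)
        fix \<tau>
        show "norm (G k \<tau> * (\<i> * of_real (\<tau> / L)) ^ q) \<le> norm (G k \<tau>)"
        proof (cases "G k \<tau> = 0")
          case False
          then have "\<bar>\<tau> / L\<bar> \<le> 1" using supp L by (simp add: L_def)
          then have "norm ((\<i> * of_real (\<tau> / L)) ^ q :: complex) \<le> 1"
            unfolding norm_power norm_mult norm_of_real norm_ii mult_1 by (intro power_le_one) auto
          then show ?thesis unfolding norm_mult by (intro mult_left_le) auto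
        qed simp
      qed auto
      finally show "(\<Sum>m\<in>?S. ennreal ((norm (c m k q))\<^sup>2)) \<le> ennreal (2 * pi * L) * (\<integral>\<^sup>+\<tau>. ennreal ((norm (G k \<tau>))\<^sup>2) \<partial>lborel)" .
    qed
    also have "\<dots> = ennreal (2 * pi * L) * ?Z" by (simp add: sum_distrib_left)
    finally have "(\<Sum>m\<in>?S. (\<Sum>k\<in>K. ennreal ((norm (c m k q))\<^sup>2))\<^sup>2) \<le> (ennreal (2 * pi * L) * ?Z)\<^sup>2"
      by (simp add: power_mono)
    then show "(\<Sum>m\<in>?S. ennreal (exp 3) * w q * (ennreal D * (\<Sum>k\<in>K. ennreal ((norm (c m k q))\<^sup>2))\<^sup>2))
      \<le> ennreal (exp 3) * w q * (ennreal D * (ennreal (2 * pi * L) * ?Z)\<^sup>2)"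
      unfolding sum_distrib_left[symmetric] by (intro mult_left_mono) auto
  qed auto
  also have "\<dots> = (ennreal (exp 3) * (\<Sum>q. w q)) * (ennreal D * (ennreal (2 * pi * L) * ?Z)\<^sup>2)"
    by (simp only: ennreal_suminf_multc ennreal_suminf_cmult)
  also have "\<dots> = ennreal (exp 3 * exp 1 * D * (2 * pi * L)\<^sup>2) * ?Z\<^sup>2"
  proof -
    have "(ennreal (2 * pi * L) * ?Z)\<^sup>2 = ennreal ((2 * pi * L)\<^sup>2) * ?Z\<^sup>2"
      unfolding power_mult_distrib[of "ennreal (2 * pi * L)"] using L by (subst ennreal_power) auto
    then show ?thesis
      unfolding w_sum using D by (simp only: mult.assoc[symmetric]) (simp add: ennreal_mult[symmetric])
  qed
  also have "exp 3 * exp 1 * D * (2 * pi * L)\<^sup>2 = ?C"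
  proof -
    have "exp 3 * exp 1 = exp (4::real)" by (simp add: mult_exp_exp)
    moreover have "L\<^sup>2 = 8 ^ j * 2 ^ j" by (simp add: L_def power_mult_distrib[symmetric] power2_eq_square)
    ultimately have "exp 3 * exp 1 * D * (2 * pi * L)\<^sup>2 = exp 4 * (2 * pi * (3 + 4 * B) / 2 ^ j) * (4 * pi\<^sup>2 * (8 ^ j * 2 ^ j))"
      unfolding D_def power_mult_distrib by simp
    then show ?thesis by (simp add: power3_eq_cube power2_eq_square)
  qed
  finally show ?thesis .
qed

section \<open>Summation over dyadic shells of the modulation\<close>

definition shell :: "nat \<Rightarrow> real set" where
  "shell j = {\<tau>. \<bar>\<tau>\<bar> \<le> 4 ^ j \<and> (j = 0 \<or> 4 ^ (j - 1) < \<bar>\<tau>\<bar>)}"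

lemma shell_sets [measurable]: "shell j \<in> sets borel"
  unfolding shell_def by measurable

text \<open>For \<open>j > 0\<close> the shell lies beyond \<open>4 ^ (j - 1)\<close>, where the
  weight is at least \<open>16 powr (b * (j - 1))\<close>; the factor \<open>16 powr b\<close> pays
  for the shift by one. For \<open>j = 0\<close> the weight is at least 1.\<close>

lemma japanese_powr_shell_ge:
  assumes "\<tau> \<in> shell j" "0 \<le> b"
  shows "1 \<le> 16 powr b * (16 powr (- b)) ^ j * japanese \<tau> powr (2 * b)"
proof (cases j)
  case 0
  have "1 \<le> japanese \<tau>" by (simp add: japanese_def)
  then show ?thesis using 0 assms
    by (simp add: ge_one_powr_ge_zero mult_ge1_I)
next
  case (Suc i)
  then have i: "4 ^ i \<le> \<bar>\<tau>\<bar>" using assms by (simp add: shell_def)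
  have "\<bar>\<tau>\<bar> \<le> japanese \<tau>" unfolding japanese_def by (rule real_le_rsqrt) simp
  then have "(4 ^ i) powr (2 * b) \<le> japanese \<tau> powr (2 * b)" using i assms by (intro powr_mono2) auto
  moreover have "(4 ^ i) powr (2 * b) = ((16::real) powr b) ^ i"
  proof -
    have "((4::real) ^ i) powr (2 * b) = (4 powr real i) powr (2 * b)" by (simp add: powr_realpow)
    also have "\<dots> = 4 powr (2 * (b * real i))" by (simp add: powr_powr mult_ac)
    also have "\<dots> = (4 powr 2) powr (b * real i)" by (simp only: powr_powr)
    also have "\<dots> = 16 powr (b * real i)" by simp
    also have "\<dots> = (16 powr b) ^ i" by (simp add: powr_powr[symmetric] powr_realpow)
    finally show ?thesis .
  qed
  ultimately have "16 powr b * (16 powr (- b)) ^ j * ((16 powr b) ^ i) \<le> 16 powr b * (16 powr (- b)) ^ j * japanese \<tau> powr (2 * b)"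
    by (intro mult_left_mono) auto
  moreover have "16 powr b * (16 powr (- b)) ^ j * ((16 powr b) ^ i) = (1::real)"
    by (simp add: Suc powr_minus power_inverse field_simps)
  ultimately show ?thesis by simp
qed

text \<open>The squared norm inside \<open>Hb_norm\<close>, without the factor
  \<open>1 / (2 * pi)\<close> and over \<open>lborel\<close>, for Borel representatives of the
  Fourier transform.\<close>

definition sobolev_sq :: "real \<Rightarrow> (real \<Rightarrow> complex) \<Rightarrow> ennreal" where
  "sobolev_sq b g = (\<integral>\<^sup>+\<tau>. ennreal (japanese \<tau> powr (2 * b) * (norm (g \<tau>))\<^sup>2) \<partial>lborel)"

text \<open>The \<open>j\<close>-th shell contributes \<open>8\<^sup>j\<close> to the fourth power and gains \<open>16\<^bsup>-2bj\<^esup>\<close> from the weight, so Jensen's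
  inequality with the weights \<open>q\<^sup>j\<close>, where \<open>q = 4\<^bsup>3/8 - b\<^esup>\<close>, sums the shells.\<close>

lemma dyadic_L4:
  fixes g :: "int \<Rightarrow> real \<Rightarrow> complex"
  assumes sep: "separated p K B" and fin: "finite K" and B: "0 \<le> B" and b: "3 / 8 < b"
    and p [measurable]: "\<And>k. p k \<in> borel_measurable borel"
    and g [measurable]: "\<And>k. g k \<in> borel_measurable borel"
  shows "(\<integral>\<^sup>+t\<in>{- real Q..real Q}. (\<integral>\<^sup>+x\<in>{0..2 * pi}. (\<Sum>j. ennreal (norm (\<Sum>k\<in>K.
        (LINT \<tau>|lborel. (g k \<tau> * indicator (shell j) \<tau>) * cis (t * \<tau>)) * cis (of_int k * x - p k t)))) ^ 4 \<partial>lborel) \<partial>lborel)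
    \<le> ennreal (exp 4 * 8 * pi ^ 3 * (3 + 4 * B) * 256 powr b / (1 - 4 powr (3 / 8 - b)) ^ 4)
        * (\<Sum>k\<in>K. sobolev_sq b (g k))\<^sup>2"
proof -
  define q where "q = (4::real) powr (3 / 8 - b)"
  have q: "0 < q" "q < 1" using b by (auto simp: q_def powr_less_one)
  define D where "D = exp 4 * 8 * pi ^ 3 * (3 + 4 * B)"
  have D: "0 \<le> D" using B by (simp add: D_def)
  define Z where "Z = (\<Sum>k\<in>K. sobolev_sq b (g k))"
  define V where "V j t x = (\<Sum>k\<in>K.
        (LINT \<tau>|lborel. (g k \<tau> * indicator (shell j) \<tau>) * cis (t * \<tau>)) * cis (of_int k * x - p k t))" for j t x
  have V_meas [measurable]: "case_prod (\<lambda>t x. ennreal (norm (V j t x) ^ 4)) \<in> borel_measurable (borel \<Otimes>\<^sub>M borel)" for j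
    unfolding V_def by measurable
  \<comment> \<open>Jensen with the weights \<open>q ^ j\<close> acts on
    \<open>norm (V j t x) / q ^ j\<close>; the fourth power of \<open>1 / q ^ j\<close> is kept in
    \<open>v\<close>.\<close>
  define v where "v j = q ^ j * (1 / q) ^ (4 * j)" for j
  have v0: "0 \<le> v j" for j using q by (simp add: v_def)
  have geo: "(\<Sum>j. ennreal (q ^ j)) = ennreal (1 / (1 - q))"
    using q geometric_sums[of q] by (intro suminf_ennreal_eq) auto
  have pointwise: "(\<Sum>j. ennreal (norm (V j t x))) ^ 4
      \<le> (\<Sum>j. (ennreal ((1 / (1 - q)) ^ 3) * ennreal (v j)) * ennreal (norm (V j t x) ^ 4))" for t x
  proof -
    have "(\<Sum>j. ennreal (norm (V j t x))) = (\<Sum>j. ennreal (q ^ j) * ennreal ((1 / q) ^ j * norm (V j t x)))"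
      using q by (intro suminf_cong) (simp add: ennreal_mult[symmetric] mult.assoc[symmetric] power_mult_distrib[symmetric])
    also have "\<dots> ^ 4 \<le> (\<Sum>j. ennreal (q ^ j)) ^ 3 * (\<Sum>j. ennreal (q ^ j) * ennreal ((1 / q) ^ j * norm (V j t x)) ^ 4)"
      by (rule power4_suminf_le)
    also have "(\<Sum>j. ennreal (q ^ j) * ennreal ((1 / q) ^ j * norm (V j t x)) ^ 4)
        = (\<Sum>j. ennreal (v j) * ennreal (norm (V j t x) ^ 4))"
    proof (rule suminf_cong)
      fix j
      have "ennreal (q ^ j) * ennreal ((1 / q) ^ j * norm (V j t x)) ^ 4
          = ennreal (q ^ j * ((1 / q) ^ j * norm (V j t x)) ^ 4)"
        using q by (subst ennreal_power, simp, subst ennreal_mult[symmetric]) auto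
      also have "q ^ j * ((1 / q) ^ j * norm (V j t x)) ^ 4 = v j * norm (V j t x) ^ 4"
        by (simp add: v_def power_mult_distrib power_mult[symmetric] mult.commute)
      also have "ennreal \<dots> = ennreal (v j) * ennreal (norm (V j t x) ^ 4)"
        using v0 by (intro ennreal_mult) auto
      finally show "ennreal (q ^ j) * ennreal ((1 / q) ^ j * norm (V j t x)) ^ 4
        = ennreal (v j) * ennreal (norm (V j t x) ^ 4)" .
    qed
    also have "(\<Sum>j. ennreal (q ^ j)) ^ 3 = ennreal ((1 / (1 - q)) ^ 3)"
      unfolding geo using q by (intro ennreal_power) auto
    finally show ?thesis by (simp only: mult.assoc ennreal_suminf_cmult)
  qed
  have band: "(\<integral>\<^sup>+t\<in>{- real Q..real Q}. (\<integral>\<^sup>+x\<in>{0..2 * pi}. ennreal (norm (V j t x) ^ 4) \<partial>lborel) \<partial>lborel)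
      \<le> ennreal (D * 8 ^ j * (16 powr b * (16 powr (- b)) ^ j)\<^sup>2) * Z\<^sup>2" for j
  proof -
    let ?e = "16 powr b * (16 powr (- b)) ^ j"
    have "(\<integral>\<^sup>+t\<in>{- real Q..real Q}. (\<integral>\<^sup>+x\<in>{0..2 * pi}. ennreal (norm (V j t x) ^ 4) \<partial>lborel) \<partial>lborel)
      \<le> ennreal (D * 8 ^ j) * (\<Sum>k\<in>K. \<integral>\<^sup>+\<tau>. ennreal ((norm (g k \<tau> * indicator (shell j) \<tau>))\<^sup>2) \<partial>lborel)\<^sup>2"
      unfolding V_def D_def
    proof (rule band_limited_L4[OF sep fin B p])
      fix k \<tau> assume "g k \<tau> * indicator (shell j) \<tau> \<noteq> 0"
      then show "\<bar>\<tau>\<bar> \<le> 4 ^ j" by (auto simp: shell_def indicator_def split: if_splits)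
    qed measurable
    also have "(\<Sum>k\<in>K. \<integral>\<^sup>+\<tau>. ennreal ((norm (g k \<tau> * indicator (shell j) \<tau>))\<^sup>2) \<partial>lborel) \<le> (\<Sum>k\<in>K. ennreal ?e * sobolev_sq b (g k))"
    proof (rule sum_mono)
      fix k
      have "(\<integral>\<^sup>+\<tau>. ennreal ((norm (g k \<tau> * indicator (shell j) \<tau>))\<^sup>2) \<partial>lborel)
        \<le> (\<integral>\<^sup>+\<tau>. ennreal ?e * ennreal (japanese \<tau> powr (2 * b) * (norm (g k \<tau>))\<^sup>2) \<partial>lborel)"
      proof (rule nn_integral_mono)
        fix \<tau>
        have "(norm (g k \<tau> * indicator (shell j) \<tau>))\<^sup>2 \<le> ?e * (japanese \<tau> powr (2 * b) * (norm (g k \<tau>))\<^sup>2)"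
        proof (cases "\<tau> \<in> shell j")
          case True
          have "1 * (norm (g k \<tau>))\<^sup>2 \<le> ?e * japanese \<tau> powr (2 * b) * (norm (g k \<tau>))\<^sup>2"
            using japanese_powr_shell_ge[OF True, of b] b by (intro mult_right_mono) auto
          then show ?thesis using True by (simp add: mult.assoc)
        qed simp
        then show "ennreal ((norm (g k \<tau> * indicator (shell j) \<tau>))\<^sup>2) \<le> ennreal ?e * ennreal (japanese \<tau> powr (2 * b) * (norm (g k \<tau>))\<^sup>2)"
          by (subst ennreal_mult[symmetric]) (auto intro: ennreal_leI)
      qed
      also have "\<dots> = ennreal ?e * sobolev_sq b (g k)"
        unfolding sobolev_sq_def by (rule nn_integral_cmult) (simp add: japanese_def)
      finally show "(\<integral>\<^sup>+\<tau>. ennreal ((norm (g k \<tau> * indicator (shell j) \<tau>))\<^sup>2) \<partial>lborel) \<le> ennreal ?e * sobolev_sq b (g k)" .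
    qed
    also have "(\<Sum>k\<in>K. ennreal ?e * sobolev_sq b (g k)) = ennreal ?e * Z" by (simp add: Z_def sum_distrib_left)
    finally have "(\<integral>\<^sup>+t\<in>{- real Q..real Q}. (\<integral>\<^sup>+x\<in>{0..2 * pi}. ennreal (norm (V j t x) ^ 4) \<partial>lborel) \<partial>lborel)
      \<le> ennreal (D * 8 ^ j) * (ennreal ?e * Z)\<^sup>2"
      by (simp add: power_mono mult_left_mono)
    also have "(ennreal ?e * Z)\<^sup>2 = ennreal (?e\<^sup>2) * Z\<^sup>2"
      unfolding power_mult_distrib[of "ennreal _"] by (subst ennreal_power) auto
    also have "ennreal (D * 8 ^ j) * (ennreal (?e\<^sup>2) * Z\<^sup>2) = ennreal (D * 8 ^ j * ?e\<^sup>2) * Z\<^sup>2"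
      using D by (subst ennreal_mult[of "D * 8 ^ j" "?e\<^sup>2"]) (auto simp: mult.assoc)
    finally show ?thesis .
  qed
  \<comment> \<open>\<open>q ^ 4 = 8 / 16 powr (2 * b)\<close> cancels the growth of the band
    estimate against the Sobolev weight, up to the summable \<open>q ^ j\<close>. This last series
    adds a fourth factor \<open>1 / (1 - q)\<close> to the three from Jensen.\<close>
  have factor: "v j * (D * 8 ^ j * (16 powr b * (16 powr (- b)) ^ j)\<^sup>2) = D * 256 powr b * q ^ j" for j
  proof -
    have q4: "q ^ 4 = 8 * (16 powr (- b))\<^sup>2"
    proof -
      have "q ^ 4 = 4 powr (3 / 2 - 4 * b)" by (simp add: q_def powr_realpow[symmetric] powr_powr algebra_simps)
      also have "\<dots> = 4 powr (1 + 1 / 2) * 4 powr (- 4 * b)"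
        unfolding powr_add[symmetric] by (rule arg_cong) simp
      also have "4 powr (1 + 1 / 2) = (8::real)" unfolding powr_add by (simp add: powr_half_sqrt)
      also have "(4::real) powr (- 4 * b) = (4 powr 2) powr (- b * 2)" unfolding powr_powr by simp
      also have "\<dots> = (16 powr (- b)) powr 2" by (simp add: powr_powr)
      also have "\<dots> = (16 powr (- b))\<^sup>2" by simp
      finally show ?thesis .
    qed
    have "(16 powr b)\<^sup>2 = (256::real) powr b"
      by (simp add: power2_eq_square powr_mult[symmetric])
    then have "v j * (D * 8 ^ j * (16 powr b * (16 powr (- b)) ^ j)\<^sup>2)
        = D * 256 powr b * (q ^ j * (1 / q) ^ (4 * j) * (8 * (16 powr (- b))\<^sup>2) ^ j)"
      by (simp add: v_def power_mult_distrib power_mult[symmetric] mult_ac)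
    also have "(1 / q) ^ (4 * j) * (8 * (16 powr (- b))\<^sup>2) ^ j = 1"
      unfolding q4[symmetric] using q by (simp add: power_mult[symmetric] power_divide)
    then have "q ^ j * (1 / q) ^ (4 * j) * (8 * (16 powr (- b))\<^sup>2) ^ j = q ^ j" by (simp add: mult.assoc)
    finally show ?thesis .
  qed
  have "(\<integral>\<^sup>+t\<in>{- real Q..real Q}. (\<integral>\<^sup>+x\<in>{0..2 * pi}. (\<Sum>j. ennreal (norm (V j t x))) ^ 4 \<partial>lborel) \<partial>lborel)
    \<le> (\<integral>\<^sup>+t\<in>{- real Q..real Q}. (\<integral>\<^sup>+x\<in>{0..2 * pi}. (\<Sum>j. (ennreal ((1 / (1 - q)) ^ 3) * ennreal (v j)) * ennreal (norm (V j t x) ^ 4)) \<partial>lborel) \<partial>lborel)"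
    by (intro nn_integral_mono mult_right_mono pointwise) auto
  also have "\<dots> = (\<Sum>j. (ennreal ((1 / (1 - q)) ^ 3) * ennreal (v j)) *
      (\<integral>\<^sup>+t\<in>{- real Q..real Q}. (\<integral>\<^sup>+x\<in>{0..2 * pi}. ennreal (norm (V j t x) ^ 4) \<partial>lborel) \<partial>lborel))"
    by (rule nested_nn_integral_suminf[OF V_meas]) auto
  also have "\<dots> \<le> (\<Sum>j. (ennreal ((1 / (1 - q)) ^ 3) * ennreal (v j)) *
      (ennreal (D * 8 ^ j * (16 powr b * (16 powr (- b)) ^ j)\<^sup>2) * Z\<^sup>2))"
    by (intro suminf_le mult_left_mono band) auto
  also have "\<dots> = (\<Sum>j. ennreal ((1 / (1 - q)) ^ 3 * (D * 256 powr b)) * ennreal (q ^ j) * Z\<^sup>2)"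
  proof (rule suminf_cong)
    fix j
    have "(ennreal ((1 / (1 - q)) ^ 3) * ennreal (v j)) * (ennreal (D * 8 ^ j * (16 powr b * (16 powr (- b)) ^ j)\<^sup>2) * Z\<^sup>2)
      = ennreal ((1 / (1 - q)) ^ 3) * (ennreal (v j) * ennreal (D * 8 ^ j * (16 powr b * (16 powr (- b)) ^ j)\<^sup>2)) * Z\<^sup>2"
      by (simp only: mult.assoc)
    also have "ennreal (v j) * ennreal (D * 8 ^ j * (16 powr b * (16 powr (- b)) ^ j)\<^sup>2) = ennreal (D * 256 powr b * q ^ j)"
      using v0 D by (subst ennreal_mult[symmetric]) (auto simp: factor)
    also have "ennreal ((1 / (1 - q)) ^ 3) * ennreal (D * 256 powr b * q ^ j) = ennreal ((1 / (1 - q)) ^ 3 * (D * 256 powr b)) * ennreal (q ^ j)"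
      using q D by (simp add: ennreal_mult[symmetric] mult.assoc)
    finally show "(ennreal ((1 / (1 - q)) ^ 3) * ennreal (v j)) * (ennreal (D * 8 ^ j * (16 powr b * (16 powr (- b)) ^ j)\<^sup>2) * Z\<^sup>2)
      = ennreal ((1 / (1 - q)) ^ 3 * (D * 256 powr b)) * ennreal (q ^ j) * Z\<^sup>2" .
  qed
  also have "\<dots> = ennreal ((1 / (1 - q)) ^ 3 * (D * 256 powr b)) * ennreal (1 / (1 - q)) * Z\<^sup>2"
    by (simp only: ennreal_suminf_multc ennreal_suminf_cmult geo)
  also have "ennreal ((1 / (1 - q)) ^ 3 * (D * 256 powr b)) * ennreal (1 / (1 - q)) = ennreal (D * 256 powr b / (1 - q) ^ 4)"
  proof -
    have "(1 / y) ^ 3 * E * (1 / y) = E / y ^ 4" for y E :: real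
      by (simp add: power_divide power3_eq_cube power4_eq_xxxx)
    then show ?thesis using q D by (subst ennreal_mult[symmetric]) auto
  qed
  finally show ?thesis unfolding V_def D_def Z_def q_def .
qed

section \<open>Separation of the two phases\<close>

lemma borel_measurable_cnj [measurable (raw)]:
  assumes "f \<in> borel_measurable M"
  shows "(\<lambda>x. cnj (f x)) \<in> borel_measurable M"
  using borel_measurable_continuous_on[OF _ assms, of cnj] by (simp add: continuous_on_cnj continuous_on_id)

text \<open>The weight \<open>w\<close> majorizes \<open>1\<^bsub>K\<^esub>\<close>, and duality (the \<open>T T\<^sup>*\<close> method) reduces the estimate
  to Schur's test for the kernel of \<open>T T\<^sup>*\<close>.\<close>

lemma TTstar_Schur:
  fixes \<theta> :: "int \<Rightarrow> real \<Rightarrow> real" and w :: "int \<Rightarrow> real"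
  assumes fin: "finite K" "finite W" "K \<subseteq> W" and w0: "\<And>k. 0 \<le> w k" and w1: "\<And>k. k \<in> K \<Longrightarrow> 1 \<le> w k"
    and cont: "\<And>k. continuous_on UNIV (\<theta> k)" and ab: "a \<le> b"
    and kernel: "\<And>t s. t \<in> {a..b} \<Longrightarrow> s \<in> {a..b} \<Longrightarrow>
        norm (\<Sum>k\<in>W. of_real (w k) * cis (\<theta> k t - \<theta> k s)) \<le> \<kappa> t s"
    and \<kappa>_sym: "\<And>t s. \<kappa> t s = \<kappa> s t" and \<kappa>0: "\<And>t s. 0 \<le> \<kappa> t s"
    and \<kappa>_meas [measurable]: "case_prod \<kappa> \<in> borel_measurable (borel \<Otimes>\<^sub>M borel)"
    and Schur: "\<And>t. t \<in> {a..b} \<Longrightarrow> (\<integral>\<^sup>+s\<in>{a..b}. ennreal (\<kappa> t s) \<partial>lborel) \<le> ennreal A" and A: "0 \<le> A"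
  shows "(\<integral>\<^sup>+t\<in>{a..b}. ennreal ((norm (\<Sum>k\<in>K. d k * cis (- \<theta> k t)))\<^sup>2) \<partial>lborel)
    \<le> ennreal (A * (\<Sum>k\<in>K. (norm (d k))\<^sup>2))"
proof -
  have [measurable]: "\<theta> k \<in> borel_measurable borel" for k
    using cont by (intro borel_measurable_continuous_onI)
  \<comment> \<open>Integration over \<open>{a..b}\<close> as a finite measure, on which bounded
    measurable functions are integrable.\<close>
  define M :: "real measure" where "M = density lborel (indicator {a..b})"
  have sets_M [measurable_cong]: "sets M = sets borel" by (simp add: M_def)
  have nn_M: "(\<integral>\<^sup>+t. f t \<partial>M) = (\<integral>\<^sup>+t\<in>{a..b}. f t \<partial>lborel)" if "f \<in> borel_measurable borel" for f
    using that by (simp add: M_def nn_integral_density mult.commute)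
  have AE_M: "AE t in M. t \<in> {a..b}"
    unfolding M_def by (subst AE_density) (auto simp: indicator_def split: if_splits)
  interpret M: finite_measure M
    by (rule finite_measureI) (simp add: M_def emeasure_density ab)
  interpret MM: pair_sigma_finite M M ..
  define g where "g t = (\<Sum>k\<in>K. d k * cis (- \<theta> k t))" for t
  have g_meas [measurable]: "g \<in> borel_measurable borel" unfolding g_def by measurable
  define S where "S = (\<Sum>k\<in>K. (norm (d k))\<^sup>2)"
  define N where "N = (\<Sum>k\<in>K. norm (d k))"
  have g_bd: "norm (g t) \<le> N" for t
    unfolding g_def N_def by (rule sum_norm_le) (simp add: norm_mult)
  have int [simp]: "integrable M f" if "f \<in> borel_measurable borel" "\<And>t. norm (f t) \<le> c" for f :: "real \<Rightarrow> complex" and c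
    using that by (intro M.integrable_const_bound[of _ c]) (auto simp: measurable_cong_sets[OF sets_M refl])
  have intr: "integrable M f" if "f \<in> borel_measurable borel" "\<And>t. \<bar>f t\<bar> \<le> c" for f :: "real \<Rightarrow> real" and c
    using that by (intro M.integrable_const_bound[of _ c]) (auto simp: measurable_cong_sets[OF sets_M refl])
  define X where "X = (LINT t|M. (norm (g t))\<^sup>2)"
  \<comment> \<open>The squared norm \<open>X\<close> of \<open>g\<close> is the sum of
    \<open>d k * I k\<close>. By Cauchy-Schwarz it remains to bound the energy of the
    \<open>I k\<close>, where the sum over \<open>k\<close> becomes the kernel.\<close>
  define I where "I k = (LINT t|M. cnj (g t) * cis (- \<theta> k t))" for k
  have Iint: "integrable M (\<lambda>t. cnj (g t) * cis (- \<theta> k t))" for k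
    by (rule int[where c=N], measurable) (auto simp: norm_mult g_bd)
  have X0: "0 \<le> X" by (simp add: X_def)
  have nn_X: "(\<integral>\<^sup>+t. ennreal ((norm (g t))\<^sup>2) \<partial>M) = ennreal X"
    unfolding X_def using g_bd
    by (intro nn_integral_eq_integral intr[where c="N\<^sup>2"]) (auto intro!: power_mono)
  have "complex_of_real X = (LINT t|M. g t * cnj (g t))"
    unfolding X_def by (simp add: integral_complex_of_real[symmetric] complex_norm_square del: of_real_power)
  also have "\<dots> = (LINT t|M. (\<Sum>k\<in>K. d k * (cnj (g t) * cis (- \<theta> k t))))"
    by (intro Bochner_Integration.integral_cong refl) (simp add: g_def[of _] sum_distrib_right mult_ac)
  also have "\<dots> = (\<Sum>k\<in>K. d k * I k)"
    using Iint by (simp add: I_def)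
  finally have "X = norm (\<Sum>k\<in>K. d k * I k)" using X0 by (metis norm_of_real abs_of_nonneg)
  also have "\<dots> \<le> (\<Sum>k\<in>K. norm (d k) * norm (I k))" by (rule sum_norm_le) (simp add: norm_mult)
  finally have "X\<^sup>2 \<le> (\<Sum>k\<in>K. norm (d k) * norm (I k))\<^sup>2" using X0 by (intro power_mono) auto
  also have "\<dots> \<le> S * (\<Sum>k\<in>K. (norm (I k))\<^sup>2)" unfolding S_def by (rule Cauchy_Schwarz_ineq_sum)
  finally have X_le: "X\<^sup>2 \<le> S * (\<Sum>k\<in>K. (norm (I k))\<^sup>2)" .
  have "(\<Sum>k\<in>K. (norm (I k))\<^sup>2) \<le> (\<Sum>k\<in>W. w k * (norm (I k))\<^sup>2)"
  proof -
    have "(\<Sum>k\<in>K. (norm (I k))\<^sup>2) \<le> (\<Sum>k\<in>K. w k * (norm (I k))\<^sup>2)"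
    proof (rule sum_mono)
      fix k assume "k \<in> K"
      from mult_right_mono[OF w1[OF this] zero_le_power2[of "norm (I k)"]]
      show "(norm (I k))\<^sup>2 \<le> w k * (norm (I k))\<^sup>2" by simp
    qed
    also have "\<dots> \<le> (\<Sum>k\<in>W. w k * (norm (I k))\<^sup>2)" using fin w0 by (intro sum_mono2) auto
    finally show ?thesis .
  qed
  also have "(\<Sum>k\<in>W. w k * (norm (I k))\<^sup>2) \<le> A * X"
  proof -
    have inner: "(LINT s|M. cnj (g t) * g s * (of_real (w k) * cis (\<theta> k s - \<theta> k t))) = of_real (w k) * (cnj (g t) * cis (- \<theta> k t)) * cnj (I k)" for t k
    proof -
      have "cnj (I k) = (LINT s|M. g s * cis (\<theta> k s))"
        unfolding I_def Bochner_Integration.integral_cnj[symmetric] by (simp add: cis_cnj)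
      moreover have "(LINT s|M. cnj (g t) * g s * (of_real (w k) * cis (\<theta> k s - \<theta> k t)))
          = (LINT s|M. (of_real (w k) * (cnj (g t) * cis (- \<theta> k t))) * (g s * cis (\<theta> k s)))"
      proof (intro Bochner_Integration.integral_cong refl)
        fix s
        have "cis (\<theta> k s - \<theta> k t) = cis (- \<theta> k t) * cis (\<theta> k s)" by (simp add: cis_mult)
        then show "cnj (g t) * g s * (of_real (w k) * cis (\<theta> k s - \<theta> k t)) = (of_real (w k) * (cnj (g t) * cis (- \<theta> k t))) * (g s * cis (\<theta> k s))"
          by (simp only: mult_ac)
      qed
      ultimately show ?thesis by simp
    qed
    let ?k = "\<lambda>t s. \<Sum>k\<in>W. of_real (w k) * cis (\<theta> k s - \<theta> k t)"
    define H where "H t = (LINT s|M. cnj (g t) * g s * ?k t s)" for t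
    have H_eq: "H t = (\<Sum>k\<in>W. of_real (w k) * (cnj (g t) * cis (- \<theta> k t)) * cnj (I k))" for t
    proof -
      have "H t = (LINT s|M. (\<Sum>k\<in>W. cnj (g t) * g s * (of_real (w k) * cis (\<theta> k s - \<theta> k t))))"
        by (simp add: H_def sum_distrib_left)
      also have "\<dots> = (\<Sum>k\<in>W. LINT s|M. cnj (g t) * g s * (of_real (w k) * cis (\<theta> k s - \<theta> k t)))"
      proof (rule Bochner_Integration.integral_sum)
        fix k
        show "integrable M (\<lambda>s. cnj (g t) * g s * (of_real (w k) * cis (\<theta> k s - \<theta> k t)))"
          using w0[of k] g_bd[of t] g_bd order_trans[OF norm_ge_zero g_bd]
          by (intro int[where c="N * N * w k"], measurable) (auto simp: norm_mult mult.assoc[symmetric] intro!: mult_mono)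
      qed
      finally show ?thesis by (simp add: inner)
    qed
    have "complex_of_real (\<Sum>k\<in>W. w k * (norm (I k))\<^sup>2) = (\<Sum>k\<in>W. of_real (w k) * I k * cnj (I k))"
      by (simp add: complex_norm_square mult.assoc del: of_real_power)
    also have "\<dots> = (LINT t|M. H t)"
    proof -
      have "(LINT t|M. H t) = (\<Sum>k\<in>W. LINT t|M. of_real (w k) * (cnj (g t) * cis (- \<theta> k t)) * cnj (I k))"
        unfolding H_eq
        by (intro Bochner_Integration.integral_sum integrable_mult_left integrable_mult_right Iint)
      also have "\<dots> = (\<Sum>k\<in>W. of_real (w k) * I k * cnj (I k))"
        by (intro sum.cong refl) (simp only: integral_mult_left_zero integral_mult_right_zero I_def)
      finally show ?thesis ..
    qed
    finally have y: "complex_of_real (\<Sum>k\<in>W. w k * (norm (I k))\<^sup>2) = (LINT t|M. H t)" .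
    have y0: "0 \<le> (\<Sum>k\<in>W. w k * (norm (I k))\<^sup>2)" using w0 by (intro sum_nonneg) auto
    have "(\<Sum>k\<in>W. w k * (norm (I k))\<^sup>2) = norm (LINT t|M. H t)"
      unfolding y[symmetric] norm_of_real using y0 by simp
    then have "ennreal (\<Sum>k\<in>W. w k * (norm (I k))\<^sup>2) \<le> (\<integral>\<^sup>+t. ennreal (norm (H t)) \<partial>M)"
      by (cases "integrable M H") (auto intro: integral_norm_bound_ennreal simp: not_integrable_integral_eq)
    \<comment> \<open>\<open>norm (g t) * norm (g s)\<close> is replaced by half the sum of the
      squares. By the symmetry of \<open>\<kappa>\<close> the two halves are equal, and
      \<open>Schur\<close> bounds each of them.\<close>
    also have "\<dots> \<le> (\<integral>\<^sup>+t. (\<integral>\<^sup>+s. ennreal (((norm (g t))\<^sup>2 / 2 + (norm (g s))\<^sup>2 / 2) * \<kappa> t s) \<partial>M) \<partial>M)"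
    proof (rule nn_integral_mono_AE, rule AE_mp[OF AE_M], rule AE_I2, rule impI)
      fix t assume t: "t \<in> {a..b}"
      have "ennreal (norm (H t)) \<le> (\<integral>\<^sup>+s. ennreal (norm (cnj (g t) * g s * ?k t s)) \<partial>M)"
        unfolding H_def
        by (cases "integrable M (\<lambda>s. cnj (g t) * g s * ?k t s)") (auto intro: integral_norm_bound_ennreal simp: not_integrable_integral_eq)
      also have "\<dots> \<le> (\<integral>\<^sup>+s. ennreal (((norm (g t))\<^sup>2 / 2 + (norm (g s))\<^sup>2 / 2) * \<kappa> t s) \<partial>M)"
      proof (rule nn_integral_mono_AE, rule AE_mp[OF AE_M], rule AE_I2, rule impI, rule ennreal_leI)
        fix s assume s: "s \<in> {a..b}"
        have "norm (g t) * norm (g s) \<le> (norm (g t))\<^sup>2 / 2 + (norm (g s))\<^sup>2 / 2"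
          using zero_le_power2[of "norm (g t) - norm (g s)"] by (simp add: power2_diff)
        then show "norm (cnj (g t) * g s * ?k t s) \<le> ((norm (g t))\<^sup>2 / 2 + (norm (g s))\<^sup>2 / 2) * \<kappa> t s"
          unfolding norm_mult complex_mod_cnj using kernel[OF s t] \<kappa>_sym[of t s] by (intro mult_mono) auto
      qed
      finally show "ennreal (norm (H t)) \<le> (\<integral>\<^sup>+s. ennreal (((norm (g t))\<^sup>2 / 2 + (norm (g s))\<^sup>2 / 2) * \<kappa> t s) \<partial>M)" .
    qed
    also have "\<dots> = (\<integral>\<^sup>+t. (\<integral>\<^sup>+s. ennreal ((norm (g t))\<^sup>2 / 2 * \<kappa> t s) \<partial>M) \<partial>M) + (\<integral>\<^sup>+t. (\<integral>\<^sup>+s. ennreal ((norm (g s))\<^sup>2 / 2 * \<kappa> t s) \<partial>M) \<partial>M)"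
      using \<kappa>0 by (simp add: distrib_right nn_integral_add)
    also have "(\<integral>\<^sup>+t. (\<integral>\<^sup>+s. ennreal ((norm (g s))\<^sup>2 / 2 * \<kappa> t s) \<partial>M) \<partial>M) = (\<integral>\<^sup>+s. (\<integral>\<^sup>+t. ennreal ((norm (g s))\<^sup>2 / 2 * \<kappa> t s) \<partial>M) \<partial>M)"
      by (rule MM.Fubini') measurable
    also have "(\<integral>\<^sup>+s. (\<integral>\<^sup>+t. ennreal ((norm (g s))\<^sup>2 / 2 * \<kappa> t s) \<partial>M) \<partial>M) = (\<integral>\<^sup>+t. (\<integral>\<^sup>+s. ennreal ((norm (g t))\<^sup>2 / 2 * \<kappa> t s) \<partial>M) \<partial>M)"
      by (simp add: \<kappa>_sym)
    also have "(\<integral>\<^sup>+t. (\<integral>\<^sup>+s. ennreal ((norm (g t))\<^sup>2 / 2 * \<kappa> t s) \<partial>M) \<partial>M) \<le> (\<integral>\<^sup>+t. ennreal ((norm (g t))\<^sup>2 / 2) * ennreal A \<partial>M)"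
    proof (rule nn_integral_mono_AE, rule AE_mp[OF AE_M], rule AE_I2, rule impI)
      fix t assume t: "t \<in> {a..b}"
      have "(\<integral>\<^sup>+s. ennreal ((norm (g t))\<^sup>2 / 2 * \<kappa> t s) \<partial>M) = ennreal ((norm (g t))\<^sup>2 / 2) * (\<integral>\<^sup>+s\<in>{a..b}. ennreal (\<kappa> t s) \<partial>lborel)"
      proof -
        have "ennreal ((norm (g t))\<^sup>2 / 2 * \<kappa> t s) = ennreal ((norm (g t))\<^sup>2 / 2) * ennreal (\<kappa> t s)" for s
          using \<kappa>0 by (intro ennreal_mult) auto
        then show ?thesis by (simp add: nn_integral_cmult nn_M del: times_divide_eq_left)
      qed
      also have "\<dots> \<le> ennreal ((norm (g t))\<^sup>2 / 2) * ennreal A"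
        using Schur[OF t] by (intro mult_left_mono) auto
      finally show "(\<integral>\<^sup>+s. ennreal ((norm (g t))\<^sup>2 / 2 * \<kappa> t s) \<partial>M) \<le> ennreal ((norm (g t))\<^sup>2 / 2) * ennreal A" .
    qed
    finally have "ennreal (\<Sum>k\<in>W. w k * (norm (I k))\<^sup>2)
        \<le> (\<integral>\<^sup>+t. ennreal ((norm (g t))\<^sup>2 / 2) * ennreal A \<partial>M) + (\<integral>\<^sup>+t. ennreal ((norm (g t))\<^sup>2 / 2) * ennreal A \<partial>M)"
      by (auto intro: add_mono order_trans)
    also have "\<dots> = (\<integral>\<^sup>+t. ennreal ((norm (g t))\<^sup>2) * ennreal A \<partial>M)"
      using A by (subst nn_integral_add[symmetric]) (auto simp: ennreal_mult[symmetric] ennreal_plus[symmetric] simp del: ennreal_plus intro!: nn_integral_cong)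
    also have "\<dots> = ennreal X * ennreal A"
      by (simp add: nn_integral_multc nn_X)
    finally show ?thesis using X0 A by (simp add: ennreal_mult[symmetric] mult.commute)
  qed
  finally have "(\<Sum>k\<in>K. (norm (I k))\<^sup>2) \<le> A * X" .
  moreover have S0: "0 \<le> S" by (simp add: S_def sum_nonneg)
  ultimately have "S * (\<Sum>k\<in>K. (norm (I k))\<^sup>2) \<le> S * (A * X)" by (rule mult_left_mono)
  \<comment> \<open>Duality has reproduced \<open>X\<close> on the right with a lower power; it is a
    finite real and can be divided out.\<close>
  with X_le have XX: "X * X \<le> A * S * X" by (simp add: power2_eq_square mult_ac)
  have "X \<le> A * S"
  proof (cases "X = 0")
    case True
    then show ?thesis using A S0 by simp
  next
    case False
    then have "0 < X" using X0 by simp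
    with XX show ?thesis by (rule mult_right_le_imp_le)
  qed
  moreover have "(\<integral>\<^sup>+t\<in>{a..b}. ennreal ((norm (g t))\<^sup>2) \<partial>lborel) = ennreal X"
    using nn_X by (simp add: nn_M)
  ultimately show ?thesis by (simp add: g_def S_def ennreal_leI)
qed

text \<open>The remainder \<open>r n t\<close> is free of \<open>k\<close> and leaves the modulus of
  the sum unchanged. The remaining frequencies are spaced by \<open>2 * n\<close>, hence orthogonal
  on every interval of length \<open>pi / n\<close>; as \<open>pi > 1\<close>, such an interval
  contains the given one, and its length is the constant obtained.\<close>

lemma separated_quadratic:
  fixes p :: "int \<Rightarrow> real \<Rightarrow> real" and r :: "int \<Rightarrow> real \<Rightarrow> real"
  assumes fin: "finite K" and p: "\<And>k n t. p (k + n) t - p k t = 2 * of_int n * of_int k * t + r n t"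
  shows "separated p K pi"
  unfolding separated_def
proof (intro allI impI)
  fix n :: int and t\<^sub>0 :: real and d :: "int \<Rightarrow> complex"
  assume n: "1 \<le> n"
  let ?K = "{k. k \<in> K \<and> k + n \<in> K}"
  \<comment> \<open>The reciprocal of the frequency spacing; \<open>s\<close> will be the midpoint
    of the period of length \<open>2 * pi * L\<close> that starts at
    \<open>t\<^sub>0\<close>.\<close>
  define L where "L = 1 / (2 * real_of_int n)"
  have L: "0 < L" using n by (simp add: L_def)
  define s where "s = t\<^sub>0 + pi * L"
  have fin': "finite ?K" using fin by (rule finite_subset[rotated]) auto
  have norm_eq: "norm (\<Sum>k\<in>?K. d k * cis (- (p (k + n) t - p k t))) = norm (\<Sum>k\<in>?K. d k * cis (of_int (- k) / L * t))" for t
  proof -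
    have e: "d k * cis (- (p (k + n) t - p k t)) = cis (- r n t) * (d k * cis (of_int (- k) / L * t))" for k
    proof -
      have "- (p (k + n) t - p k t) = - r n t + of_int (- k) / L * t" unfolding p by (simp add: L_def)
      then show ?thesis by (simp only: cis_mult[symmetric] mult_ac)
    qed
    show ?thesis by (simp only: e sum_distrib_left[symmetric] norm_mult norm_cis mult_1)
  qed
  have shift: "(\<Sum>k\<in>?K. d k * cis (of_int (- k) / L * (s + \<tau>))) = (\<Sum>m\<in>uminus ` ?K. (d (- m) * cis (of_int m / L * s)) * cis (of_int m / L * \<tau>))" for \<tau>
    by (subst sum.reindex) (auto simp: mult.assoc cis_mult distrib_left)
  have "(\<integral>\<^sup>+t\<in>{t\<^sub>0..t\<^sub>0 + 1 / of_int n}. ennreal ((norm (\<Sum>k\<in>?K. d k * cis (- (p (k + n) t - p k t))))\<^sup>2) \<partial>lborel)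
    \<le> (\<integral>\<^sup>+t\<in>{s - pi * L..s + pi * L}. ennreal ((norm (\<Sum>k\<in>?K. d k * cis (of_int (- k) / L * t)))\<^sup>2) \<partial>lborel)"
  proof (rule nn_integral_mono)
    fix t
    have sub: "{t\<^sub>0..t\<^sub>0 + 1 / of_int n} \<subseteq> {s - pi * L..s + pi * L}"
    proof -
      have "1 / of_int n = 2 * L" using n by (simp add: L_def)
      moreover have "2 * L \<le> 2 * (pi * L)" using pi_gt3 L by simp
      ultimately show ?thesis by (auto simp: s_def mult.commute)
    qed
    show "ennreal ((norm (\<Sum>k\<in>?K. d k * cis (- (p (k + n) t - p k t))))\<^sup>2) * indicator {t\<^sub>0..t\<^sub>0 + 1 / of_int n} t
      \<le> ennreal ((norm (\<Sum>k\<in>?K. d k * cis (of_int (- k) / L * t)))\<^sup>2) * indicator {s - pi * L..s + pi * L} t"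
    proof (cases "t \<in> {t\<^sub>0..t\<^sub>0 + 1 / of_int n}")
      case True
      then have "t \<in> {s - pi * L..s + pi * L}" using sub by blast
      then show ?thesis unfolding norm_eq using True by (simp only: indicator_simps order_refl)
    qed simp
  qed
  also have "\<dots> = (\<integral>\<^sup>+\<tau>\<in>{- pi * L..pi * L}. ennreal ((norm (\<Sum>m\<in>uminus ` ?K. (d (- m) * cis (of_int m / L * s)) * cis (of_int m / L * \<tau>)))\<^sup>2) \<partial>lborel)"
  proof -
    have "indicator {s - pi * L..s + pi * L} (s + \<tau>) = (indicator {- pi * L..pi * L} \<tau> :: ennreal)" for \<tau>
      by (auto simp: indicator_def)
    then show ?thesis
      by (subst nn_integral_real_affine[where c=1 and t=s]) (simp, simp, simp only: mult_1 shift abs_one ennreal_1)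
  qed
  also have "\<dots> = ennreal (2 * pi * L * (\<Sum>m\<in>uminus ` ?K. (norm (d (- m) * cis (of_int m / L * s)))\<^sup>2))"
    using L fin' by (intro nn_integral_norm_square_trig_scaled) auto
  also have "\<dots> = ennreal (pi / of_int n * (\<Sum>k\<in>?K. (norm (d k))\<^sup>2))"
    by (subst sum.reindex) (auto simp: norm_mult L_def)
  finally show "(\<integral>\<^sup>+t\<in>{t\<^sub>0..t\<^sub>0 + 1 / of_int n}. ennreal ((norm (\<Sum>k\<in>?K. d k * cis (- (p (k + n) t - p k t))))\<^sup>2) \<partial>lborel)
    \<le> ennreal (pi / of_int n * (\<Sum>k\<in>?K. (norm (d k))\<^sup>2))" .
qed

text \<open>A weight supported in \<open>|y| <= R\<close> with Lipschitz first derivative. This is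
  all the smoothness that two summations by parts ask for, and the differences of a piecewise
  polynomial have explicit bounds.\<close>

definition bump :: "real \<Rightarrow> real \<Rightarrow> real" where
  "bump R y = (max 0 (R\<^sup>2 - y\<^sup>2))\<^sup>2"

lemma bump_nonneg: "0 \<le> bump R y" by (simp add: bump_def)

lemma bump_eq_0:
  assumes "0 \<le> R" "R \<le> \<bar>y\<bar>" shows "bump R y = 0"
proof -
  have "R\<^sup>2 \<le> \<bar>y\<bar>\<^sup>2" using assms by (intro power_mono)
  then have "max 0 (R\<^sup>2 - y\<^sup>2) = 0" by (simp add: max_def)
  then show ?thesis by (simp only: bump_def) simp
qed

lemma bump_le:
  assumes "0 \<le> R" "R \<le> 2" shows "bump R y \<le> 16"
proof -
  have "max 0 (R\<^sup>2 - y\<^sup>2) \<le> 2\<^sup>2" using assms power_mono[of R 2 2] by (auto simp: max_def intro: order_trans[of _ "R\<^sup>2"])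
  then have "(max 0 (R\<^sup>2 - y\<^sup>2))\<^sup>2 \<le> (2\<^sup>2)\<^sup>2" by (intro power_mono) auto
  then show ?thesis by (simp add: bump_def)
qed

lemma bump_ge:
  assumes "\<bar>y\<bar> \<le> r" "r \<le> R" shows "(R\<^sup>2 - r\<^sup>2)\<^sup>2 \<le> bump R y"
proof -
  have "y\<^sup>2 \<le> r\<^sup>2" "r\<^sup>2 \<le> R\<^sup>2" using assms power_mono[of "\<bar>y\<bar>" r 2] power_mono[of r R 2] by auto
  then show ?thesis unfolding bump_def by (intro power_mono) auto
qed

text \<open>The squared positive part has derivative \<open>2 * max 0 x\<close>, which is
  nondecreasing and 2-Lipschitz, so the remainder of its linearization lies between 0 and the square
  of the increment.\<close>

lemma square_max_0_diff:
  fixes a b :: real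
  shows "0 \<le> (max 0 b)\<^sup>2 - (max 0 a)\<^sup>2 - 2 * max 0 a * (b - a)"
    and "(max 0 b)\<^sup>2 - (max 0 a)\<^sup>2 - 2 * max 0 a * (b - a) \<le> (b - a)\<^sup>2"
proof -
  show "0 \<le> (max 0 b)\<^sup>2 - (max 0 a)\<^sup>2 - 2 * max 0 a * (b - a)"
  proof (cases "0 \<le> a"; cases "0 \<le> b")
    assume "0 \<le> a" "0 \<le> b"
    then show ?thesis using zero_le_power2[of "b - a"] by (simp add: max_def power2_eq_square algebra_simps)
  next
    assume "0 \<le> a" "\<not> 0 \<le> b"
    then have "0 \<le> a * (a - 2 * b)" by (intro mult_nonneg_nonneg) auto
    then show ?thesis using \<open>0 \<le> a\<close> \<open>\<not> 0 \<le> b\<close> by (simp add: max_def power2_eq_square algebra_simps)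
  qed (auto simp: max_def)
  show "(max 0 b)\<^sup>2 - (max 0 a)\<^sup>2 - 2 * max 0 a * (b - a) \<le> (b - a)\<^sup>2"
  proof (cases "0 \<le> a"; cases "0 \<le> b")
    assume "0 \<le> a" "0 \<le> b"
    then show ?thesis by (simp add: max_def power2_eq_square algebra_simps)
  next
    assume "\<not> 0 \<le> a" "0 \<le> b"
    then have "b\<^sup>2 \<le> (b - a)\<^sup>2" by (intro power_mono) auto
    then show ?thesis using \<open>\<not> 0 \<le> a\<close> \<open>0 \<le> b\<close> by (simp add: max_def)
  qed (use zero_le_power2[of "b - a"] in \<open>auto simp: max_def power2_eq_square algebra_simps\<close>)
qed

lemma bump_diff_le:
  assumes "0 \<le> R" "R \<le> 2" "0 \<le> h" "h \<le> 1"
  shows "\<bar>bump R (y + h) - bump R y\<bar> \<le> 114 * h"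
proof (cases "R \<le> \<bar>y\<bar> \<and> R \<le> \<bar>y + h\<bar>")
  case True
  then show ?thesis using assms by (simp add: bump_eq_0)
next
  case False
  let ?a = "R\<^sup>2 - y\<^sup>2" and ?b = "R\<^sup>2 - (y + h)\<^sup>2"
  have y: "\<bar>2 * y + h\<bar> \<le> 7" using False assms by (auto simp: not_le abs_if split: if_splits)
  have R: "R\<^sup>2 \<le> 4" using assms power_mono[of R 2 2] by simp
  have "bump R (y + h) - bump R y = (max 0 ?b - max 0 ?a) * (max 0 ?b + max 0 ?a)"
    by (simp add: bump_def power2_eq_square algebra_simps)
  also have "\<bar>\<dots>\<bar> \<le> (7 * h) * 8"
    unfolding abs_mult
  proof (rule mult_mono)
    have "\<bar>max 0 ?b - max 0 ?a\<bar> \<le> \<bar>?b - ?a\<bar>" by (auto simp: max_def)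
    also have "?b - ?a = - (2 * y + h) * h" by (simp add: power2_eq_square algebra_simps)
    also have "\<bar>\<dots>\<bar> \<le> 7 * h" using y assms unfolding abs_mult abs_minus_cancel by (intro mult_mono) auto
    finally show "\<bar>max 0 ?b - max 0 ?a\<bar> \<le> 7 * h" .
    have "max 0 ?a \<le> 4" "max 0 ?b \<le> 4" using R by (auto intro: order_trans[of _ "R\<^sup>2"])
    then show "\<bar>max 0 ?b + max 0 ?a\<bar> \<le> 8" by simp
  qed (use assms in auto)
  also have "\<dots> \<le> 114 * h" using assms by simp
  finally show ?thesis .
qed

text \<open>114 = 49 + 49 + 16: two linearization remainders with increments at most
  \<open>7 * h\<close>, as \<open>|y| <= 3\<close> near the support, and the second difference
  \<open>- 2 * h ^ 2\<close> of \<open>R ^ 2 - y ^ 2\<close> times the derivative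
  \<open>2 * max 0 a <= 8\<close>.\<close>

lemma bump_second_diff_le:
  assumes "0 \<le> R" "R \<le> 2" "0 \<le> h" "h \<le> 1"
  shows "\<bar>bump R (y + h) - 2 * bump R y + bump R (y - h)\<bar> \<le> 114 * h\<^sup>2"
proof (cases "R \<le> \<bar>y\<bar> \<and> R \<le> \<bar>y + h\<bar> \<and> R \<le> \<bar>y - h\<bar>")
  case True
  then show ?thesis using assms by (simp add: bump_eq_0)
next
  case False
  define a where "a = R\<^sup>2 - y\<^sup>2"
  define b where "b = R\<^sup>2 - (y + h)\<^sup>2"
  define c where "c = R\<^sup>2 - (y - h)\<^sup>2"
  have y: "\<bar>y\<bar> \<le> 3" using False assms by (auto simp: not_le abs_if split: if_splits)
  have R: "R\<^sup>2 \<le> 4" using assms power_mono[of R 2 2] by simp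
  have ba: "b - a = - (2 * y + h) * h" and ca: "c - a = (2 * y - h) * h"
    by (simp_all add: a_def b_def c_def power2_eq_square algebra_simps)
  have sq: "(b - a)\<^sup>2 \<le> 49 * h\<^sup>2" "(c - a)\<^sup>2 \<le> 49 * h\<^sup>2"
  proof -
    have "\<bar>2 * y + h\<bar> \<le> 7" "\<bar>2 * y - h\<bar> \<le> 7" using y assms by linarith+
    then have "(2 * y + h)\<^sup>2 \<le> 7\<^sup>2" "(2 * y - h)\<^sup>2 \<le> 7\<^sup>2"
      using abs_le_square_iff[of "2 * y + h" 7] abs_le_square_iff[of "2 * y - h" 7] by simp_all
    then show "(b - a)\<^sup>2 \<le> 49 * h\<^sup>2" "(c - a)\<^sup>2 \<le> 49 * h\<^sup>2"
      unfolding ba ca power_mult_distrib power2_minus by (auto intro: mult_right_mono)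
  qed
  have "bump R (y + h) - 2 * bump R y + bump R (y - h)
     = ((max 0 b)\<^sup>2 - (max 0 a)\<^sup>2 - 2 * max 0 a * (b - a)) + ((max 0 c)\<^sup>2 - (max 0 a)\<^sup>2 - 2 * max 0 a * (c - a)) - 4 * max 0 a * h\<^sup>2"
  proof -
    have "2 * max 0 a * (b - a) + 2 * max 0 a * (c - a) = - 4 * max 0 a * h\<^sup>2"
      unfolding ba ca by (simp add: power2_eq_square algebra_simps)
    then show ?thesis unfolding bump_def a_def[symmetric] b_def[symmetric] c_def[symmetric] by linarith
  qed
  moreover have "4 * max 0 a * h\<^sup>2 \<le> 16 * h\<^sup>2"
  proof -
    have "max 0 a \<le> 4" using R by (auto simp: a_def intro: order_trans[of _ "R\<^sup>2"])
    then show ?thesis by (intro mult_right_mono) auto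
  qed
  moreover have "0 \<le> 4 * max 0 a * h\<^sup>2" by simp
  ultimately show ?thesis
    using square_max_0_diff[where b=b and a=a] square_max_0_diff[where b=c and a=a] sq by linarith
qed

lemma nn_integral_Lorentzian_le:
  fixes c t :: real
  assumes "0 < c" "a \<le> b" "0 \<le> A"
  shows "(\<integral>\<^sup>+s\<in>{a..b}. ennreal (A / (1 + (c * (t - s))\<^sup>2)) \<partial>lborel) \<le> ennreal (A / c * pi)"
proof -
  let ?F = "\<lambda>s. - (A / c * arctan (c * (t - s)))"
  have "(\<integral>\<^sup>+s. ennreal (A / (1 + (c * (t - s))\<^sup>2)) * indicator {a..b} s \<partial>lborel) = ennreal (?F b - ?F a)"
  proof (rule nn_integral_FTC_Icc)
    fix s
    have "1 + (c * (t - s))\<^sup>2 > 0" by (simp add: add_pos_nonneg)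
    then show "(?F has_real_derivative A / (1 + (c * (t - s))\<^sup>2)) (at s)"
      using assms by (auto intro!: derivative_eq_intros simp: divide_inverse)
  qed (use assms in \<open>auto intro!: divide_nonneg_nonneg\<close>)
  also have "\<dots> \<le> ennreal (A / c * pi)"
  proof (rule ennreal_leI)
    have "?F b - ?F a = A / c * (arctan (c * (t - a)) - arctan (c * (t - b)))" by (simp add: right_diff_distrib)
    also have "\<dots> \<le> A / c * pi"
      using assms arctan_lbound[of "c * (t - b)"] arctan_ubound[of "c * (t - a)"] by (intro mult_left_mono) auto
    finally show "?F b - ?F a \<le> A / c * pi" .
  qed
  finally show ?thesis .
qed

text \<open>\<open>C\<close> and \<open>S\<close> are the integrals of \<open>cos (h a)\<close> and \<open>sin (h a)\<close>, so that
  \<open>cos \<eta> \<Delta>C + sin \<eta> \<Delta>S\<close> is the integral of \<open>cos (\<eta> - h a)\<close>. As \<open>a\<close> is merely measurable there is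
  no oscillation to exploit in \<open>t\<close>; all cancellation comes from the sum over \<open>k\<close>.\<close>

lemma separated_discrete:
  fixes p :: "int \<Rightarrow> real \<Rightarrow> real" and C S :: "real \<Rightarrow> real"
  assumes K: "K \<subseteq> {k. \<bar>h * of_int k\<bar> \<le> r}" and h: "0 < h" "h \<le> 1"
    and r: "0 < r" "0 < \<rho>" "r + \<rho> < pi / 2" and c: "0 < c\<^sub>1" "c\<^sub>1 \<le> 1"
    and p: "\<And>k t. p k t = e t - 2 / h\<^sup>2 * (cos (h * of_int k) * C t + sin (h * of_int k) * S t)"
    and cont: "continuous_on UNIV C" "continuous_on UNIV S"
    and upper: "\<And>\<eta> s t. s \<le> t \<Longrightarrow> \<bar>cos \<eta> * (C t - C s) + sin \<eta> * (S t - S s)\<bar> \<le> t - s"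
    and lower: "\<And>\<eta> s t. s \<le> t \<Longrightarrow> \<bar>\<eta>\<bar> \<le> r + 3 * \<rho> / 4 \<Longrightarrow> c\<^sub>1 * (t - s) \<le> cos \<eta> * (C t - C s) + sin \<eta> * (S t - S s)"
  shows "separated p K (7 * (114 / (((r + \<rho> / 2)\<^sup>2 - r\<^sup>2)\<^sup>2)) * (1 + (20 + 100 / (c\<^sub>1 / 9)\<^sup>2) * 9 / (c\<^sub>1 / 9)\<^sup>2) * pi + 40 / \<rho> + 1)"
proof -
  \<comment> \<open>The weight reaches halfway into the margin \<open>\<rho>\<close>. The increments
    are evaluated a few steps of size \<open>h\<close> further out, still within
    \<open>r + 3 * \<rho> / 4\<close>.\<close>
  define R where "R = r + \<rho> / 2"
  define W where "W = 114 / (R\<^sup>2 - r\<^sup>2)\<^sup>2"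
  define A where "A = 7 * W * (1 + (20 + 100 / (c\<^sub>1 / 9)\<^sup>2) * 9 / (c\<^sub>1 / 9)\<^sup>2)"
  have pi2: "pi / 2 < 2" using pi_less_4 by simp
  have R: "r < R" "0 < R" "R \<le> 2" using r pi2 by (auto simp: R_def)
  have Rr: "0 < (R\<^sup>2 - r\<^sup>2)\<^sup>2" using R r power_strict_mono[of r R 2] by auto
  have W0: "0 < W" using Rr by (simp add: W_def)
  have A0: "0 < A" using W0 c by (simp add: A_def add_pos_nonneg)
  have fin: "finite K"
  proof (rule finite_subset)
    show "K \<subseteq> {- \<lceil>r / h\<rceil>..\<lceil>r / h\<rceil>}"
    proof
      fix k assume "k \<in> K"
      then have "\<bar>h * of_int k\<bar> \<le> r" using K by blast
      then have "\<bar>of_int k\<bar> \<le> r / h" using h by (simp add: abs_mult field_simps)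
      then show "k \<in> {- \<lceil>r / h\<rceil>..\<lceil>r / h\<rceil>}" by (simp add: abs_le_iff) linarith
    qed
  qed simp
  show ?thesis
    unfolding separated_def R_def[symmetric] W_def[symmetric] A_def[symmetric]
  proof (intro allI impI)
    fix n :: int and t\<^sub>0 :: real and d :: "int \<Rightarrow> complex"
    assume n: "1 \<le> n"
    let ?K = "{k. k \<in> K \<and> k + n \<in> K}"
    have finK: "finite ?K" using fin by (rule finite_subset[rotated]) auto
    define D where "D = (\<Sum>k\<in>?K. (norm (d k))\<^sup>2)"
    have D0: "0 \<le> D" by (simp add: D_def sum_nonneg)
    define \<theta> where "\<theta> k t = p (k + n) t - p k t" for k t
    have "(\<integral>\<^sup>+t\<in>{t\<^sub>0..t\<^sub>0 + 1 / of_int n}. ennreal ((norm (\<Sum>k\<in>?K. d k * cis (- \<theta> k t)))\<^sup>2) \<partial>lborel)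
      \<le> ennreal ((A * pi + 40 / \<rho> + 1) / of_int n * D)" (is "?lhs \<le> _")
    \<comment> \<open>For \<open>h > \<rho> / 10\<close> there are at most
      \<open>40 / \<rho> + 1\<close> frequencies, and Cauchy-Schwarz suffices. For smaller
      \<open>h\<close>, the two and a half steps beyond \<open>R\<close> that are needed below stay
      within \<open>\<rho> / 4\<close>.\<close>
    proof (cases "h \<le> \<rho> / 10 \<and> ?K \<noteq> {}")
      case False
      have "real (card ?K) \<le> 40 / \<rho> + 1"
      proof (cases "?K = {}")
        case False
        then have "\<rho> / 10 < h" using \<open>\<not> (h \<le> \<rho> / 10 \<and> ?K \<noteq> {})\<close> by auto
        then have hr: "r / h \<le> 20 / \<rho>" using r pi2 h by (intro order_trans[OF divide_right_mono[of r 2]]) (auto simp: field_simps)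
        have "?K \<subseteq> {- \<lfloor>r / h\<rfloor>..\<lfloor>r / h\<rfloor>}"
        proof
          fix k assume "k \<in> ?K"
          then have "\<bar>h * of_int k\<bar> \<le> r" using K by blast
          then have "\<bar>of_int k\<bar> \<le> r / h" using h by (simp add: abs_mult field_simps)
          then show "k \<in> {- \<lfloor>r / h\<rfloor>..\<lfloor>r / h\<rfloor>}" by (simp add: abs_le_iff le_floor_iff) linarith
        qed
        then have "card ?K \<le> card {- \<lfloor>r / h\<rfloor>..\<lfloor>r / h\<rfloor>}" by (intro card_mono) auto
        also have "\<dots> = nat (2 * \<lfloor>r / h\<rfloor> + 1)" by simp
        also have "real \<dots> \<le> 2 * (r / h) + 1" using r h by (simp add: of_nat_nat) linarith
        finally show ?thesis using hr by simp
      next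
        case True
        have "card ?K = 0" unfolding True by simp
        then show ?thesis using r by simp
      qed
      note card = this
      have "?lhs \<le> (\<integral>\<^sup>+t\<in>{t\<^sub>0..t\<^sub>0 + 1 / of_int n}. ennreal ((40 / \<rho> + 1) * D) \<partial>lborel)"
      proof (intro nn_integral_mono mult_right_mono ennreal_leI)
        fix t
        have "(norm (\<Sum>k\<in>?K. d k * cis (- \<theta> k t)))\<^sup>2 \<le> (\<Sum>k\<in>?K. 1 * norm (d k))\<^sup>2"
          by (intro power_mono sum_norm_le) (auto simp: norm_mult)
        also have "\<dots> \<le> (\<Sum>k\<in>?K. 1\<^sup>2) * D" unfolding D_def by (rule Cauchy_Schwarz_ineq_sum)
        also have "\<dots> \<le> (40 / \<rho> + 1) * D" using card D0 by (intro mult_right_mono) auto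
        finally show "(norm (\<Sum>k\<in>?K. d k * cis (- \<theta> k t)))\<^sup>2 \<le> (40 / \<rho> + 1) * D" .
      qed auto
      also have "\<dots> = ennreal ((40 / \<rho> + 1) * D / of_int n)"
        using n r D0 by (simp add: nn_integral_cmult_indicator ennreal_mult'[symmetric])
      also have "\<dots> \<le> ennreal ((A * pi + 40 / \<rho> + 1) / of_int n * D)"
        using n r D0 A0 by (intro ennreal_leI) (simp add: divide_right_mono mult_right_mono)
      finally show ?thesis .
    next
      case True
      then obtain k\<^sub>0 where k0: "k\<^sub>0 \<in> K" "k\<^sub>0 + n \<in> K" and h\<rho>: "h \<le> \<rho> / 10" by auto
      have yK: "\<bar>h * (of_int k + of_int n / 2)\<bar> \<le> r" if "k \<in> K" "k + n \<in> K" for k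
      proof -
        have "\<bar>h * of_int k\<bar> \<le> r" "\<bar>h * of_int (k + n)\<bar> \<le> r" using K that by blast+
        then have "\<bar>h * of_int k + h * of_int (k + n)\<bar> \<le> 2 * r" by linarith
        also have "h * of_int k + h * of_int (k + n) = 2 * (h * (of_int k + of_int n / 2))" by (simp add: algebra_simps)
        finally show ?thesis by (simp add: abs_mult)
      qed
      \<comment> \<open>Two angles of modulus at most \<open>r < pi / 2\<close> differ by at most
        \<open>pi\<close>, so \<open>sin (h * n / 2)\<close> is comparable to its argument.\<close>
      have hn: "h * of_int n \<le> pi"
      proof -
        have "\<bar>h * of_int k\<^sub>0\<bar> \<le> r" "\<bar>h * of_int (k\<^sub>0 + n)\<bar> \<le> r" using K k0 by blast+
        moreover have "h * of_int n = h * of_int (k\<^sub>0 + n) - h * of_int k\<^sub>0" by (simp add: algebra_simps)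
        ultimately show ?thesis using r by linarith
      qed
      have hn0: "0 < h * of_int n" using h n by simp
      \<comment> \<open>The angle midway between \<open>h * k\<close> and
        \<open>h * (k + n)\<close>: in this variable the differences of the cosines and of the sines
        are trigonometric functions of \<open>y k\<close> times a factor free of
        \<open>k\<close>.\<close>
      define y where "y k = h * (of_int k + of_int n / 2)" for k :: int
      define q\<^sub>1 where "q\<^sub>1 = \<lceil>- R / h - of_int n / 2\<rceil>"
      define q\<^sub>2 where "q\<^sub>2 = \<lfloor>R / h - of_int n / 2\<rfloor>"
      have y_in: "k \<in> {q\<^sub>1..q\<^sub>2} \<longleftrightarrow> \<bar>y k\<bar> \<le> R" for k
      proof -
        have "q\<^sub>1 \<le> k \<longleftrightarrow> - R / h \<le> of_int k + of_int n / 2" by (auto simp: q\<^sub>1_def ceiling_le_iff)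
        also have "\<dots> \<longleftrightarrow> - R \<le> y k" unfolding y_def using pos_divide_le_eq[OF h(1)] by (simp only: mult.commute)
        finally have 1: "q\<^sub>1 \<le> k \<longleftrightarrow> - R \<le> y k" .
        have "k \<le> q\<^sub>2 \<longleftrightarrow> of_int k + of_int n / 2 \<le> R / h" by (auto simp: q\<^sub>2_def le_floor_iff)
        also have "\<dots> \<longleftrightarrow> y k \<le> R" using h by (simp add: y_def pos_le_divide_eq mult.commute)
        finally show ?thesis using 1 by auto
      qed
      define w where "w k = bump R (y k) / (R\<^sup>2 - r\<^sup>2)\<^sup>2" for k
      have q12: "q\<^sub>1 \<le> q\<^sub>2" using y_in[of k\<^sub>0] yK[OF k0] R by (simp add: y_def)
      have q_len: "real_of_int (q\<^sub>2 - q\<^sub>1 + 3) \<le> 7 / h"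
      proof -
        have "real_of_int q\<^sub>2 \<le> R / h - of_int n / 2" "real_of_int q\<^sub>1 \<ge> - R / h - of_int n / 2"
          by (auto simp: q\<^sub>1_def q\<^sub>2_def)
        then have "real_of_int (q\<^sub>2 - q\<^sub>1 + 3) \<le> 2 * (R / h) + 3" by simp
        also have "\<dots> \<le> 2 * (2 / h) + 3 / h"
          using R h by (intro add_mono mult_left_mono divide_right_mono) (auto simp: field_simps)
        finally show ?thesis by simp
      qed
      have y_step: "y (k + 1) = y k + h" "y (k + 2) = y (k + 1) + h" "y k = y (k + 1) - h" for k
        by (simp_all add: y_def algebra_simps)
      have w_abs: "\<bar>w k\<bar> \<le> W" "\<bar>w (k + 1) - w k\<bar> \<le> W * h" "\<bar>w (k + 2) - 2 * w (k + 1) + w k\<bar> \<le> W * h\<^sup>2" for k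
      proof -
        have "\<bar>bump R (y k)\<bar> \<le> 114" using bump_le[of R "y k"] bump_nonneg[of R "y k"] R by simp
        then show "\<bar>w k\<bar> \<le> W" using Rr by (simp add: w_def W_def abs_divide divide_right_mono)
        have "\<bar>bump R (y (k + 1)) - bump R (y k)\<bar> \<le> 114 * h" unfolding y_step(1)[of k] using R h by (intro bump_diff_le) auto
        then show "\<bar>w (k + 1) - w k\<bar> \<le> W * h"
          using Rr by (simp add: w_def W_def diff_divide_distrib[symmetric] abs_divide divide_right_mono)
        have "\<bar>bump R (y (k + 2)) - 2 * bump R (y (k + 1)) + bump R (y k)\<bar> \<le> 114 * h\<^sup>2"
          unfolding y_step(2,3)[of k] using R h by (intro bump_second_diff_le) auto
        moreover have "w (k + 2) - 2 * w (k + 1) + w k = (bump R (y (k + 2)) - 2 * bump R (y (k + 1)) + bump R (y k)) / (R\<^sup>2 - r\<^sup>2)\<^sup>2"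
          by (simp add: w_def diff_divide_distrib add_divide_distrib)
        ultimately show "\<bar>w (k + 2) - 2 * w (k + 1) + w k\<bar> \<le> W * h\<^sup>2"
          using Rr by (simp add: W_def abs_divide divide_right_mono)
      qed
      \<comment> \<open>\<open>\<beta>\<close> is the factor of the lag-\<open>n\<close> difference
        of \<open>p\<close>, and \<open>\<gamma>\<close> that of its increment from \<open>k\<close>
        to \<open>k + 1\<close>; both come from product formulas, with half steps
        \<open>h * n / 2\<close> and \<open>h / 2\<close>. Using \<open>sin_ge_third\<close> twice
        gives \<open>2 / 9 * n <= \<gamma>\<close>.\<close>
      define \<beta> where "\<beta> = 4 / h\<^sup>2 * sin (h * of_int n / 2)"
      define \<gamma> where "\<gamma> = 2 * \<beta> * sin (h / 2)"
      have \<theta>_eq: "\<theta> k t = \<beta> * (sin (y k) * C t - cos (y k) * S t)" for k t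
      proof -
        define m where "m = h * of_int n / 2"
        have hk: "h * of_int k = y k - m" "h * of_int (k + n) = y k + m" by (simp_all add: y_def m_def algebra_simps)
        show ?thesis unfolding \<theta>_def p hk \<beta>_def m_def[symmetric] cos_add cos_diff sin_add sin_diff
          by (simp add: algebra_simps diff_divide_distrib add_divide_distrib)
      qed
      have \<gamma>: "2 / 9 * of_int n \<le> \<gamma>" "\<gamma> \<le> 2 * of_int n"
      proof -
        have \<gamma>_eq: "\<gamma> = 8 / h\<^sup>2 * (sin (h * of_int n / 2) * sin (h / 2))" by (simp add: \<gamma>_def \<beta>_def)
        have l: "h * of_int n / 2 / 3 \<le> sin (h * of_int n / 2)" "h / 2 / 3 \<le> sin (h / 2)"
          using hn hn0 h pi2 sin_ge_third[of "h * of_int n / 2"] sin_ge_third[of "h / 2"] by simp_all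
        have u: "sin (h * of_int n / 2) \<le> h * of_int n / 2" "sin (h / 2) \<le> h / 2"
          using hn0 h sin_x_le_x[of "h * of_int n / 2"] sin_x_le_x[of "h / 2"] by simp_all
        have "2 / 9 * of_int n = 8 / h\<^sup>2 * ((h * of_int n / 2 / 3) * (h / 2 / 3))" using h by (simp add: power2_eq_square)
        also have "\<dots> \<le> \<gamma>" unfolding \<gamma>_eq using l hn0 h by (intro mult_left_mono mult_mono) auto
        finally show "2 / 9 * of_int n \<le> \<gamma>" .
        have "\<gamma> \<le> 8 / h\<^sup>2 * ((h * of_int n / 2) * (h / 2))"
          unfolding \<gamma>_eq using u l hn0 h by (intro mult_left_mono mult_mono) auto
        also have "\<dots> = 2 * of_int n" using h by (simp add: power2_eq_square)
        finally show "\<gamma> \<le> 2 * of_int n" .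
      qed
      \<comment> \<open>The trivial bound of order \<open>1 / h\<close> (the number of frequencies)
        and the decay of order \<open>h / (n * (t - s)) ^ 2\<close> are combined into one integrable
        kernel of width \<open>h / n\<close>.\<close>
      define \<kappa> where "\<kappa> t s = A / h / (1 + (of_int n / h * (t - s))\<^sup>2)" for t s :: real
      have kernel_le: "norm (\<Sum>k\<in>{q\<^sub>1..q\<^sub>2}. of_real (w k) * cis (\<theta> k t - \<theta> k s)) \<le> \<kappa> t s"
        if ts: "s \<le> t" "t - s \<le> 1 / of_int n" for t s
      proof -
        let ?N = "norm (\<Sum>k\<in>{q\<^sub>1..q\<^sub>2}. of_real (w k) * cis (\<theta> k t - \<theta> k s))"
        let ?c = "c\<^sub>1 / 9"
        let ?e = "(20 + 100 / ?c\<^sup>2) * 9 / ?c\<^sup>2"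
        have e0: "0 \<le> ?e" by (intro divide_nonneg_nonneg mult_nonneg_nonneg add_nonneg_nonneg) auto
        have "?N \<le> (\<Sum>k\<in>{q\<^sub>1..q\<^sub>2}. W)"
          using w_abs(1) by (intro sum_norm_le) (simp add: norm_mult)
        also have "\<dots> = real_of_int (q\<^sub>2 - q\<^sub>1 + 1) * W" using q12 by simp
        also have "\<dots> \<le> 7 / h * W" using q_len W0 by (intro mult_right_mono) auto
        finally have N1: "h * ?N \<le> 7 * W" using h by (simp add: field_simps)
        have N2: "h * ?N * (of_int n / h * (t - s))\<^sup>2 \<le> 7 * W * ?e"
        proof (cases "s = t")
          case True
          then show ?thesis using W0 e0 by simp
        next
          case False
          then have st: "0 < t - s" using ts by simp
          \<comment> \<open>\<open>\<sigma> <= 2\<close> because \<open>t - s <= 1 / n\<close>. The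
            increments are at least \<open>2 / 9 * n * c\<^sub>1 * (t - s)\<close>, which is
            \<open>c\<^sub>1 / 9\<close> times \<open>\<sigma>\<close>: the origin of the 9 in the
            constant.\<close>
          define \<sigma> where "\<sigma> = 2 * of_int n * (t - s)"
          define Dk where "Dk \<eta> = \<gamma> * (cos \<eta> * (C t - C s) + sin \<eta> * (S t - S s))" for \<eta>
          have \<gamma>0: "0 \<le> \<gamma>" using \<gamma>(1) n by linarith
          have \<gamma>\<sigma>: "\<gamma> * (t - s) \<le> \<sigma>" unfolding \<sigma>_def using \<gamma>(2) st by (intro mult_right_mono) auto
          have \<sigma>: "0 < \<sigma>" "\<sigma> \<le> 2" using st n ts by (auto simp: \<sigma>_def field_simps)
          have Dk_abs: "\<bar>Dk \<eta>\<bar> \<le> \<sigma>" for \<eta>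
          proof -
            have "\<bar>Dk \<eta>\<bar> \<le> \<gamma> * (t - s)" unfolding Dk_def abs_mult using upper[OF ts(1)] \<gamma>0 by (intro mult_mono) auto
            then show ?thesis using \<gamma>\<sigma> by linarith
          qed
          have scale: "h * N * (of_int n / h * (t - s))\<^sup>2 \<le> 7 * W * E"
            if "N \<le> 7 / h * (E * W * h\<^sup>2 / \<sigma>\<^sup>2)" "0 \<le> E" for N E :: real
          proof -
            have "N * (h * \<sigma>\<^sup>2) \<le> 7 / h * (E * W * h\<^sup>2 / \<sigma>\<^sup>2) * (h * \<sigma>\<^sup>2)"
              using that h by (intro mult_right_mono) auto
            also have "\<dots> = 7 * W * E * h\<^sup>2" using h \<sigma> by simp
            also have "\<sigma>\<^sup>2 = 4 * ((of_int n / h * (t - s))\<^sup>2 * h\<^sup>2)"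
              using h by (simp add: \<sigma>_def power_mult_distrib power_divide)
            finally have "4 * (h * N * (of_int n / h * (t - s))\<^sup>2) * h\<^sup>2 \<le> 7 * W * E * h\<^sup>2" by (simp only: mult_ac)
            moreover have "0 < h\<^sup>2" using h by simp
            ultimately have "4 * (h * N * (of_int n / h * (t - s))\<^sup>2) \<le> 7 * W * E" by (rule mult_right_le_imp_le)
            moreover have "0 \<le> 7 * W * E" using W0 that by simp
            ultimately show ?thesis by linarith
          qed
          have sin_h: "0 \<le> 2 * sin (h / 2)" "2 * sin (h / 2) \<le> h"
            using sin_ge_third[of "h / 2"] sin_x_le_x[of "h / 2"] h by auto
          have "?N \<le> real_of_int (q\<^sub>2 - q\<^sub>1 + 3) * (?e * W * h\<^sup>2 / \<sigma>\<^sup>2)"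
          proof (rule oscillatory_sum_bound[where D="\<lambda>k. Dk (y k + h / 2)" and \<Theta>="\<lambda>k. \<theta> k t - \<theta> k s"])
            fix k
            define z where "z = y k + h / 2"
            have yz: "y k = z - h / 2" "y (k + 1) = z + h / 2" "y (k + 1) + h / 2 = z + h" "y (k + 2) + h / 2 = (z + h) + h"
              by (simp_all add: z_def y_step(1,2)[of k])
            show "\<theta> (k + 1) t - \<theta> (k + 1) s = \<theta> k t - \<theta> k s + Dk (y k + h / 2)"
              unfolding z_def[symmetric] unfolding \<theta>_eq yz(1,2) Dk_def \<gamma>_def sin_add sin_diff cos_add cos_diff by (simp add: algebra_simps)
            \<comment> \<open>A difference of \<open>Dk\<close> is \<open>Dk\<close> again, with the
              angle turned by \<open>pi / 2\<close>, times \<open>2 * sin (h / 2) <= h\<close>. Both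
              difference bounds thus reduce to the bound of \<open>Dk\<close> at an arbitrary angle,
              where \<open>upper\<close> holds.\<close>
            have diff1: "Dk (u + h) - Dk u = 2 * sin (h / 2) * Dk (u + h / 2 + pi / 2)" for u
            proof -
              have "Dk ((v + h / 2)) - Dk (v - h / 2) = 2 * sin (h / 2) * Dk (v + pi / 2)" for v
                unfolding Dk_def cos_add sin_add cos_diff sin_diff by (simp add: algebra_simps)
              from this[of "u + h / 2"] show ?thesis by (simp add: algebra_simps)
            qed
            have d1: "\<bar>Dk (u + h) - Dk u\<bar> \<le> h * \<sigma>" for u
              unfolding diff1 abs_mult[of "2 * sin (h / 2)"] using sin_h Dk_abs h by (intro mult_mono) auto
            show "\<bar>Dk (y (k + 1) + h / 2) - Dk (y k + h / 2)\<bar> \<le> h * \<sigma>"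
              unfolding yz(3) z_def[symmetric] by (rule d1)
            have "Dk (z + h + h) - 2 * Dk (z + h) + Dk z = (Dk (z + h + h) - Dk (z + h)) - (Dk (z + h) - Dk z)" by simp
            also have "\<dots> = 2 * sin (h / 2) * (Dk (z + h / 2 + pi / 2 + h) - Dk (z + h / 2 + pi / 2))"
            proof -
              have e: "z + h + h / 2 + pi / 2 = z + h / 2 + pi / 2 + h" by simp
              show ?thesis by (simp only: diff1[of "z + h"] diff1[of z] e right_diff_distrib)
            qed
            also have "\<bar>\<dots>\<bar> \<le> h * (h * \<sigma>)"
              unfolding abs_mult[of "2 * sin (h / 2)"] using sin_h h by (intro mult_mono d1) auto
            finally show "\<bar>Dk (y (k + 2) + h / 2) - 2 * Dk (y (k + 1) + h / 2) + Dk (y k + h / 2)\<bar> \<le> h\<^sup>2 * \<sigma>"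
              unfolding yz(3,4) z_def[symmetric] by (simp add: power2_eq_square mult.assoc)
            show "Dk (y k + h / 2) \<le> \<sigma>" using Dk_abs abs_le_D1 by blast
            show "w k = 0" if "k \<notin> {q\<^sub>1..q\<^sub>2}"
              using that R unfolding y_in by (simp add: w_def bump_eq_0)
            show "?c * \<sigma> \<le> Dk (y k + h / 2)" if "k \<in> {q\<^sub>1 - 2..q\<^sub>2 + 2}"
            proof -
              \<comment> \<open>The nearest index whose angle lies in the support of the weight;
                \<open>k\<close> is at most two steps away from it.\<close>
              define k' where "k' = max q\<^sub>1 (min q\<^sub>2 k)"
              have "k' \<in> {q\<^sub>1..q\<^sub>2}" "\<bar>k - k'\<bar> \<le> 2" using that q12 by (auto simp: k'_def)
              then have k': "\<bar>y k'\<bar> \<le> R" "\<bar>real_of_int k - real_of_int k'\<bar> \<le> 2" unfolding y_in by linarith+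
              have "\<bar>y k - y k'\<bar> = h * \<bar>real_of_int k - real_of_int k'\<bar>"
                using h by (simp add: y_def right_diff_distrib[symmetric] abs_mult)
              also have "\<dots> \<le> h * 2" using k' h by (intro mult_left_mono) auto
              finally have "\<bar>y k + h / 2\<bar> \<le> r + 3 * \<rho> / 4" using k'(1) h\<rho> h unfolding R_def by linarith
              from lower[OF ts(1) this] have "c\<^sub>1 * (t - s) \<le> cos (y k + h / 2) * (C t - C s) + sin (y k + h / 2) * (S t - S s)" .
              then have "(2 / 9 * of_int n) * (c\<^sub>1 * (t - s)) \<le> Dk (y k + h / 2)"
                unfolding Dk_def using \<gamma> n c st by (intro mult_mono) auto
              then show ?thesis by (simp add: \<sigma>_def mult_ac)
            qed
          qed (use w_abs q12 c \<sigma> h W0 in auto)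
          also have "\<dots> \<le> 7 / h * (?e * W * h\<^sup>2 / \<sigma>\<^sup>2)"
            using q_len e0 W0 by (intro mult_right_mono) auto
          finally show ?thesis by (rule scale[OF _ e0])
        qed
        have "h * ?N * (1 + (of_int n / h * (t - s))\<^sup>2) \<le> A"
          using N1 N2 by (simp add: A_def distrib_left)
        then show ?thesis using h by (simp add: \<kappa>_def field_simps add_pos_nonneg)
      qed
      have "?lhs \<le> ennreal (A * pi / of_int n * D)"
        unfolding D_def
      proof (rule TTstar_Schur[where w=w and W="{q\<^sub>1..q\<^sub>2}" and \<kappa>=\<kappa>])
        show "?K \<subseteq> {q\<^sub>1..q\<^sub>2}" unfolding subset_iff y_in using yK R by (fastforce simp: y_def)
        show "0 \<le> w k" for k by (simp add: w_def bump_nonneg)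
        show "1 \<le> w k" if "k \<in> ?K" for k
          using bump_ge[of "y k" r R] yK[of k] that R Rr by (simp add: w_def y_def)
        show "continuous_on UNIV (\<theta> k)" for k unfolding \<theta>_eq[abs_def] using cont by (intro continuous_intros)
        show \<kappa>_sym: "\<kappa> t s = \<kappa> s t" for t s by (simp add: \<kappa>_def power2_eq_square algebra_simps)
        show "norm (\<Sum>k\<in>{q\<^sub>1..q\<^sub>2}. of_real (w k) * cis (\<theta> k t - \<theta> k s)) \<le> \<kappa> t s"
          if "t \<in> {t\<^sub>0..t\<^sub>0 + 1 / of_int n}" "s \<in> {t\<^sub>0..t\<^sub>0 + 1 / of_int n}" for t s
        proof (cases "s \<le> t")
          case True
          then show ?thesis using that by (intro kernel_le) auto
        next
          case False
          have "(\<Sum>k\<in>{q\<^sub>1..q\<^sub>2}. of_real (w k) * cis (\<theta> k t - \<theta> k s)) = cnj (\<Sum>k\<in>{q\<^sub>1..q\<^sub>2}. of_real (w k) * cis (\<theta> k s - \<theta> k t))"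
            by (simp add: cnj_sum cis_cnj)
          then show ?thesis using kernel_le[of t s] that False \<kappa>_sym by (simp del: cnj_sum)
        qed
        show "0 \<le> \<kappa> t s" for t s using A0 h by (simp add: \<kappa>_def)
        show "case_prod \<kappa> \<in> borel_measurable (borel \<Otimes>\<^sub>M borel)" unfolding \<kappa>_def by measurable
        \<comment> \<open>The height \<open>A / h\<close> times the width \<open>h / n\<close>: the
          mesh size drops out.\<close>
        show "(\<integral>\<^sup>+s\<in>{t\<^sub>0..t\<^sub>0 + 1 / of_int n}. ennreal (\<kappa> t s) \<partial>lborel) \<le> ennreal (A * pi / of_int n)" for t
          unfolding \<kappa>_def using nn_integral_Lorentzian_le[of "of_int n / h" t\<^sub>0 "t\<^sub>0 + 1 / of_int n" "A / h" t] n h A0 by simp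
      qed (use n A0 finK in auto)
      also have "\<dots> \<le> ennreal ((A * pi + 40 / \<rho> + 1) / of_int n * D)"
        using n r D0 A0 by (intro ennreal_leI mult_right_mono divide_right_mono) auto
      finally show ?thesis .
    qed
    then show "(\<integral>\<^sup>+t\<in>{t\<^sub>0..t\<^sub>0 + 1 / of_int n}. ennreal ((norm (\<Sum>k\<in>?K. d k * cis (- (p (k + n) t - p k t))))\<^sup>2) \<partial>lborel)
      \<le> ennreal ((A * pi + 40 / \<rho> + 1) / of_int n * (\<Sum>k\<in>?K. (norm (d k))\<^sup>2))"
      by (simp only: \<theta>_def D_def)
  qed
qed

section \<open>The two phases as integrals of bounded Borel functions\<close>

lemma interval_integral_lebesgue_eq:
  fixes f g :: "real \<Rightarrow> real"
  assumes f: "f \<in> borel_measurable lebesgue" and g: "g \<in> borel_measurable borel"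
    and eq: "AE x in lborel. f x = g x"
  shows "(LINT x=ereal a..ereal b|lebesgue. f x) = (LBINT x=ereal a..ereal b. g x)"
proof -
  have [measurable]: "f \<in> borel_measurable lebesgue" "g \<in> borel_measurable lebesgue"
    using f g by (auto intro: measurable_completion)
  have "(LINT x:S|lebesgue. f x) = (LBINT x:S. g x)" if S: "S \<in> sets borel" for S
  proof -
    have [measurable]: "S \<in> sets lebesgue" using S by simp
    have "(LINT x:S|lebesgue. f x) = (LINT x:S|lebesgue. g x)"
      unfolding set_lebesgue_integral_def
      using AE_completion[OF eq] by (intro integral_cong_AE) auto
    also have "\<dots> = (LBINT x:S. g x)"
      unfolding set_lebesgue_integral_def using g S by (intro integral_completion) auto
    finally show ?thesis .
  qed
  then show ?thesis by (simp add: interval_lebesgue_integral_def)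
qed

lemma interval_integrable_bounded:
  fixes f :: "real \<Rightarrow> real"
  assumes [measurable]: "f \<in> borel_measurable borel" and M: "\<And>x. \<bar>f x\<bar> \<le> M"
  shows "interval_lebesgue_integrable lborel (ereal a) (ereal b) f"
proof -
  have "set_integrable lborel (einterval (ereal c) (ereal d)) f" for c d
    unfolding set_integrable_def
  proof (rule Bochner_Integration.integrable_bound)
    show "integrable lborel (\<lambda>x. indicator {c..d} x *\<^sub>R M)"
      by (intro integrable_scaleR_left integrable_real_indicator) (auto simp: emeasure_lborel_Icc_eq)
    show "AE x in lborel. norm (indicator (einterval (ereal c) (ereal d)) x *\<^sub>R f x) \<le> norm (indicator {c..d} x *\<^sub>R M)"
      using M order_trans[OF abs_ge_zero M] by (intro AE_I2) (auto simp: indicator_def einterval_iff)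
  qed measurable
  then show ?thesis by (simp add: interval_lebesgue_integrable_def)
qed

lemma interval_integral_increment:
  fixes f :: "real \<Rightarrow> real"
  assumes "f \<in> borel_measurable borel" "\<And>x. \<bar>f x\<bar> \<le> M"
  shows "(LBINT x=ereal 0..ereal t. f x) - (LBINT x=ereal 0..ereal s. f x) = (LBINT x=ereal s..ereal t. f x)"
proof -
  have "(LBINT x=ereal 0..ereal s. f x) + (LBINT x=ereal s..ereal t. f x) = (LBINT x=ereal 0..ereal t. f x)"
    using interval_integrable_bounded[OF assms]
    by (intro interval_integral_sum) (simp add: min_def max_def)
  then show ?thesis by simp
qed

lemma interval_integral_bounds:
  fixes f :: "real \<Rightarrow> real"
  assumes f: "f \<in> borel_measurable borel" "\<And>x. \<bar>f x\<bar> \<le> M" and st: "s \<le> t"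
  shows "(\<And>x. c \<le> f x) \<Longrightarrow> c * (t - s) \<le> (LBINT x=ereal s..ereal t. f x)"
    and "(\<And>x. f x \<le> c) \<Longrightarrow> (LBINT x=ereal s..ereal t. f x) \<le> c * (t - s)"
proof -
  have int: "set_integrable lborel {s<..<t} f"
    using interval_integrable_bounded[OF f, of s t] st by (simp add: interval_lebesgue_integrable_def einterval_eq)
  have cint: "set_integrable lborel {s<..<t} (\<lambda>_. c)"
    unfolding set_integrable_def using st
    by (intro integrable_scaleR_left integrable_real_indicator) auto
  have eq: "(LBINT x=ereal s..ereal t. g x) = (LBINT x:{s<..<t}. g x)" for g :: "real \<Rightarrow> real"
    using st by (simp add: interval_lebesgue_integral_le_eq)
  have ceq: "(LBINT x:{s<..<t}. c) = c * (t - s)" using st by (simp add: set_lebesgue_integral_def)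
  show "c * (t - s) \<le> (LBINT x=ereal s..ereal t. f x)" if "\<And>x. c \<le> f x"
    unfolding eq ceq[symmetric] using int cint that by (intro set_integral_mono) auto
  show "(LBINT x=ereal s..ereal t. f x) \<le> c * (t - s)" if "\<And>x. f x \<le> c"
    unfolding eq ceq[symmetric] using int cint that by (intro set_integral_mono) auto
qed

lemma continuous_interval_integral:
  fixes f :: "real \<Rightarrow> real"
  assumes f: "f \<in> borel_measurable borel" "\<And>x. \<bar>f x\<bar> \<le> M"
  shows "continuous_on UNIV (\<lambda>t. LBINT x=ereal 0..ereal t. f x)"
proof -
  let ?F = "\<lambda>t. LBINT x=ereal 0..ereal t. f x"
  have M: "0 \<le> M" using f(2)[of 0] by linarith
  have f': "- M \<le> f x" "f x \<le> M" for x using f(2)[of x] by linarith+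
  have lip: "\<bar>?F t - ?F s\<bar> \<le> M * \<bar>t - s\<bar>" for s t
  proof -
    have *: "\<bar>?F v - ?F u\<bar> \<le> M * (v - u)" if "u \<le> v" for u v
      unfolding interval_integral_increment[OF f]
      using interval_integral_bounds(1)[OF f that f'(1)] interval_integral_bounds(2)[OF f that f'(2)] by simp
    show ?thesis
    proof (cases "s \<le> t")
      case False
      then show ?thesis using *[of t s] by (simp add: abs_minus_commute)
    qed (use *[of s t] in simp)
  qed
  have "lipschitz_on M UNIV ?F" using lip M by (intro lipschitz_onI) (auto simp: dist_real_def)
  then show ?thesis by (rule lipschitz_on_continuous_on)
qed

text \<open>A Borel version of \<open>a\<close>, clamped to the essential bound. The inequality is
  needed at every point because the bounds on the phase integrals are pointwise in the
  integrand.\<close>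

lemma bounded_borel_representative:
  fixes a :: "real \<Rightarrow> real"
  assumes a: "a \<in> borel_measurable lebesgue" and fin: "Linf_norm a < \<infinity>"
  obtains a' where "a' \<in> borel_measurable borel" "AE x in lborel. a x = a' x"
    "\<And>x. \<bar>a' x\<bar> \<le> real_of_ereal (Linf_norm a)"
proof -
  define A where "A = real_of_ereal (Linf_norm a)"
  have ae: "AE x in lebesgue. ereal \<bar>a x\<bar> \<le> Linf_norm a" unfolding Linf_norm_def by (rule esssup_AE)
  have "0 \<le> Linf_norm a"
  proof -
    \<comment> \<open>Lebesgue measure is nonzero, so the almost everywhere inequality holds at some
      point. This excludes the value minus infinity and makes \<open>real_of_ereal\<close>
      faithful.\<close>
    have "ae_filter lebesgue \<noteq> (bot :: real filter)" by (simp add: ae_filter_eq_bot_iff)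
    then obtain x where "ereal \<bar>a x\<bar> \<le> Linf_norm a" using eventually_happens'[OF _ ae] by blast
    then show ?thesis by (metis abs_ge_zero ereal_less_eq(5) order_trans)
  qed
  then have LA: "Linf_norm a = ereal A" using fin by (cases "Linf_norm a") (auto simp: A_def)
  have A0: "0 \<le> A" using \<open>0 \<le> Linf_norm a\<close> LA by simp
  obtain g where g: "g \<in> borel_measurable lborel" "AE x in lborel. a x = g x"
    using completion_ex_borel_measurable_real[OF a] by auto
  let ?a = "\<lambda>x. max (- A) (min A (g x))"
  have "AE x in lborel. \<bar>a x\<bar> \<le> A" using ae unfolding LA AE_completion_iff by simp
  then have "AE x in lborel. a x = ?a x" using g(2) by eventually_elim auto
  moreover have "?a \<in> borel_measurable borel" using g(1) by simp
  moreover have "\<bar>?a x\<bar> \<le> A" for x using A0 by auto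
  ultimately show thesis using that unfolding A_def by blast
qed

text \<open>\<open>(k + n - a) ^ 2 - (k - a) ^ 2 = 2 * n * k + (n ^ 2 - 2 * n * a)\<close>: the
  function \<open>a\<close> enters only the part free of \<open>k\<close>, so the separation
  constant \<open>pi\<close> does not depend on it.\<close>

lemma phase_properties:
  fixes a :: "real \<Rightarrow> real"
  assumes a: "a \<in> borel_measurable lebesgue" and fin: "Linf_norm a < \<infinity>"
  shows "continuous_on UNIV (phase a k)"
    and "finite K \<Longrightarrow> separated (phase a) K pi"
proof -
  obtain a' where a' [measurable]: "a' \<in> borel_measurable borel" and ae: "AE x in lborel. a x = a' x"
    and A: "\<And>x. \<bar>a' x\<bar> \<le> real_of_ereal (Linf_norm a)"
    using bounded_borel_representative[OF a fin] by blast
  define A where "A = real_of_ereal (Linf_norm a)"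
  have A: "\<bar>a' x\<bar> \<le> A" for x using A by (simp add: A_def)
  have A0: "0 \<le> A" using A[of 0] by linarith
  have eq: "phase a k t = (LBINT x=ereal 0..ereal t. (of_int k - a' x)\<^sup>2)" for k t
    unfolding phase_def
  proof (rule interval_integral_lebesgue_eq)
    show "AE x in lborel. (of_int k - a x)\<^sup>2 = (of_int k - a' x)\<^sup>2" using ae by eventually_elim simp
  qed (use a in measurable)
  have bd: "\<bar>(of_int k - a' x)\<^sup>2\<bar> \<le> (\<bar>of_int k\<bar> + A)\<^sup>2" for k x
  proof -
    have "\<bar>of_int k - a' x\<bar>\<^sup>2 \<le> (\<bar>of_int k\<bar> + A)\<^sup>2" using A[of x] by (intro power_mono) auto
    then show ?thesis by simp
  qed
  show "continuous_on UNIV (phase a k)"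
    unfolding eq[abs_def] using bd by (intro continuous_interval_integral) auto
  show "separated (phase a) K pi" if "finite K"
  proof (rule separated_quadratic[OF that])
    fix k n :: int and t
    let ?i = "\<lambda>f. LBINT x=ereal 0..ereal t. f x"
    have "phase a (k + n) t - phase a k t = ?i (\<lambda>x. (of_int (k + n) - a' x)\<^sup>2 - (of_int k - a' x)\<^sup>2)"
      unfolding eq
      by (intro interval_lebesgue_integral_diff(2)[symmetric] interval_integrable_bounded[OF _ bd]; measurable)
    also have "\<dots> = ?i (\<lambda>x. 2 * of_int n * of_int k + ((of_int n)\<^sup>2 - 2 * of_int n * a' x))"
      by (intro arg_cong[of _ _ ?i] ext) (simp add: power2_eq_square algebra_simps)
    also have "\<dots> = ?i (\<lambda>x. 2 * of_int n * of_int k) + ?i (\<lambda>x. (of_int n)\<^sup>2 - 2 * of_int n * a' x)"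
    proof (intro interval_lebesgue_integral_add(2))
      show "interval_lebesgue_integrable lborel (ereal 0) (ereal t) (\<lambda>x. 2 * of_int n * of_int k :: real)"
        by (rule interval_integrable_bounded[where M="\<bar>2 * of_int n * of_int k\<bar>"]) auto
      show "interval_lebesgue_integrable lborel (ereal 0) (ereal t) (\<lambda>x. (of_int n)\<^sup>2 - 2 * of_int n * a' x)"
      proof (rule interval_integrable_bounded[where M="(of_int n)\<^sup>2 + \<bar>2 * of_int n\<bar> * A"])
      fix x
      show "\<bar>(of_int n)\<^sup>2 - 2 * of_int n * a' x\<bar> \<le> (of_int n)\<^sup>2 + \<bar>2 * of_int n\<bar> * A"
        using mult_left_mono[OF A[of x], of "\<bar>2 * of_int n\<bar>"] by (intro order_trans[OF abs_triangle_ineq4]) (simp add: abs_mult)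
      qed measurable
    qed
    also have "?i (\<lambda>x. 2 * of_int n * of_int k) = 2 * of_int n * of_int k * t" by simp
    finally show "phase a (k + n) t - phase a k t = 2 * of_int n * of_int k * t + ?i (\<lambda>x. (of_int n)\<^sup>2 - 2 * of_int n * a' x)" .
  qed
qed

text \<open>The constant of \<open>separated_discrete\<close> for \<open>r = \<Lambda>\<pi>\<close>: the angles \<open>h (k - a)\<close> keep a distance of at least \<open>\<rho>/4\<close>
  from \<open>\<plusminus> \<pi>/2\<close>, which yields the lower bound \<open>c\<close>.\<close>

definition disc_const :: "real \<Rightarrow> real" where
  "disc_const \<Lambda> = (let r = \<Lambda> * pi; \<rho> = pi * (1 / 2 - \<Lambda>) / 2; c = sin (\<rho> / 4) in
     7 * (114 / (((r + \<rho> / 2)\<^sup>2 - r\<^sup>2)\<^sup>2)) * (1 + (20 + 100 / (c / 9)\<^sup>2) * 9 / (c / 9)\<^sup>2) * pi + 40 / \<rho> + 1)"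

text \<open>\<open>omega_h\<close> equals \<open>2 / h ^ 2 * (1 - cos (h * k - h * a))\<close>, and
  the addition formula separates \<open>k\<close> from \<open>a\<close>. The time integrals of
  \<open>cos (h * a)\<close> and \<open>sin (h * a)\<close> are all that remains of
  \<open>a\<close>.\<close>

lemma phase_h_properties:
  fixes a :: "real \<Rightarrow> real"
  assumes a: "a \<in> borel_measurable lebesgue" and fin: "Linf_norm a < \<infinity>" and \<Lambda>: "0 < \<Lambda>" "\<Lambda> < 1 / 2"
    and h: "0 < h" "h \<le> min 1 (pi * (1/2 - \<Lambda>) / (2 * japanese (real_of_ereal (Linf_norm a))))"
  shows "continuous_on UNIV (phase_h h a k)"
    and "separated (phase_h h a) (low_freqs \<Lambda> h) (disc_const \<Lambda>)"
proof -
  obtain a' where a' [measurable]: "a' \<in> borel_measurable borel" and ae: "AE x in lborel. a x = a' x"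
    and A': "\<And>x. \<bar>a' x\<bar> \<le> real_of_ereal (Linf_norm a)"
    using bounded_borel_representative[OF a fin] by blast
  define A where "A = real_of_ereal (Linf_norm a)"
  \<comment> \<open>Half the gap between \<open>\<Lambda> * pi\<close> and \<open>pi / 2\<close>
    and, by the choice of \<open>h\<close>, also an upper bound for \<open>h * |a|\<close>.\<close>
  define \<rho> where "\<rho> = pi * (1 / 2 - \<Lambda>) / 2"
  have \<rho>: "0 < \<rho>" using \<Lambda> by (simp add: \<rho>_def)
  have r\<rho>: "\<Lambda> * pi = pi / 2 - 2 * \<rho>" by (simp add: \<rho>_def field_simps)
  have A: "\<bar>a' x\<bar> \<le> A" for x using A' by (simp add: A_def)
  have A0: "0 \<le> A" using A[of 0] by linarith
  have hA: "h * A \<le> \<rho>"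
  proof -
    have J: "A \<le> japanese A" "0 < japanese A" unfolding japanese_def
      by (rule real_le_rsqrt, simp) (simp add: add_pos_nonneg)
    have "h * A \<le> h * japanese A" using J h by (intro mult_left_mono) auto
    also have "h \<le> \<rho> / japanese A" using h by (simp add: A_def \<rho>_def)
    then have "h * japanese A \<le> \<rho>" using J by (simp add: pos_le_divide_eq)
    finally show ?thesis .
  qed
  have ha: "\<bar>h * a' x\<bar> \<le> \<rho>" for x
  proof -
    have "h * \<bar>a' x\<bar> \<le> h * A" using A h by (intro mult_left_mono) auto
    then have "h * \<bar>a' x\<bar> \<le> \<rho>" using hA by (rule order_trans)
    then show ?thesis using h by (simp add: abs_mult)
  qed
  define C where "C t = (LBINT x=ereal 0..ereal t. cos (h * a' x))" for t
  define S where "S t = (LBINT x=ereal 0..ereal t. sin (h * a' x))" for t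
  have Ci: "interval_lebesgue_integrable lborel (ereal s) (ereal t) (\<lambda>x. cos (h * a' x))"
    and Si: "interval_lebesgue_integrable lborel (ereal s) (ereal t) (\<lambda>x. sin (h * a' x))" for s t
    by (intro interval_integrable_bounded[where M=1]; simp)+
  have eq: "phase_h h a k t = 2 / h\<^sup>2 * t - 2 / h\<^sup>2 * (cos (h * of_int k) * C t + sin (h * of_int k) * S t)" for k t
  proof -
    let ?i = "\<lambda>f. LBINT x=ereal 0..ereal t. f x"
    have "phase_h h a k t = ?i (\<lambda>x. omega_h h (a' x) k)"
      unfolding phase_h_def
    proof (rule interval_integral_lebesgue_eq)
      show "AE x in lborel. omega_h h (a x) k = omega_h h (a' x) k" using ae by eventually_elim simp
    qed (use a in \<open>unfold omega_h_def, measurable\<close>)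
    also have "\<dots> = ?i (\<lambda>x. 2 / h\<^sup>2 - (2 / h\<^sup>2 * cos (h * of_int k) * cos (h * a' x) + 2 / h\<^sup>2 * sin (h * of_int k) * sin (h * a' x)))"
    proof (intro arg_cong[of _ _ ?i] ext)
      fix x
      have "2 * (sin (h * (of_int k - a' x) / 2))\<^sup>2 = 1 - cos (h * of_int k - h * a' x)"
      proof -
        have "cos (h * of_int k - h * a' x) = cos (2 * (h * (of_int k - a' x) / 2))"
          by (rule arg_cong[of _ _ cos]) (simp add: field_simps)
        then show ?thesis by (simp only: cos_double_sin)
      qed
      then show "omega_h h (a' x) k = 2 / h\<^sup>2 - (2 / h\<^sup>2 * cos (h * of_int k) * cos (h * a' x) + 2 / h\<^sup>2 * sin (h * of_int k) * sin (h * a' x))"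
        unfolding omega_h_def cos_diff using h by (simp add: field_simps)
    qed
    also have "\<dots> = 2 / h\<^sup>2 * t - (2 / h\<^sup>2 * cos (h * of_int k) * C t + 2 / h\<^sup>2 * sin (h * of_int k) * S t)"
      unfolding C_def S_def using Ci[of 0 t] Si[of 0 t]
      by (simp add: interval_lebesgue_integral_diff interval_lebesgue_integral_add)
    finally show ?thesis by (simp add: algebra_simps)
  qed
  have cont: "continuous_on UNIV C" "continuous_on UNIV S"
    unfolding C_def[abs_def] S_def[abs_def] by (intro continuous_interval_integral[where M=1]; simp)+
  show "continuous_on UNIV (phase_h h a k)"
    unfolding eq[abs_def] by (intro continuous_intros cont)
  have incr: "cos \<eta> * (C t - C s) + sin \<eta> * (S t - S s) = (LBINT x=ereal s..ereal t. cos (\<eta> - h * a' x))" for \<eta> s t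
  proof -
    have "cos \<eta> * (C t - C s) + sin \<eta> * (S t - S s)
        = cos \<eta> * (LBINT x=ereal s..ereal t. cos (h * a' x)) + sin \<eta> * (LBINT x=ereal s..ereal t. sin (h * a' x))"
      unfolding C_def S_def by (subst (1 2) interval_integral_increment[where M=1]) auto
    also have "\<dots> = (LBINT x=ereal s..ereal t. cos \<eta> * cos (h * a' x) + sin \<eta> * sin (h * a' x))"
      using Ci[of s t] Si[of s t] by (simp add: interval_lebesgue_integral_add)
    finally show ?thesis by (simp add: cos_diff)
  qed
  have c: "0 < sin (\<rho> / 4)"
  proof (rule sin_gt_zero)
    have "0 < \<Lambda> * pi" using \<Lambda> by simp
    then show "\<rho> / 4 < pi" using r\<rho> pi_gt_zero by linarith
  qed (use \<rho> in simp)
  show "separated (phase_h h a) (low_freqs \<Lambda> h) (disc_const \<Lambda>)"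
    unfolding disc_const_def Let_def \<rho>_def[symmetric]
  proof (rule separated_discrete[OF _ h(1) _ _ \<rho> _ c _ eq cont])
    show "low_freqs \<Lambda> h \<subseteq> {k. \<bar>h * of_int k\<bar> \<le> \<Lambda> * pi}" by (auto simp: low_freqs_def)
    show "\<Lambda> * pi + \<rho> < pi / 2" using \<rho> r\<rho> by simp
    show "\<bar>cos \<eta> * (C t - C s) + sin \<eta> * (S t - S s)\<bar> \<le> t - s" if "s \<le> t" for \<eta> s t
    proof -
      have m: "(\<lambda>x. cos (\<eta> - h * a' x)) \<in> borel_measurable borel" by measurable
      have b: "- 1 * (t - s) \<le> (LBINT x=ereal s..ereal t. cos (\<eta> - h * a' x))" "(LBINT x=ereal s..ereal t. cos (\<eta> - h * a' x)) \<le> 1 * (t - s)"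
        by (rule interval_integral_bounds[OF m _ that, of 1]; simp)+
      then show ?thesis unfolding incr by simp
    qed
    show "sin (\<rho> / 4) * (t - s) \<le> cos \<eta> * (C t - C s) + sin \<eta> * (S t - S s)"
      if "s \<le> t" and \<eta>: "\<bar>\<eta>\<bar> \<le> \<Lambda> * pi + 3 * \<rho> / 4" for \<eta> s t
      unfolding incr
    proof (rule interval_integral_bounds(1)[OF _ _ \<open>s \<le> t\<close>, of _ 1])
      fix x
      \<comment> \<open>The margins add up: \<open>\<Lambda> * pi + 3 * \<rho> / 4 + \<rho> = pi / 2
        - \<rho> / 4\<close>.\<close>
      have "\<bar>\<eta> - h * a' x\<bar> \<le> pi / 2 - \<rho> / 4" using \<eta> ha[of x] r\<rho> by linarith
      then have "cos (pi / 2 - \<rho> / 4) \<le> cos \<bar>\<eta> - h * a' x\<bar>"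
        using \<rho> pi_gt_zero by (intro cos_monotone_0_pi_le) auto
      then show "sin (\<rho> / 4) \<le> cos (\<eta> - h * a' x)" by (simp add: sin_cos_eq)
    qed auto
  qed (use h \<Lambda> in auto)
qed

lemma disc_const_nonneg: "0 < \<Lambda> \<Longrightarrow> \<Lambda> < 1 / 2 \<Longrightarrow> 0 \<le> disc_const \<Lambda>"
  unfolding disc_const_def Let_def
  by (intro add_nonneg_nonneg mult_nonneg_nonneg divide_nonneg_nonneg) auto

lemma finite_low_freqs: "finite (low_freqs \<Lambda> h)"
  unfolding low_freqs_def by (rule finite_subset[of _ "dual_grid h"]) (auto simp: dual_grid_def)

section \<open>Test functions\<close>

lemma nderiv_0 [simp]: "nderiv 0 f = f"
  by (simp add: nderiv_def)

lemma nderiv_Suc: "nderiv (Suc n) f = (\<lambda>t. vector_derivative (nderiv n f) (at t))"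
  by (simp add: nderiv_def)

text \<open>Coinduction on derivatives: a class closed under differentiation stands in for formulas
  of the higher derivatives, both for test functions and for their transforms.\<close>

lemma smooth_coinduct:
  assumes f: "f \<in> F"
    and F: "\<And>f. f \<in> F \<Longrightarrow> \<exists>f'\<in>F. \<forall>t. (f has_vector_derivative f' t) (at t)"
  shows "nderiv n f \<in> F" and "smooth f"
proof -
  have *: "nderiv n f \<in> F" for n
  proof (induction n)
    case (Suc n)
    from F[OF Suc] obtain f' where f': "f' \<in> F" "\<And>t. (nderiv n f has_vector_derivative f' t) (at t)" by blast
    have "nderiv (Suc n) f = f'"
      unfolding nderiv_Suc using f'(2) by (intro ext vector_derivative_at)
    then show ?case using f' by simp
  qed (simp add: f)
  show "nderiv n f \<in> F" by (rule *)
  show "smooth f"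
    unfolding smooth_def using F[OF *] by (meson differentiableI_vector)
qed

text \<open>The standard function that is flat at 0. Powers of \<open>1 / x\<close> close the family
  under differentiation, and for \<open>m = 0\<close> the limit
  \<open>\<epsilon> \<rightarrow> 0\<close> is the indicator of \<open>{0<..}\<close>.\<close>

definition flat_exp :: "real \<Rightarrow> nat \<Rightarrow> real \<Rightarrow> real" where
  "flat_exp \<epsilon> m x = (if 0 < x then exp (- \<epsilon> / x) / x ^ m else 0)"

text \<open>With \<open>y = 1 / x\<close> this is the limit of
  \<open>y ^ m / exp (\<epsilon> * y)\<close> at infinity.\<close>

lemma flat_tendsto_0:
  assumes "0 < \<epsilon>" shows "((\<lambda>x. flat_exp \<epsilon> m x) \<longlongrightarrow> 0) (at_right 0)"
proof -
  have "((\<lambda>y. y ^ m / exp (\<epsilon> * y)) \<longlongrightarrow> 0) at_top"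
  proof -
    have "((\<lambda>y. (\<epsilon> * y) ^ m / exp (\<epsilon> * y)) \<longlongrightarrow> 0) at_top"
      by (rule filterlim_compose[OF tendsto_power_div_exp_0])
        (intro filterlim_tendsto_pos_mult_at_top[OF tendsto_const assms] filterlim_ident)
    then have "((\<lambda>y. inverse (\<epsilon> ^ m) * ((\<epsilon> * y) ^ m / exp (\<epsilon> * y))) \<longlongrightarrow> 0) at_top"
      by (rule tendsto_mult_right_zero)
    moreover have "inverse (\<epsilon> ^ m) * ((\<epsilon> * y) ^ m / exp (\<epsilon> * y)) = y ^ m / exp (\<epsilon> * y)" for y
      using assms by (simp add: power_mult_distrib)
    ultimately show ?thesis by (simp only:)
  qed
  then have "((\<lambda>x. inverse x ^ m / exp (\<epsilon> * inverse x)) \<longlongrightarrow> 0) (at_right 0)"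
    by (rule filterlim_compose[OF _ filterlim_inverse_at_top_right])
  moreover have "\<forall>\<^sub>F x in at_right 0. inverse x ^ m / exp (\<epsilon> * inverse x) = flat_exp \<epsilon> m x"
    using eventually_at_right_less[of 0]
  proof eventually_elim
    case (elim x)
    define E where "E = exp (\<epsilon> * inverse x)"
    have "exp (- \<epsilon> / x) = inverse E" unfolding E_def exp_minus[symmetric] by (simp add: divide_inverse)
    then show ?case using elim unfolding E_def[symmetric]
      by (simp add: flat_exp_def divide_inverse power_inverse mult.commute)
  qed
  ultimately show ?thesis by (rule Lim_transform_eventually)
qed

lemma flat_has_derivative:
  assumes "0 < \<epsilon>"
  shows "(flat_exp \<epsilon> m has_real_derivative \<epsilon> * flat_exp \<epsilon> (m + 2) x - real m * flat_exp \<epsilon> (m + 1) x) (at x)"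
proof -
  consider "0 < x" | "x < 0" | "x = 0" by linarith
  then show ?thesis
  proof cases
    case 1
    have "((\<lambda>x. exp (- (\<epsilon> * inverse x)) * inverse x ^ m) has_real_derivative
        exp (- (\<epsilon> * inverse x)) * (\<epsilon> * (inverse x * inverse x)) * inverse x ^ m
        + exp (- (\<epsilon> * inverse x)) * (real m * inverse x ^ (m - 1) * (- (inverse x * inverse x)))) (at x)"
      using 1 by (auto intro!: derivative_eq_intros simp: algebra_simps)
    then have "((\<lambda>x. exp (- (\<epsilon> * inverse x)) * inverse x ^ m) has_real_derivative
        \<epsilon> * flat_exp \<epsilon> (m + 2) x - real m * flat_exp \<epsilon> (m + 1) x) (at x)"
    proof (rule DERIV_cong)
      define y where "y = inverse x"
      have fl: "flat_exp \<epsilon> k x = exp (- (\<epsilon> * y)) * y ^ k" for k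
        using 1 by (simp add: flat_exp_def y_def divide_inverse power_inverse)
      show "exp (- (\<epsilon> * inverse x)) * (\<epsilon> * (inverse x * inverse x)) * inverse x ^ m
          + exp (- (\<epsilon> * inverse x)) * (real m * inverse x ^ (m - 1) * (- (inverse x * inverse x)))
        = \<epsilon> * flat_exp \<epsilon> (m + 2) x - real m * flat_exp \<epsilon> (m + 1) x"
        unfolding fl y_def[symmetric] by (cases m) (simp_all add: algebra_simps)
    qed
    then show ?thesis
    proof (rule has_field_derivative_transform_within_open)
      show "exp (- (\<epsilon> * inverse y)) * inverse y ^ m = flat_exp \<epsilon> m y" if "y \<in> {0<..}" for y
        using that by (simp add: flat_exp_def divide_inverse power_inverse)
    qed (use 1 in auto)
  next
    case 2
    have "((\<lambda>x. 0) has_real_derivative \<epsilon> * flat_exp \<epsilon> (m + 2) x - real m * flat_exp \<epsilon> (m + 1) x) (at x)"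
      using 2 by (auto simp: flat_exp_def)
    then show ?thesis
      by (rule has_field_derivative_transform_within_open[of _ _ _ "{..<0}"]) (use 2 in \<open>auto simp: flat_exp_def\<close>)
  next
    case 3
    \<comment> \<open>At 0 the difference quotient from the right is the member of the family with
      exponent \<open>m + 1\<close>; from the left it is 0.\<close>
    have r: "((\<lambda>y. (flat_exp \<epsilon> m y - flat_exp \<epsilon> m 0) / (y - 0)) \<longlongrightarrow> 0) (at_right 0)"
      using flat_tendsto_0[OF assms, of "m + 1"]
    proof (rule Lim_transform_eventually)
      show "\<forall>\<^sub>F y in at_right 0. flat_exp \<epsilon> (m + 1) y = (flat_exp \<epsilon> m y - flat_exp \<epsilon> m 0) / (y - 0)"
        using eventually_at_right_less[of 0] by eventually_elim (simp add: flat_exp_def)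
    qed
    have l: "((\<lambda>y. (flat_exp \<epsilon> m y - flat_exp \<epsilon> m 0) / (y - 0)) \<longlongrightarrow> 0) (at_left 0)"
      by (rule tendsto_eventually)
        (unfold eventually_at_filter, intro always_eventually allI impI, simp add: flat_exp_def)
    have z: "\<epsilon> * flat_exp \<epsilon> (m + 2) 0 - real m * flat_exp \<epsilon> (m + 1) 0 = 0" by (simp add: flat_exp_def)
    show ?thesis unfolding 3 has_field_derivative_iff z by (rule filterlim_split_at[OF l r])
  qed
qed

text \<open>Closed under differentiation and multiplication by \<open>t\<close>, hence under all the operations that
  occur in the Schwartz seminorms of the Fourier transform.\<close>

inductive_set testfun :: "real \<Rightarrow> real \<Rightarrow> real \<Rightarrow> (real \<Rightarrow> complex) set" for \<epsilon> \<alpha> \<beta> where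
  base: "(\<lambda>t. of_real (flat_exp \<epsilon> m (t - \<alpha>) * flat_exp \<epsilon> l (\<beta> - t))) \<in> testfun \<epsilon> \<alpha> \<beta>"
| add: "f \<in> testfun \<epsilon> \<alpha> \<beta> \<Longrightarrow> g \<in> testfun \<epsilon> \<alpha> \<beta> \<Longrightarrow> (\<lambda>t. f t + g t) \<in> testfun \<epsilon> \<alpha> \<beta>"
| scale: "f \<in> testfun \<epsilon> \<alpha> \<beta> \<Longrightarrow> (\<lambda>t. c * f t) \<in> testfun \<epsilon> \<alpha> \<beta>"
| mult: "f \<in> testfun \<epsilon> \<alpha> \<beta> \<Longrightarrow> (\<lambda>t. of_real t * f t) \<in> testfun \<epsilon> \<alpha> \<beta>"

lemma testfun_derivative:
  assumes "0 < \<epsilon>" "f \<in> testfun \<epsilon> \<alpha> \<beta>"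
  shows "\<exists>f'\<in>testfun \<epsilon> \<alpha> \<beta>. \<forall>t. (f has_vector_derivative f' t) (at t)"
  using assms(2)
proof induction
  case (base m l)
  let ?b = "\<lambda>m l t. complex_of_real (flat_exp \<epsilon> m (t - \<alpha>) * flat_exp \<epsilon> l (\<beta> - t))"
  let ?f = "\<lambda>t. (of_real \<epsilon> * ?b (m + 2) l t + of_real (- real m) * ?b (m + 1) l t)
      + (of_real (- \<epsilon>) * ?b m (l + 2) t + of_real (real l) * ?b m (l + 1) t)"
  have "?f \<in> testfun \<epsilon> \<alpha> \<beta>"
  proof -
    have b: "?b m' l' \<in> testfun \<epsilon> \<alpha> \<beta>" for m' l' by (rule testfun.base)
    have c: "(\<lambda>t. of_real x * ?b m' l' t + of_real y * ?b m'' l'' t) \<in> testfun \<epsilon> \<alpha> \<beta>" for x y m' l' m'' l''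
      by (rule testfun.add[OF testfun.scale[OF b] testfun.scale[OF b]])
    show ?thesis by (rule testfun.add[OF c c])
  qed
  moreover have "(?b m l has_vector_derivative ?f t) (at t)" for t
  proof -
    have 1: "((\<lambda>t. flat_exp \<epsilon> m (t - \<alpha>)) has_real_derivative (\<epsilon> * flat_exp \<epsilon> (m + 2) (t - \<alpha>) - real m * flat_exp \<epsilon> (m + 1) (t - \<alpha>)) * 1) (at t)"
      by (rule DERIV_chain2[OF flat_has_derivative[OF assms(1)]]) (auto intro!: derivative_eq_intros)
    have 2: "((\<lambda>t. flat_exp \<epsilon> l (\<beta> - t)) has_real_derivative (\<epsilon> * flat_exp \<epsilon> (l + 2) (\<beta> - t) - real l * flat_exp \<epsilon> (l + 1) (\<beta> - t)) * (- 1)) (at t)"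
      by (rule DERIV_chain2[OF flat_has_derivative[OF assms(1)]]) (auto intro!: derivative_eq_intros)
    from DERIV_mult[OF 1 2] have "((\<lambda>t. flat_exp \<epsilon> m (t - \<alpha>) * flat_exp \<epsilon> l (\<beta> - t)) has_real_derivative
        ((\<epsilon> * flat_exp \<epsilon> (m + 2) (t - \<alpha>) - real m * flat_exp \<epsilon> (m + 1) (t - \<alpha>)) * 1 * flat_exp \<epsilon> l (\<beta> - t)
         + (\<epsilon> * flat_exp \<epsilon> (l + 2) (\<beta> - t) - real l * flat_exp \<epsilon> (l + 1) (\<beta> - t)) * (- 1) * flat_exp \<epsilon> m (t - \<alpha>))) (at t)"
      by simp
    from has_vector_derivative_of_real[OF this] show ?thesis
      by (rule has_vector_derivative_eq_rhs) (simp add: algebra_simps)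
  qed
  ultimately show ?case by (intro bexI[of _ ?f] allI)
next
  case (add f g)
  then obtain f' g' where "f' \<in> testfun \<epsilon> \<alpha> \<beta>" "\<forall>t. (f has_vector_derivative f' t) (at t)"
    "g' \<in> testfun \<epsilon> \<alpha> \<beta>" "\<forall>t. (g has_vector_derivative g' t) (at t)" by blast
  then show ?case by (intro bexI[of _ "\<lambda>t. f' t + g' t"] allI has_vector_derivative_add testfun.add) auto
next
  case (scale f c)
  then obtain f' where "f' \<in> testfun \<epsilon> \<alpha> \<beta>" "\<forall>t. (f has_vector_derivative f' t) (at t)" by blast
  then show ?case by (intro bexI[of _ "\<lambda>t. c * f' t"] allI has_vector_derivative_mult_right testfun.scale) auto
next
  case (mult f)
  then obtain f' where f': "f' \<in> testfun \<epsilon> \<alpha> \<beta>" "\<forall>t. (f has_vector_derivative f' t) (at t)" by blast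
  have "((\<lambda>t. of_real t * f t) has_vector_derivative of_real t * f' t + 1 * f t) (at t)" for t
  proof -
    have "((\<lambda>t. complex_of_real t) has_vector_derivative of_real 1) (at t)"
      by (rule has_vector_derivative_of_real) (rule DERIV_ident)
    from has_vector_derivative_mult[OF this f'(2)[THEN spec]] show ?thesis by simp
  qed
  moreover have "(\<lambda>t. of_real t * f' t + 1 * f t) \<in> testfun \<epsilon> \<alpha> \<beta>"
    by (rule testfun.add testfun.scale testfun.mult f'(1) mult(1))+
  ultimately show ?case by (intro bexI[of _ "\<lambda>t. of_real t * f' t + 1 * f t"] allI)
qed

lemma testfun_support: "f \<in> testfun \<epsilon> \<alpha> \<beta> \<Longrightarrow> t \<notin> {\<alpha><..<\<beta>} \<Longrightarrow> f t = 0"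
proof (induction rule: testfun.induct)
  case (base m l)
  then have "\<not> 0 < t - \<alpha> \<or> \<not> 0 < \<beta> - t" by auto
  then show ?case by (elim disjE) (simp_all add: flat_exp_def)
qed simp_all

lemma testfun_continuous:
  assumes "0 < \<epsilon>" "f \<in> testfun \<epsilon> \<alpha> \<beta>" shows "continuous_on S f"
proof -
  obtain f' where "\<And>t. (f has_vector_derivative f' t) (at t)" using testfun_derivative[OF assms] by blast
  then show ?thesis by (intro continuous_at_imp_continuous_on ballI) (blast dest: has_vector_derivative_continuous)
qed

lemma testfun_bounded:
  assumes "0 < \<epsilon>" "f \<in> testfun \<epsilon> \<alpha> \<beta>"
  obtains M where "\<And>t. norm (f t) \<le> M"
proof -
  have "compact (f ` {\<alpha>..\<beta>})"
    by (rule compact_continuous_image[OF testfun_continuous[OF assms] compact_Icc])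
  then have "bounded (f ` {\<alpha>..\<beta>})" by (rule compact_imp_bounded)
  then obtain M where M: "\<forall>t\<in>{\<alpha>..\<beta>}. norm (f t) \<le> M" unfolding bounded_iff by blast
  have "norm (f t) \<le> max M 0" for t
    using M testfun_support[OF assms(2), of t] by (cases "t \<in> {\<alpha><..<\<beta>}") (auto simp: le_max_iff_disj)
  then show ?thesis by (rule that)
qed

lemma testfun_integrable:
  assumes "0 < \<epsilon>" "f \<in> testfun \<epsilon> \<alpha> \<beta>" shows "integrable lborel f"
proof -
  obtain M where M: "\<And>t. norm (f t) \<le> M" using testfun_bounded[OF assms] by blast
  have [measurable]: "f \<in> borel_measurable borel"
    by (intro borel_measurable_continuous_onI testfun_continuous[OF assms])
  show ?thesis
  proof (rule Bochner_Integration.integrable_bound)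
    show "integrable lborel (\<lambda>t. indicator {\<alpha>..\<beta>} t *\<^sub>R M)"
      by (intro integrable_scaleR_left integrable_real_indicator) (auto simp: emeasure_lborel_Icc_eq)
    show "AE t in lborel. norm (f t) \<le> norm (indicator {\<alpha>..\<beta>} t *\<^sub>R M)"
    proof (rule AE_I2)
      fix t show "norm (f t) \<le> norm (indicator {\<alpha>..\<beta>} t *\<^sub>R M)"
        using order_trans[OF M[of t] abs_ge_self] testfun_support[OF assms(2), of t] by (cases "t \<in> {\<alpha><..<\<beta>}") auto
    qed
  qed measurable
qed

section \<open>Fourier inversion for test functions\<close>

text \<open>With an exponential kernel this is the multiplication formula, which moves a Fourier
  transform from one factor to the other.\<close>

lemma Fubini_bounded_kernel:
  fixes a b :: "real \<Rightarrow> complex" and k :: "real \<Rightarrow> real \<Rightarrow> complex"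
  assumes a: "integrable lborel a" and b: "integrable lborel b"
    and k [measurable]: "case_prod k \<in> borel_measurable (borel \<Otimes>\<^sub>M borel)" and k1: "\<And>t \<tau>. norm (k t \<tau>) \<le> 1"
  shows "(LINT t|lborel. a t * (LINT \<tau>|lborel. b \<tau> * k t \<tau>)) = (LINT \<tau>|lborel. b \<tau> * (LINT t|lborel. a t * k t \<tau>))"
proof -
  have [measurable]: "a \<in> borel_measurable borel" "b \<in> borel_measurable borel" using a b by auto
  have bk: "integrable lborel (\<lambda>\<tau>. b \<tau> * k t \<tau>)" for t
  proof (rule Bochner_Integration.integrable_bound[OF b])
    show "AE \<tau> in lborel. norm (b \<tau> * k t \<tau>) \<le> norm (b \<tau>)"
      using k1 by (intro AE_I2) (simp add: norm_mult mult_left_le)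
  qed measurable
  have abk: "integrable lborel (\<lambda>\<tau>. norm (a t * b \<tau> * k t \<tau>))" for t
    using integrable_norm[OF integrable_mult_right[OF bk[of t], of "a t"]] by (simp add: mult.assoc)
  have int: "integrable (lborel \<Otimes>\<^sub>M lborel) (\<lambda>(t, \<tau>). a t * b \<tau> * k t \<tau>)"
  proof (rule lborel_pair.Fubini_integrable)
    show "integrable lborel (\<lambda>t. LINT \<tau>|lborel. norm (case (t, \<tau>) of (t, \<tau>) \<Rightarrow> a t * b \<tau> * k t \<tau>))"
    proof (rule Bochner_Integration.integrable_bound)
      show "integrable lborel (\<lambda>t. norm (a t) * (LINT \<tau>|lborel. norm (b \<tau>)))" using a by simp
      show "AE t in lborel. norm (LINT \<tau>|lborel. norm (case (t, \<tau>) of (t, \<tau>) \<Rightarrow> a t * b \<tau> * k t \<tau>))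
          \<le> norm (norm (a t) * (LINT \<tau>|lborel. norm (b \<tau>)))"
      proof (rule AE_I2)
        fix t
        have "(LINT \<tau>|lborel. norm (a t * b \<tau> * k t \<tau>)) \<le> (LINT \<tau>|lborel. norm (a t) * norm (b \<tau>))"
          using abk b k1 by (intro integral_mono) (auto simp: norm_mult mult_left_le)
        then show "norm (LINT \<tau>|lborel. norm (case (t, \<tau>) of (t, \<tau>) \<Rightarrow> a t * b \<tau> * k t \<tau>))
          \<le> norm (norm (a t) * (LINT \<tau>|lborel. norm (b \<tau>)))" by simp
      qed
    qed measurable
    show "AE t in lborel. integrable lborel (\<lambda>\<tau>. case (t, \<tau>) of (t, \<tau>) \<Rightarrow> a t * b \<tau> * k t \<tau>)"
      using integrable_mult_right[OF bk] by (intro AE_I2) (simp add: mult.assoc)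
  qed measurable
  have "(LINT t|lborel. a t * (LINT \<tau>|lborel. b \<tau> * k t \<tau>)) = (LINT t|lborel. (LINT \<tau>|lborel. a t * b \<tau> * k t \<tau>))"
    by (simp only: integral_mult_right_zero mult.assoc)
  also have "\<dots> = (LINT \<tau>|lborel. (LINT t|lborel. a t * b \<tau> * k t \<tau>))"
    using lborel_pair.Fubini_integral[OF int] by simp
  also have "\<dots> = (LINT \<tau>|lborel. (LINT t|lborel. b \<tau> * (a t * k t \<tau>)))"
    by (simp only: mult_ac)
  also have "\<dots> = (LINT \<tau>|lborel. b \<tau> * (LINT t|lborel. a t * k t \<tau>))"
    by (simp only: integral_mult_right_zero)
  finally show ?thesis .
qed

text \<open>The sign is opposite to that of \<open>fourier\<close>, so that
  \<open>fourier (ft f)\<close> returns \<open>2 * pi * f\<close> and \<open>has_fourier\<close> can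
  be tested against \<open>ft f\<close>.\<close>

definition ft :: "(real \<Rightarrow> complex) \<Rightarrow> real \<Rightarrow> complex" where
  "ft f \<tau> = (LINT t|lborel. f t * cis (t * \<tau>))"

lemma ft_integrable: "integrable lborel f \<Longrightarrow> integrable lborel (\<lambda>t. f t * cis (t * \<tau>))"
  by (rule Bochner_Integration.integrable_bound) (auto simp: norm_mult)

lemma norm_ft_le: "integrable lborel f \<Longrightarrow> norm (ft f \<tau>) \<le> (LINT t|lborel. norm (f t))"
  unfolding ft_def by (rule order_trans[OF integral_norm_bound]) (simp add: norm_mult)

text \<open>The Taylor remainder of the exponential is quadratic in \<open>y - \<tau>\<close> with
  the factor \<open>t ^ 2\<close>, and the second moment of \<open>f\<close> is integrable, being
  that of a test function.\<close>

lemma ft_derivative: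
  assumes \<epsilon>: "0 < \<epsilon>" and f: "f \<in> testfun \<epsilon> \<alpha> \<beta>"
  shows "(ft f has_vector_derivative ft (\<lambda>t. \<i> * (of_real t * f t)) \<tau>) (at \<tau>)"
proof -
  let ?f1 = "\<lambda>t. \<i> * (of_real t * f t)"
  have f1: "?f1 \<in> testfun \<epsilon> \<alpha> \<beta>" using f by (intro testfun.intros)
  have f2: "(\<lambda>t. of_real t * (of_real t * f t)) \<in> testfun \<epsilon> \<alpha> \<beta>" using f by (intro testfun.intros)
  note i = testfun_integrable[OF \<epsilon> f] testfun_integrable[OF \<epsilon> f1] testfun_integrable[OF \<epsilon> f2]
  define C where "C = (LINT t|lborel. norm (of_real t * (of_real t * f t)))"
  have bound: "norm (ft f y - ft f \<tau> - (y - \<tau>) *\<^sub>R ft ?f1 \<tau>) \<le> C * (y - \<tau>)\<^sup>2" for y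
  proof -
    have "ft f y - ft f \<tau> - (y - \<tau>) *\<^sub>R ft ?f1 \<tau>
        = (LINT t|lborel. f t * cis (t * y) - f t * cis (t * \<tau>) - (y - \<tau>) *\<^sub>R (?f1 t * cis (t * \<tau>)))"
      unfolding ft_def using i by (simp add: ft_integrable)
    also have "norm \<dots> \<le> (LINT t|lborel. norm (of_real t * (of_real t * f t)) * (y - \<tau>)\<^sup>2)"
    proof (rule order_trans[OF integral_norm_bound], rule integral_mono)
      show "integrable lborel (\<lambda>t. norm (f t * cis (t * y) - f t * cis (t * \<tau>) - (y - \<tau>) *\<^sub>R (?f1 t * cis (t * \<tau>))))"
        using i by (intro integrable_norm Bochner_Integration.integrable_diff ft_integrable integrable_scaleR_right)
      show "integrable lborel (\<lambda>t. norm (of_real t * (of_real t * f t)) * (y - \<tau>)\<^sup>2)"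
        using i by (intro integrable_mult_left integrable_norm)
      fix t
      have "cis (t * y) = cis (t * \<tau>) * cis (t * (y - \<tau>))" unfolding cis_mult by (simp add: algebra_simps)
      then have "f t * cis (t * y) - f t * cis (t * \<tau>) - (y - \<tau>) *\<^sub>R (?f1 t * cis (t * \<tau>))
          = f t * cis (t * \<tau>) * (cis (t * (y - \<tau>)) - 1 - \<i> * of_real (t * (y - \<tau>)))"
        by (simp add: scaleR_conv_of_real algebra_simps)
      also have "norm \<dots> \<le> norm (f t) * ((t * (y - \<tau>))\<^sup>2 / 2)"
        unfolding norm_mult[of "f t * cis (t * \<tau>)"]
        using mult_left_mono[OF norm_cis_minus_linear[of "t * (y - \<tau>)"] norm_ge_zero[of "f t"]] by (simp add: norm_mult)
      also have "\<dots> \<le> norm (f t) * (t * (y - \<tau>))\<^sup>2" by (intro mult_left_mono) auto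
      also have "\<dots> = norm (of_real t * (of_real t * f t)) * (y - \<tau>)\<^sup>2"
        by (simp add: norm_mult power_mult_distrib power2_eq_square)
      finally show "norm (f t * cis (t * y) - f t * cis (t * \<tau>) - (y - \<tau>) *\<^sub>R (?f1 t * cis (t * \<tau>)))
        \<le> norm (of_real t * (of_real t * f t)) * (y - \<tau>)\<^sup>2" .
    qed
    finally show ?thesis by (simp add: C_def)
  qed
  have "((\<lambda>y. C * \<bar>y - \<tau>\<bar>) \<longlongrightarrow> C * \<bar>\<tau> - \<tau>\<bar>) (at \<tau>)" by (intro tendsto_intros)
  then have lim: "((\<lambda>y. C * \<bar>y - \<tau>\<bar>) \<longlongrightarrow> 0) (at \<tau>)" by simp
  have "((\<lambda>y. norm (ft f y - ft f \<tau> - (y - \<tau>) *\<^sub>R ft ?f1 \<tau>) / norm (y - \<tau>)) \<longlongrightarrow> 0) (at \<tau>)"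
  proof (rule tendsto_sandwich[OF _ _ tendsto_const lim])
    show "\<forall>\<^sub>F y in at \<tau>. norm (ft f y - ft f \<tau> - (y - \<tau>) *\<^sub>R ft ?f1 \<tau>) / norm (y - \<tau>) \<le> C * \<bar>y - \<tau>\<bar>"
      unfolding eventually_at_filter
    proof (intro always_eventually allI impI)
      fix y :: real assume "y \<noteq> \<tau>"
      then show "norm (ft f y - ft f \<tau> - (y - \<tau>) *\<^sub>R ft ?f1 \<tau>) / norm (y - \<tau>) \<le> C * \<bar>y - \<tau>\<bar>"
        using bound[of y] by (simp add: divide_le_eq mult.assoc flip: power2_eq_square)
    qed
  qed simp
  then show ?thesis
    unfolding has_vector_derivative_def has_derivative_iff_norm by (intro conjI bounded_linear_scaleR_left)
qed

text \<open>Integration by parts over \<open>{\<alpha>..\<beta>}\<close>; test functions vanish at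
  both end points, so there are no boundary terms.\<close>

lemma ft_times_variable:
  assumes \<epsilon>: "0 < \<epsilon>" and f: "f \<in> testfun \<epsilon> \<alpha> \<beta>" and ab: "\<alpha> \<le> \<beta>"
  shows "\<exists>f'\<in>testfun \<epsilon> \<alpha> \<beta>. \<forall>\<tau>. of_real \<tau> * ft f \<tau> = \<i> * ft f' \<tau>"
proof -
  obtain f' where f': "f' \<in> testfun \<epsilon> \<alpha> \<beta>" and d: "\<And>t. (f has_vector_derivative f' t) (at t)"
    using testfun_derivative[OF \<epsilon> f] by blast
  note i = testfun_integrable[OF \<epsilon> f] testfun_integrable[OF \<epsilon> f']
  have "of_real \<tau> * ft f \<tau> = \<i> * ft f' \<tau>" for \<tau>
  proof -
    let ?F = "\<lambda>t. f t * cis (\<tau> * t)" and ?f = "\<lambda>t. f t * (\<i> * of_real \<tau> * cis (\<tau> * t)) + f' t * cis (\<tau> * t)"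
    have supp: "f \<alpha> = 0" "f \<beta> = 0" using testfun_support[OF f] by auto
    have "(LINT t|lborel. indicator {\<alpha>..\<beta>} t *\<^sub>R ?f t) = ?F \<beta> - ?F \<alpha>"
    proof (rule integral_FTC_Icc[OF ab])
      show "(?F has_vector_derivative ?f t) (at t within {\<alpha>..\<beta>})" for t
        by (intro has_vector_derivative_mult has_vector_derivative_at_within[OF d] has_vector_derivative_cis_linear)
      show "continuous_on {\<alpha>..\<beta>} ?f"
        by (intro continuous_intros testfun_continuous[OF \<epsilon> f] testfun_continuous[OF \<epsilon> f'])
    qed
    moreover have "indicator {\<alpha>..\<beta>} t *\<^sub>R ?f t = \<i> * of_real \<tau> * (f t * cis (t * \<tau>)) + f' t * cis (t * \<tau>)" for t
      using testfun_support[OF f, of t] testfun_support[OF f', of t]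
      by (cases "t \<in> {\<alpha>..\<beta>}") (auto simp: mult_ac)
    ultimately have "\<i> * of_real \<tau> * ft f \<tau> + ft f' \<tau> = 0"
      using i supp by (simp add: ft_def ft_integrable)
    then have "\<i> * (\<i> * of_real \<tau> * ft f \<tau> + ft f' \<tau>) = 0" by simp
    then show ?thesis by (simp add: algebra_simps)
  qed
  then show ?thesis using f' by blast
qed

lemma ft_rapid_decay:
  assumes \<epsilon>: "0 < \<epsilon>" and ab: "\<alpha> \<le> \<beta>"
  shows "f \<in> testfun \<epsilon> \<alpha> \<beta> \<Longrightarrow> \<exists>M. \<forall>\<tau>. norm (of_real \<tau> ^ j * ft f \<tau>) \<le> M"
proof (induction j arbitrary: f)
  case 0
  then show ?case using norm_ft_le[OF testfun_integrable[OF \<epsilon> 0]] by (intro exI[of _ "LINT t|lborel. norm (f t)"]) simp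
next
  case (Suc j)
  obtain f' where f': "f' \<in> testfun \<epsilon> \<alpha> \<beta>" "\<And>\<tau>. of_real \<tau> * ft f \<tau> = \<i> * ft f' \<tau>"
    using ft_times_variable[OF \<epsilon> Suc.prems ab] by blast
  obtain M where M: "\<And>\<tau>. norm (of_real \<tau> ^ j * ft f' \<tau>) \<le> M" using Suc.IH[OF f'(1)] by blast
  have "norm (of_real \<tau> ^ Suc j * ft f \<tau>) = norm (of_real \<tau> ^ j * (of_real \<tau> * ft f \<tau>))" for \<tau>
    by (simp add: mult_ac)
  also have "\<dots> \<tau> = norm (of_real \<tau> ^ j * ft f' \<tau>)" for \<tau> unfolding f'(2) by (simp add: norm_mult)
  finally show ?case using M by auto
qed

text \<open>Derivatives of transforms, and their products with \<tau>, are up to unimodular factors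
  transforms of test functions again. All seminorms thus reduce to the bound of a transform by an
  L^1 norm.\<close>

lemma schwartz_ft:
  assumes \<epsilon>: "0 < \<epsilon>" and ab: "\<alpha> \<le> \<beta>" and f: "f \<in> testfun \<epsilon> \<alpha> \<beta>"
  shows "schwartz (ft f)"
proof -
  have closed: "\<exists>g'\<in>ft ` testfun \<epsilon> \<alpha> \<beta>. \<forall>t. (g has_vector_derivative g' t) (at t)" if g: "g \<in> ft ` testfun \<epsilon> \<alpha> \<beta>" for g
  proof -
    obtain u where u: "u \<in> testfun \<epsilon> \<alpha> \<beta>" "g = ft u" using g by blast
    have "(\<lambda>t. \<i> * (of_real t * u t)) \<in> testfun \<epsilon> \<alpha> \<beta>" using u by (intro testfun.intros)
    then show ?thesis unfolding u(2) using ft_derivative[OF \<epsilon> u(1)]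
      by (intro bexI[of _ "ft (\<lambda>t. \<i> * (of_real t * u t))"]) auto
  qed
  have mem: "ft f \<in> ft ` testfun \<epsilon> \<alpha> \<beta>" using f by blast
  have "bounded (range (\<lambda>t. of_real t ^ j * nderiv n (ft f) t))" for j n
  proof -
    obtain u where "u \<in> testfun \<epsilon> \<alpha> \<beta>" "nderiv n (ft f) = ft u"
      using smooth_coinduct(1)[OF mem closed, of n] by blast
    then show ?thesis using ft_rapid_decay[OF \<epsilon> ab, of u j] by (auto simp: bounded_iff)
  qed
  then show ?thesis unfolding schwartz_def using smooth_coinduct(2)[OF mem closed] by blast
qed

lemma schwartz_bounded:
  assumes "schwartz f" obtains M where "\<And>t. \<bar>t\<bar> ^ j * norm (f t) \<le> M"
proof -
  have "bounded (range (\<lambda>t. of_real t ^ j * nderiv 0 f t))" using assms unfolding schwartz_def by blast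
  then obtain M where "\<And>t. norm (of_real t ^ j * f t) \<le> M" by (auto simp: bounded_iff)
  then show ?thesis by (intro that[of M]) (simp add: norm_mult norm_power)
qed

lemma schwartz_continuous:
  assumes "schwartz f" shows "continuous_on UNIV f"
proof -
  have "nderiv 0 f differentiable (at t)" for t using assms unfolding schwartz_def smooth_def by blast
  then show ?thesis by (simp add: differentiable_imp_continuous_within continuous_at_imp_continuous_on)
qed

lemma schwartz_integrable:
  assumes "schwartz f" shows "integrable lborel f"
proof -
  obtain M where M: "\<And>t. \<bar>t\<bar> ^ 0 * norm (f t) \<le> M" using schwartz_bounded[OF assms, of 0] by blast
  obtain N where N: "\<And>t. \<bar>t\<bar> ^ 2 * norm (f t) \<le> N" using schwartz_bounded[OF assms, of 2] by blast
  have int: "integrable lborel (\<lambda>t::real. inverse (1 + t\<^sup>2))"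
    using integrable_inverse_1_plus_square by (simp add: set_integrable_def)
  show ?thesis
  proof (rule Bochner_Integration.integrable_bound)
    show "integrable lborel (\<lambda>t::real. (M + N) * inverse (1 + t\<^sup>2))" using int by simp
    show "AE t in lborel. norm (f t) \<le> norm ((M + N) * inverse (1 + t\<^sup>2))"
    proof (rule AE_I2)
      fix t :: real
      have p: "0 < 1 + t\<^sup>2" by (simp add: add_pos_nonneg)
      have "norm (f t) * (1 + t\<^sup>2) \<le> M + N" using M[of t] N[of t] by (simp add: algebra_simps)
      then have "norm (f t) \<le> (M + N) * inverse (1 + t\<^sup>2)"
        using p by (simp add: divide_inverse[symmetric] pos_le_divide_eq)
      then show "norm (f t) \<le> norm ((M + N) * inverse (1 + t\<^sup>2))" by (simp only: real_norm_def abs_ge_self order_trans)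
    qed
    show "f \<in> borel_measurable lborel"
      using borel_measurable_continuous_onI[OF schwartz_continuous[OF assms]] by simp
  qed
qed

lemma fourier_eq_lborel:
  assumes "f \<in> borel_measurable borel"
  shows "fourier f \<tau> = (LINT t|lborel. f t * cis (- (t * \<tau>)))"
  unfolding fourier_def using assms by (intro integral_completion) auto

text \<open>Both parts come from the standard normal distribution, its characteristic function and
  its density, by scaling with \<epsilon>.\<close>

lemma
  assumes \<epsilon>: "0 < \<epsilon>"
  shows gaussian_ft: "(LINT \<tau>|lborel. of_real (exp (- (\<epsilon> * \<tau>)\<^sup>2 / 2)) * cis (u * \<tau>)) = of_real (sqrt (2 * pi) / \<epsilon> * exp (- (u / \<epsilon>)\<^sup>2 / 2))"
    and gaussian_integrable: "integrable lborel (\<lambda>\<tau>. exp (- (\<epsilon> * \<tau>)\<^sup>2 / 2))"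
proof -
  define v where "v = u / \<epsilon>"
  have "of_real (exp (- v\<^sup>2 / 2)) = char std_normal_distribution v"
    by (simp add: char_std_normal_distribution)
  also have "\<dots> = (LINT x|lborel. std_normal_density x *\<^sub>R iexp (v * x))"
    unfolding char_def by (subst integral_density) auto
  also have "\<dots> = (LINT x|lborel. of_real (1 / sqrt (2 * pi)) * (of_real (exp (- x\<^sup>2 / 2)) * cis (v * x)))"
    by (intro Bochner_Integration.integral_cong refl)
      (simp add: std_normal_density_def scaleR_conv_of_real cis_conv_exp mult.assoc)
  also have "\<dots> = of_real (1 / sqrt (2 * pi)) * (LINT x|lborel. of_real (exp (- x\<^sup>2 / 2)) * cis (v * x))"
    by (rule integral_mult_right_zero)
  also have "(LINT x|lborel. of_real (exp (- x\<^sup>2 / 2)) * cis (v * x))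
      = \<epsilon> *\<^sub>R (LINT \<tau>|lborel. of_real (exp (- (0 + \<epsilon> * \<tau>)\<^sup>2 / 2)) * cis (v * (0 + \<epsilon> * \<tau>)))"
    using \<epsilon> by (subst lborel_integral_real_affine[where c=\<epsilon> and t=0]) auto
  also have "\<dots> = \<epsilon> *\<^sub>R (LINT \<tau>|lborel. of_real (exp (- (\<epsilon> * \<tau>)\<^sup>2 / 2)) * cis (u * \<tau>))"
    using \<epsilon> by (simp add: v_def)
  finally show "(LINT \<tau>|lborel. of_real (exp (- (\<epsilon> * \<tau>)\<^sup>2 / 2)) * cis (u * \<tau>)) = of_real (sqrt (2 * pi) / \<epsilon> * exp (- (u / \<epsilon>)\<^sup>2 / 2))"
    using \<epsilon> by (simp add: v_def scaleR_conv_of_real field_simps)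
  have "integrable lborel std_normal_density" by simp
  then have "integrable lborel (\<lambda>x. sqrt (2 * pi) * std_normal_density x)" by simp
  then have "integrable lborel (\<lambda>x::real. exp (- x\<^sup>2 / 2) :: real)" by (simp add: std_normal_density_def)
  from lborel_integrable_real_affine[OF this, of \<epsilon> 0] show "integrable lborel (\<lambda>\<tau>. exp (- (\<epsilon> * \<tau>)\<^sup>2 / 2))"
    using \<epsilon> by simp
qed

text \<open>Gaussian summability: \<open>A n\<close>, the transform of \<open>ft f\<close> damped by
  a Gaussian, tends to the undamped one. By Fubini it is also a Gaussian mean of \<open>f\<close>
  around \<open>s\<close> of width \<open>d n\<close>, which tends to a multiple of
  \<open>f s\<close>. The \<open>2 * pi\<close> is \<open>sqrt (2 * pi)\<close> squared: once from
  the Gaussian transform, once from the total mass.\<close>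

lemma testfun_fourier_inversion:
  assumes \<epsilon>: "0 < \<epsilon>" and ab: "\<alpha> \<le> \<beta>" and f: "f \<in> testfun \<epsilon> \<alpha> \<beta>"
  shows "fourier (ft f) s = of_real (2 * pi) * f s"
proof -
  define d where "d n = inverse (real (Suc n))" for n
  have d: "0 < d n" for n by (simp add: d_def)
  have d_lim: "d \<longlonglongrightarrow> 0" unfolding d_def by (rule LIMSEQ_inverse_real_of_nat)
  note fint = testfun_integrable[OF \<epsilon> f]
  have Fint: "integrable lborel (ft f)" by (rule schwartz_integrable[OF schwartz_ft[OF \<epsilon> ab f]])
  have [measurable]: "f \<in> borel_measurable borel" "ft f \<in> borel_measurable borel" using fint Fint by auto
  obtain M where M: "\<And>t. norm (f t) \<le> M" using testfun_bounded[OF \<epsilon> f] by blast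
  have M0: "0 \<le> M" using order_trans[OF norm_ge_zero M] .
  define A where "A n = (LINT \<tau>|lborel. of_real (exp (- (d n * \<tau>)\<^sup>2 / 2)) * (ft f \<tau> * cis (- (\<tau> * s))))" for n
  have lim1: "A \<longlonglongrightarrow> (LINT \<tau>|lborel. ft f \<tau> * cis (- (\<tau> * s)))"
    unfolding A_def
  proof (rule integral_dominated_convergence)
    show "integrable lborel (\<lambda>\<tau>. norm (ft f \<tau>))" using Fint by simp
    show "AE \<tau> in lborel. (\<lambda>n. of_real (exp (- (d n * \<tau>)\<^sup>2 / 2)) * (ft f \<tau> * cis (- (\<tau> * s)))) \<longlonglongrightarrow> ft f \<tau> * cis (- (\<tau> * s))"
    proof (rule AE_I2)
      fix \<tau>
      have "(\<lambda>n. of_real (exp (- (d n * \<tau>)\<^sup>2 / 2)) * (ft f \<tau> * cis (- (\<tau> * s)))) \<longlonglongrightarrow> of_real (exp (- (0 * \<tau>)\<^sup>2 / 2)) * (ft f \<tau> * cis (- (\<tau> * s)))"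
        by (intro tendsto_intros d_lim) simp
      then show "(\<lambda>n. of_real (exp (- (d n * \<tau>)\<^sup>2 / 2)) * (ft f \<tau> * cis (- (\<tau> * s)))) \<longlonglongrightarrow> ft f \<tau> * cis (- (\<tau> * s))" by simp
    qed
    show "AE \<tau> in lborel. norm (of_real (exp (- (d n * \<tau>)\<^sup>2 / 2)) * (ft f \<tau> * cis (- (\<tau> * s)))) \<le> norm (ft f \<tau>)" for n
      by (intro AE_I2) (simp add: norm_mult mult_left_le_one_le)
  qed measurable
  have A_eq: "A n = (LINT x|lborel. f (s + d n * x) * of_real (sqrt (2 * pi) * exp (- x\<^sup>2 / 2)))" for n
  proof -
    let ?g = "\<lambda>\<tau>. complex_of_real (exp (- (d n * \<tau>)\<^sup>2 / 2))"
    have "A n = (LINT \<tau>|lborel. ?g \<tau> * (LINT t|lborel. f t * cis ((t - s) * \<tau>)))"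
      unfolding A_def
    proof (intro Bochner_Integration.integral_cong refl arg_cong2[of _ _ _ _ "(*)"])
      fix \<tau>
      have e: "f t * cis ((t - s) * \<tau>) = f t * cis (t * \<tau>) * cis (- (\<tau> * s))" for t
        by (simp add: mult.assoc cis_mult algebra_simps)
      show "ft f \<tau> * cis (- (\<tau> * s)) = (LINT t|lborel. f t * cis ((t - s) * \<tau>))"
        unfolding ft_def e by (rule integral_mult_left_zero[symmetric])
    qed
    also have "\<dots> = (LINT t|lborel. f t * (LINT \<tau>|lborel. ?g \<tau> * cis ((t - s) * \<tau>)))"
    proof (rule Fubini_bounded_kernel[symmetric, OF fint])
      show "integrable lborel ?g" using gaussian_integrable[OF d[of n]] by (intro integrable_of_real)
    qed auto
    also have "\<dots> = (LINT t|lborel. f t * of_real (sqrt (2 * pi) / d n * exp (- ((t - s) / d n)\<^sup>2 / 2)))"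
      by (simp only: gaussian_ft[OF d])
    also have "\<dots> = d n *\<^sub>R (LINT x|lborel. f (s + d n * x) * of_real (sqrt (2 * pi) / d n * exp (- ((s + d n * x - s) / d n)\<^sup>2 / 2)))"
      using d[of n] by (subst lborel_integral_real_affine[where c="d n" and t=s]) auto
    also have "\<dots> = (LINT x|lborel. d n *\<^sub>R (f (s + d n * x) * of_real (sqrt (2 * pi) / d n * exp (- ((s + d n * x - s) / d n)\<^sup>2 / 2))))"
      by (rule integral_scaleR_right[symmetric])
    also have "\<dots> = (LINT x|lborel. f (s + d n * x) * of_real (sqrt (2 * pi) * exp (- x\<^sup>2 / 2)))"
      using d[of n] by (intro Bochner_Integration.integral_cong refl) (simp add: scaleR_conv_of_real)
    finally show ?thesis .
  qed
  have g1: "integrable lborel (\<lambda>x::real. exp (- x\<^sup>2 / 2))" using gaussian_integrable[of 1] by simp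
  have lim2: "A \<longlonglongrightarrow> (LINT x|lborel. f s * of_real (sqrt (2 * pi) * exp (- x\<^sup>2 / 2)))"
    unfolding A_eq[abs_def]
  proof (rule integral_dominated_convergence)
    show "integrable lborel (\<lambda>x. M * (sqrt (2 * pi) * exp (- x\<^sup>2 / 2)))" using g1 by (intro integrable_mult_right)
    show "AE x in lborel. (\<lambda>n. f (s + d n * x) * of_real (sqrt (2 * pi) * exp (- x\<^sup>2 / 2))) \<longlonglongrightarrow> f s * of_real (sqrt (2 * pi) * exp (- x\<^sup>2 / 2))"
    proof (rule AE_I2)
      fix x
      have "(\<lambda>n. s + d n * x) \<longlonglongrightarrow> s + 0 * x" by (intro tendsto_intros d_lim)
      moreover have "isCont f (s + 0 * x)"
        using testfun_continuous[OF \<epsilon> f, of UNIV] by (simp add: continuous_on_eq_continuous_at)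
      ultimately have "(\<lambda>n. f (s + d n * x)) \<longlonglongrightarrow> f (s + 0 * x)" by (rule isCont_tendsto_compose[rotated])
      then show "(\<lambda>n. f (s + d n * x) * of_real (sqrt (2 * pi) * exp (- x\<^sup>2 / 2))) \<longlonglongrightarrow> f s * of_real (sqrt (2 * pi) * exp (- x\<^sup>2 / 2))"
        by (intro tendsto_mult tendsto_const) simp
    qed
    show "AE x in lborel. norm (f (s + d n * x) * of_real (sqrt (2 * pi) * exp (- x\<^sup>2 / 2))) \<le> M * (sqrt (2 * pi) * exp (- x\<^sup>2 / 2))" for n
      unfolding norm_mult norm_of_real using M M0 by (intro AE_I2 mult_mono) (auto simp: abs_mult)
  qed measurable
  have "(LINT x|lborel. of_real (exp (- x\<^sup>2 / 2)) :: complex) = of_real (sqrt (2 * pi))"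
    using gaussian_ft[of 1 0] by simp
  then have "(LINT x|lborel. f s * of_real (sqrt (2 * pi) * exp (- x\<^sup>2 / 2))) = f s * (of_real (sqrt (2 * pi)) * of_real (sqrt (2 * pi)))"
    by (simp only: integral_mult_right_zero of_real_mult)
  also have "\<dots> = of_real (2 * pi) * f s" by (simp flip: of_real_mult)
  finally show ?thesis
    using LIMSEQ_unique[OF lim1 lim2] by (simp add: fourier_eq_lborel)
qed

section \<open>Distributions with a restriction norm are functions\<close>

lemma completion_ex_borel_measurable_complex:
  fixes f :: "'a \<Rightarrow> complex"
  assumes "f \<in> borel_measurable (completion M)"
  obtains g where "g \<in> borel_measurable M" "AE x in M. f x = g x"
proof -
  have "(\<lambda>x. Re (f x)) \<in> borel_measurable (completion M)" "(\<lambda>x. Im (f x)) \<in> borel_measurable (completion M)"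
    using assms by auto
  then obtain u v where u: "u \<in> borel_measurable M" "AE x in M. Re (f x) = u x"
    and v: "v \<in> borel_measurable M" "AE x in M. Im (f x) = v x"
    using completion_ex_borel_measurable_real by metis
  have "(\<lambda>x. Complex (u x) (v x)) \<in> borel_measurable M" using u(1) v(1) by (simp add: borel_measurable_complex_iff)
  moreover have "AE x in M. f x = Complex (u x) (v x)" using u(2) v(2) by eventually_elim (simp add: complex_eq_iff)
  ultimately show thesis by (rule that)
qed

text \<open>The measures whose densities are the positive and the negative part of \<open>h\<close>
  are finite and agree on all half-lines, hence everywhere, so the densities agree.\<close>

lemma AE_zero_if_integrals_zero:
  fixes h :: "real \<Rightarrow> real"
  assumes h: "integrable lborel h" and z: "\<And>x. (LINT t|lborel. indicator {x<..} t * h t) = 0"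
  shows "AE t in lborel. h t = 0"
proof -
  have [measurable]: "h \<in> borel_measurable borel" using h by auto
  let ?f = "\<lambda>t. ennreal (h t)" and ?g = "\<lambda>t. ennreal (- h t)"
  have fin: "(\<integral>\<^sup>+t. ennreal (norm (h t)) \<partial>lborel) < \<infinity>" using h by (simp add: integrable_iff_bounded)
  have ff: "(\<integral>\<^sup>+t. ?f t * indicator A t \<partial>lborel) < \<infinity>" for A
  proof -
    have "(\<integral>\<^sup>+t. ?f t * indicator A t \<partial>lborel) \<le> (\<integral>\<^sup>+t. ennreal (norm (h t)) \<partial>lborel)"
      by (intro nn_integral_mono) (auto simp: indicator_def intro!: ennreal_leI)
    then show ?thesis using fin by (rule order.strict_trans1)
  qed
  have gf: "(\<integral>\<^sup>+t. ?g t * indicator A t \<partial>lborel) < \<infinity>" for A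
  proof -
    have "(\<integral>\<^sup>+t. ?g t * indicator A t \<partial>lborel) \<le> (\<integral>\<^sup>+t. ennreal (norm (h t)) \<partial>lborel)"
      by (intro nn_integral_mono) (auto simp: indicator_def intro!: ennreal_leI)
    then show ?thesis using fin by (rule order.strict_trans1)
  qed
  have eq: "(\<integral>\<^sup>+t. ?f t * indicator {x<..} t \<partial>lborel) = (\<integral>\<^sup>+t. ?g t * indicator {x<..} t \<partial>lborel)" for x
  proof -
    have i: "integrable lborel (\<lambda>t. indicator {x<..} t * h t)"
      using integrable_mult_indicator[OF _ h, of "{x<..}"] by simp
    have e: "(\<integral>\<^sup>+t. ennreal (indicator {x<..} t * h t) \<partial>lborel) = (\<integral>\<^sup>+t. ?f t * indicator {x<..} t \<partial>lborel)"
      "(\<integral>\<^sup>+t. ennreal (- (indicator {x<..} t * h t)) \<partial>lborel) = (\<integral>\<^sup>+t. ?g t * indicator {x<..} t \<partial>lborel)"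
      by (auto intro!: nn_integral_cong simp: indicator_def)
    from real_lebesgue_integral_def[OF i] z[of x]
    have "enn2real (\<integral>\<^sup>+t. ?f t * indicator {x<..} t \<partial>lborel) = enn2real (\<integral>\<^sup>+t. ?g t * indicator {x<..} t \<partial>lborel)"
      unfolding e by simp
    then show ?thesis using ff[of "{x<..}"] gf[of "{x<..}"]
      by (metis ennreal_enn2real infinity_ennreal_def)
  qed
  have "density lborel ?f = density lborel ?g"
  proof (rule measure_eqI_lessThan)
    show "emeasure (density lborel ?f) {x<..} < \<infinity>" for x using ff by (simp add: emeasure_density)
    show "emeasure (density lborel ?f) {x<..} = emeasure (density lborel ?g) {x<..}" for x
      using eq by (simp add: emeasure_density)
  qed auto
  moreover have "(\<integral>\<^sup>+t. ?f t \<partial>lborel) \<noteq> \<infinity>" using ff[of UNIV] by simp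
  ultimately have "AE t in lborel. ?f t = ?g t" by (subst (asm) finite_density_unique) auto
  then show ?thesis
  proof eventually_elim
    case (elim t)
    \<comment> \<open>\<open>ennreal\<close> sends negative numbers to 0, so the equality forces
      \<open>h t = 0\<close> for either sign.\<close>
    then show ?case by (cases "0 \<le> h t") (auto simp: ennreal_neg ennreal_eq_0_iff)
  qed
qed

definition test_bump :: "real \<Rightarrow> real \<Rightarrow> real \<Rightarrow> real \<Rightarrow> complex" where
  "test_bump \<epsilon> \<alpha> \<beta> t = of_real (flat_exp \<epsilon> 0 (t - \<alpha>) * flat_exp \<epsilon> 0 (\<beta> - t))"

lemma test_bump_testfun: "test_bump \<epsilon> \<alpha> \<beta> \<in> testfun \<epsilon> \<alpha> \<beta>"
  unfolding test_bump_def[abs_def] by (rule testfun.base)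

lemma flat_exp_0_le_1: "0 < \<epsilon> \<Longrightarrow> flat_exp \<epsilon> 0 x \<le> 1" "0 \<le> flat_exp \<epsilon> 0 x"
  by (auto simp: flat_exp_def)

lemma norm_test_bump_le: "0 < \<epsilon> \<Longrightarrow> norm (test_bump \<epsilon> \<alpha> \<beta> t) \<le> 1"
  unfolding test_bump_def norm_of_real abs_mult
  by (intro mult_le_one) (auto simp: flat_exp_0_le_1)

lemma test_bump_measurable [measurable]: "test_bump \<epsilon> \<alpha> \<beta> \<in> borel_measurable borel"
  unfolding test_bump_def[abs_def] flat_exp_def by measurable

lemma flat_exp_0_lim:
  assumes "d \<longlonglongrightarrow> 0" shows "(\<lambda>n. flat_exp (d n) 0 x) \<longlonglongrightarrow> indicator {0<..} x"
proof (cases "0 < x")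
  case True
  have "(\<lambda>n. exp (- d n / x)) \<longlonglongrightarrow> exp (- 0 / x)" using True by (intro tendsto_intros assms) auto
  then show ?thesis using True by (simp add: flat_exp_def)
qed (simp add: flat_exp_def)

text \<open>As \<open>\<epsilon> \<rightarrow> 0\<close>, the bumps increase to the indicator function of an interval.\<close>

lemma AE_zero_if_bump_integrals_zero:
  fixes H :: "real \<Rightarrow> complex"
  assumes H: "integrable lborel H" and supp: "\<And>t. t \<notin> {c..d} \<Longrightarrow> H t = 0"
    and z: "\<And>\<epsilon> \<alpha> \<beta>. 0 < \<epsilon> \<Longrightarrow> c \<le> \<alpha> \<Longrightarrow> \<alpha> \<le> \<beta> \<Longrightarrow> \<beta> \<le> d \<Longrightarrow> (LINT t|lborel. H t * test_bump \<epsilon> \<alpha> \<beta> t) = 0"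
  shows "AE t in lborel. H t = 0"
proof (cases "c \<le> d")
  case True
  have [measurable]: "H \<in> borel_measurable borel" using H by auto
  have int0: "(LINT t|lborel. indicator {x<..} t *\<^sub>R H t) = 0" for x
  proof -
    \<comment> \<open>\<open>x\<close> clamped to \<open>{c..d}\<close>: inside this interval the
      half-line and the interval from \<open>\<alpha>\<close> to \<open>d\<close> coincide up to end
      points, which form a null set.\<close>
    define \<alpha> where "\<alpha> = max c (min x d)"
    have \<alpha>: "c \<le> \<alpha>" "\<alpha> \<le> d" using True by (auto simp: \<alpha>_def)
    define e where "e n = inverse (real (Suc n))" for n
    have e: "0 < e n" for n by (simp add: e_def)
    have e_lim: "e \<longlonglongrightarrow> 0" unfolding e_def by (rule LIMSEQ_inverse_real_of_nat)
    have "(\<lambda>n. LINT t|lborel. H t * test_bump (e n) \<alpha> d t) \<longlonglongrightarrow> (LINT t|lborel. H t * (of_real (indicator {0<..} (t - \<alpha>) * indicator {0<..} (d - t))))"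
    proof (rule integral_dominated_convergence)
      show "integrable lborel (\<lambda>t. norm (H t))" using H by simp
      show "AE t in lborel. (\<lambda>n. H t * test_bump (e n) \<alpha> d t) \<longlonglongrightarrow> H t * (of_real (indicator {0<..} (t - \<alpha>) * indicator {0<..} (d - t)))"
        unfolding test_bump_def by (intro AE_I2 tendsto_intros flat_exp_0_lim e_lim)
      show "AE t in lborel. norm (H t * test_bump (e n) \<alpha> d t) \<le> norm (H t)" for n
        using norm_test_bump_le[OF e] by (intro AE_I2) (simp add: norm_mult mult_left_le)
    qed measurable
    moreover have "(LINT t|lborel. H t * test_bump (e n) \<alpha> d t) = 0" for n using e \<alpha> by (intro z) auto
    ultimately have "(LINT t|lborel. H t * (of_real (indicator {0<..} (t - \<alpha>) * indicator {0<..} (d - t)))) = 0"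
      using LIMSEQ_unique[OF _ tendsto_const] by simp
    also have "(LINT t|lborel. H t * (of_real (indicator {0<..} (t - \<alpha>) * indicator {0<..} (d - t)))) = (LINT t|lborel. indicator {x<..} t *\<^sub>R H t)"
    proof (rule integral_cong_AE)
      have "AE t in lborel. t \<noteq> c \<and> t \<noteq> d" by (intro AE_conjI AE_lborel_singleton)
      then show "AE t in lborel. H t * (of_real (indicator {0<..} (t - \<alpha>) * indicator {0<..} (d - t))) = indicator {x<..} t *\<^sub>R H t"
      proof eventually_elim
        case (elim t)
        show ?case
        proof (cases "t \<in> {c..d}")
          case t: True
          then have "t \<in> {x<..} \<longleftrightarrow> t - \<alpha> \<in> {0<..} \<and> d - t \<in> {0<..}" using elim by (auto simp: \<alpha>_def)
          then show ?thesis by (auto simp: indicator_def)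
        qed (simp add: supp)
      qed
    qed measurable
    finally show ?thesis .
  qed
  have Hi: "integrable lborel (\<lambda>t. indicator {x<..} t *\<^sub>R H t)" for x
    by (rule integrable_mult_indicator[OF _ H]) simp
  have "(LINT t|lborel. indicator {x<..} t * Re (H t)) = 0" "(LINT t|lborel. indicator {x<..} t * Im (H t)) = 0" for x
    using integral_Re[OF Hi[of x]] integral_Im[OF Hi[of x]] unfolding int0 by simp_all
  then have "AE t in lborel. Re (H t) = 0" "AE t in lborel. Im (H t) = 0"
    using H by (intro AE_zero_if_integrals_zero; simp)+
  then show ?thesis by eventually_elim (simp add: complex_eq_iff)
qed (use supp in auto)

text \<open>The inverse Fourier integral over one shell, without the factor
  \<open>1 / (2 * pi)\<close>; so the pieces of the transform of \<open>f\<close> sum to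
  \<open>2 * pi * f\<close>.\<close>

definition piece :: "(real \<Rightarrow> complex) \<Rightarrow> nat \<Rightarrow> real \<Rightarrow> complex" where
  "piece g j t = (LINT \<tau>|lborel. (g \<tau> * indicator (shell j) \<tau>) * cis (t * \<tau>))"

lemma piece_measurable [measurable]:
  assumes [measurable]: "g \<in> borel_measurable borel" shows "piece g j \<in> borel_measurable borel"
  unfolding piece_def by measurable

lemma shell_unique: "\<exists>i. \<forall>j. \<tau> \<in> shell j \<longleftrightarrow> j = i"
proof -
  obtain n where "\<bar>\<tau>\<bar> < 4 ^ n" using real_arch_pow[of 4 "\<bar>\<tau>\<bar>"] by auto
  then have ex: "\<exists>n. \<bar>\<tau>\<bar> \<le> 4 ^ n" using less_imp_le by blast
  define i where "i = (LEAST n. \<bar>\<tau>\<bar> \<le> 4 ^ n)"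
  have i: "\<bar>\<tau>\<bar> \<le> 4 ^ i" unfolding i_def using ex by (rule LeastI_ex)
  have lt: "4 ^ n < \<bar>\<tau>\<bar>" if "n < i" for n using not_less_Least[of n "\<lambda>n. \<bar>\<tau>\<bar> \<le> 4 ^ n"] that by (simp add: i_def)
  have "\<tau> \<in> shell j \<longleftrightarrow> j = i" for j
  proof
    assume j: "\<tau> \<in> shell j"
    then have "i \<le> j" using lt[of j] by (force simp: shell_def)
    moreover have "\<not> i < j"
    proof
      assume "i < j"
      then have "(4::real) ^ i \<le> 4 ^ (j - 1)" by (intro power_increasing) auto
      moreover have "4 ^ (j - 1) < \<bar>\<tau>\<bar>" using j \<open>i < j\<close> by (auto simp: shell_def)
      ultimately show False using i by linarith
    qed
    ultimately show "j = i" by simp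
  next
    assume "j = i"
    then show "\<tau> \<in> shell j" using i lt[of "i - 1"] by (cases "i = 0") (auto simp: shell_def)
  qed
  then show ?thesis by blast
qed

lemma shell_square_integrable:
  fixes g :: "real \<Rightarrow> complex"
  assumes [measurable]: "g \<in> borel_measurable borel" and fin: "sobolev_sq b g < \<infinity>" and b: "0 \<le> b"
  shows "(\<integral>\<^sup>+\<tau>. ennreal ((norm (g \<tau> * indicator (shell j) \<tau>))\<^sup>2) \<partial>lborel) < \<infinity>"
    and "integrable lborel (\<lambda>\<tau>. g \<tau> * indicator (shell j) \<tau>)"
proof -
  let ?e = "16 powr b * (16 powr (- b)) ^ j"
  have "(\<integral>\<^sup>+\<tau>. ennreal ((norm (g \<tau> * indicator (shell j) \<tau>))\<^sup>2) \<partial>lborel) \<le> (\<integral>\<^sup>+\<tau>. ennreal ?e * ennreal (japanese \<tau> powr (2 * b) * (norm (g \<tau>))\<^sup>2) \<partial>lborel)"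
  proof (rule nn_integral_mono)
    fix \<tau>
    have "(norm (g \<tau> * indicator (shell j) \<tau>))\<^sup>2 \<le> ?e * (japanese \<tau> powr (2 * b) * (norm (g \<tau>))\<^sup>2)"
    proof (cases "\<tau> \<in> shell j")
      case True
      have "1 * (norm (g \<tau>))\<^sup>2 \<le> ?e * japanese \<tau> powr (2 * b) * (norm (g \<tau>))\<^sup>2"
        using japanese_powr_shell_ge[OF True b] by (intro mult_right_mono) auto
      then show ?thesis using True by (simp add: mult.assoc)
    qed simp
    then show "ennreal ((norm (g \<tau> * indicator (shell j) \<tau>))\<^sup>2) \<le> ennreal ?e * ennreal (japanese \<tau> powr (2 * b) * (norm (g \<tau>))\<^sup>2)"
      by (subst ennreal_mult[symmetric]) (auto intro: ennreal_leI)
  qed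
  also have "\<dots> = ennreal ?e * sobolev_sq b g"
    unfolding sobolev_sq_def by (rule nn_integral_cmult) (simp add: japanese_def)
  also have "\<dots> < \<infinity>" using fin by (simp add: ennreal_mult_less_top)
  finally show sq: "(\<integral>\<^sup>+\<tau>. ennreal ((norm (g \<tau> * indicator (shell j) \<tau>))\<^sup>2) \<partial>lborel) < \<infinity>" .
  show "integrable lborel (\<lambda>\<tau>. g \<tau> * indicator (shell j) \<tau>)"
    by (rule integrable_of_square_bounded_support[OF _ _ sq, of "4 ^ j"])
      (auto simp: shell_def indicator_def split: if_splits)
qed

text \<open>\<open>dyadic_L4\<close> for the single frequency 0 with phase 0, where integration over
  \<open>x\<close> merely contributes \<open>2 * pi\<close>. On a bounded interval, L^4 is turned
  into L^1 by \<open>s <= 1 + s ^ 4\<close>.\<close>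

lemma piece_sum_integrable:
  fixes g :: "real \<Rightarrow> complex"
  assumes [measurable]: "g \<in> borel_measurable borel" and fin: "sobolev_sq b g < \<infinity>" and b: "3 / 8 < b"
  shows "(\<integral>\<^sup>+t\<in>{- real Q..real Q}. (\<Sum>j. ennreal (norm (piece g j t))) \<partial>lborel) < \<infinity>"
proof -
  let ?S = "\<lambda>t. \<Sum>j. ennreal (norm (piece g j t))"
  \<comment> \<open>Vacuous, with constant 0: no two elements of \<open>{0}\<close> differ by
    \<open>n >= 1\<close>.\<close>
  have sep: "separated (\<lambda>k t. 0) {0} 0"
    unfolding separated_def
  proof (intro allI impI)
    fix n :: int and t\<^sub>0 d assume "1 \<le> n"
    then have "{k. k \<in> {0} \<and> k + n \<in> {0::int}} = {}" by auto
    then show "(\<integral>\<^sup>+t\<in>{t\<^sub>0..t\<^sub>0 + 1 / of_int n}. ennreal ((norm (\<Sum>k | k \<in> {0} \<and> k + n \<in> {0}. d k * cis (- (0 - 0))))\<^sup>2) \<partial>lborel)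
      \<le> ennreal (0 / of_int n * (\<Sum>k | k \<in> {0} \<and> k + n \<in> {0}. (norm (d k))\<^sup>2))" by (simp only:) simp
  qed
  define C where "C = ennreal (exp 4 * 8 * pi ^ 3 * (3 + 4 * 0) * 256 powr b / (1 - 4 powr (3 / 8 - b)) ^ 4)"
  have single: "(\<Sum>k\<in>{0::int}. piece g j t * cis (of_int k * x - 0)) = piece g j t" for j t x by simp
  have "(\<integral>\<^sup>+t\<in>{- real Q..real Q}. (\<integral>\<^sup>+x\<in>{0..2 * pi}. (\<Sum>j. ennreal (norm (\<Sum>k\<in>{0::int}. piece g j t * cis (of_int k * x - 0)))) ^ 4 \<partial>lborel) \<partial>lborel)
    \<le> C * (\<Sum>k\<in>{0::int}. sobolev_sq b g)\<^sup>2"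
    unfolding piece_def C_def by (rule dyadic_L4[OF sep _ _ b]) measurable
  then have "(\<integral>\<^sup>+t\<in>{- real Q..real Q}. (\<integral>\<^sup>+x\<in>{0..2 * pi}. (?S t) ^ 4 \<partial>lborel) \<partial>lborel) \<le> C * (\<Sum>k\<in>{0::int}. sobolev_sq b g)\<^sup>2"
    by (simp only: single)
  also have "\<dots> < \<infinity>"
  proof -
    have "C < \<infinity>" by (simp add: C_def)
    then show ?thesis using fin by (simp add: ennreal_mult_less_top power_less_top_ennreal)
  qed
  also have "(\<integral>\<^sup>+t\<in>{- real Q..real Q}. (\<integral>\<^sup>+x\<in>{0..2 * pi}. (?S t) ^ 4 \<partial>lborel) \<partial>lborel)
      = ennreal (2 * pi) * (\<integral>\<^sup>+t\<in>{- real Q..real Q}. (?S t) ^ 4 \<partial>lborel)"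
  proof -
    have "(\<integral>\<^sup>+x\<in>{0..2 * pi}. (?S t) ^ 4 \<partial>lborel) * indicator {- real Q..real Q} t = ennreal (2 * pi) * ((?S t) ^ 4 * indicator {- real Q..real Q} t)" for t
    proof -
      have c: "(\<integral>\<^sup>+x\<in>{0..2 * pi}. c \<partial>lborel) = c * ennreal (2 * pi)" for c :: ennreal
        by (subst nn_integral_cmult_indicator) auto
      show ?thesis unfolding c by (simp only: mult_ac)
    qed
    then show ?thesis by (simp only:) (rule nn_integral_cmult, measurable)
  qed
  finally have "(\<integral>\<^sup>+t\<in>{- real Q..real Q}. (?S t) ^ 4 \<partial>lborel) < \<infinity>" by (auto simp: ennreal_mult_less_top)
  then have fin4: "(\<integral>\<^sup>+t. (?S t) ^ 4 * indicator {- real Q..real Q} t \<partial>lborel) < top"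
    by (simp only: infinity_ennreal_def)
  have fin1: "(\<integral>\<^sup>+t. 1 * indicator {- real Q..real Q} t \<partial>lborel) < top" by simp
  have "(\<integral>\<^sup>+t\<in>{- real Q..real Q}. 1 + (?S t) ^ 4 \<partial>lborel)
    = (\<integral>\<^sup>+t. 1 * indicator {- real Q..real Q} t \<partial>lborel) + (\<integral>\<^sup>+t. (?S t) ^ 4 * indicator {- real Q..real Q} t \<partial>lborel)"
    unfolding distrib_right by (rule nn_integral_add) measurable
  then have fin': "(\<integral>\<^sup>+t\<in>{- real Q..real Q}. 1 + (?S t) ^ 4 \<partial>lborel) < \<infinity>"
    unfolding infinity_ennreal_def using fin1 fin4 by (simp only: ennreal_add_less_top)
  have le: "s \<le> 1 + s ^ 4" for s :: ennreal
  proof (cases "s \<le> 1")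
    case False
    then have "s * 1 \<le> s * s ^ 3" by (intro mult_left_mono one_le_power) auto
    then show ?thesis by (simp add: eval_nat_numeral add_increasing)
  qed (simp add: add_increasing2)
  have "(\<integral>\<^sup>+t\<in>{- real Q..real Q}. ?S t \<partial>lborel) \<le> (\<integral>\<^sup>+t\<in>{- real Q..real Q}. 1 + (?S t) ^ 4 \<partial>lborel)"
    by (rule nn_integral_mono) (rule mult_right_mono[OF le], simp)
  then show ?thesis using fin' by (rule order.strict_trans1)
qed

lemma testfun_smooth: "0 < \<epsilon> \<Longrightarrow> f \<in> testfun \<epsilon> \<alpha> \<beta> \<Longrightarrow> smooth f"
  using smooth_coinduct(2)[of f "testfun \<epsilon> \<alpha> \<beta>"] testfun_derivative by blast

lemma testfun_compact_support:
  assumes "f \<in> testfun \<epsilon> \<alpha> \<beta>"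
  shows "closure {t. f t \<noteq> 0} \<subseteq> {\<alpha>..\<beta>}" and "compact (closure {t. f t \<noteq> 0})"
proof -
  have sub: "{t. f t \<noteq> 0} \<subseteq> {\<alpha>..\<beta>}"
  proof
    fix t assume "t \<in> {t. f t \<noteq> 0}"
    then have "t \<in> {\<alpha><..<\<beta>}" using testfun_support[OF assms, of t] by auto
    then show "t \<in> {\<alpha>..\<beta>}" by auto
  qed
  then show "closure {t. f t \<noteq> 0} \<subseteq> {\<alpha>..\<beta>}" by (rule closure_minimal) simp
  show "compact (closure {t. f t \<noteq> 0})"
    unfolding compact_closure using sub by (rule bounded_subset[OF compact_imp_bounded[OF compact_Icc]])
qed

text \<open>The multiplication formula applies to each piece, because \<open>g\<close> is integrable
  on every shell even if not on the line. Each \<tau> lies in exactly one shell, so the partial sums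
  of the integrand are either 0 or \<open>g \<tau> * ft \<phi> \<tau>\<close>, and dominated
  convergence applies.\<close>

lemma pieces_pairing:
  fixes g :: "real \<Rightarrow> complex"
  assumes g [measurable]: "g \<in> borel_measurable borel" and fin: "sobolev_sq b g < \<infinity>" and b: "0 \<le> b"
    and \<epsilon>: "0 < \<epsilon>" and \<phi>: "\<phi> \<in> testfun \<epsilon> \<alpha> \<beta>" and int: "integrable lborel (\<lambda>\<tau>. g \<tau> * ft \<phi> \<tau>)"
  shows "(\<lambda>n. LINT t|lborel. \<phi> t * (\<Sum>j<n. piece g j t)) \<longlonglongrightarrow> (LINT \<tau>|lborel. g \<tau> * ft \<phi> \<tau>)"
proof -
  note \<phi>i = testfun_integrable[OF \<epsilon> \<phi>]
  have [measurable]: "\<phi> \<in> borel_measurable borel" using \<phi>i by auto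
  have [measurable]: "ft \<phi> \<in> borel_measurable borel" unfolding ft_def[abs_def] by measurable
  note gi = shell_square_integrable(2)[OF g fin b]
  have one: "(LINT t|lborel. \<phi> t * piece g j t) = (LINT \<tau>|lborel. (g \<tau> * indicator (shell j) \<tau>) * ft \<phi> \<tau>)" for j
    unfolding piece_def ft_def by (rule Fubini_bounded_kernel[OF \<phi>i gi]) auto
  have pbd: "norm (piece g j t) \<le> (LINT \<tau>|lborel. norm (g \<tau> * indicator (shell j) \<tau>))" for j t
    unfolding piece_def by (rule order_trans[OF integral_norm_bound]) (simp add: norm_mult)
  have pi: "integrable lborel (\<lambda>t. \<phi> t * piece g j t)" for j
  proof (rule Bochner_Integration.integrable_bound)
    show "integrable lborel (\<lambda>t. norm (\<phi> t) * (LINT \<tau>|lborel. norm (g \<tau> * indicator (shell j) \<tau>)))" using \<phi>i by simp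
    show "AE t in lborel. norm (\<phi> t * piece g j t) \<le> norm (norm (\<phi> t) * (LINT \<tau>|lborel. norm (g \<tau> * indicator (shell j) \<tau>)))"
      using pbd by (intro AE_I2) (simp add: norm_mult mult_left_mono)
  qed measurable
  have gsi: "integrable lborel (\<lambda>\<tau>. (g \<tau> * indicator (shell j) \<tau>) * ft \<phi> \<tau>)" for j
  proof (rule Bochner_Integration.integrable_bound[OF int])
    show "AE \<tau> in lborel. norm ((g \<tau> * indicator (shell j) \<tau>) * ft \<phi> \<tau>) \<le> norm (g \<tau> * ft \<phi> \<tau>)"
      by (intro AE_I2) (auto simp: indicator_def)
  qed measurable
  have eq: "(LINT t|lborel. \<phi> t * (\<Sum>j<n. piece g j t)) = (LINT \<tau>|lborel. (\<Sum>j<n. (g \<tau> * indicator (shell j) \<tau>) * ft \<phi> \<tau>))" for n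
  proof -
    have "(LINT t|lborel. \<phi> t * (\<Sum>j<n. piece g j t)) = (\<Sum>j<n. LINT t|lborel. \<phi> t * piece g j t)"
      unfolding sum_distrib_left by (rule Bochner_Integration.integral_sum) (rule pi)
    also have "\<dots> = (\<Sum>j<n. LINT \<tau>|lborel. (g \<tau> * indicator (shell j) \<tau>) * ft \<phi> \<tau>)" by (simp only: one)
    also have "\<dots> = (LINT \<tau>|lborel. (\<Sum>j<n. (g \<tau> * indicator (shell j) \<tau>) * ft \<phi> \<tau>))"
      by (rule Bochner_Integration.integral_sum[symmetric]) (rule gsi)
    finally show ?thesis .
  qed
  have partial: "(\<Sum>j<n. (g \<tau> * indicator (shell j) \<tau>) * ft \<phi> \<tau>) = (if i < n then g \<tau> * ft \<phi> \<tau> else 0)"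
    if "\<forall>j. \<tau> \<in> shell j \<longleftrightarrow> j = i" for n i \<tau>
  proof -
    have "(\<Sum>j<n. (g \<tau> * indicator (shell j) \<tau>) * ft \<phi> \<tau>) = (\<Sum>j<n. if j = i then g \<tau> * ft \<phi> \<tau> else 0)"
      using that by (intro sum.cong) (auto simp: indicator_def)
    then show ?thesis by simp
  qed
  show ?thesis unfolding eq
  proof (rule integral_dominated_convergence)
    show "integrable lborel (\<lambda>\<tau>. norm (g \<tau> * ft \<phi> \<tau>))" using int by (rule integrable_norm)
    show "AE \<tau> in lborel. (\<lambda>n. \<Sum>j<n. (g \<tau> * indicator (shell j) \<tau>) * ft \<phi> \<tau>) \<longlonglongrightarrow> g \<tau> * ft \<phi> \<tau>"
    proof (rule AE_I2)
      fix \<tau>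
      obtain i where i: "\<forall>j. \<tau> \<in> shell j \<longleftrightarrow> j = i" using shell_unique by blast
      show "(\<lambda>n. \<Sum>j<n. (g \<tau> * indicator (shell j) \<tau>) * ft \<phi> \<tau>) \<longlonglongrightarrow> g \<tau> * ft \<phi> \<tau>"
        unfolding partial[OF i] by (rule tendsto_eventually) (use eventually_gt_at_top[of i] in eventually_elim, simp)
    qed
    show "AE \<tau> in lborel. norm (\<Sum>j<n. (g \<tau> * indicator (shell j) \<tau>) * ft \<phi> \<tau>) \<le> norm (g \<tau> * ft \<phi> \<tau>)" for n
    proof (rule AE_I2)
      fix \<tau>
      obtain i where i: "\<forall>j. \<tau> \<in> shell j \<longleftrightarrow> j = i" using shell_unique by blast
      show "norm (\<Sum>j<n. (g \<tau> * indicator (shell j) \<tau>) * ft \<phi> \<tau>) \<le> norm (g \<tau> * ft \<phi> \<tau>)"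
        unfolding partial[OF i] by simp
    qed
  qed measurable
qed

text \<open>Up to the factor \<open>2 * pi\<close>, a bump is the \<open>fourier\<close> image of a
  Schwartz function. The value of \<open>T\<close> at it can therefore be computed both from
  \<open>g\<close> by \<open>has_fourier\<close> and from \<open>f\<close> by
  \<open>restricts_to\<close>; comparing over all bumps in \<open>{c..d}\<close> identifies the two
  functions.\<close>

lemma distribution_eq_pieces_on_interval:
  fixes g :: "real \<Rightarrow> complex"
  assumes res: "restricts_to T I f" and four: "has_fourier T g\<^sub>0"
    and g [measurable]: "g \<in> borel_measurable borel" and g0: "AE \<tau> in lborel. g\<^sub>0 \<tau> = g \<tau>"
    and fin: "sobolev_sq b g < \<infinity>" and b: "3 / 8 < b" and cd: "{c..d} \<subseteq> interior I"
  shows "AE t in lborel. t \<in> {c..d} \<longrightarrow> summable (\<lambda>j. norm (piece g j t)) \<and> of_real (2 * pi) * f t = (\<Sum>j. piece g j t)"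
proof -
  have b0: "0 \<le> b" using b by simp
  obtain Q :: nat where Q: "max \<bar>c\<bar> \<bar>d\<bar> \<le> real Q" using real_arch_simple by blast
  define S where "S t = (\<Sum>j. ennreal (norm (piece g j t)))" for t
  have S_meas [measurable]: "S \<in> borel_measurable borel" unfolding S_def[abs_def] by measurable
  have "(\<integral>\<^sup>+t\<in>{c..d}. S t \<partial>lborel) \<le> (\<integral>\<^sup>+t\<in>{- real Q..real Q}. S t \<partial>lborel)"
  proof (rule nn_integral_mono, rule mult_left_mono)
    fix t
    show "indicator {c..d} t \<le> (indicator {- real Q..real Q} t :: ennreal)" using Q by (auto simp: indicator_def)
  qed simp
  then have S_fin: "(\<integral>\<^sup>+t\<in>{c..d}. S t \<partial>lborel) < \<infinity>"
    using piece_sum_integrable[OF g fin b, of Q] unfolding S_def by (rule order.strict_trans1)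
  have S_ae: "AE t in lborel. S t * indicator {c..d} t \<noteq> \<infinity>"
  proof (rule nn_integral_PInf_AE)
    show "(\<lambda>t. S t * indicator {c..d} t) \<in> borel_measurable lborel" by measurable
  qed (use S_fin in \<open>simp only: infinity_ennreal_def less_top\<close>)
  have S_summ: "summable (\<lambda>j. norm (piece g j t))" if "S t < \<infinity>" for t
    using that unfolding S_def by (intro summable_suminf_not_top) (auto simp only: infinity_ennreal_def less_top norm_ge_zero)
  define F where "F t = (\<Sum>j. piece g j t)" for t
  have F_meas [measurable]: "F \<in> borel_measurable borel" unfolding F_def[abs_def] by measurable
  have F_le: "ennreal (norm (F t)) \<le> S t" if "S t < \<infinity>" for t
    unfolding F_def S_def by (rule sums_norm_ennreal_le[OF summable_sums[OF summable_norm_cancel[OF S_summ[OF that]]]])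
  have Fi: "integrable lborel (\<lambda>t. indicator {c..d} t *\<^sub>R F t)"
  proof (rule integrableI_bounded)
    have "(\<integral>\<^sup>+t. ennreal (norm (indicator {c..d} t *\<^sub>R F t)) \<partial>lborel) \<le> (\<integral>\<^sup>+t\<in>{c..d}. S t \<partial>lborel)"
    proof (rule nn_integral_mono_AE, use S_ae in eventually_elim)
      case (elim t)
      then show ?case using F_le[of t] by (cases "t \<in> {c..d}") (auto simp: less_top)
    qed
    then show "(\<integral>\<^sup>+t. ennreal (norm (indicator {c..d} t *\<^sub>R F t)) \<partial>lborel) < \<infinity>" using S_fin by (rule order.strict_trans1)
  qed measurable
  have "set_integrable lebesgue {c..d} f" using res cd unfolding restricts_to_def by auto
  then have fi: "integrable lebesgue (\<lambda>t. indicator {c..d} t *\<^sub>R f t)" by (simp add: set_integrable_def)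
  then obtain f' where f' [measurable]: "f' \<in> borel_measurable lborel" and ff: "AE t in lborel. indicator {c..d} t *\<^sub>R f t = f' t"
    using completion_ex_borel_measurable_complex[of "\<lambda>t. indicator {c..d} t *\<^sub>R f t" lborel] by auto
  \<comment> \<open>The second indicator makes the representative vanish at every point outside
    \<open>{c..d}\<close>, as the bump criterion demands.\<close>
  define f1 where "f1 t = indicator {c..d} t *\<^sub>R f' t" for t
  have f1_meas [measurable]: "f1 \<in> borel_measurable borel" unfolding f1_def using f' by measurable
  have ff1: "AE t in lborel. indicator {c..d} t *\<^sub>R f t = f1 t"
    using ff by eventually_elim (auto simp: f1_def indicator_def)
  have f1i: "integrable lborel f1"
  proof -
    have "integrable lebesgue f1"
      by (rule integrable_cong_AE_imp[OF fi]) (use ff1 in \<open>auto intro: measurable_completion AE_completion elim: AE_mp\<close>)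
    then show ?thesis by (simp add: integrable_completion)
  qed
  define H where "H t = of_real (2 * pi) * f1 t - indicator {c..d} t *\<^sub>R F t" for t
  have "AE t in lborel. H t = 0"
  proof (rule AE_zero_if_bump_integrals_zero)
    show "integrable lborel H" unfolding H_def using f1i Fi by (intro Bochner_Integration.integrable_diff integrable_mult_right)
    show "H t = 0" if "t \<notin> {c..d}" for t using that by (simp add: H_def f1_def)
    fix \<epsilon> \<alpha> \<beta> :: real assume \<epsilon>: "0 < \<epsilon>" and ab: "c \<le> \<alpha>" "\<alpha> \<le> \<beta>" "\<beta> \<le> d"
    let ?\<phi> = "test_bump \<epsilon> \<alpha> \<beta>"
    have \<phi>: "?\<phi> \<in> testfun \<epsilon> \<alpha> \<beta>" by (rule test_bump_testfun)
    have \<phi>_out: "?\<phi> t = 0" if "t \<notin> {c..d}" for t using testfun_support[OF \<phi>, of t] that ab by auto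
    have \<phi>1: "norm (?\<phi> t) \<le> 1" for t by (rule norm_test_bump_le[OF \<epsilon>])
    have schw: "schwartz (ft ?\<phi>)" by (rule schwartz_ft[OF \<epsilon> ab(2) \<phi>])
    have [measurable]: "ft ?\<phi> \<in> borel_measurable borel" unfolding ft_def[abs_def] by measurable
    have Tf: "integrable lebesgue (\<lambda>\<tau>. g\<^sub>0 \<tau> * ft ?\<phi> \<tau>)" "T (fourier (ft ?\<phi>)) = (LINT \<tau>|lebesgue. g\<^sub>0 \<tau> * ft ?\<phi> \<tau>)"
      using four schw unfolding has_fourier_def by auto
    have ae: "AE \<tau> in lebesgue. g\<^sub>0 \<tau> * ft ?\<phi> \<tau> = g \<tau> * ft ?\<phi> \<tau>"
      using AE_completion[OF g0] by eventually_elim simp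
    have gm: "(\<lambda>\<tau>. g \<tau> * ft ?\<phi> \<tau>) \<in> borel_measurable lebesgue" by (rule measurable_completion) simp
    have "integrable lebesgue (\<lambda>\<tau>. g \<tau> * ft ?\<phi> \<tau>)" by (rule integrable_cong_AE_imp[OF Tf(1) gm ae])
    then have gi: "integrable lborel (\<lambda>\<tau>. g \<tau> * ft ?\<phi> \<tau>)" by (simp add: integrable_completion)
    have "T (fourier (ft ?\<phi>)) = (LINT \<tau>|lebesgue. g \<tau> * ft ?\<phi> \<tau>)"
      unfolding Tf(2) using Tf(1) gm ae by (intro integral_cong_AE) auto
    then have T1: "T (fourier (ft ?\<phi>)) = (LINT \<tau>|lborel. g \<tau> * ft ?\<phi> \<tau>)" by (simp add: integral_completion)
    \<comment> \<open>\<open>T\<close> is evaluated at \<open>2 * pi\<close> times the bump, because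
      this is what \<open>fourier\<close> makes of its transform.\<close>
    define \<psi> where "\<psi> t = of_real (2 * pi) * ?\<phi> t" for t
    have \<psi>: "\<psi> \<in> testfun \<epsilon> \<alpha> \<beta>" unfolding \<psi>_def by (rule testfun.scale[OF \<phi>])
    have four_eq: "fourier (ft ?\<phi>) = \<psi>" unfolding \<psi>_def using testfun_fourier_inversion[OF \<epsilon> ab(2) \<phi>] by auto
    have "smooth \<psi> \<and> compact (closure {t. \<psi> t \<noteq> 0}) \<and> closure {t. \<psi> t \<noteq> 0} \<subseteq> interior I"
      using testfun_smooth[OF \<epsilon> \<psi>] testfun_compact_support[OF \<psi>] ab cd by (auto simp: subset_iff)
    then have "T \<psi> = (LINT t:interior I|lebesgue. f t * \<psi> t)" using res unfolding restricts_to_def by blast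
    also have "\<dots> = (LINT t|lebesgue. (indicator {c..d} t *\<^sub>R f t) * \<psi> t)"
      unfolding set_lebesgue_integral_def
      using \<phi>_out cd by (intro Bochner_Integration.integral_cong refl) (auto simp: indicator_def \<psi>_def)
    also have "\<dots> = (LINT t|lebesgue. f1 t * \<psi> t)"
    proof (rule integral_cong_AE)
      have [measurable]: "\<psi> \<in> borel_measurable lebesgue" unfolding \<psi>_def by (rule measurable_completion) simp
      have [measurable]: "f1 \<in> borel_measurable lebesgue" by (rule measurable_completion) simp
      have [measurable]: "(\<lambda>t. indicator {c..d} t *\<^sub>R f t) \<in> borel_measurable lebesgue" using fi by (rule borel_measurable_integrable)
      show "(\<lambda>t. (indicator {c..d} t *\<^sub>R f t) * \<psi> t) \<in> borel_measurable lebesgue" by (rule borel_measurable_times) measurable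
      show "(\<lambda>t. f1 t * \<psi> t) \<in> borel_measurable lebesgue" by measurable
      show "AE t in lebesgue. (indicator {c..d} t *\<^sub>R f t) * \<psi> t = f1 t * \<psi> t"
        using AE_completion[OF ff1] by eventually_elim simp
    qed
    also have "\<dots> = (LINT t|lborel. f1 t * \<psi> t)" by (rule integral_completion) (simp add: \<psi>_def)
    also have "\<dots> = of_real (2 * pi) * (LINT t|lborel. f1 t * ?\<phi> t)"
    proof -
      have "f1 t * \<psi> t = of_real (2 * pi) * (f1 t * ?\<phi> t)" for t by (simp only: \<psi>_def mult.left_commute)
      then show ?thesis by (simp only: integral_mult_right_zero)
    qed
    finally have T2: "T \<psi> = of_real (2 * pi) * (LINT t|lborel. f1 t * ?\<phi> t)" .
    have lim1: "(\<lambda>n. LINT t|lborel. ?\<phi> t * (\<Sum>j<n. piece g j t)) \<longlonglongrightarrow> (LINT \<tau>|lborel. g \<tau> * ft ?\<phi> \<tau>)"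
      by (rule pieces_pairing[OF g fin b0 \<epsilon> \<phi> gi])
    have lim2: "(\<lambda>n. LINT t|lborel. ?\<phi> t * (\<Sum>j<n. piece g j t)) \<longlonglongrightarrow> (LINT t|lborel. ?\<phi> t * (indicator {c..d} t *\<^sub>R F t))"
    proof (rule integral_dominated_convergence)
      show "integrable lborel (\<lambda>t. indicator {c..d} t * enn2real (S t))"
      proof (rule integrableI_bounded)
        have "(\<integral>\<^sup>+t. ennreal (norm (indicator {c..d} t * enn2real (S t))) \<partial>lborel) = (\<integral>\<^sup>+t\<in>{c..d}. S t \<partial>lborel)"
          by (rule nn_integral_cong_AE, use S_ae in eventually_elim) (auto simp: indicator_def less_top)
        then show "(\<integral>\<^sup>+t. ennreal (norm (indicator {c..d} t * enn2real (S t))) \<partial>lborel) < \<infinity>" using S_fin by simp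
      qed measurable
      show "AE t in lborel. (\<lambda>n. ?\<phi> t * (\<Sum>j<n. piece g j t)) \<longlonglongrightarrow> ?\<phi> t * (indicator {c..d} t *\<^sub>R F t)"
        using S_ae
      proof eventually_elim
        case (elim t)
        show ?case
        proof (cases "t \<in> {c..d}")
          case True
          then have "S t < \<infinity>" using elim by (simp add: less_top)
          then have "(\<lambda>n. \<Sum>j<n. piece g j t) \<longlonglongrightarrow> F t"
            unfolding F_def by (intro summable_LIMSEQ summable_norm_cancel[OF S_summ])
          then show ?thesis using True by (intro tendsto_mult tendsto_const) simp
        qed (simp add: \<phi>_out)
      qed
      show "AE t in lborel. norm (?\<phi> t * (\<Sum>j<n. piece g j t)) \<le> indicator {c..d} t * enn2real (S t)" for n
        using S_ae
      proof eventually_elim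
        case (elim t)
        show ?case
        proof (cases "t \<in> {c..d}")
          case True
          then have fin_t: "S t < \<infinity>" using elim by (simp add: less_top)
          have "ennreal (norm (\<Sum>j<n. piece g j t)) \<le> (\<Sum>j<n. ennreal (norm (piece g j t)))"
            by (simp add: sum_ennreal ennreal_leI norm_sum)
          also have "\<dots> \<le> S t" unfolding S_def by (intro sum_le_suminf) auto
          also have "S t = ennreal (enn2real (S t))" by (rule ennreal_enn2real[symmetric]) (use fin_t in \<open>simp only: infinity_ennreal_def\<close>)
          finally have "norm (\<Sum>j<n. piece g j t) \<le> enn2real (S t)" by (simp only: ennreal_le_iff[OF enn2real_nonneg])
          then have "norm (?\<phi> t) * norm (\<Sum>j<n. piece g j t) \<le> 1 * enn2real (S t)"
            using \<phi>1 by (intro mult_mono) auto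
          then show ?thesis using True by (simp add: norm_mult)
        qed (simp add: \<phi>_out)
      qed
    qed measurable
    have "(LINT t|lborel. H t * ?\<phi> t) = of_real (2 * pi) * (LINT t|lborel. f1 t * ?\<phi> t) - (LINT t|lborel. ?\<phi> t * (indicator {c..d} t *\<^sub>R F t))"
    proof -
      have i1: "integrable lborel (\<lambda>t. f1 t * ?\<phi> t)"
        by (rule Bochner_Integration.integrable_bound[OF f1i]) (use \<phi>1 in \<open>auto simp: norm_mult mult_left_le\<close>)
      have i2: "integrable lborel (\<lambda>t. ?\<phi> t * (indicator {c..d} t *\<^sub>R F t))"
        by (rule Bochner_Integration.integrable_bound[OF Fi]) (use \<phi>1 in \<open>auto simp: norm_mult intro!: mult_left_mono mult_left_le_one_le\<close>)
      have "H t * ?\<phi> t = of_real (2 * pi) * (f1 t * ?\<phi> t) - ?\<phi> t * (indicator {c..d} t *\<^sub>R F t)" for t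
        by (simp add: H_def algebra_simps)
      then have "(LINT t|lborel. H t * ?\<phi> t) = (LINT t|lborel. of_real (2 * pi) * (f1 t * ?\<phi> t) - ?\<phi> t * (indicator {c..d} t *\<^sub>R F t))"
        by (simp only:)
      also have "\<dots> = (LINT t|lborel. of_real (2 * pi) * (f1 t * ?\<phi> t)) - (LINT t|lborel. ?\<phi> t * (indicator {c..d} t *\<^sub>R F t))"
        by (rule Bochner_Integration.integral_diff[OF integrable_mult_right[OF i1] i2])
      also have "(LINT t|lborel. of_real (2 * pi) * (f1 t * ?\<phi> t)) = of_real (2 * pi) * (LINT t|lborel. f1 t * ?\<phi> t)"
        by (rule integral_mult_right_zero)
      finally show ?thesis .
    qed
    also have "\<dots> = 0" using T1 T2 LIMSEQ_unique[OF lim1 lim2] unfolding four_eq by simp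
    finally show "(LINT t|lborel. H t * ?\<phi> t) = 0" .
  qed
  then show ?thesis using ff1 S_ae
  proof eventually_elim
    case (elim t)
    show ?case
    proof
      assume t: "t \<in> {c..d}"
      then have "S t < \<infinity>" using elim by (simp add: less_top)
      then show "summable (\<lambda>j. norm (piece g j t)) \<and> of_real (2 * pi) * f t = (\<Sum>j. piece g j t)"
        using S_summ elim(1,2) t by (simp add: H_def F_def)
    qed
  qed
qed

text \<open>Countably many compact intervals with rational end points cover the interior, so the
  union of the exceptional sets is still a null set.\<close>

lemma distribution_eq_pieces:
  fixes g :: "real \<Rightarrow> complex"
  assumes "restricts_to T I f" "has_fourier T g\<^sub>0" "g \<in> borel_measurable borel" "AE \<tau> in lborel. g\<^sub>0 \<tau> = g \<tau>"
    and "sobolev_sq b g < \<infinity>" "3 / 8 < b"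
  shows "AE t in lborel. t \<in> interior I \<longrightarrow> summable (\<lambda>j. norm (piece g j t)) \<and> of_real (2 * pi) * f t = (\<Sum>j. piece g j t)"
proof -
  let ?P = "\<lambda>t. summable (\<lambda>j. norm (piece g j t)) \<and> of_real (2 * pi) * f t = (\<Sum>j. piece g j t)"
  have "AE t in lborel. \<forall>p :: rat \<times> rat. {of_rat (fst p)..of_rat (snd p)} \<subseteq> interior I \<longrightarrow> t \<in> {of_rat (fst p)..of_rat (snd p)} \<longrightarrow> ?P t"
    unfolding AE_all_countable using distribution_eq_pieces_on_interval[OF assms] by (auto simp: AE_impI)
  then show ?thesis
  proof eventually_elim
    case (elim t)
    show ?case
    proof
      assume "t \<in> interior I"
      then obtain e where e: "0 < e" "ball t e \<subseteq> interior I" by (meson open_contains_ball open_interior)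
      obtain q where q: "t - e < of_rat q" "of_rat q < t" using of_rat_dense[of "t - e" t] e by auto
      obtain r where r: "t < of_rat r" "of_rat r < t + e" using of_rat_dense[of t "t + e"] e by auto
      have "{of_rat q..of_rat r} \<subseteq> ball t e" using q r by (auto simp: dist_real_def)
      then show "?P t" using elim[rule_format, of "(q, r)"] e q r by auto
    qed
  qed
qed

section \<open>The first inequality\<close>

lemma epowr_mono: "x \<le> y \<Longrightarrow> 0 \<le> p \<Longrightarrow> epowr x p \<le> epowr y p"
  unfolding epowr_def by (auto simp: top_unique intro!: ennreal_leI powr_mono2 enn2real_mono) (auto simp: less_top)

lemma epowr_cmult: "0 < c \<Longrightarrow> epowr (ennreal c * x) p = ennreal (c powr p) * epowr x p"
  unfolding epowr_def by (auto simp: ennreal_mult_eq_top_iff enn2real_mult powr_mult ennreal_mult ennreal_mult_top)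

lemma epowr_square: "epowr (x\<^sup>2) (p / 2) = epowr x p"
proof (cases "x = top")
  case False
  then have "enn2real (x\<^sup>2) powr (p / 2) = enn2real x powr p"
    by (cases "enn2real x = 0") (auto simp: power2_eq_square enn2real_mult powr_mult simp flip: powr_add)
  then show ?thesis using False by (simp add: epowr_def power_eq_top_ennreal_iff)
qed (simp add: epowr_def power2_eq_square)

lemma AE_lborel_fst:
  fixes P :: "real \<Rightarrow> bool"
  assumes "AE t in lborel. P t"
  shows "AE z in (lborel :: (real \<times> real) measure). P (fst z)"
proof -
  obtain N where N: "{t. \<not> P t} \<subseteq> N" "emeasure lborel N = 0" "N \<in> sets lborel"
    using assms by (auto elim!: AE_E)
  have "emeasure (lborel \<Otimes>\<^sub>M lborel) (N \<times> (UNIV :: real set)) = emeasure lborel N * emeasure lborel (UNIV :: real set)"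
    using N(3) by (intro lborel.emeasure_pair_measure_Times) auto
  then have "N \<times> (UNIV :: real set) \<in> null_sets lborel"
    using N unfolding lborel_prod[symmetric] by (auto simp: null_sets_def)
  then show ?thesis by (rule AE_I') (use N(1) in auto)
qed

lemma nn_integral_plane:
  fixes f :: "real \<times> real \<Rightarrow> ennreal"
  assumes "f \<in> borel_measurable (borel \<Otimes>\<^sub>M borel)"
  shows "(\<integral>\<^sup>+z. f z \<partial>lborel) = (\<integral>\<^sup>+t. (\<integral>\<^sup>+x. f (t, x) \<partial>lborel) \<partial>lborel)"
  unfolding lborel_prod[symmetric] by (rule lborel.nn_integral_fst[symmetric]) (use assms in measurable)

lemma nn_integral_strip:
  fixes f :: "real \<times> real \<Rightarrow> ennreal"
  assumes "is_interval I"
  shows "(\<integral>\<^sup>+z. f z \<partial>lebesgue_on (I \<times> {0..<2 * pi})) = (\<integral>\<^sup>+z. f z * indicator (I \<times> {0..<2 * pi}) z \<partial>lborel)"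
proof -
  have "I \<in> sets borel" using assms by (rule real_interval_borel_measurable)
  then have "I \<times> {0..<2 * pi} \<in> sets (borel \<Otimes>\<^sub>M borel)" by auto
  then have "I \<times> {0..<2 * pi} \<in> sets (borel :: (real \<times> real) measure)" by (simp only: borel_prod)
  then show ?thesis by (subst nn_integral_restrict_space) (auto simp: nn_integral_completion)
qed

text \<open>An interval is convex, so its frontier is a null set. This bridges the distributions,
  which are tested only inside \<open>interior I\<close>, and the L^p norms, which are taken over
  \<open>I\<close> itself.\<close>

lemma AE_in_interior: "is_interval I \<Longrightarrow> AE t::real in lborel. t \<in> I \<longrightarrow> t \<in> interior I"
proof -
  assume "is_interval I"
  then have "negligible (frontier I)" by (simp add: is_interval_convex negligible_convex_frontier)
  then have "frontier I \<in> null_sets lebesgue" by (simp add: negligible_iff_null_sets)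
  then have "AE t in lebesgue. t \<in> I \<longrightarrow> t \<in> interior I"
    by (rule AE_I') (use closure_subset in \<open>auto simp: frontier_def\<close>)
  then show "AE t in lborel. t \<in> I \<longrightarrow> t \<in> interior I" by (simp only: AE_completion_iff)
qed

text \<open>The constant of \<open>dyadic_L4\<close>. It contains the geometric ratio
  \<open>4 powr (3 / 8 - b)\<close> and blows up as \<open>b\<close> decreases to 3/8.\<close>

definition L4_const :: "real \<Rightarrow> real \<Rightarrow> real" where
  "L4_const B b = exp 4 * 8 * pi ^ 3 * (3 + 4 * B) * 256 powr b / (1 - 4 powr (3 / 8 - b)) ^ 4"

lemma L4_const_pos: "0 \<le> B \<Longrightarrow> 3 / 8 < b \<Longrightarrow> 0 < L4_const B b"
  unfolding L4_const_def by (intro divide_pos_pos mult_pos_pos zero_less_power) (auto simp: powr_less_one)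

text \<open>Multiplying the pieces by \<open>cis (k * x - p k t)\<close> undoes the modulation by
  \<open>cis (p k t)\<close>, so they sum to \<open>2 * pi\<close> times the function;
  \<open>2 * pi >= 1\<close> is then given away.\<close>

lemma L4_of_piece_sums:
  fixes g :: "int \<Rightarrow> real \<Rightarrow> complex"
  assumes sep: "separated p K B" and fin: "finite K" and B: "0 \<le> B" and b: "3 / 8 < b"
    and p: "\<And>k. p k \<in> borel_measurable borel" and g: "\<And>k. g k \<in> borel_measurable borel"
    and I: "is_interval I" "I \<subseteq> {- real Q..real Q}"
    and c: "AE t in lborel. t \<in> interior I \<longrightarrow> (\<forall>k\<in>K. summable (\<lambda>j. norm (piece (g k) j t))
              \<and> of_real (2 * pi) * (cis (p k t) * c k t) = (\<Sum>j. piece (g k) j t))"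
  shows "(\<integral>\<^sup>+z. ennreal (norm (\<Sum>k\<in>K. c k (fst z) * cis (of_int k * snd z)) powr 4) \<partial>lebesgue_on (I \<times> {0..<2 * pi}))
    \<le> ennreal (L4_const B b) * (\<Sum>k\<in>K. sobolev_sq b (g k))\<^sup>2"
proof -
  note [measurable] = p g
  define S where "S t x = (\<Sum>j. ennreal (norm (\<Sum>k\<in>K. piece (g k) j t * cis (of_int k * x - p k t))))" for t x
  have S_meas [measurable]: "case_prod S \<in> borel_measurable (borel \<Otimes>\<^sub>M borel)"
    unfolding S_def[abs_def] by measurable
  define W where "W t x = (\<Sum>k\<in>K. c k t * cis (of_int k * x))" for t x
  have W: "ennreal (norm (W t x)) \<le> S t x"
    if *: "\<forall>k\<in>K. summable (\<lambda>j. norm (piece (g k) j t)) \<and> of_real (2 * pi) * (cis (p k t) * c k t) = (\<Sum>j. piece (g k) j t)" for t x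
  proof -
    have "(\<lambda>j. \<Sum>k\<in>K. piece (g k) j t * cis (of_int k * x - p k t)) sums (\<Sum>k\<in>K. (of_real (2 * pi) * (cis (p k t) * c k t)) * cis (of_int k * x - p k t))"
    proof (intro sums_sum sums_mult2)
      fix k assume "k \<in> K"
      then show "(\<lambda>j. piece (g k) j t) sums (of_real (2 * pi) * (cis (p k t) * c k t))"
        using * summable_sums[OF summable_norm_cancel[of "\<lambda>j. piece (g k) j t"]] by simp
    qed
    also have "(\<Sum>k\<in>K. (of_real (2 * pi) * (cis (p k t) * c k t)) * cis (of_int k * x - p k t)) = of_real (2 * pi) * W t x"
      unfolding W_def sum_distrib_left
    proof (rule sum.cong[OF refl])
      fix k
      have "(of_real (2 * pi) * (cis (p k t) * c k t)) * cis (of_int k * x - p k t) = of_real (2 * pi) * (c k t * (cis (p k t) * cis (of_int k * x - p k t)))"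
        by (simp only: ac_simps)
      then show "(of_real (2 * pi) * (cis (p k t) * c k t)) * cis (of_int k * x - p k t) = of_real (2 * pi) * (c k t * cis (of_int k * x))"
        by (simp add: cis_mult)
    qed
    finally have "ennreal (norm (of_real (2 * pi) * W t x)) \<le> S t x" unfolding S_def by (rule sums_norm_ennreal_le)
    moreover have "norm (W t x) \<le> norm (of_real (2 * pi) * W t x)"
    proof -
      have "1 * norm (W t x) \<le> (2 * pi) * norm (W t x)" using pi_gt3 by (intro mult_right_mono) auto
      then show ?thesis by (simp add: norm_mult)
    qed
    ultimately show ?thesis by (meson ennreal_leI order_trans)
  qed
  have "(\<integral>\<^sup>+z. ennreal (norm (W (fst z) (snd z)) powr 4) \<partial>lebesgue_on (I \<times> {0..<2 * pi}))
      = (\<integral>\<^sup>+z. ennreal (norm (W (fst z) (snd z)) powr 4) * indicator (I \<times> {0..<2 * pi}) z \<partial>lborel)"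
    by (rule nn_integral_strip[OF I(1)])
  also have "\<dots> \<le> (\<integral>\<^sup>+z. (S (fst z) (snd z) ^ 4 * indicator {0..2 * pi} (snd z)) * indicator {- real Q..real Q} (fst z) \<partial>lborel)"
  proof (rule nn_integral_mono_AE)
    show "AE z in lborel. ennreal (norm (W (fst z) (snd z)) powr 4) * indicator (I \<times> {0..<2 * pi}) z
        \<le> (S (fst z) (snd z) ^ 4 * indicator {0..2 * pi} (snd z)) * indicator {- real Q..real Q} (fst z)"
      using AE_lborel_fst[OF c] AE_lborel_fst[OF AE_in_interior[OF I(1)]]
    proof eventually_elim
      case (elim z)
      show ?case
      proof (cases "z \<in> I \<times> {0..<2 * pi}")
        case True
        then have z: "fst z \<in> I" "snd z \<in> {0..2 * pi}" by auto
        then have "ennreal (norm (W (fst z) (snd z))) \<le> S (fst z) (snd z)" using elim by (intro W) blast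
        then have "ennreal (norm (W (fst z) (snd z))) ^ 4 \<le> S (fst z) (snd z) ^ 4" by (rule power_mono) simp
        moreover have "ennreal (norm (W (fst z) (snd z)) powr 4) = ennreal (norm (W (fst z) (snd z))) ^ 4"
          by (simp add: ennreal_power powr_numeral)
        moreover have "fst z \<in> {- real Q..real Q}" using z I by blast
        ultimately show ?thesis using True z by (simp only: indicator_simps mult_1_right)
      qed simp
    qed
  qed
  also have "\<dots> = (\<integral>\<^sup>+t\<in>{- real Q..real Q}. (\<integral>\<^sup>+x\<in>{0..2 * pi}. S t x ^ 4 \<partial>lborel) \<partial>lborel)"
  proof (subst nn_integral_plane)
    show "(\<lambda>z. (S (fst z) (snd z) ^ 4 * indicator {0..2 * pi} (snd z)) * indicator {- real Q..real Q} (fst z)) \<in> borel_measurable (borel \<Otimes>\<^sub>M borel)"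
      by measurable
    show "(\<integral>\<^sup>+t. (\<integral>\<^sup>+x. (S (fst (t, x)) (snd (t, x)) ^ 4 * indicator {0..2 * pi} (snd (t, x))) * indicator {- real Q..real Q} (fst (t, x)) \<partial>lborel) \<partial>lborel)
      = (\<integral>\<^sup>+t\<in>{- real Q..real Q}. (\<integral>\<^sup>+x\<in>{0..2 * pi}. S t x ^ 4 \<partial>lborel) \<partial>lborel)"
      unfolding fst_conv snd_conv by (intro nn_integral_cong nn_integral_multc) measurable
  qed
  also have "\<dots> \<le> ennreal (L4_const B b) * (\<Sum>k\<in>K. sobolev_sq b (g k))\<^sup>2"
    unfolding S_def L4_const_def by (rule dyadic_L4[OF sep fin B b p g, folded piece_def])
  finally show ?thesis unfolding W_def .
qed

section \<open>Coefficients of the projection, and near-minimal extensions\<close>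

lemma fcoef_eq_lborel_Icc:
  assumes "f \<in> borel_measurable borel"
  shows "fcoef f k = of_real (1 / (2 * pi)) * (LINT x:{0..2 * pi}|lborel. f x * cis (- (of_int k * x)))"
proof -
  have [measurable]: "f \<in> borel_measurable borel" by (rule assms)
  have [measurable]: "(\<lambda>x. cis (- (of_int k * x))) \<in> borel_measurable borel"
    by (intro borel_measurable_continuous_onI continuous_intros)
  have "(LINT x:{0..<2 * pi}|lebesgue. f x * cis (- (of_int k * x))) = (LINT x:{0..<2 * pi}|lborel. f x * cis (- (of_int k * x)))"
    unfolding set_lebesgue_integral_def by (rule integral_completion) measurable
  also have "\<dots> = (LINT x:{0..2 * pi}|lborel. f x * cis (- (of_int k * x)))"
    unfolding set_lebesgue_integral_def
  proof (rule integral_cong_AE)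
    show "AE x in lborel. indicator {0..<2 * pi} x *\<^sub>R (f x * cis (- (of_int k * x))) = indicator {0..2 * pi} x *\<^sub>R (f x * cis (- (of_int k * x)))"
      using AE_lborel_singleton[of "2 * pi"] by eventually_elim (auto simp: indicator_def)
  qed measurable
  finally show ?thesis by (simp add: fcoef_def)
qed

lemma fcoef_proj: "fcoef (proj \<Lambda> h f) k = (if k \<in> low_freqs \<Lambda> h then fcoef f k else 0)"
proof -
  let ?K = "low_freqs \<Lambda> h"
  have cis_int: "set_integrable lborel {0..2 * pi} (\<lambda>x. cis (of_int n * x))" for n
    by (rule borel_integrable_atLeastAtMost') (intro continuous_intros)
  have "fcoef (proj \<Lambda> h f) k = of_real (1 / (2 * pi)) * (LINT x:{0..2 * pi}|lborel. proj \<Lambda> h f x * cis (- (of_int k * x)))"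
    by (rule fcoef_eq_lborel_Icc)
       (unfold Defs.proj_def[abs_def], intro borel_measurable_continuous_onI continuous_intros)
  also have "(\<lambda>x. proj \<Lambda> h f x * cis (- (of_int k * x))) = (\<lambda>x. \<Sum>l\<in>?K. fcoef f l * cis (of_int (l - k) * x))"
    by (rule ext) (simp add: Defs.proj_def sum_distrib_right mult.assoc cis_mult left_diff_distrib)
  also have "(LINT x:{0..2 * pi}|lborel. \<Sum>l\<in>?K. fcoef f l * cis (of_int (l - k) * x))
      = (\<Sum>l\<in>?K. LINT x:{0..2 * pi}|lborel. fcoef f l * cis (of_int (l - k) * x))"
    unfolding set_lebesgue_integral_def scaleR_sum_right
    by (rule Bochner_Integration.integral_sum, fold set_integrable_def) (rule set_integrable_mult_right[OF cis_int])
  also have "\<dots> = (\<Sum>l\<in>?K. if l = k then fcoef f l * of_real (2 * pi) else 0)"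
    by (intro sum.cong refl) (simp add: integral_cis_int del: of_int_diff)
  finally show ?thesis using finite_low_freqs by (simp add: sum.delta)
qed

text \<open>The infima over extensions and transforms need not be attained. The error is added to
  the square of the norm, because squares are what is summed over \<open>k\<close> later.\<close>

lemma Hb_norm_on_near_minimizer:
  assumes fin: "Hb_norm_on b I f < \<infinity>" and \<eta>: "0 < \<eta>"
  obtains T g\<^sub>0 g where "restricts_to T I f" "has_fourier T g\<^sub>0" "g \<in> borel_measurable borel" "AE \<tau> in lborel. g\<^sub>0 \<tau> = g \<tau>"
    "sobolev_sq b g \<le> ennreal (2 * pi) * ((Hb_norm_on b I f)\<^sup>2 + ennreal \<eta>)"
proof -
  define r where "r = enn2real (Hb_norm_on b I f)"
  have r: "Hb_norm_on b I f = ennreal r" "0 \<le> r" using fin by (auto simp: r_def less_top)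
  \<comment> \<open>Strictly above the infimum, also when \<open>r = 0\<close>.\<close>
  have "r < sqrt (r\<^sup>2 + \<eta>)" using \<eta> r(2) by (intro real_less_rsqrt) auto
  then have "Hb_norm_on b I f < ennreal (sqrt (r\<^sup>2 + \<eta>))" using r by (simp add: ennreal_less_iff)
  then obtain T where T: "restricts_to T I f" "Hb_norm b T < ennreal (sqrt (r\<^sup>2 + \<eta>))"
    unfolding Hb_norm_on_def INF_less_iff by blast
  then obtain g\<^sub>0 where g0: "has_fourier T g\<^sub>0"
    and lt: "epowr (ennreal (1 / (2 * pi)) * (\<integral>\<^sup>+\<tau>. ennreal (japanese \<tau> powr (2 * b) * (norm (g\<^sub>0 \<tau>))\<^sup>2) \<partial>lebesgue)) (1/2) < ennreal (sqrt (r\<^sup>2 + \<eta>))"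
    unfolding Hb_norm_def INF_less_iff by blast
  obtain g where g: "g \<in> borel_measurable lborel" "AE \<tau> in lborel. g\<^sub>0 \<tau> = g \<tau>"
    using completion_ex_borel_measurable_complex[of g\<^sub>0 lborel] g0 unfolding has_fourier_def by blast
  have w: "(\<integral>\<^sup>+\<tau>. ennreal (japanese \<tau> powr (2 * b) * (norm (g\<^sub>0 \<tau>))\<^sup>2) \<partial>lebesgue) = sobolev_sq b g"
    unfolding nn_integral_completion sobolev_sq_def
    by (rule nn_integral_cong_AE) (use g(2) in eventually_elim, simp)
  define Y where "Y = ennreal (1 / (2 * pi)) * sobolev_sq b g"
  have Y: "epowr Y (1/2) < ennreal (sqrt (r\<^sup>2 + \<eta>))" using lt unfolding w Y_def .
  then have "Y \<noteq> top" by (auto simp: epowr_def)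
  moreover have "sqrt (enn2real Y) < sqrt (r\<^sup>2 + \<eta>)"
    using Y \<open>Y \<noteq> top\<close> by (simp add: epowr_def powr_half_sqrt ennreal_less_iff)
  ultimately have "Y \<le> ennreal (r\<^sup>2 + \<eta>)" by (metis ennreal_enn2real ennreal_leI less_imp_le less_top real_sqrt_less_iff)
  then have "ennreal (2 * pi) * Y \<le> ennreal (2 * pi) * ((Hb_norm_on b I f)\<^sup>2 + ennreal \<eta>)"
    unfolding r using \<eta> r(2) by (intro mult_left_mono) (simp_all add: ennreal_power)
  moreover have "ennreal (2 * pi) * Y = sobolev_sq b g"
    unfolding Y_def mult.assoc[symmetric] by (simp add: ennreal_mult[symmetric])
  ultimately show thesis using that T(1) g0 g by simp
qed

lemma bounded_subset_nat_Icc: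
  assumes "bounded I" obtains Q :: nat where "I \<subseteq> {- real Q..real Q}"
proof -
  obtain M where M: "\<And>t. t \<in> I \<Longrightarrow> \<bar>t\<bar> \<le> M" using assms by (auto simp: bounded_iff)
  obtain n :: nat where "M \<le> real n" using real_arch_simple by blast
  then show ?thesis using that[of n] M by (force simp: abs_le_iff)
qed

text \<open>Near-minimal extensions are chosen for the finitely many \<open>k\<close> with a common
  error \<eta>; it contributes \<open>card K * \<eta>\<close> and is sent to 0 at the end. The
  factor \<open>4 * pi ^ 2\<close> is the square of the \<open>2 * pi\<close> between
  \<open>sobolev_sq\<close> and the squared \<open>Hb_norm\<close>.\<close>

lemma L4_of_restriction_norm:
  fixes c :: "int \<Rightarrow> real \<Rightarrow> complex"
  assumes sep: "separated p K B" and K: "finite K" and B: "0 \<le> B" and b: "3 / 8 < b"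
    and p: "\<And>k. p k \<in> borel_measurable borel" and I: "is_interval I" "bounded I"
  defines "N \<equiv> (\<Sum>k\<in>K. (Hb_norm_on b I (\<lambda>t. cis (p k t) * c k t))\<^sup>2)"
  shows "(\<integral>\<^sup>+z. ennreal (norm (\<Sum>k\<in>K. c k (fst z) * cis (of_int k * snd z)) powr 4) \<partial>lebesgue_on (I \<times> {0..<2 * pi}))
    \<le> ennreal (4 * pi\<^sup>2 * L4_const B b) * N\<^sup>2" (is "?X \<le> _")
proof (cases "N < top")
  case False
  have "0 < 4 * pi\<^sup>2 * L4_const B b" using L4_const_pos[OF B b] by simp
  then have "ennreal (4 * pi\<^sup>2 * L4_const B b) * N\<^sup>2 = top"
    using False L4_const_pos[OF B b] by (simp add: less_top[symmetric] power2_eq_square ennreal_mult_top)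
  then show ?thesis by simp
next
  case True
  obtain Q :: nat where Q: "I \<subseteq> {- real Q..real Q}" using I(2) by (rule bounded_subset_nat_Icc)
  define H where "H k = Hb_norm_on b I (\<lambda>t. cis (p k t) * c k t)" for k
  have N_eq: "N = (\<Sum>k\<in>K. (H k)\<^sup>2)" by (simp add: N_def H_def)
  have H_fin: "H k < \<infinity>" if "k \<in> K" for k
  proof -
    have "(H k)\<^sup>2 \<le> N" unfolding N_eq using K that by (intro member_le_sum) auto
    then have "(H k)\<^sup>2 < top" using True by (rule order.strict_trans1)
    then show ?thesis by (simp add: power_less_top_ennreal)
  qed
  have approx: "?X \<le> ennreal (L4_const B b) * (ennreal (2 * pi) * (N + of_nat (card K) * ennreal \<eta>))\<^sup>2" if \<eta>: "0 < \<eta>" for \<eta>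
  proof -
    let ?P = "\<lambda>k g. g \<in> borel_measurable borel \<and> (AE t in lborel. t \<in> interior I \<longrightarrow> summable (\<lambda>j. norm (piece g j t))
        \<and> of_real (2 * pi) * (cis (p k t) * c k t) = (\<Sum>j. piece g j t)) \<and> sobolev_sq b g \<le> ennreal (2 * pi) * ((H k)\<^sup>2 + ennreal \<eta>)"
    have "\<forall>k\<in>K. \<exists>g. ?P k g"
    proof
      fix k assume k: "k \<in> K"
      obtain T g\<^sub>0 g where T: "restricts_to T I (\<lambda>t. cis (p k t) * c k t)" "has_fourier T g\<^sub>0" "g \<in> borel_measurable borel"
          "AE \<tau> in lborel. g\<^sub>0 \<tau> = g \<tau>" and w: "sobolev_sq b g \<le> ennreal (2 * pi) * ((H k)\<^sup>2 + ennreal \<eta>)"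
        using Hb_norm_on_near_minimizer[OF H_fin[OF k, unfolded H_def] \<eta>] unfolding H_def by blast
      have "sobolev_sq b g < \<infinity>"
        by (rule order.strict_trans1[OF w]) (use H_fin[OF k] in \<open>simp add: ennreal_mult_less_top power_less_top_ennreal\<close>)
      then show "\<exists>g. ?P k g" using distribution_eq_pieces[OF T _ b] T(3) w by blast
    qed
    then obtain G where G: "\<forall>k\<in>K. ?P k (G k)" by (rule bchoice[THEN exE])
    \<comment> \<open>Zero off \<open>K\<close>, since measurability is required for every
      \<open>k\<close>.\<close>
    define g where "g k = (if k \<in> K then G k else (\<lambda>_. 0))" for k
    have g: "g k \<in> borel_measurable borel" for k using G by (auto simp: g_def)
    have "?X \<le> ennreal (L4_const B b) * (\<Sum>k\<in>K. sobolev_sq b (g k))\<^sup>2"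
    proof (rule L4_of_piece_sums[OF sep K B b p g I(1) Q])
      have "AE t in lborel. \<forall>k\<in>K. t \<in> interior I \<longrightarrow> summable (\<lambda>j. norm (piece (g k) j t))
        \<and> of_real (2 * pi) * (cis (p k t) * c k t) = (\<Sum>j. piece (g k) j t)"
        using G by (intro AE_finite_allI[OF K]) (auto simp: g_def)
      then show "AE t in lborel. t \<in> interior I \<longrightarrow> (\<forall>k\<in>K. summable (\<lambda>j. norm (piece (g k) j t))
        \<and> of_real (2 * pi) * (cis (p k t) * c k t) = (\<Sum>j. piece (g k) j t))"
        by eventually_elim blast
    qed
    also have "\<dots> \<le> ennreal (L4_const B b) * (ennreal (2 * pi) * (N + of_nat (card K) * ennreal \<eta>))\<^sup>2"
    proof (intro mult_left_mono power_mono)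
      have "(\<Sum>k\<in>K. sobolev_sq b (g k)) \<le> (\<Sum>k\<in>K. ennreal (2 * pi) * ((H k)\<^sup>2 + ennreal \<eta>))"
        using G by (intro sum_mono) (auto simp: g_def)
      also have "\<dots> = ennreal (2 * pi) * (N + of_nat (card K) * ennreal \<eta>)"
        by (simp only: N_eq sum_distrib_left[symmetric] sum.distrib sum_constant)
      finally show "(\<Sum>k\<in>K. sobolev_sq b (g k)) \<le> ennreal (2 * pi) * (N + of_nat (card K) * ennreal \<eta>)" .
    qed auto
    finally show ?thesis .
  qed
  obtain s where s: "N = ennreal s" "0 \<le> s" using True by (cases N) auto
  have C: "0 \<le> L4_const B b" using L4_const_pos[OF B b] by simp
  have "?X \<le> ennreal (L4_const B b * (2 * pi * (s + real (card K) * inverse (real (Suc n))))\<^sup>2)" for n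
  proof -
    have "ennreal (L4_const B b * (2 * pi * (s + real (card K) * inverse (real (Suc n))))\<^sup>2)
      = ennreal (L4_const B b) * (ennreal (2 * pi) * (N + of_nat (card K) * ennreal (inverse (real (Suc n)))))\<^sup>2"
      unfolding s ennreal_of_nat_eq_real_of_nat using s(2) C
      by (simp only: ennreal_mult[symmetric] ennreal_plus[symmetric] ennreal_power of_nat_0_le_iff inverse_nonnegative_iff_nonnegative mult_nonneg_nonneg add_nonneg_nonneg pi_ge_zero zero_le_numeral zero_le_power)
    then show ?thesis using approx[of "inverse (real (Suc n))"] by simp
  qed
  moreover have "(\<lambda>n. ennreal (L4_const B b * (2 * pi * (s + real (card K) * inverse (real (Suc n))))\<^sup>2))
      \<longlonglongrightarrow> ennreal (L4_const B b * (2 * pi * (s + real (card K) * 0))\<^sup>2)"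
    by (intro tendsto_ennrealI tendsto_intros LIMSEQ_inverse_real_of_nat)
  ultimately have "?X \<le> ennreal (L4_const B b * (2 * pi * (s + real (card K) * 0))\<^sup>2)"
    by (intro LIMSEQ_le_const) auto
  also have "L4_const B b * (2 * pi * (s + real (card K) * 0))\<^sup>2 = 4 * pi\<^sup>2 * L4_const B b * s\<^sup>2" by (simp add: power2_eq_square)
  also have "ennreal (4 * pi\<^sup>2 * L4_const B b * s\<^sup>2) = ennreal (4 * pi\<^sup>2 * L4_const B b) * N\<^sup>2"
    unfolding s using C s(2) by (simp add: ennreal_mult ennreal_power)
  finally show ?thesis .
qed

lemma japanese_powr_0: "japanese x powr (2 * 0) = 1"
proof -
  have "1 + x\<^sup>2 \<noteq> 0" by (metis add_pos_nonneg less_irrefl zero_le_power2 zero_less_one)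
  then show ?thesis by (simp add: japanese_def)
qed

text \<open>Passing from the low frequencies to the whole \<open>dual_grid\<close> only adds
  nonnegative terms. The fourth root of the squared sum is the square root that defines
  \<open>Xh_norm\<close>.\<close>

lemma Lp_norm_4_proj_le:
  assumes a: "a \<in> borel_measurable lebesgue" "Linf_norm a < \<infinity>" and \<Lambda>: "0 < \<Lambda>" "\<Lambda> < 1/2" and b: "3/8 < b"
    and h: "0 < h" "h \<le> min 1 (pi * (1/2 - \<Lambda>) / (2 * japanese (real_of_ereal (Linf_norm a))))"
    and I: "is_interval I" "bounded I"
  shows "Lp_norm 4 I (\<lambda>t. proj \<Lambda> h (U t))
    \<le> ennreal ((4 * pi\<^sup>2 * L4_const (disc_const \<Lambda>) b) powr (1/4)) * Xh_norm h a 0 b I (\<lambda>t. proj \<Lambda> h (U t))"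
proof -
  let ?C = "4 * pi\<^sup>2 * L4_const (disc_const \<Lambda>) b" and ?K = "low_freqs \<Lambda> h"
  define H where "H k = (Hb_norm_on b I (\<lambda>t. cis (phase_h h a k t) * fcoef (proj \<Lambda> h (U t)) k))\<^sup>2" for k
  have C: "0 < ?C" using L4_const_pos[OF disc_const_nonneg[OF \<Lambda>] b] by simp
  have "phase_h h a k \<in> borel_measurable borel" for k
    using phase_h_properties(1)[OF a \<Lambda> h] by (rule borel_measurable_continuous_onI)
  note L = L4_of_restriction_norm[OF phase_h_properties(2)[OF a \<Lambda> h] finite_low_freqs disc_const_nonneg[OF \<Lambda>] b this I]
  have eq: "(\<Sum>k\<in>?K. (Hb_norm_on b I (\<lambda>t. cis (phase_h h a k t) * fcoef (U t) k))\<^sup>2) = (\<Sum>k\<in>?K. H k)"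
    by (intro sum.cong refl) (simp add: H_def fcoef_proj)
  have "(\<Sum>k\<in>?K. H k) \<le> (\<Sum>k\<in>dual_grid h. H k)"
    by (rule sum_mono2) (auto simp: low_freqs_def dual_grid_def)
  then have le: "(\<integral>\<^sup>+(t, x). ennreal (norm (proj \<Lambda> h (U t) x) powr 4) \<partial>lebesgue_on (I \<times> {0..<2*pi}))
      \<le> ennreal ?C * (\<Sum>k\<in>dual_grid h. H k)\<^sup>2"
    using L[of "\<lambda>k t. fcoef (U t) k"] unfolding eq Defs.proj_def case_prod_beta
    by (meson mult_left_mono power_mono order_trans zero_le)
  have "Lp_norm 4 I (\<lambda>t. proj \<Lambda> h (U t)) \<le> epowr (ennreal ?C * (\<Sum>k\<in>dual_grid h. H k)\<^sup>2) ((1/2)/2)"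
    unfolding Lp_norm_def using epowr_mono[OF le, of "1/4"] by simp
  also have "\<dots> = ennreal (?C powr (1/4)) * epowr (\<Sum>k\<in>dual_grid h. H k) (1/2)"
    by (simp only: epowr_cmult[OF C] epowr_square) simp
  also have "epowr (\<Sum>k\<in>dual_grid h. H k) (1/2) = Xh_norm h a 0 b I (\<lambda>t. proj \<Lambda> h (U t))"
    unfolding Xh_norm_def H_def japanese_powr_0 by (simp only: ennreal_1 mult_1)
  finally show ?thesis .
qed

section \<open>The dual inequality\<close>

lemma measurable_completion_cong_AE:
  fixes f g :: "'a \<Rightarrow> 'b::topological_space"
  assumes f: "f \<in> borel_measurable M" and ae: "AE x in M. f x = g x"
  shows "g \<in> borel_measurable (completion M)"
proof (rule measurableI)
  fix A :: "'b set" assume A: "A \<in> sets borel"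
  show "g -` A \<inter> space (completion M) \<in> sets (completion M)"
  proof (rule completion.in_sets_AE)
    have "AE x in completion M. f x = g x" by (rule AE_completion[OF ae])
    then show "AE x in completion M. x \<in> f -` A \<inter> space M \<longleftrightarrow> x \<in> g -` A \<inter> space (completion M)"
      by eventually_elim auto
    show "f -` A \<inter> space M \<in> sets (completion M)" using measurable_sets[OF f A] by (rule sets_completionI_sets)
  qed auto
qed simp

lemma integral_completion_cong_AE:
  fixes f g :: "'a \<Rightarrow> complex"
  assumes "f \<in> borel_measurable M" and "AE x in M. f x = g x"
  shows "integral\<^sup>L (completion M) f = integral\<^sup>L (completion M) g"
  by (rule integral_cong_AE[OF measurable_completion[OF assms(1)] measurable_completion_cong_AE[OF assms] AE_completion[OF assms(2)]])

lemma integrable_completion_cong_AE: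
  fixes f g :: "'a \<Rightarrow> complex"
  assumes "integrable (completion M) f" and "f \<in> borel_measurable M" and "AE x in M. f x = g x"
  shows "integrable (completion M) g"
  by (rule integrable_cong_AE_imp[OF assms(1) measurable_completion_cong_AE[OF assms(2,3)]])
    (rule AE_completion, use assms(3) in eventually_elim, simp)

lemma norm_integral_le_nn_integral:
  fixes h :: "'a \<Rightarrow> complex"
  shows "ennreal (norm (integral\<^sup>L M h)) \<le> (\<integral>\<^sup>+x. ennreal (norm (h x)) \<partial>M)"
proof (cases "integrable M h")
  case True
  then show ?thesis by (rule integral_norm_bound_ennreal)
qed (simp add: not_integrable_integral_eq)

lemma norm_le_schwartz_seminorm:
  assumes "schwartz f" shows "norm (f t) \<le> schwartz_seminorm 0 0 f"
proof -
  obtain M where M: "\<And>t. \<bar>t\<bar> ^ 0 * norm (f t) \<le> M" using schwartz_bounded[OF assms, of 0] by blast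
  have "norm (of_real t ^ 0 * nderiv 0 f t) \<le> schwartz_seminorm 0 0 f"
    unfolding schwartz_seminorm_def
  proof (rule cSUP_upper)
    show "bdd_above (range (\<lambda>t. norm (of_real t ^ 0 * nderiv 0 f t)))"
      by (rule bdd_aboveI2[of _ _ M]) (use M in \<open>simp add: nderiv_def\<close>)
  qed simp
  then show ?thesis by (simp add: nderiv_def)
qed

lemma integrable_mult_schwartz:
  assumes F: "integrable lborel F" and f: "schwartz f"
  shows "integrable lborel (\<lambda>t. F t * f t)"
proof (rule Bochner_Integration.integrable_bound)
  have [measurable]: "F \<in> borel_measurable borel" "f \<in> borel_measurable borel"
    using F schwartz_integrable[OF f] by auto
  show "(\<lambda>t. F t * f t) \<in> borel_measurable lborel" by measurable
  show "integrable lborel (\<lambda>t. norm (F t) * schwartz_seminorm 0 0 f)" using F by simp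
  show "AE t in lborel. norm (F t * f t) \<le> norm (norm (F t) * schwartz_seminorm 0 0 f)"
  proof (rule AE_I2)
    fix t
    have "norm (F t * f t) \<le> norm (F t) * schwartz_seminorm 0 0 f"
      unfolding norm_mult by (intro mult_left_mono norm_le_schwartz_seminorm[OF f]) simp
    also have "\<dots> \<le> norm (norm (F t) * schwartz_seminorm 0 0 f)" by simp
    finally show "norm (F t * f t) \<le> norm (norm (F t) * schwartz_seminorm 0 0 f)" .
  qed
qed

text \<open>Integration against \<open>F\<close> is a tempered distribution that extends
  \<open>f\<close>, and its Fourier transform is the classical one; so it competes in the infimum.
  The factor \<open>1 / (2 * pi) <= 1\<close> is given away.\<close>

lemma Hb_norm_on_integrable_le:
  fixes F f :: "real \<Rightarrow> complex"
  assumes F: "integrable lborel F" and eq: "AE t in lborel. t \<in> interior I \<longrightarrow> f t = F t"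
  shows "(Hb_norm_on b I f)\<^sup>2 \<le> sobolev_sq b (\<lambda>\<tau>. LINT t|lborel. F t * cis (- (t * \<tau>)))"
proof -
  have [measurable]: "F \<in> borel_measurable borel" using F by auto
  define T where "T \<phi> = (LINT t|lborel. F t * \<phi> t)" for \<phi>
  define g where "g \<tau> = (LINT t|lborel. F t * cis (- (t * \<tau>)))" for \<tau>
  have g_meas [measurable]: "g \<in> borel_measurable borel" unfolding g_def[abs_def] by measurable
  have g_le: "norm (g \<tau>) \<le> (LINT t|lborel. norm (F t))" for \<tau>
    unfolding g_def by (rule order_trans[OF integral_norm_bound]) (simp add: norm_mult)
  have "tempered T"
    unfolding tempered_def
  proof (intro conjI allI impI exI)
    fix \<phi> \<psi> :: "real \<Rightarrow> complex" assume "schwartz \<phi>" "schwartz \<psi>"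
    then show "T (\<lambda>t. \<phi> t + \<psi> t) = T \<phi> + T \<psi>"
      unfolding T_def distrib_left by (intro Bochner_Integration.integral_add integrable_mult_schwartz F)
  next
    fix c and \<phi> :: "real \<Rightarrow> complex"
    show "T (\<lambda>t. c * \<phi> t) = c * T \<phi>" unfolding T_def by (simp only: mult.left_commute[of _ c] integral_mult_right_zero)
  next
    fix \<phi> :: "real \<Rightarrow> complex" assume \<phi>: "schwartz \<phi>"
    have "norm (T \<phi>) \<le> (LINT t|lborel. norm (F t * \<phi> t))" unfolding T_def by (rule integral_norm_bound)
    also have "\<dots> \<le> (LINT t|lborel. norm (F t) * schwartz_seminorm 0 0 \<phi>)"
    proof (rule integral_mono)
      show "integrable lborel (\<lambda>t. norm (F t * \<phi> t))" by (rule integrable_norm[OF integrable_mult_schwartz[OF F \<phi>]])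
      show "integrable lborel (\<lambda>t. norm (F t) * schwartz_seminorm 0 0 \<phi>)" using F by simp
    qed (auto simp: norm_mult intro!: mult_left_mono norm_le_schwartz_seminorm[OF \<phi>])
    \<comment> \<open>The distribution has order zero: only the supremum norm enters, and the
      constant is the L^1 norm of \<open>F\<close>.\<close>
    finally show "norm (T \<phi>) \<le> (LINT t|lborel. norm (F t)) * (\<Sum>j\<le>0. \<Sum>n\<le>0. schwartz_seminorm j n \<phi>)" by simp
  qed
  moreover have "restricts_to T I f"
    unfolding restricts_to_def
  proof (intro conjI allI impI)
    fix K assume K: "compact K \<and> K \<subseteq> interior I"
    then have [measurable]: "K \<in> sets borel" by (simp add: borel_compact)
    have ae: "AE t in lborel. indicator K t *\<^sub>R F t = indicator K t *\<^sub>R f t"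
      using eq by eventually_elim (use K in \<open>auto simp: indicator_def\<close>)
    have "integrable lborel (\<lambda>t. indicator K t *\<^sub>R F t)" using F by (rule integrable_mult_indicator[rotated]) simp
    then have "integrable lebesgue (\<lambda>t. indicator K t *\<^sub>R F t)" by (simp add: integrable_completion)
    then show "set_integrable lebesgue K f" unfolding set_integrable_def
      by (rule integrable_completion_cong_AE[OF _ _ ae]) simp
  next
    fix \<phi> assume \<phi>: "smooth \<phi> \<and> compact (closure {t. \<phi> t \<noteq> 0}) \<and> closure {t. \<phi> t \<noteq> 0} \<subseteq> interior I"
    have "nderiv 0 \<phi> differentiable (at t)" for t using \<phi> unfolding smooth_def by blast
    then have "continuous_on UNIV \<phi>" by (simp add: nderiv_def differentiable_imp_continuous_within continuous_at_imp_continuous_on)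
    then have [measurable]: "\<phi> \<in> borel_measurable borel" by (rule borel_measurable_continuous_onI)
    have "{t. \<phi> t \<noteq> 0} \<subseteq> interior I" using closure_subset[of "{t. \<phi> t \<noteq> 0}"] \<phi> by (meson order_trans)
    then have out: "\<phi> t = 0" if "t \<notin> interior I" for t using that by auto
    have "T \<phi> = (LINT t|lebesgue. F t * \<phi> t)" unfolding T_def by (rule integral_completion[symmetric]) simp
    also have "\<dots> = (LINT t|lebesgue. indicator (interior I) t *\<^sub>R (f t * \<phi> t))"
    proof (rule integral_completion_cong_AE)
      show "(\<lambda>t. F t * \<phi> t) \<in> borel_measurable lborel" by measurable
      show "AE t in lborel. F t * \<phi> t = indicator (interior I) t *\<^sub>R (f t * \<phi> t)"
        using eq by eventually_elim (auto simp: indicator_def out)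
    qed
    finally show "T \<phi> = (LINT t:interior I|lebesgue. f t * \<phi> t)" by (simp add: set_lebesgue_integral_def)
  qed
  ultimately have "Hb_norm_on b I f \<le> Hb_norm b T" unfolding Hb_norm_on_def by (intro INF_lower) simp
  also have "has_fourier T g"
    unfolding has_fourier_def
  proof (intro conjI allI impI)
    show "g \<in> borel_measurable lebesgue" by (rule measurable_completion) simp
    fix f :: "real \<Rightarrow> complex" assume f: "schwartz f"
    note fi = schwartz_integrable[OF f]
    then have [measurable]: "f \<in> borel_measurable borel" by auto
    have "integrable lborel (\<lambda>\<tau>. g \<tau> * f \<tau>)"
    proof (rule Bochner_Integration.integrable_bound)
      show "integrable lborel (\<lambda>\<tau>. (LINT t|lborel. norm (F t)) * norm (f \<tau>))" using fi by simp
      show "AE \<tau> in lborel. norm (g \<tau> * f \<tau>) \<le> norm ((LINT t|lborel. norm (F t)) * norm (f \<tau>))"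
        using g_le by (intro AE_I2) (simp add: norm_mult mult_right_mono)
    qed measurable
    then show "integrable lebesgue (\<lambda>\<tau>. g \<tau> * f \<tau>)" by (simp add: integrable_completion)
    have "T (fourier f) = (LINT t|lborel. F t * (LINT \<tau>|lborel. f \<tau> * cis (- (\<tau> * t))))"
      unfolding T_def by (simp add: fourier_eq_lborel)
    also have "\<dots> = (LINT \<tau>|lborel. f \<tau> * (LINT t|lborel. F t * cis (- (\<tau> * t))))"
      by (rule Fubini_bounded_kernel[OF F fi]) auto
    also have "\<dots> = (LINT \<tau>|lborel. g \<tau> * f \<tau>)" by (simp add: g_def mult.commute)
    also have "\<dots> = (LINT \<tau>|lebesgue. g \<tau> * f \<tau>)" by (rule integral_completion[symmetric]) simp
    finally show "T (fourier f) = (LINT \<tau>|lebesgue. g \<tau> * f \<tau>)" .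
  qed
  then have "Hb_norm b T \<le> epowr (ennreal (1 / (2 * pi)) * (\<integral>\<^sup>+\<tau>. ennreal (japanese \<tau> powr (2 * b) * (norm (g \<tau>))\<^sup>2) \<partial>lebesgue)) (1/2)"
    unfolding Hb_norm_def by (intro INF_lower) simp
  also have "\<dots> \<le> epowr (sobolev_sq b g) (1/2)"
  proof (rule epowr_mono)
    have "1 / (2 * pi) \<le> 1" using pi_gt3 by simp
    then have "ennreal (1 / (2 * pi)) * sobolev_sq b g \<le> 1 * sobolev_sq b g" by (intro mult_right_mono) (auto simp flip: ennreal_1)
    then show "ennreal (1 / (2 * pi)) * (\<integral>\<^sup>+\<tau>. ennreal (japanese \<tau> powr (2 * b) * (norm (g \<tau>))\<^sup>2) \<partial>lebesgue) \<le> sobolev_sq b g"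
      by (simp add: nn_integral_completion sobolev_sq_def)
  qed simp
  finally have "(Hb_norm_on b I f)\<^sup>2 \<le> (epowr (sobolev_sq b g) (1/2))\<^sup>2" by (intro power_mono) auto
  also have "\<dots> = sobolev_sq b g"
    by (cases "sobolev_sq b g") (auto simp: epowr_def ennreal_power powr_half_sqrt)
  finally show ?thesis unfolding g_def .
qed

section \<open>Duality with truncation to finitely many shells\<close>

definition shells :: "nat \<Rightarrow> real set" where
  "shells n = (\<Union>j<n. shell j)"

lemma shells_measurable [measurable]: "shells n \<in> sets borel"
  unfolding shells_def by measurable

lemma shells_bounded: "\<tau> \<in> shells n \<Longrightarrow> \<bar>\<tau>\<bar> \<le> 4 ^ n"
proof -
  assume "\<tau> \<in> shells n"
  then obtain j where "j < n" "\<bar>\<tau>\<bar> \<le> 4 ^ j" by (auto simp: shells_def shell_def)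
  moreover from \<open>j < n\<close> have "(4::real) ^ j \<le> 4 ^ n" by (intro power_increasing) auto
  ultimately show ?thesis by linarith
qed

lemma integrable_on_shells:
  fixes f :: "real \<Rightarrow> 'a::{banach, second_countable_topology}"
  assumes "f \<in> borel_measurable borel" and M: "\<And>\<tau>. norm (f \<tau>) \<le> M * indicator (shells n) \<tau>"
  shows "integrable lborel f"
proof (rule Bochner_Integration.integrable_bound)
  have "integrable lborel (indicator ({- (4 ^ n)..4 ^ n} :: real set) :: real \<Rightarrow> real)" by (simp add: integrable_indicator_iff)
  then show "integrable lborel (\<lambda>\<tau>. \<bar>M\<bar> * indicator ({- (4 ^ n)..4 ^ n} :: real set) \<tau> :: real)" by simp
  show "AE \<tau> in lborel. norm (f \<tau>) \<le> norm (\<bar>M\<bar> * indicator ({- (4 ^ n)..4 ^ n} :: real set) \<tau> :: real)"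
  proof (rule AE_I2)
    fix \<tau>
    show "norm (f \<tau>) \<le> norm (\<bar>M\<bar> * indicator ({- (4 ^ n)..4 ^ n} :: real set) \<tau> :: real)"
    proof (cases "\<tau> \<in> shells n")
      case True
      then show ?thesis using M[of \<tau>] shells_bounded[OF True] by (simp add: indicator_def abs_le_iff)
    next
      case False
      then have "norm (f \<tau>) \<le> 0" using M[of \<tau>] by simp
      then show ?thesis by simp
    qed
  qed
qed (use assms(1) in simp)

lemma piece_sum_eq_truncation:
  assumes G: "integrable lborel G" and out: "\<And>\<tau>. \<tau> \<notin> shells n \<Longrightarrow> G \<tau> = 0"
  shows "(\<Sum>j<n. piece G j t) = (LINT \<tau>|lborel. G \<tau> * cis (t * \<tau>))"
proof -
  have i: "integrable lborel (\<lambda>\<tau>. (G \<tau> * indicator (shell j) \<tau>) * cis (t * \<tau>))" for j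
  proof (rule Bochner_Integration.integrable_bound[OF G])
    have "G \<in> borel_measurable borel" using G by auto
    then show "(\<lambda>\<tau>. (G \<tau> * indicator (shell j) \<tau>) * cis (t * \<tau>)) \<in> borel_measurable lborel" by measurable
  qed (auto simp: norm_mult indicator_def)
  have "(\<Sum>j<n. (G \<tau> * indicator (shell j) \<tau>) * cis (t * \<tau>)) = G \<tau> * cis (t * \<tau>)" for \<tau>
  proof -
    obtain i where i: "\<forall>j. \<tau> \<in> shell j \<longleftrightarrow> j = i" using shell_unique by blast
    have "(\<Sum>j<n. (G \<tau> * indicator (shell j) \<tau>) * cis (t * \<tau>)) = (\<Sum>j<n. if j = i then G \<tau> * cis (t * \<tau>) else 0)"
      using i by (intro sum.cong) (auto simp: indicator_def)
    moreover have "G \<tau> = 0" if "\<not> i < n" using i that by (intro out) (auto simp: shells_def)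
    ultimately show ?thesis by auto
  qed
  then show ?thesis unfolding piece_def by (subst Bochner_Integration.integral_sum[symmetric, OF i]) (simp only:)
qed

text \<open>The function \<open>G\<close> is the truncation to \<open>shells n\<close> of \<open>\<langle>\<tau>\<rangle>\<^sup>-\<^sup>2\<^sup>b g(\<tau>)\<close>, which is dual to \<open>g\<close> in the weighted norms.\<close>

lemma truncated_dual_function:
  fixes F :: "real \<Rightarrow> complex"
  assumes F: "integrable lborel F" and b: "0 \<le> b"
  defines "g \<equiv> \<lambda>\<tau>. LINT t|lborel. F t * cis (- (t * \<tau>))"
  obtains G z where "G \<in> borel_measurable borel" "0 \<le> z" "sobolev_sq b G = ennreal z"
    "ennreal z = (\<integral>\<^sup>+\<tau>\<in>shells n. ennreal (japanese \<tau> powr (2 * (- b)) * (norm (g \<tau>))\<^sup>2) \<partial>lborel)"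
    "integrable lborel (\<lambda>t. F t * cnj (\<Sum>j<n. piece G j t))"
    "of_real z = (LINT t|lborel. F t * cnj (\<Sum>j<n. piece G j t))"
proof -
  have [measurable]: "F \<in> borel_measurable borel" using F by auto
  have g_meas [measurable]: "g \<in> borel_measurable borel" unfolding g_def by measurable
  have j_meas [measurable]: "japanese \<in> borel_measurable borel" unfolding japanese_def[abs_def] by measurable
  define M where "M = (LINT t|lborel. norm (F t))"
  have g_le: "norm (g \<tau>) \<le> M" for \<tau>
    unfolding g_def M_def by (rule order_trans[OF integral_norm_bound]) (simp add: norm_mult)
  have M: "0 \<le> M" unfolding M_def by simp
  define w where "w \<tau> = japanese \<tau> powr (2 * (- b))" for \<tau>
  have w_meas [measurable]: "w \<in> borel_measurable borel" unfolding w_def[abs_def] by measurable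
  have j1: "1 \<le> japanese \<tau>" for \<tau> by (simp add: japanese_def)
  have w: "0 \<le> w \<tau>" "w \<tau> \<le> 1" for \<tau>
  proof -
    show "0 \<le> w \<tau>" by (simp add: w_def)
    have "w \<tau> \<le> japanese \<tau> powr 0" unfolding w_def using j1 b by (intro powr_mono) auto
    then show "w \<tau> \<le> 1" using j1[of \<tau>] by simp
  qed
  \<comment> \<open>This identity makes the squared \<open>b\<close>-norm of \<open>w * g\<close>
    equal to the squared \<open>- b\<close>-norm of \<open>g\<close>, so that one number
    \<open>z\<close> serves both sides of the duality.\<close>
  have ww: "japanese \<tau> powr (2 * b) * (w \<tau>)\<^sup>2 = w \<tau>" for \<tau>
    using j1[of \<tau>] unfolding w_def power2_eq_square powr_add[symmetric] by simp
  \<comment> \<open>The cutoff makes \<open>G\<close> integrable and \<open>z\<close> finite, since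
    \<open>g\<close> is bounded by the L^1 norm of \<open>F\<close>.\<close>
  define G where "G \<tau> = of_real (w \<tau> * indicator (shells n) \<tau>) * g \<tau>" for \<tau>
  define h where "h \<tau> = w \<tau> * (norm (g \<tau>))\<^sup>2 * indicator (shells n) \<tau>" for \<tau>
  define v where "v t = (\<Sum>j<n. piece G j t)" for t
  have G_meas [measurable]: "G \<in> borel_measurable borel" unfolding G_def[abs_def] by measurable
  have Gi: "integrable lborel G"
  proof (rule integrable_on_shells[OF G_meas])
    fix \<tau>
    have "w \<tau> * norm (g \<tau>) \<le> 1 * M" using w g_le M by (intro mult_mono) auto
    then show "norm (G \<tau>) \<le> M * indicator (shells n) \<tau>"
      using w(1)[of \<tau>] by (auto simp: G_def norm_mult indicator_def)
  qed
  have hi: "integrable lborel h"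
  proof (rule integrable_on_shells)
    show "h \<in> borel_measurable borel" unfolding h_def[abs_def] by measurable
    fix \<tau>
    have "w \<tau> * (norm (g \<tau>))\<^sup>2 \<le> 1 * M\<^sup>2" using w g_le M by (intro mult_mono power_mono) auto
    then show "norm (h \<tau>) \<le> M\<^sup>2 * indicator (shells n) \<tau>"
      using w(1)[of \<tau>] by (auto simp: h_def indicator_def)
  qed
  have h0: "0 \<le> h \<tau>" for \<tau> using w by (simp add: h_def)
  define z where "z = (LINT \<tau>|lborel. h \<tau>)"
  have z0: "0 \<le> z" unfolding z_def using h0 by simp
  have z_nn: "(\<integral>\<^sup>+\<tau>. ennreal (h \<tau>) \<partial>lborel) = ennreal z"
    unfolding z_def using h0 by (intro nn_integral_eq_integral[OF hi]) simp
  have "sobolev_sq b G = (\<integral>\<^sup>+\<tau>. ennreal (h \<tau>) \<partial>lborel)" unfolding sobolev_sq_def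
  proof (intro nn_integral_cong arg_cong[of _ _ ennreal])
    fix \<tau>
    have "japanese \<tau> powr (2 * b) * (norm (G \<tau>))\<^sup>2 = (japanese \<tau> powr (2 * b) * (w \<tau>)\<^sup>2) * ((norm (g \<tau>))\<^sup>2 * indicator (shells n) \<tau>)"
      by (simp add: G_def norm_mult power_mult_distrib indicator_def)
    then show "japanese \<tau> powr (2 * b) * (norm (G \<tau>))\<^sup>2 = h \<tau>" unfolding ww h_def by simp
  qed
  then have wG: "sobolev_sq b G = ennreal z" using z_nn by simp
  have z_eq: "ennreal z = (\<integral>\<^sup>+\<tau>\<in>shells n. ennreal (japanese \<tau> powr (2 * (- b)) * (norm (g \<tau>))\<^sup>2) \<partial>lborel)"
    unfolding z_nn[symmetric] h_def w_def by (intro nn_integral_cong) (simp add: indicator_def)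
  have v_eq: "v t = (LINT \<tau>|lborel. G \<tau> * cis (t * \<tau>))" for t
    unfolding v_def by (rule piece_sum_eq_truncation[OF Gi]) (simp add: G_def)
  have v_meas [measurable]: "v \<in> borel_measurable borel" unfolding v_def[abs_def] by measurable
  have Fv: "integrable lborel (\<lambda>t. F t * cnj (v t))"
  proof (rule Bochner_Integration.integrable_bound)
    show "integrable lborel (\<lambda>t. norm (F t) * (LINT \<tau>|lborel. norm (G \<tau>)))" using F by simp
    have "norm (v t) \<le> (LINT \<tau>|lborel. norm (G \<tau>))" for t
      unfolding v_eq by (rule order_trans[OF integral_norm_bound]) (simp add: norm_mult)
    then show "AE t in lborel. norm (F t * cnj (v t)) \<le> norm (norm (F t) * (LINT \<tau>|lborel. norm (G \<tau>)))"
      by (intro AE_I2) (simp add: norm_mult mult_left_mono)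
  qed measurable
  have "of_real z = (LINT \<tau>|lborel. cnj (G \<tau>) * g \<tau>)"
  proof -
    have "cnj (G \<tau>) * g \<tau> = of_real (h \<tau>)" for \<tau>
    proof -
      have "cnj (G \<tau>) * g \<tau> = of_real (w \<tau> * indicator (shells n) \<tau>) * (g \<tau> * cnj (g \<tau>))"
        by (simp add: G_def)
      also have "\<dots> = of_real (w \<tau> * indicator (shells n) \<tau> * (norm (g \<tau>))\<^sup>2)"
        by (simp only: complex_norm_square[symmetric] of_real_mult)
      also have "w \<tau> * indicator (shells n) \<tau> * (norm (g \<tau>))\<^sup>2 = h \<tau>" by (simp add: h_def)
      finally show ?thesis .
    qed
    then show ?thesis by (simp add: z_def)
  qed
  \<comment> \<open>The multiplication formula moves the transform from \<open>F\<close> to the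
    truncated dual function.\<close>
  also have "\<dots> = (LINT t|lborel. F t * (LINT \<tau>|lborel. cnj (G \<tau>) * cis (- (t * \<tau>))))"
    unfolding g_def by (rule Fubini_bounded_kernel) (use Gi F in \<open>auto simp: integrable_cnj\<close>)
  also have "\<dots> = (LINT t|lborel. F t * cnj (v t))"
  proof -
    have "(LINT \<tau>|lborel. cnj (G \<tau>) * cis (- (t * \<tau>))) = cnj (v t)" for t
    proof -
      have "(LINT \<tau>|lborel. cnj (G \<tau>) * cis (- (t * \<tau>))) = (LINT \<tau>|lborel. cnj (G \<tau> * cis (t * \<tau>)))"
        by (simp add: cis_cnj del: Bochner_Integration.integral_cnj)
      also have "\<dots> = cnj (v t)" unfolding v_eq by (rule Bochner_Integration.integral_cnj)
      finally show ?thesis .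
    qed
    then show ?thesis by simp
  qed
  finally show thesis using that[OF G_meas z0 wG z_eq] Fv unfolding v_def by blast
qed

text \<open>The dual pairing bounds the truncated norm \<open>z\<close> by \<open>\<parallel>u\<parallel>\<^bsub>4/3\<^esub> \<parallel>V\<parallel>\<^sub>4 \<le> C \<parallel>u\<parallel>\<^bsub>4/3\<^esub> z\<^bsup>1/2\<^esup>\<close>,
  where \<open>V\<close> is built from the truncated dual functions; since \<open>z\<close> is finite, it can be cancelled.\<close>

lemma truncated_dual_estimate:
  fixes u :: "real \<times> real \<Rightarrow> complex"
  assumes sep: "separated p K B" and K: "finite K" and B: "0 \<le> B" and b: "3 / 8 < b"
    and p: "\<And>k. p k \<in> borel_measurable borel"
    and u: "integrable (lborel \<Otimes>\<^sub>M lborel) u" and out: "\<And>t x. t \<notin> {- real Q..real Q} \<or> x \<notin> {0..2 * pi} \<Longrightarrow> u (t, x) = 0"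
    and \<alpha>: "0 \<le> \<alpha>" "(\<integral>\<^sup>+z. ennreal (norm (u z) powr (4/3)) \<partial>(lborel \<Otimes>\<^sub>M lborel)) = ennreal \<alpha>"
  defines "F \<equiv> \<lambda>k t. cis (p k t) * (of_real (1 / (2 * pi)) * (LINT x|lborel. u (t, x) * cis (- (of_int k * x))))"
  defines "g \<equiv> \<lambda>k \<tau>. LINT t|lborel. F k t * cis (- (t * \<tau>))"
  shows "integrable lborel (F k)"
    and "(\<Sum>k\<in>K. \<integral>\<^sup>+\<tau>\<in>shells n. ennreal (japanese \<tau> powr (2 * (- b)) * (norm (g k \<tau>))\<^sup>2) \<partial>lborel) \<le> ennreal (sqrt (L4_const B b * \<alpha> ^ 3))"
proof -
  note [measurable] = p
  have u_meas [measurable]: "u \<in> borel_measurable (borel \<Otimes>\<^sub>M borel)" using borel_measurable_integrable[OF u] by simp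
  show Fi: "integrable lborel (F k)" for k
  proof -
    have "integrable (lborel \<Otimes>\<^sub>M lborel) (\<lambda>z. u z * cis (- (of_int k * snd z)))"
      by (rule Bochner_Integration.integrable_bound[OF u]) (auto simp: norm_mult)
    then have i: "integrable lborel (\<lambda>t. LINT x|lborel. u (t, x) * cis (- (of_int k * x)))"
      by (drule_tac lborel_pair.integrable_fst') simp
    show ?thesis
    proof (rule Bochner_Integration.integrable_bound)
      show "integrable lborel (\<lambda>t. of_real (1 / (2 * pi)) * (LINT x|lborel. u (t, x) * cis (- (of_int k * x))) :: complex)"
        using i by (rule integrable_mult_right)
      show "F k \<in> borel_measurable lborel" unfolding F_def by measurable
    qed (rule AE_I2, simp only: F_def norm_mult norm_cis mult_1 order_refl)
  qed
  have b0: "0 \<le> b" using b by simp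
  let ?Z = "\<lambda>k. \<integral>\<^sup>+\<tau>\<in>shells n. ennreal (japanese \<tau> powr (2 * (- b)) * (norm (g k \<tau>))\<^sup>2) \<partial>lborel"
  let ?P = "\<lambda>k G z. G \<in> borel_measurable borel \<and> 0 \<le> z \<and> sobolev_sq b G = ennreal z \<and> ennreal z = ?Z k
      \<and> integrable lborel (\<lambda>t. F k t * cnj (\<Sum>j<n. piece G j t)) \<and> of_real z = (LINT t|lborel. F k t * cnj (\<Sum>j<n. piece G j t))"
  have ex: "\<forall>k. \<exists>G z. ?P k G z"
  proof
    fix k
    show "\<exists>G z. ?P k G z" unfolding g_def
      by (rule truncated_dual_function[OF Fi[of k] b0, of n]) (intro exI conjI; assumption)
  qed
  obtain G where "\<forall>k. \<exists>z. ?P k (G k) z" by (rule exE[OF choice[OF ex]])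
  from choice[OF this] obtain z where Gz: "\<forall>k. ?P k (G k) (z k)" by (rule exE)
  note Gz = Gz[rule_format]
  note G [measurable] = Gz[THEN conjunct1]
  note z = Gz[THEN conjunct2, THEN conjunct1] Gz[THEN conjunct2, THEN conjunct2, THEN conjunct1]
  note zZ = Gz[THEN conjunct2, THEN conjunct2, THEN conjunct2, THEN conjunct1]
  note vi = Gz[THEN conjunct2, THEN conjunct2, THEN conjunct2, THEN conjunct2, THEN conjunct1]
  note zv = Gz[THEN conjunct2, THEN conjunct2, THEN conjunct2, THEN conjunct2, THEN conjunct2]
  define v where "v k t = (\<Sum>j<n. piece (G k) j t)" for k t
  define S where "S t x = (\<Sum>j. ennreal (norm (\<Sum>k\<in>K. piece (G k) j t * cis (of_int k * x - p k t))))" for t x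
  have S_meas [measurable]: "case_prod S \<in> borel_measurable (borel \<Otimes>\<^sub>M borel)"
    unfolding S_def[abs_def] by measurable
  \<comment> \<open>\<open>V\<close> carries the phases \<open>- p k t\<close>, so that conjugation
    restores the factor \<open>cis (p k t)\<close> in \<open>F\<close>. It is a finite partial sum
    of the series in \<open>S\<close> and hence bounded by it.\<close>
  define V where "V t x = (\<Sum>k\<in>K. v k t * cis (of_int k * x - p k t))" for t x
  have VS: "ennreal (norm (V t x)) \<le> S t x" for t x
  proof -
    have "V t x = (\<Sum>j<n. \<Sum>k\<in>K. piece (G k) j t * cis (of_int k * x - p k t))"
      unfolding V_def v_def sum_distrib_right by (rule sum.swap)
    then have "ennreal (norm (V t x)) \<le> ennreal (\<Sum>j<n. norm (\<Sum>k\<in>K. piece (G k) j t * cis (of_int k * x - p k t)))"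
      by (simp only: ennreal_leI norm_sum)
    also have "\<dots> = (\<Sum>j<n. ennreal (norm (\<Sum>k\<in>K. piece (G k) j t * cis (of_int k * x - p k t))))"
      by (rule sum_ennreal[symmetric]) simp
    also have "\<dots> \<le> S t x" unfolding S_def by (rule sum_le_suminf) auto
    finally show ?thesis .
  qed
  define Z where "Z = (\<Sum>k\<in>K. z k)"
  have Z0: "0 \<le> Z" unfolding Z_def using z by (intro sum_nonneg) auto
  \<comment> \<open>Parseval in \<open>x\<close> for fixed \<open>t\<close>, with the coefficient
    integrals written out: the sum over \<open>k\<close> is \<open>1 / (2 * pi)\<close> times the
    integral of \<open>u * cnj V\<close>, and this factor is bounded by 1.\<close>
  have slice: "ennreal (norm (\<Sum>k\<in>K. F k t * cnj (v k t))) \<le> (\<integral>\<^sup>+x. ennreal (norm (u (t, x))) * S t x \<partial>lborel)"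
    if ut: "integrable lborel (\<lambda>x. u (t, x))" for t
  proof -
    have ui: "integrable lborel (\<lambda>x. u (t, x) * cis (- (of_int k * x)))" for k
    proof (rule Bochner_Integration.integrable_bound[OF ut])
      have [measurable]: "(\<lambda>x. u (t, x)) \<in> borel_measurable borel" using ut by auto
      show "(\<lambda>x. u (t, x) * cis (- (of_int k * x))) \<in> borel_measurable lborel" by measurable
    qed (simp add: norm_mult)
    define c where "c k = cis (p k t) * of_real (1 / (2 * pi)) * cnj (v k t)" for k
    have "(\<Sum>k\<in>K. F k t * cnj (v k t)) = (\<Sum>k\<in>K. LINT x|lborel. c k * (u (t, x) * cis (- (of_int k * x))))"
    proof (rule sum.cong[OF refl])
      fix k
      have "F k t * cnj (v k t) = c k * (LINT x|lborel. u (t, x) * cis (- (of_int k * x)))"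
        unfolding F_def c_def by (simp only: ac_simps)
      then show "F k t * cnj (v k t) = (LINT x|lborel. c k * (u (t, x) * cis (- (of_int k * x))))"
        by (simp only: integral_mult_right_zero)
    qed
    also have "\<dots> = (LINT x|lborel. (\<Sum>k\<in>K. c k * (u (t, x) * cis (- (of_int k * x)))))"
      by (rule Bochner_Integration.integral_sum[symmetric]) (rule integrable_mult_right[OF ui])
    also have "(\<lambda>x. \<Sum>k\<in>K. c k * (u (t, x) * cis (- (of_int k * x)))) = (\<lambda>x. of_real (1 / (2 * pi)) * (u (t, x) * cnj (V t x)))"
    proof
      fix x
      have "c k * (u (t, x) * cis (- (of_int k * x))) = of_real (1 / (2 * pi)) * (u (t, x) * cnj (v k t * cis (of_int k * x - p k t)))" for k
      proof -
        have "cnj (cis (of_int k * x - p k t)) = cis (p k t) * cis (- (of_int k * x))"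
          by (simp add: cis_cnj cis_mult)
        then show ?thesis unfolding c_def complex_cnj_mult by (simp only: ac_simps)
      qed
      then show "(\<Sum>k\<in>K. c k * (u (t, x) * cis (- (of_int k * x)))) = of_real (1 / (2 * pi)) * (u (t, x) * cnj (V t x))"
        unfolding V_def cnj_sum sum_distrib_left by (simp only:)
    qed
    finally have "ennreal (norm (\<Sum>k\<in>K. F k t * cnj (v k t))) \<le> (\<integral>\<^sup>+x. ennreal (norm (of_real (1 / (2 * pi)) * (u (t, x) * cnj (V t x)))) \<partial>lborel)"
      by (simp only: norm_integral_le_nn_integral)
    also have "\<dots> \<le> (\<integral>\<^sup>+x. ennreal (norm (u (t, x))) * S t x \<partial>lborel)"
    proof (rule nn_integral_mono)
      fix x
      have "norm (of_real (1 / (2 * pi)) * (u (t, x) * cnj (V t x))) = norm (of_real (1 / (2 * pi)) :: complex) * (norm (u (t, x)) * norm (V t x))"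
        by (simp only: norm_mult complex_mod_cnj)
      also have "norm (of_real (1 / (2 * pi)) :: complex) * (norm (u (t, x)) * norm (V t x)) = 1 / (2 * pi) * (norm (u (t, x)) * norm (V t x))"
        unfolding norm_of_real by simp
      also have "\<dots> \<le> 1 * (norm (u (t, x)) * norm (V t x))" using pi_gt3 by (intro mult_right_mono) auto
      finally have "ennreal (norm (of_real (1 / (2 * pi)) * (u (t, x) * cnj (V t x)))) \<le> ennreal (norm (u (t, x)) * norm (V t x))"
        by (simp only: mult_1 ennreal_leI)
      also have "\<dots> = ennreal (norm (u (t, x))) * ennreal (norm (V t x))" by (rule ennreal_mult) auto
      also have "\<dots> \<le> ennreal (norm (u (t, x))) * S t x" by (rule mult_left_mono[OF VS]) simp
      finally show "ennreal (norm (of_real (1 / (2 * pi)) * (u (t, x) * cnj (V t x)))) \<le> ennreal (norm (u (t, x))) * S t x" .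
    qed
    finally show ?thesis .
  qed
  define y where "y w = S (fst w) (snd w) * indicator {0..2 * pi} (snd w) * indicator {- real Q..real Q} (fst w)" for w
  have y_meas [measurable]: "y \<in> borel_measurable (borel \<Otimes>\<^sub>M borel)" unfolding y_def[abs_def] by measurable
  have "of_real Z = (LINT t|lborel. (\<Sum>k\<in>K. F k t * cnj (v k t)))"
    unfolding Z_def of_real_sum zv v_def by (rule Bochner_Integration.integral_sum[symmetric]) (rule vi)
  then have "ennreal Z = ennreal (norm (LINT t|lborel. (\<Sum>k\<in>K. F k t * cnj (v k t))))"
    using Z0 by (metis abs_of_nonneg norm_of_real)
  also have "\<dots> \<le> (\<integral>\<^sup>+t. ennreal (norm (\<Sum>k\<in>K. F k t * cnj (v k t))) \<partial>lborel)" by (rule norm_integral_le_nn_integral)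
  also have "\<dots> \<le> (\<integral>\<^sup>+t. (\<integral>\<^sup>+x. ennreal (norm (u (t, x))) * S t x \<partial>lborel) \<partial>lborel)"
  proof (rule nn_integral_mono_AE)
    show "AE t in lborel. ennreal (norm (\<Sum>k\<in>K. F k t * cnj (v k t))) \<le> (\<integral>\<^sup>+x. ennreal (norm (u (t, x))) * S t x \<partial>lborel)"
      using lborel_pair.AE_integrable_fst'[OF u]
    proof eventually_elim
      case (elim t)
      then show ?case by (rule slice)
    qed
  qed
  \<comment> \<open>\<open>norm (u (t, x))\<close> is the cube of its cube root, the form that
    \<open>nn_integral_Holder_4\<close> asks for. \<open>S\<close> may be cut off to the rectangle,
    outside of which \<open>u\<close> vanishes.\<close>
  also have "\<dots> = (\<integral>\<^sup>+t. (\<integral>\<^sup>+x. ennreal (norm (u (t, x)) powr (1/3)) ^ 3 * y (t, x) \<partial>lborel) \<partial>lborel)"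
  proof (intro nn_integral_cong)
    fix t x
    show "ennreal (norm (u (t, x))) * S t x = ennreal (norm (u (t, x)) powr (1/3)) ^ 3 * y (t, x)"
    proof (cases "u (t, x) = 0")
      case False
      then have "t \<in> {- real Q..real Q}" "x \<in> {0..2 * pi}" using out[of t x] by auto
      moreover have "ennreal (norm (u (t, x)) powr (1/3)) ^ 3 = ennreal (norm (u (t, x)))"
        using False by (simp add: ennreal_power powr_power)
      ultimately show ?thesis by (simp add: y_def)
    qed simp
  qed
  also have "\<dots> = (\<integral>\<^sup>+w. ennreal (norm (u w) powr (1/3)) ^ 3 * y w \<partial>(lborel \<Otimes>\<^sub>M lborel))"
    by (rule lborel.nn_integral_fst) measurable
  finally have "(ennreal Z) ^ 4 \<le> (\<integral>\<^sup>+w. ennreal (norm (u w) powr (1/3)) ^ 3 * y w \<partial>(lborel \<Otimes>\<^sub>M lborel)) ^ 4"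
    by (rule power_mono) simp
  also have "\<dots> \<le> (\<integral>\<^sup>+w. ennreal (norm (u w) powr (1/3)) ^ 4 \<partial>(lborel \<Otimes>\<^sub>M lborel)) ^ 3 * (\<integral>\<^sup>+w. y w ^ 4 \<partial>(lborel \<Otimes>\<^sub>M lborel))"
    by (rule nn_integral_Holder_4) measurable
  also have "(\<integral>\<^sup>+w. ennreal (norm (u w) powr (1/3)) ^ 4 \<partial>(lborel \<Otimes>\<^sub>M lborel)) = ennreal \<alpha>"
    unfolding \<alpha>(2)[symmetric]
  proof (rule nn_integral_cong)
    fix w
    show "ennreal (norm (u w) powr (1/3)) ^ 4 = ennreal (norm (u w) powr (4/3))"
      by (cases "u w = 0") (simp_all add: ennreal_power powr_power)
  qed
  also have "(\<integral>\<^sup>+w. y w ^ 4 \<partial>(lborel \<Otimes>\<^sub>M lborel)) \<le> ennreal (L4_const B b) * (ennreal Z)\<^sup>2"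
  proof -
    have "(\<integral>\<^sup>+w. y w ^ 4 \<partial>(lborel \<Otimes>\<^sub>M lborel)) = (\<integral>\<^sup>+t. (\<integral>\<^sup>+x. y (t, x) ^ 4 \<partial>lborel) \<partial>lborel)"
      by (rule lborel.nn_integral_fst[symmetric]) measurable
    also have "\<dots> = (\<integral>\<^sup>+t\<in>{- real Q..real Q}. (\<integral>\<^sup>+x\<in>{0..2 * pi}. S t x ^ 4 \<partial>lborel) \<partial>lborel)"
    proof (rule nn_integral_cong)
      fix t
      have "y (t, x) ^ 4 = (S t x ^ 4 * indicator {0..2 * pi} x) * indicator {- real Q..real Q} t" for x
        by (simp add: y_def power_mult_distrib indicator_def)
      then have "(\<integral>\<^sup>+x. y (t, x) ^ 4 \<partial>lborel) = (\<integral>\<^sup>+x. (S t x ^ 4 * indicator {0..2 * pi} x) * indicator {- real Q..real Q} t \<partial>lborel)"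
        by (simp only:)
      also have "\<dots> = (\<integral>\<^sup>+x\<in>{0..2 * pi}. S t x ^ 4 \<partial>lborel) * indicator {- real Q..real Q} t"
        by (rule nn_integral_multc) measurable
      finally show "(\<integral>\<^sup>+x. y (t, x) ^ 4 \<partial>lborel) = (\<integral>\<^sup>+x\<in>{0..2 * pi}. S t x ^ 4 \<partial>lborel) * indicator {- real Q..real Q} t" .
    qed
    also have "\<dots> \<le> ennreal (L4_const B b) * (\<Sum>k\<in>K. sobolev_sq b (G k))\<^sup>2"
      unfolding S_def L4_const_def by (rule dyadic_L4[OF sep K B b p G, folded piece_def])
    also have "(\<Sum>k\<in>K. sobolev_sq b (G k)) = ennreal Z" unfolding Z_def z(2) by (rule sum_ennreal) (rule z(1))
    finally show ?thesis .
  qed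
  finally have est: "(ennreal Z) ^ 4 \<le> ennreal \<alpha> ^ 3 * (ennreal (L4_const B b) * (ennreal Z)\<^sup>2)"
    by (simp add: mult_left_mono)
  have L: "0 \<le> L4_const B b" using L4_const_pos[OF B b] by simp
  have "ennreal (Z ^ 4) \<le> ennreal (\<alpha> ^ 3 * (L4_const B b * Z\<^sup>2))"
    using est \<alpha>(1) Z0 L by (simp add: ennreal_power ennreal_mult)
  \<comment> \<open>From \<open>Z ^ 4 <= L4_const B b * \<alpha> ^ 3 * Z ^ 2\<close>, where
    \<open>Z\<close> is a finite real, so \<open>Z ^ 2\<close> can be cancelled unless it is
    0.\<close>
  then have "Z\<^sup>2 * Z\<^sup>2 \<le> (L4_const B b * \<alpha> ^ 3) * Z\<^sup>2"
    using \<alpha>(1) Z0 L by (simp add: ennreal_le_iff power4_eq_xxxx power2_eq_square ac_simps)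
  then have "Z\<^sup>2 \<le> L4_const B b * \<alpha> ^ 3"
    using \<alpha>(1) L by (cases "Z = 0") (auto intro: mult_right_le_imp_le[of _ "Z\<^sup>2"])
  then have "Z \<le> sqrt (L4_const B b * \<alpha> ^ 3)" by (rule real_le_rsqrt)
  moreover have "(\<Sum>k\<in>K. ?Z k) = ennreal Z" unfolding Z_def zZ[symmetric] by (rule sum_ennreal) (rule z(1))
  ultimately show "(\<Sum>k\<in>K. ?Z k) \<le> ennreal (sqrt (L4_const B b * \<alpha> ^ 3))" by (simp only: ennreal_leI)
qed

text \<open>The truncated bound is uniform in \<open>n\<close>, and the truncated integrals increase
  to the full ones by monotone convergence.\<close>

lemma dual_estimate:
  fixes u :: "real \<times> real \<Rightarrow> complex"
  assumes sep: "separated p K B" and K: "finite K" and B: "0 \<le> B" and b: "3 / 8 < b"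
    and p: "\<And>k. p k \<in> borel_measurable borel"
    and u: "integrable (lborel \<Otimes>\<^sub>M lborel) u" and out: "\<And>t x. t \<notin> {- real Q..real Q} \<or> x \<notin> {0..2 * pi} \<Longrightarrow> u (t, x) = 0"
    and \<alpha>: "0 \<le> \<alpha>" "(\<integral>\<^sup>+z. ennreal (norm (u z) powr (4/3)) \<partial>(lborel \<Otimes>\<^sub>M lborel)) = ennreal \<alpha>"
  defines "F \<equiv> \<lambda>k t. cis (p k t) * (of_real (1 / (2 * pi)) * (LINT x|lborel. u (t, x) * cis (- (of_int k * x))))"
  shows "(\<Sum>k\<in>K. sobolev_sq (- b) (\<lambda>\<tau>. LINT t|lborel. F k t * cis (- (t * \<tau>)))) \<le> ennreal (sqrt (L4_const B b * \<alpha> ^ 3))"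
proof -
  define g where "g k \<tau> = (LINT t|lborel. F k t * cis (- (t * \<tau>)))" for k \<tau>
  define w where "w k \<tau> = ennreal (japanese \<tau> powr (2 * (- b)) * (norm (g k \<tau>))\<^sup>2)" for k \<tau>
  have [measurable]: "F k \<in> borel_measurable borel" for k
  proof -
    have "integrable lborel (F k)"
      unfolding F_def by (rule truncated_dual_estimate(1)[OF sep K B b p u out \<alpha>])
    then show ?thesis by auto
  qed
  have [measurable]: "g k \<in> borel_measurable borel" for k unfolding g_def[abs_def] by measurable
  have w_meas [measurable]: "w k \<in> borel_measurable borel" for k
    unfolding w_def[abs_def] japanese_def by measurable
  have le: "(\<Sum>k\<in>K. \<integral>\<^sup>+\<tau>\<in>shells n. w k \<tau> \<partial>lborel) \<le> ennreal (sqrt (L4_const B b * \<alpha> ^ 3))" for n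
    unfolding w_def g_def F_def by (rule truncated_dual_estimate(2)[OF sep K B b p u out \<alpha>])
  have lim: "(\<lambda>n. \<integral>\<^sup>+\<tau>\<in>shells n. w k \<tau> \<partial>lborel) \<longlonglongrightarrow> (\<integral>\<^sup>+\<tau>. w k \<tau> \<partial>lborel)" for k
  proof (rule nn_integral_LIMSEQ)
    show "(\<lambda>\<tau>. w k \<tau> * indicator (shells n) \<tau>) \<in> borel_measurable lborel" for n by measurable
    show "incseq (\<lambda>n \<tau>. w k \<tau> * indicator (shells n) \<tau>)"
      by (auto simp: incseq_def le_fun_def shells_def indicator_def)
    show "(\<lambda>n. w k \<tau> * indicator (shells n) \<tau>) \<longlonglongrightarrow> w k \<tau>" for \<tau>
    proof -
      obtain i where i: "\<tau> \<in> shell i" using shell_unique by blast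
      have "w k \<tau> * indicator (shells n) \<tau> = w k \<tau>" if "i < n" for n using i that by (auto simp: shells_def indicator_def)
      then show ?thesis by (intro tendsto_eventually) (use eventually_gt_at_top[of i] in eventually_elim, blast)
    qed
  qed
  have "(\<lambda>n. \<Sum>k\<in>K. \<integral>\<^sup>+\<tau>\<in>shells n. w k \<tau> \<partial>lborel) \<longlonglongrightarrow> (\<Sum>k\<in>K. \<integral>\<^sup>+\<tau>. w k \<tau> \<partial>lborel)"
    by (intro tendsto_sum lim)
  then have "(\<Sum>k\<in>K. \<integral>\<^sup>+\<tau>. w k \<tau> \<partial>lborel) \<le> ennreal (sqrt (L4_const B b * \<alpha> ^ 3))"
    by (rule LIMSEQ_le_const2) (use le in blast)
  then show ?thesis unfolding sobolev_sq_def w_def g_def .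
qed

text \<open>\<open>U\<close> is replaced by a Borel function extended by zero outside the strip. Its
  modulated coefficients are competitors in the restriction norms for all \<open>k\<close> at once,
  and they are integrable because L^(4/3) embeds into L^1 on a bounded set.\<close>

lemma restriction_norm_dual_L4:
  fixes U :: "real \<Rightarrow> real \<Rightarrow> complex"
  assumes sep: "separated p K B" and K: "finite K" and B: "0 \<le> B" and b: "3 / 8 < b"
    and p: "\<And>k. p k \<in> borel_measurable borel" and I: "is_interval I" "bounded I"
    and U: "case_prod U \<in> borel_measurable (lebesgue_on (I \<times> UNIV))"
    and \<alpha>: "0 \<le> \<alpha>" "(\<integral>\<^sup>+(t, x). ennreal (norm (U t x) powr (4/3)) \<partial>lebesgue_on (I \<times> {0..<2*pi})) = ennreal \<alpha>"
  shows "(\<Sum>k\<in>K. (Hb_norm_on (- b) I (\<lambda>t. cis (p k t) * fcoef (U t) k))\<^sup>2) \<le> ennreal (sqrt (L4_const B b * \<alpha> ^ 3))"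
proof -
  obtain Q :: nat where Q: "I \<subseteq> {- real Q..real Q}" using I(2) by (rule bounded_subset_nat_Icc)
  define E where "E = I \<times> {0..<2 * pi}"
  have I_meas [measurable]: "I \<in> sets borel" using I(1) by (rule real_interval_borel_measurable)
  have prod_meas: "I \<times> J \<in> sets (borel :: (real \<times> real) measure)" if "J \<in> sets borel" for J
  proof -
    have "I \<times> J \<in> sets (borel \<Otimes>\<^sub>M borel)" using that by auto
    then show ?thesis by (simp only: borel_prod)
  qed
  have E_meas [measurable]: "E \<in> sets borel" unfolding E_def by (rule prod_meas) simp
  define f where "f z = indicator E z *\<^sub>R case_prod U z" for z
  have "f \<in> borel_measurable lebesgue"
  proof -
    have "I \<times> UNIV \<inter> space lebesgue \<in> sets (lebesgue :: (real \<times> real) measure)"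
      using prod_meas[of UNIV] by simp
    then have "(\<lambda>z. indicator (I \<times> UNIV) z *\<^sub>R case_prod U z) \<in> borel_measurable lebesgue"
      using U by (simp only: borel_measurable_restrict_space_iff)
    moreover have "(indicator E :: real \<times> real \<Rightarrow> real) \<in> borel_measurable lebesgue"
      by (rule measurable_completion) simp
    ultimately have "(\<lambda>z. indicator E z *\<^sub>R (indicator (I \<times> UNIV) z *\<^sub>R case_prod U z)) \<in> borel_measurable lebesgue"
      by (rule borel_measurable_scaleR[rotated])
    also have "(\<lambda>z. indicator E z *\<^sub>R (indicator (I \<times> UNIV) z *\<^sub>R case_prod U z)) = f"
      by (auto simp: f_def E_def indicator_def)
    finally show ?thesis .
  qed
  then obtain u\<^sub>0 where u0: "u\<^sub>0 \<in> borel_measurable lborel" "AE z in lborel. f z = u\<^sub>0 z"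
    by (rule completion_ex_borel_measurable_complex)
  \<comment> \<open>Cut off once more, so that \<open>u\<close> vanishes at every point outside
    \<open>E\<close> and not only almost everywhere.\<close>
  define u where "u z = indicator E z *\<^sub>R u\<^sub>0 z" for z
  have u_meas': "u \<in> borel_measurable borel" unfolding u_def using u0(1) by measurable
  then have u_meas [measurable]: "u \<in> borel_measurable (borel \<Otimes>\<^sub>M borel)" by (simp only: borel_prod)
  have fu: "AE z in lborel. f z = u z"
    using u0(2) by eventually_elim (auto simp: u_def f_def indicator_def)
  have u_norm: "(\<integral>\<^sup>+z. ennreal (norm (u z) powr (4/3)) \<partial>(lborel \<Otimes>\<^sub>M lborel)) = ennreal \<alpha>"
  proof -
    have "(\<integral>\<^sup>+z. ennreal (norm (u z) powr (4/3)) \<partial>(lborel \<Otimes>\<^sub>M lborel)) = (\<integral>\<^sup>+z. ennreal (norm (f z) powr (4/3)) \<partial>lborel)"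
      unfolding lborel_prod by (rule nn_integral_cong_AE) (use fu in eventually_elim, simp)
    also have "\<dots> = (\<integral>\<^sup>+z. ennreal (norm (case_prod U z) powr (4/3)) * indicator (I \<times> {0..<2 * pi}) z \<partial>lborel)"
      unfolding f_def E_def by (intro nn_integral_cong) (simp add: indicator_def)
    also have "\<dots> = (\<integral>\<^sup>+z. ennreal (norm (case_prod U z) powr (4/3)) \<partial>lebesgue_on (I \<times> {0..<2 * pi}))"
      by (rule nn_integral_strip[OF I(1), symmetric])
    finally show ?thesis using \<alpha>(2) by (simp add: case_prod_beta')
  qed
  have out: "u (t, x) = 0" if "t \<notin> {- real Q..real Q} \<or> x \<notin> {0..2 * pi}" for t x
    using that Q by (auto simp: u_def E_def indicator_def)
  have u_int: "integrable (lborel \<Otimes>\<^sub>M lborel) u"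
  proof (rule integrableI_bounded)
    let ?R = "{- real Q..real Q} \<times> {0..2 * pi}"
    have R: "?R \<in> sets (lborel \<Otimes>\<^sub>M lborel)" by simp
    have "(\<integral>\<^sup>+z. ennreal (norm (u z)) \<partial>(lborel \<Otimes>\<^sub>M lborel)) \<le> (\<integral>\<^sup>+z. indicator ?R z + ennreal (norm (u z) powr (4/3)) \<partial>(lborel \<Otimes>\<^sub>M lborel))"
    proof (rule nn_integral_mono)
      fix z
      show "ennreal (norm (u z)) \<le> indicator ?R z + ennreal (norm (u z) powr (4/3))"
      proof (cases "u z = 0")
        case False
        then have z: "z \<in> ?R" using out[of "fst z" "snd z"] by (auto simp: mem_Times_iff)
        have "norm (u z) \<le> 1 + norm (u z) powr (4/3)"
        proof (cases "norm (u z) \<le> 1")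
          case False
          then have "norm (u z) powr 1 \<le> norm (u z) powr (4/3)" by (intro powr_mono) auto
          then show ?thesis by simp
        qed (simp add: add_increasing2)
        then have "ennreal (norm (u z)) \<le> ennreal (1 + norm (u z) powr (4/3))" by (rule ennreal_leI)
        also have "\<dots> = 1 + ennreal (norm (u z) powr (4/3))" by (subst ennreal_plus) auto
        finally show ?thesis using z by simp
      qed simp
    qed
    also have "\<dots> = emeasure (lborel \<Otimes>\<^sub>M lborel) ?R + ennreal \<alpha>"
      unfolding u_norm[symmetric] nn_integral_indicator[OF R, symmetric]
      by (rule nn_integral_add) (use R in measurable)
    also have "emeasure (lborel \<Otimes>\<^sub>M lborel) ?R = emeasure lborel {- real Q..real Q} * emeasure lborel {0..2 * pi}"
      by (rule lborel.emeasure_pair_measure_Times) auto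
    also have "\<dots> + ennreal \<alpha> < \<infinity>" by (simp add: ennreal_mult_less_top)
    finally show "(\<integral>\<^sup>+z. ennreal (norm (u z)) \<partial>(lborel \<Otimes>\<^sub>M lborel)) < \<infinity>" .
  qed measurable
  define F where "F k t = cis (p k t) * (of_real (1 / (2 * pi)) * (LINT x|lborel. u (t, x) * cis (- (of_int k * x))))" for k t
  have Fi: "integrable lborel (F k)" for k
    unfolding F_def[abs_def] by (rule truncated_dual_estimate(1)[OF sep K B b p u_int out \<alpha>(1) u_norm])
  \<comment> \<open>Fubini for null sets: for almost every \<open>t\<close> the slices agree almost
    everywhere in \<open>x\<close> and so have the same Fourier coefficients.\<close>
  have "AE t in lborel. AE x in lborel. f (t, x) = u (t, x)"
    using fu unfolding lborel_prod[symmetric] by (rule lborel_pair.AE_pair)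
  then have F: "AE t in lborel. t \<in> interior I \<longrightarrow> cis (p k t) * fcoef (U t) k = F k t" for k
  proof eventually_elim
    case (elim t)
    show ?case
    proof
      assume "t \<in> interior I"
      then have t: "t \<in> I" using interior_subset by blast
      have [measurable]: "(\<lambda>x. u (t, x)) \<in> borel_measurable borel" by measurable
      have "(LINT x|lborel. u (t, x) * cis (- (of_int k * x))) = (LINT x|lebesgue. u (t, x) * cis (- (of_int k * x)))"
        by (rule integral_completion[symmetric]) measurable
      also have "\<dots> = (LINT x|lebesgue. indicator {0..<2 * pi} x *\<^sub>R (U t x * cis (- (of_int k * x))))"
      proof (rule integral_completion_cong_AE)
        show "(\<lambda>x. u (t, x) * cis (- (of_int k * x))) \<in> borel_measurable lborel" by measurable
        show "AE x in lborel. u (t, x) * cis (- (of_int k * x)) = indicator {0..<2 * pi} x *\<^sub>R (U t x * cis (- (of_int k * x)))"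
          using elim by eventually_elim (use t in \<open>auto simp: f_def E_def indicator_def split: if_splits\<close>)
      qed
      finally show "cis (p k t) * fcoef (U t) k = F k t" unfolding F_def fcoef_def set_lebesgue_integral_def by (simp only:)
    qed
  qed
  have "(\<Sum>k\<in>K. (Hb_norm_on (- b) I (\<lambda>t. cis (p k t) * fcoef (U t) k))\<^sup>2) \<le> (\<Sum>k\<in>K. sobolev_sq (- b) (\<lambda>\<tau>. LINT t|lborel. F k t * cis (- (t * \<tau>))))"
    by (intro sum_mono Hb_norm_on_integrable_le Fi F)
  also have "\<dots> \<le> ennreal (sqrt (L4_const B b * \<alpha> ^ 3))"
    unfolding F_def by (rule dual_estimate[OF sep K B b p u_int out \<alpha>(1) u_norm])
  finally show ?thesis .
qed

text \<open>Bookkeeping of exponents: with L the constant, the square root of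
  \<open>L * \<alpha> ^ 3\<close> is the square of
  \<open>L powr (1/4) * \<alpha> powr (3/4)\<close>, and the last factor is the norm of
  \<open>U\<close>. If that norm is infinite, so is the right-hand side, as the constant is
  positive.\<close>

lemma restriction_norm_le_L4_dual:
  fixes U :: "real \<Rightarrow> real \<Rightarrow> complex"
  assumes sep: "separated p K B" and K: "finite K" and B: "0 \<le> B" and b: "3 / 8 < b"
    and p: "\<And>k. p k \<in> borel_measurable borel" and I: "is_interval I" "bounded I"
    and U: "case_prod U \<in> borel_measurable (lebesgue_on (I \<times> UNIV))"
  shows "(\<Sum>k\<in>K. (Hb_norm_on (- b) I (\<lambda>t. cis (p k t) * fcoef (U t) k))\<^sup>2)
    \<le> (ennreal (L4_const B b powr (1/4)) * Lp_norm (4/3) I U)\<^sup>2"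
proof -
  define X where "X = (\<integral>\<^sup>+(t, x). ennreal (norm (U t x) powr (4/3)) \<partial>lebesgue_on (I \<times> {0..<2*pi}))"
  have L: "0 < L4_const B b" by (rule L4_const_pos[OF B b])
  have Lp: "Lp_norm (4/3) I U = epowr X (3/4)" by (simp add: Lp_norm_def X_def)
  show ?thesis
  proof (cases X)
    case (real \<alpha>)
    have "sqrt (L4_const B b * \<alpha> ^ 3) = (L4_const B b powr (1/4) * \<alpha> powr (3/4))\<^sup>2"
    proof (rule real_sqrt_unique)
      have "((L4_const B b powr (1/4) * \<alpha> powr (3/4))\<^sup>2)\<^sup>2 = (L4_const B b powr (1/4)) ^ 4 * (\<alpha> powr (3/4)) ^ 4"
        by (simp add: power_mult_distrib flip: power_mult)
      also have "\<dots> = L4_const B b * \<alpha> ^ 3" using L real(1) by (cases "\<alpha> = 0") (simp_all add: powr_power)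
      finally show "((L4_const B b powr (1/4) * \<alpha> powr (3/4))\<^sup>2)\<^sup>2 = L4_const B b * \<alpha> ^ 3" .
    qed simp
    moreover have "ennreal (L4_const B b powr (1/4) * \<alpha> powr (3/4)) = ennreal (L4_const B b powr (1/4)) * Lp_norm (4/3) I U"
      unfolding Lp real(2) epowr_def using real(1) by (simp add: ennreal_mult)
    ultimately have "ennreal (sqrt (L4_const B b * \<alpha> ^ 3)) = (ennreal (L4_const B b powr (1/4)) * Lp_norm (4/3) I U)\<^sup>2"
      by (metis ennreal_power mult_nonneg_nonneg powr_ge_zero)
    then show ?thesis
      using restriction_norm_dual_L4[OF sep K B b p I U real(1) real(2)[unfolded X_def]] by simp
  next
    case top
    then show ?thesis using L by (simp add: Lp epowr_def power2_eq_square ennreal_mult_top)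
  qed
qed

section \<open>Assembly of the inequalities\<close>

lemma epowr_half_le: "x \<le> r\<^sup>2 \<Longrightarrow> epowr x (1/2) \<le> r"
proof -
  assume "x \<le> r\<^sup>2"
  then have "epowr x (1/2) \<le> epowr (r\<^sup>2) (1/2)" by (rule epowr_mono) simp
  also have "\<dots> = r" unfolding epowr_square by (cases r) (auto simp: epowr_def)
  finally show ?thesis .
qed

text \<open>An infinite sum of nonnegative terms is the supremum of its finite partial sums, and the
  separation constant \<open>pi\<close> is the same for every finite set of frequencies.\<close>

lemma X_norm_dual_le:
  assumes a: "a \<in> borel_measurable lebesgue" "Linf_norm a < \<infinity>" and b: "3/8 < b"
    and I: "is_interval I" "bounded I" and U: "case_prod U \<in> borel_measurable (lebesgue_on (I \<times> UNIV))"
  shows "X_norm a 0 (- b) I U \<le> ennreal (L4_const pi b powr (1/4)) * Lp_norm (4/3) I U"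
proof -
  define H where "H k = (Hb_norm_on (- b) I (\<lambda>t. cis (phase a k t) * fcoef (U t) k))\<^sup>2" for k
  have p: "phase a k \<in> borel_measurable borel" for k
    using phase_properties(1)[OF a] by (rule borel_measurable_continuous_onI)
  have "infsum H UNIV \<le> (ennreal (L4_const pi b powr (1/4)) * Lp_norm (4/3) I U)\<^sup>2"
    unfolding nonneg_infsum_complete[of UNIV H, simplified]
    by (rule SUP_least) (use restriction_norm_le_L4_dual[OF phase_properties(2)[OF a] _ pi_ge_zero b p I U] in \<open>simp add: H_def\<close>)
  then have "epowr (infsum H UNIV) (1/2) \<le> ennreal (L4_const pi b powr (1/4)) * Lp_norm (4/3) I U"
    by (rule epowr_half_le)
  then show ?thesis unfolding X_norm_def japanese_powr_0 H_def by (simp only: ennreal_1 mult_1)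
qed

text \<open>Frequencies outside \<open>low_freqs\<close> have coefficient zero, which the zero
  function extends with norm zero; on the others the projection keeps the coefficients of
  \<open>U\<close>.\<close>

lemma Xh_norm_dual_le:
  assumes a: "a \<in> borel_measurable lebesgue" "Linf_norm a < \<infinity>" and \<Lambda>: "0 < \<Lambda>" "\<Lambda> < 1/2" and b: "3/8 < b"
    and h: "0 < h" "h \<le> min 1 (pi * (1/2 - \<Lambda>) / (2 * japanese (real_of_ereal (Linf_norm a))))"
    and I: "is_interval I" "bounded I" and U: "case_prod U \<in> borel_measurable (lebesgue_on (I \<times> UNIV))"
  shows "Xh_norm h a 0 (- b) I (\<lambda>t. proj \<Lambda> h (U t)) \<le> ennreal (L4_const (disc_const \<Lambda>) b powr (1/4)) * Lp_norm (4/3) I U"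
proof -
  define H where "H k = (Hb_norm_on (- b) I (\<lambda>t. cis (phase_h h a k t) * fcoef (proj \<Lambda> h (U t)) k))\<^sup>2" for k
  have p: "phase_h h a k \<in> borel_measurable borel" for k
    using phase_h_properties(1)[OF a \<Lambda> h] by (rule borel_measurable_continuous_onI)
  have zero: "H k = 0" if "k \<notin> low_freqs \<Lambda> h" for k
  proof -
    have "H k \<le> sobolev_sq (- b) (\<lambda>\<tau>. LINT t|lborel. 0 * cis (- (t * \<tau>)))"
      unfolding H_def fcoef_proj using that by (intro Hb_norm_on_integrable_le) auto
    then show ?thesis by (simp add: sobolev_sq_def)
  qed
  have "(\<Sum>k\<in>dual_grid h. H k) = (\<Sum>k\<in>low_freqs \<Lambda> h. H k)"
    by (rule sum.mono_neutral_right) (auto simp: zero dual_grid_def low_freqs_def)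
  also have "\<dots> = (\<Sum>k\<in>low_freqs \<Lambda> h. (Hb_norm_on (- b) I (\<lambda>t. cis (phase_h h a k t) * fcoef (U t) k))\<^sup>2)"
    by (rule sum.cong[OF refl]) (simp add: H_def fcoef_proj)
  also have "\<dots> \<le> (ennreal (L4_const (disc_const \<Lambda>) b powr (1/4)) * Lp_norm (4/3) I U)\<^sup>2"
    by (rule restriction_norm_le_L4_dual[OF phase_h_properties(2)[OF a \<Lambda> h] finite_low_freqs disc_const_nonneg[OF \<Lambda>] b p I U])
  finally have "epowr (\<Sum>k\<in>dual_grid h. H k) (1/2) \<le> ennreal (L4_const (disc_const \<Lambda>) b powr (1/4)) * Lp_norm (4/3) I U"
    by (rule epowr_half_le)
  then show ?thesis unfolding Xh_norm_def japanese_powr_0 H_def by (simp only: ennreal_1 mult_1)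
qed

theorem proposition3p1:
  fixes \<Lambda> b\<^sub>0 :: real
  assumes "0 < \<Lambda>" and "\<Lambda> < 1/2" and "3/8 < b\<^sub>0" and "b\<^sub>0 < 1/2"
  shows "\<exists>C::real. C > 0 \<and>
    (\<forall>(a :: real \<Rightarrow> real) (h :: real) (I :: real set) (U :: real \<Rightarrow> real \<Rightarrow> complex).
       a \<in> borel_measurable lebesgue \<longrightarrow> Linf_norm a < \<infinity> \<longrightarrow>
       admissible h \<longrightarrow> 0 < h \<longrightarrow>
       h \<le> min 1 (pi * (1/2 - \<Lambda>) / (2 * japanese (real_of_ereal (Linf_norm a)))) \<longrightarrow>
       is_interval I \<longrightarrow> bounded I \<longrightarrow>
       case_prod U \<in> borel_measurable (lebesgue_on (I \<times> UNIV)) \<longrightarrow>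
       (\<forall>t\<in>I. \<forall>x. U t (x + 2 * pi) = U t x) \<longrightarrow>
         Lp_norm 4 I (\<lambda>t. proj \<Lambda> h (U t))
           \<le> ennreal C * Xh_norm h a 0 b\<^sub>0 I (\<lambda>t. proj \<Lambda> h (U t)) \<and>
         X_norm a 0 (- b\<^sub>0) I U + Xh_norm h a 0 (- b\<^sub>0) I (\<lambda>t. proj \<Lambda> h (U t))
           \<le> ennreal C * Lp_norm (4/3) I U)"
proof -
  \<comment> \<open>\<open>C\<^sub>1\<close> carries \<open>4 * pi ^ 2\<close> from the
    normalization of the Fourier transform, whereas in the dual bounds the corresponding factor
    \<open>1 / (2 * pi)\<close> was estimated by 1. The sum of the three constants serves both
    inequalities.\<close>
  define C\<^sub>1 where "C\<^sub>1 = (4 * pi\<^sup>2 * L4_const (disc_const \<Lambda>) b\<^sub>0) powr (1/4)"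
  define C\<^sub>2 where "C\<^sub>2 = L4_const pi b\<^sub>0 powr (1/4)"
  define C\<^sub>3 where "C\<^sub>3 = L4_const (disc_const \<Lambda>) b\<^sub>0 powr (1/4)"
  have nn: "0 \<le> C\<^sub>1" "0 \<le> C\<^sub>3" by (simp_all add: C\<^sub>1_def C\<^sub>3_def)
  have "0 < C\<^sub>2" using L4_const_pos[OF pi_ge_zero assms(3)] by (simp add: C\<^sub>2_def)
  show ?thesis
  proof (intro exI[of _ "C\<^sub>1 + C\<^sub>2 + C\<^sub>3"] conjI allI impI)
    show "0 < C\<^sub>1 + C\<^sub>2 + C\<^sub>3" using nn \<open>0 < C\<^sub>2\<close> by simp
    fix a h I and U :: "real \<Rightarrow> real \<Rightarrow> complex"
    assume a: "a \<in> borel_measurable lebesgue" "Linf_norm a < \<infinity>"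
      and h: "0 < h" "h \<le> min 1 (pi * (1/2 - \<Lambda>) / (2 * japanese (real_of_ereal (Linf_norm a))))"
      and I: "is_interval I" "bounded I" and U: "case_prod U \<in> borel_measurable (lebesgue_on (I \<times> UNIV))"
    have "Lp_norm 4 I (\<lambda>t. proj \<Lambda> h (U t)) \<le> ennreal C\<^sub>1 * Xh_norm h a 0 b\<^sub>0 I (\<lambda>t. proj \<Lambda> h (U t))"
      unfolding C\<^sub>1_def by (rule Lp_norm_4_proj_le[OF a assms(1-3) h I])
    also have "\<dots> \<le> ennreal (C\<^sub>1 + C\<^sub>2 + C\<^sub>3) * Xh_norm h a 0 b\<^sub>0 I (\<lambda>t. proj \<Lambda> h (U t))"
      using nn \<open>0 < C\<^sub>2\<close> by (intro mult_right_mono ennreal_leI) auto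
    finally show "Lp_norm 4 I (\<lambda>t. proj \<Lambda> h (U t)) \<le> ennreal (C\<^sub>1 + C\<^sub>2 + C\<^sub>3) * Xh_norm h a 0 b\<^sub>0 I (\<lambda>t. proj \<Lambda> h (U t))" .
    have "X_norm a 0 (- b\<^sub>0) I U + Xh_norm h a 0 (- b\<^sub>0) I (\<lambda>t. proj \<Lambda> h (U t))
        \<le> ennreal C\<^sub>2 * Lp_norm (4/3) I U + ennreal C\<^sub>3 * Lp_norm (4/3) I U"
      unfolding C\<^sub>2_def C\<^sub>3_def
      by (intro add_mono X_norm_dual_le[OF a assms(3) I U] Xh_norm_dual_le[OF a assms(1-3) h I U])
    also have "\<dots> = ennreal (C\<^sub>2 + C\<^sub>3) * Lp_norm (4/3) I U"
      using nn \<open>0 < C\<^sub>2\<close> by (simp add: distrib_right)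
    also have "\<dots> \<le> ennreal (C\<^sub>1 + C\<^sub>2 + C\<^sub>3) * Lp_norm (4/3) I U"
      using nn \<open>0 < C\<^sub>2\<close> by (intro mult_right_mono ennreal_leI) auto
    finally show "X_norm a 0 (- b\<^sub>0) I U + Xh_norm h a 0 (- b\<^sub>0) I (\<lambda>t. proj \<Lambda> h (U t))
        \<le> ennreal (C\<^sub>1 + C\<^sub>2 + C\<^sub>3) * Lp_norm (4/3) I U" .
  qed
qed

end
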